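(* Let $K$ be an infinite field, $E=K\langle e_1,\dots,e_n\rangle$ the exterior algebra, $J\subset E$ a graded ideal and $\tau$ an arbitrary term order on $E$ (with $e_1>_\tau e_2>_\tau\cdots>_\tau e_n$). Then (i) $\beta^E_{ijp}(E/J)\le\beta^E_{ijp}(E/\mathrm{gin}_\tau(J))$ for all $i,j,p$; (ii) $\beta^E_{ijp}(E/J)\le\beta^E_{ijp}(E/\mathrm{lex}(J))$ for all $i,j,p$.
   Context: $E$ is graded by $\deg e_i=1$; $E_1$ is the space of linear forms; monomials are $e_F=e_{a_1}\wedge\dots\wedge e_{a_k}$ for $F=\{a_1<\dots<a_k\}\subseteq\{1,\dots,n\}$. Cartan complex: for $\mathbf v=v_1,\dots,v_m\in E_1$, $C_\bullet(\mathbf v;E)$ is the free $E$-module with basis the divided power monomials $x^{(a)}=x_1^{(a_1)}\cdots x_m^{(a_m)}$, $a\in\mathbb N^m$, with $C_i(\mathbf v;E)=\bigoplus_{|a|=i}E\,x^{(a)}$ and $E$-linear differential $\partial(x^{(a)})=\sum_{a_k>0}v_k\,x_1^{(a_1)}\cdots x_k^{(a_k-1)}\cdots x_m^{(a_m)}$. For $M=E/J$ put $C_\bullet(\mathbf v;M)=C_\bullet(\mathbf v;E)\otimes_E M$, graded so that $\mu\, x^{(b)}$ with $\mu\in M_a$ has internal degree $a+|b|$. Its homology $H_i(\mathbf v;M)$ is the (graded) Cartan homology. Cartan--Betti numbers: for $1\le p\le n$ and a generic sequence of linear forms $f_1,\dots,f_p$ set $\beta^E_{ijp}(E/J)=\dim_K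 H_i(f_1,\dots,f_p;E/J)_j$ for $0\le i\le p$, and $\beta^E_{ijp}(E/J)=0$ for $i>p$. "Generic" means that the coefficient matrix expressing the forms in $e_1,\dots,e_n$ lies in a suitable non-empty Zariski open subset of $K^{p\times n}$ on which the ranks of the maps of the Cartan complex are in each degree as big as possible; the numbers do not depend on the generic sequence chosen. Generic initial ideal: for $g\in \mathrm{GL}_n(K)$ generic (acting on $E$ by linear substitution), $\mathrm{gin}_\tau(J)=\mathrm{in}_\tau(g(J))$, the initial ideal with respect to $\tau$; it is constant for $g$ in a non-empty Zariski open set. Squarefree lexsegment ideal: a monomial ideal $L\subset E$ such that whenever $e_F\in L$, $|G|=|F|$ and $e_G>_{\mathrm{lex}}e_F$, then $e_G\in L$; here, for $|F|=|G|$, $F\neq G$, $e_G>_{\mathrm{lex}}e_F$ iff the smallest element of the symmetric difference of $F$ and $G$ lies in $G$. $\mathrm{lex}(J)$ denotes the unique squarefree lexsegment ideal with the same Hilbert function as $J$. *)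

theory Defs
  imports
    "HOL-Library.Function_Algebras"
    "Jordan_Normal_Form.Matrix"
begin

subsection \<open>The exterior algebra\<close>

text \<open>
  An element of the exterior algebra on \<open>e\<^sub>1, \<dots>, e\<^sub>n\<close> is given by its coefficient function with
  respect to the monomial basis: \<open>u F\<close> is the coefficient of \<open>e\<^sub>F\<close>, and only subsets \<open>F\<close> of
  \<open>{1..n}\<close> may carry a nonzero coefficient. Addition is pointwise.
\<close>

type_synonym 'k ext = "nat set \<Rightarrow> 'k"

definition ext_alg :: "nat \<Rightarrow> 'k::field ext set" where
  "ext_alg n = {u. \<forall>F. u F \<noteq> 0 \<longrightarrow> F \<subseteq> {1..n}}"

definition ext_scale :: "'k::field \<Rightarrow> 'k ext \<Rightarrow> 'k ext" where
  "ext_scale r u = (\<lambda>F. r * u F)"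

definition ext_mono :: "nat set \<Rightarrow> 'k::field ext" where
  "ext_mono F = (\<lambda>H. if H = F then 1 else 0)"

text \<open>
  For disjoint \<open>F\<close> and \<open>G\<close> one has \<open>e\<^sub>F \<and> e\<^sub>G = shuffle_sign F G \<cdot> e\<^bsub>F \<union> G\<^esub>\<close>; the exponent counts the
  inversions when the elements of \<open>F\<close> are listed before those of \<open>G\<close>. If \<open>F\<close> and \<open>G\<close> meet, the
  product is zero.
\<close>

definition shuffle_sign :: "nat set \<Rightarrow> nat set \<Rightarrow> 'k::field" where
  "shuffle_sign F G = (- 1) ^ card {(a, b). a \<in> F \<and> b \<in> G \<and> b < a}"

definition wedge :: "'k::field ext \<Rightarrow> 'k ext \<Rightarrow> 'k ext" where
  "wedge u v = (\<lambda>H. \<Sum>F\<in>Pow H. shuffle_sign F (H - F) * u F * v (H - F))"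

definition ext_deg :: "nat \<Rightarrow> nat \<Rightarrow> 'k::field ext set" where
  "ext_deg n d = {u. \<forall>F. u F \<noteq> 0 \<longrightarrow> F \<subseteq> {1..n} \<and> card F = d}"

definition hom_component :: "nat \<Rightarrow> 'k::field ext \<Rightarrow> 'k ext" where
  "hom_component d u = (\<lambda>F. if card F = d then u F else 0)"

definition ext_ideal :: "nat \<Rightarrow> 'k::field ext set \<Rightarrow> bool" where
  "ext_ideal n J \<longleftrightarrow> J \<subseteq> ext_alg n \<and> 0 \<in> J \<and> (\<forall>u\<in>J. \<forall>v\<in>J. u + v \<in> J) \<and>
     (\<forall>u\<in>J. \<forall>w\<in>ext_alg n. wedge w u \<in> J \<and> wedge u w \<in> J)"

definition graded_ideal :: "nat \<Rightarrow> 'k::field ext set \<Rightarrow> bool" where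
  "graded_ideal n J \<longleftrightarrow> ext_ideal n J \<and> (\<forall>u\<in>J. \<forall>d. hom_component d u \<in> J)"

definition monomial_ideal :: "nat \<Rightarrow> 'k::field ext set \<Rightarrow> bool" where
  "monomial_ideal n L \<longleftrightarrow> (\<exists>S \<subseteq> Pow {1..n}. L = ext_ideal n hull (ext_mono ` S))"

text \<open>
  The dimension of \<open>Z/B\<close> for subspaces \<open>B \<subseteq> Z\<close>: \<open>basis_mod scale S Z B\<close> says that the residue
  classes of the elements of the finite set \<open>S\<close> are pairwise distinct and form a basis of \<open>Z/B\<close>.
\<close>

definition basis_mod ::
  "('k::field \<Rightarrow> 'v::ab_group_add \<Rightarrow> 'v) \<Rightarrow> 'v set \<Rightarrow> 'v set \<Rightarrow> 'v set \<Rightarrow> bool" where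
  "basis_mod scale S Z B \<longleftrightarrow> finite S \<and> S \<subseteq> Z \<and>
     (\<forall>z\<in>Z. \<exists>!r. (\<forall>s. s \<notin> S \<longrightarrow> r s = 0) \<and> z - (\<Sum>s\<in>S. scale (r s) s) \<in> B)"

definition quotient_dim ::
  "('k::field \<Rightarrow> 'v::ab_group_add \<Rightarrow> 'v) \<Rightarrow> 'v set \<Rightarrow> 'v set \<Rightarrow> nat" where
  "quotient_dim scale Z B = (THE d. \<exists>S. basis_mod scale S Z B \<and> card S = d)"

definition hilbert_fun :: "nat \<Rightarrow> 'k::field ext set \<Rightarrow> nat \<Rightarrow> nat" where
  "hilbert_fun n J d = vector_space.dim ext_scale (J \<inter> ext_deg n d)"

text \<open>
  Matrices are indexed from 0, the variables of the exterior algebra and sequences of linear forms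
  from 1; row \<open>k - 1\<close> of \<open>A\<close> holds the coefficients of the \<open>k\<close>-th linear form.
\<close>

definition lin_form :: "nat \<Rightarrow> 'k::field mat \<Rightarrow> nat \<Rightarrow> 'k ext" where
  "lin_form n A k = (\<Sum>l\<in>{1..n}. ext_scale (A $$ (k - 1, l - 1)) (ext_mono {l}))"

subsection \<open>Zariski-open sets of matrices\<close>

inductive poly_fun :: "nat \<Rightarrow> nat \<Rightarrow> ('k::field mat \<Rightarrow> 'k) \<Rightarrow> bool" for p n where
  const: "poly_fun p n (\<lambda>_. r)"
| entry: "k < p \<Longrightarrow> l < n \<Longrightarrow> poly_fun p n (\<lambda>A. A $$ (k, l))"
| add: "poly_fun p n f \<Longrightarrow> poly_fun p n g \<Longrightarrow> poly_fun p n (\<lambda>A. f A + g A)"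
| mult: "poly_fun p n f \<Longrightarrow> poly_fun p n g \<Longrightarrow> poly_fun p n (\<lambda>A. f A * g A)"

definition zariski_open :: "nat \<Rightarrow> nat \<Rightarrow> 'k::field mat set \<Rightarrow> bool" where
  "zariski_open p n U \<longleftrightarrow>
     (\<exists>P. (\<forall>f\<in>P. poly_fun p n f) \<and> U = {A \<in> carrier_mat p n. \<exists>f\<in>P. f A \<noteq> 0})"

subsection \<open>The Cartan complex\<close>

text \<open>
  The element \<open>\<Sum>\<^sub>a c\<^sub>a x\<^bsup>(a)\<^esup>\<close> of the Cartan complex of \<open>v 1, \<dots>, v m\<close> over the exterior algebra is
  represented by the function \<open>a \<mapsto> c\<^sub>a\<close>; an exponent vector is a function on the naturals that
  vanishes off \<open>{1..m}\<close>. \<open>cartan_chains n m i j\<close> is the part of homological degree \<open>i\<close> and internal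
  degree \<open>j\<close>.
\<close>

type_synonym 'k chain = "(nat \<Rightarrow> nat) \<Rightarrow> 'k ext"

definition chain_scale :: "'k::field \<Rightarrow> 'k chain \<Rightarrow> 'k chain" where
  "chain_scale r c = (\<lambda>a. ext_scale r (c a))"

definition exponents :: "nat \<Rightarrow> nat \<Rightarrow> (nat \<Rightarrow> nat) set" where
  "exponents m i = {a. (\<forall>k. a k \<noteq> 0 \<longrightarrow> k \<in> {1..m}) \<and> (\<Sum>k\<in>{1..m}. a k) = i}"

definition cartan_chains :: "nat \<Rightarrow> nat \<Rightarrow> nat \<Rightarrow> nat \<Rightarrow> 'k::field chain set" where
  "cartan_chains n m i j = {c. \<forall>a F. c a F \<noteq> 0 \<longrightarrow>
     a \<in> exponents m i \<and> F \<subseteq> {1..n} \<and> card F + i = j}"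

text \<open>
  The coefficient of \<open>x\<^bsup>(b)\<^esup>\<close> in \<open>\<partial>(\<Sum>\<^sub>a c\<^sub>a x\<^bsup>(a)\<^esup>)\<close> collects the terms with \<open>a = b + \<epsilon>\<^sub>k\<close>; the factor
  \<open>v k\<close> stands on the right since \<open>\<partial>\<close> is linear for left multiplication.
\<close>

definition cartan_diff :: "nat \<Rightarrow> (nat \<Rightarrow> 'k::field ext) \<Rightarrow> 'k chain \<Rightarrow> 'k chain" where
  "cartan_diff m v c = (\<lambda>b. \<Sum>k\<in>{1..m}. wedge (c (b(k := Suc (b k)))) (v k))"

text \<open>
  Chains with coefficients in \<open>E/J\<close> are handled through representatives: the degree \<open>(i, j)\<close> part of
  \<open>C(v; E/J)\<close> is \<open>cartan_chains n m i j\<close> modulo \<open>ideal_chains n m J i j\<close>, and \<open>cartan_cycles\<close> and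
  \<open>cartan_boundaries\<close> are the preimages of the cycles and boundaries of \<open>C(v; E/J)\<close> under this
  projection.
\<close>

definition ideal_chains ::
  "nat \<Rightarrow> nat \<Rightarrow> 'k::field ext set \<Rightarrow> nat \<Rightarrow> nat \<Rightarrow> 'k chain set" where
  "ideal_chains n m J i j = {c \<in> cartan_chains n m i j. \<forall>a. c a \<in> J}"

definition cartan_cycles ::
  "nat \<Rightarrow> nat \<Rightarrow> (nat \<Rightarrow> 'k::field ext) \<Rightarrow> 'k ext set \<Rightarrow> nat \<Rightarrow> nat \<Rightarrow> 'k chain set" where
  "cartan_cycles n m v J i j = {c \<in> cartan_chains n m i j. \<forall>b. cartan_diff m v c b \<in> J}"

definition cartan_boundaries ::
  "nat \<Rightarrow> nat \<Rightarrow> (nat \<Rightarrow> 'k::field ext) \<Rightarrow> 'k ext set \<Rightarrow> nat \<Rightarrow> nat \<Rightarrow> 'k chain set" where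
  "cartan_boundaries n m v J i j =
     {cartan_diff m v c + d | c d. c \<in> cartan_chains n m (Suc i) j \<and> d \<in> ideal_chains n m J i j}"

definition cartan_homology_dim ::
  "nat \<Rightarrow> nat \<Rightarrow> (nat \<Rightarrow> 'k::field ext) \<Rightarrow> 'k ext set \<Rightarrow> nat \<Rightarrow> nat \<Rightarrow> nat" where
  "cartan_homology_dim n m v J i j =
     quotient_dim chain_scale (cartan_cycles n m v J i j) (cartan_boundaries n m v J i j)"

text \<open>The rank of \<open>\<partial> : C\<^bsub>i+1\<^esub>(v; E/J)\<^sub>j \<rightarrow> C\<^sub>i(v; E/J)\<^sub>j\<close>.\<close>

definition cartan_rank ::
  "nat \<Rightarrow> nat \<Rightarrow> (nat \<Rightarrow> 'k::field ext) \<Rightarrow> 'k ext set \<Rightarrow> nat \<Rightarrow> nat \<Rightarrow> nat" where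
  "cartan_rank n m v J i j =
     quotient_dim chain_scale (cartan_boundaries n m v J i j) (ideal_chains n m J i j)"

text \<open>
  Only the maps \<open>\<partial>\<^sub>1, \<dots>, \<partial>\<^bsub>p+1\<^esub>\<close> enter the homology in degrees \<open>0, \<dots>, p\<close>, so genericity concerns
  these finitely many ranks.
\<close>

definition cartan_generic_set :: "nat \<Rightarrow> nat \<Rightarrow> 'k::field ext set \<Rightarrow> 'k mat set \<Rightarrow> bool" where
  "cartan_generic_set n p J U \<longleftrightarrow> zariski_open p n U \<and> U \<noteq> {} \<and>
     (\<forall>A\<in>U. \<forall>B\<in>carrier_mat p n. \<forall>i\<le>p. \<forall>j.
        cartan_rank n p (lin_form n B) J i j \<le> cartan_rank n p (lin_form n A) J i j)"

definition cartan_betti :: "nat \<Rightarrow> 'k::field ext set \<Rightarrow> nat \<Rightarrow> nat \<Rightarrow> nat \<Rightarrow> nat" where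
  "cartan_betti n J i j p =
     (if i \<le> p then
        (THE d. \<exists>U. cartan_generic_set n p J U \<and>
                    (\<forall>A\<in>U. cartan_homology_dim n p (lin_form n A) J i j = d))
      else 0)"

subsection \<open>Generic initial ideals\<close>

text \<open>\<open>tau F G\<close> means that \<open>e\<^sub>F\<close> is strictly smaller than \<open>e\<^sub>G\<close>.\<close>

definition term_order :: "nat \<Rightarrow> (nat set \<Rightarrow> nat set \<Rightarrow> bool) \<Rightarrow> bool" where
  "term_order n tau \<longleftrightarrow>
     irreflp_on (Pow {1..n}) tau \<and> transp_on (Pow {1..n}) tau \<and> totalp_on (Pow {1..n}) tau \<and>
     (\<forall>F\<in>Pow {1..n}. F \<noteq> {} \<longrightarrow> tau {} F) \<and>
     (\<forall>F\<in>Pow {1..n}. \<forall>G\<in>Pow {1..n}. \<forall>H\<in>Pow {1..n}.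
        tau F G \<longrightarrow> F \<inter> H = {} \<longrightarrow> G \<inter> H = {} \<longrightarrow> tau (F \<union> H) (G \<union> H)) \<and>
     (\<forall>a\<in>{1..n}. \<forall>b\<in>{1..n}. a < b \<longrightarrow> tau {b} {a})"

definition lead_set :: "(nat set \<Rightarrow> nat set \<Rightarrow> bool) \<Rightarrow> 'k::field ext \<Rightarrow> nat set" where
  "lead_set tau u = (THE F. u F \<noteq> 0 \<and> (\<forall>G. u G \<noteq> 0 \<longrightarrow> G \<noteq> F \<longrightarrow> tau G F))"

definition initial_ideal ::
  "nat \<Rightarrow> (nat set \<Rightarrow> nat set \<Rightarrow> bool) \<Rightarrow> 'k::field ext set \<Rightarrow> 'k ext set" where
  "initial_ideal n tau J = ext_ideal n hull {ext_mono (lead_set tau u) | u. u \<in> J \<and> u \<noteq> 0}"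

text \<open>The algebra map with \<open>e\<^sub>k \<mapsto> lin_form n g k\<close>.\<close>

definition lin_subst :: "nat \<Rightarrow> 'k::field mat \<Rightarrow> 'k ext \<Rightarrow> 'k ext" where
  "lin_subst n g u = (\<Sum>F\<in>Pow {1..n}. ext_scale (u F)
     (foldr wedge (map (lin_form n g) (sorted_list_of_set F)) (ext_mono {})))"

definition GL :: "nat \<Rightarrow> 'k::field mat set" where
  "GL n = {g \<in> carrier_mat n n. invertible_mat g}"

definition gin ::
  "nat \<Rightarrow> (nat set \<Rightarrow> nat set \<Rightarrow> bool) \<Rightarrow> 'k::field ext set \<Rightarrow> 'k ext set" where
  "gin n tau J = (THE I. \<exists>U. zariski_open n n U \<and> U \<noteq> {} \<and> U \<subseteq> GL n \<and>
     (\<forall>g\<in>U. initial_ideal n tau (lin_subst n g ` J) = I))"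

subsection \<open>Squarefree lexsegment ideals\<close>

definition lex_greater :: "nat set \<Rightarrow> nat set \<Rightarrow> bool" where
  "lex_greater G F \<longleftrightarrow> card F = card G \<and> F \<noteq> G \<and> Min ((F - G) \<union> (G - F)) \<in> G"

definition lexsegment_ideal :: "nat \<Rightarrow> 'k::field ext set \<Rightarrow> bool" where
  "lexsegment_ideal n L \<longleftrightarrow> monomial_ideal n L \<and>
     (\<forall>F\<in>Pow {1..n}. \<forall>G\<in>Pow {1..n}. ext_mono F \<in> L \<longrightarrow> lex_greater G F \<longrightarrow> ext_mono G \<in> L)"

definition lex_ideal :: "nat \<Rightarrow> 'k::field ext set \<Rightarrow> 'k ext set" where
  "lex_ideal n J = (THE L. lexsegment_ideal n L \<and> hilbert_fun n L = hilbert_fun n J)"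

end

theory Submission
  imports Defs "HOL-Computational_Algebra.Polynomial" "Jordan_Normal_Form.Determinant"
begin

text \<open>Write \<open>h\<^sub>k(i, j)\<close> for the dimension of \<open>H\<^sub>i(v\<^sub>1, \<dots>, v\<^sub>k; E/J)\<^sub>j\<close>. Three ideas carry the proof.

\<^emph>\<open>Everything is controlled by homological degree zero.\<close> Adjoining \<open>v\<^bsub>k+1\<^esub>\<close> gives a long exact sequence
\<open>\<dots> \<rightarrow> H\<^bsub>i+1\<^esub>(k)\<^bsub>j+1\<^esub> \<rightarrow> H\<^bsub>i+1\<^esub>(k+1)\<^bsub>j+1\<^esub> \<rightarrow> H\<^sub>i(k+1)\<^sub>j \<rightarrow> H\<^sub>i(k)\<^bsub>j+1\<^esub> \<rightarrow> \<dots>\<close>. Counting dimensions in it bounds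
\<open>h\<^bsub>k+1\<^esub>(i+1, j+1)\<close> by \<open>h\<^sub>k(i+1, j+1) + h\<^bsub>k+1\<^esub>(i, j)\<close> (\<open>homology_step_le\<close>), and at the end of the sequence it bounds
\<open>h\<^sub>k(1, j)\<close> in terms of the numbers \<open>h\<^sub>s(0, j)\<close> and \<open>h\<^sub>s(0, j - 1)\<close> with \<open>s \<le> k\<close> (\<open>homology_one_le\<close>, \<open>h_one_bound\<close>).
For the ideal spanned by the monomials \<open>e\<^sub>F\<close>, \<open>F \<in> S\<close>, where \<open>S\<close> is closed under supersets and under exchanging an
element for a smaller one (a strongly stable ideal), and for the sequence \<open>e\<^sub>n, e\<^bsub>n-1\<^esub>, \<dots>\<close>, all these bounds are
equalities: there every class of positive degree is represented by a chain all of whose products with the forms of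
the sequence vanish term by term (\<open>good_representative\<close>), and such a chain can be lifted. Hence
\<open>homology_comparison\<close>: if an ideal has the Hilbert function of a strongly stable one and its \<open>h\<^sub>k(0, j)\<close> are at most
those of the strongly stable ideal, then all its \<open>h\<^sub>k(i, j)\<close> are.

\<^emph>\<open>Generic means minimal.\<close> The ranks in the Cartan complex are lower semicontinuous in the coefficients of the
forms, and over an infinite field nonempty Zariski open sets meet. Hence \<open>\<beta>\<^bsub>ijp\<^esub>\<close> is the smallest value that the
homology takes on any sequence of \<open>p\<close> forms, and an upper bound for one sequence is an upper bound for \<open>\<beta>\<^bsub>ijp\<^esub>\<close>
(\<open>max_rank_min_homology\<close>, \<open>cartan_betti_eq\<close>). For a strongly stable ideal a generic sequence can be carried to
\<open>e\<^sub>n, e\<^bsub>n-1\<^esub>, \<dots>\<close> by recombining its members and by triangular substitutions, which preserve the ideal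
(\<open>cartan_betti_stable\<close>). With the comparison this yields \<open>cartan_betti_le_stable\<close>: to bound all Betti numbers of
\<open>J\<close> by those of a strongly stable ideal with the same Hilbert function, it suffices to find for each \<open>k\<close> and \<open>j\<close> one
sequence of \<open>k\<close> forms modulo which \<open>E/J\<close> has in degree \<open>j\<close> at most as many dimensions as there are sets
\<open>F \<subseteq> {1..n - k}\<close> of size \<open>j\<close> outside \<open>S\<close>.

\<^emph>\<open>Both ideals are of this kind.\<close> For generic \<open>g\<close> let \<open>S\<close> be the set of leading sets of \<open>g(J)\<close>; then \<open>gin(J)\<close> is
spanned by the \<open>e\<^sub>F\<close>, \<open>F \<in> S\<close> (\<open>gin_eq\<close>). Applying a transvection \<open>e\<^sub>j \<mapsto> e\<^sub>j + t e\<^sub>i\<close> with \<open>i < j\<close> to an element with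
leading set \<open>F\<close> produces the leading set \<open>F - {j} \<union> {i}\<close>, and for almost all \<open>t\<close> the matrix stays generic; so \<open>S\<close> is
closed under exchange (\<open>gin_shifted\<close>). Reducing by leading terms shows that modulo \<open>g(J)\<close> and \<open>e\<^sub>n, \<dots>, e\<^bsub>n+1-k\<^esub>\<close> the
algebra is spanned by the \<open>e\<^sub>F\<close> with \<open>F \<subseteq> {1..n - k}\<close> and \<open>F \<notin> S\<close> (\<open>h0_le_leads\<close>), which is the required bound after
transport along \<open>g\<close>. For the lexsegment ideal the same \<open>S\<close> is used: among all families of \<open>d\<close>-sets of a given size
which are closed under exchange, the lexsegment has the fewest members inside every \<open>{1..k}\<close> (\<open>low_minimal\<close>). This
exterior version of the theorem of Kruskal and Katona gives both that the lexsegments of the right sizes form an ideal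
and that this ideal satisfies the required bound.\<close>

section \<open>Finite-dimensional subspaces\<close>

text \<open>The functions that represent elements of the exterior algebra and chains form spaces of infinite dimension, where
\<open>dim\<close> only behaves well on subspaces of finite span.\<close>

definition fin_span :: "('k::field \<Rightarrow> 'v::ab_group_add \<Rightarrow> 'v) \<Rightarrow> 'v set \<Rightarrow> bool" where
  "fin_span scale V \<longleftrightarrow> (\<exists>T. finite T \<and> V \<subseteq> module.span scale T)"

context vector_space
begin

lemma fin_span_mono: "V \<subseteq> W \<Longrightarrow> fin_span scale W \<Longrightarrow> fin_span scale V"
  unfolding fin_span_def by blast

lemma fin_span_sum:
  assumes "fin_span scale V" "fin_span scale W"
  shows "fin_span scale {v + w | v w. v \<in> V \<and> w \<in> W}"
proof -
  obtain S T where "finite S" "V \<subseteq> span S" "finite T" "W \<subseteq> span T"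
    using assms unfolding fin_span_def by blast
  moreover have "span S \<subseteq> span (S \<union> T)" "span T \<subseteq> span (S \<union> T)"
    by (simp_all add: span_mono)
  ultimately have "{v + w | v w. v \<in> V \<and> w \<in> W} \<subseteq> span (S \<union> T)"
    by (auto intro!: span_add)
  then show ?thesis
    unfolding fin_span_def using \<open>finite S\<close> \<open>finite T\<close> by blast
qed

lemma independent_finite:
  assumes "independent B" "B \<subseteq> V" "fin_span scale V"
  shows "finite B"
  using assms independent_span_bound unfolding fin_span_def by (meson subset_trans)

lemma independent_card_le_dim:
  assumes "independent B" "B \<subseteq> V" "fin_span scale V"
  shows "card B \<le> dim V"
proof -
  obtain C where C: "C \<subseteq> V" "independent C" "V \<subseteq> span C" "card C = dim V"
    using basis_exists by blast
  have "finite C" using independent_finite C assms by blast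
  then show ?thesis using independent_span_bound[of C B] assms C by (metis subset_trans)
qed

lemma dim_subset:
  assumes "V \<subseteq> W" "fin_span scale W"
  shows "dim V \<le> dim W"
proof -
  obtain B where B: "B \<subseteq> V" "independent B" "V \<subseteq> span B" "card B = dim V"
    using basis_exists by blast
  then show ?thesis using independent_card_le_dim[of B W] assms by auto
qed

lemma basis_extension:
  assumes "subspace V" "V \<subseteq> W" "subspace W" "fin_span scale W"
  obtains B C where "finite B" "finite C" "B \<inter> C = {}" "independent (B \<union> C)"
    "span B = V" "span (B \<union> C) = W" "card B = dim V" "card B + card C = dim W"
proof -
  obtain B where B: "B \<subseteq> V" "independent B" "V \<subseteq> span B" "card B = dim V"
    using basis_exists by blast
  obtain D where D: "B \<subseteq> D" "D \<subseteq> W" "independent D" "W \<subseteq> span D"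
    using maximal_independent_subset_extend[of B W] B assms by (metis subset_trans)
  have fin: "finite D" using independent_finite D assms by blast
  have sp: "span B = V" "span D = W"
    using B D assms span_minimal by blast+
  have card: "card D = dim W" using D by (simp add: basis_card_eq_dim)
  show thesis
  proof (rule that[of B "D - B"])
    show "card B + card (D - B) = dim W"
      using fin D card by (metis card_Diff_subset card_mono finite_subset le_add_diff_inverse)
  qed (use fin B D sp in \<open>auto intro: finite_subset simp: Un_absorb1\<close>)
qed

lemma independent_sum_zero:
  assumes "independent B" "finite B" "(\<Sum>b\<in>B. scale (r b) b) = 0" "b \<in> B"
  shows "r b = 0"
  using assms by (metis dependent_finite)

lemma span_finite_sum:
  assumes "finite B" "v \<in> span B"
  obtains r where "v = (\<Sum>b\<in>B. scale (r b) b)"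
  using assms span_finite[of B] by auto

lemma finite_sum_in_span: "(\<Sum>b\<in>B. scale (r b) b) \<in> span B"
  by (intro span_sum span_scale span_base)

lemma dim_sum_Int:
  assumes "subspace V" "subspace W" "fin_span scale V" "fin_span scale W"
  shows "dim {v + w | v w. v \<in> V \<and> w \<in> W} + dim (V \<inter> W) = dim V + dim W"
proof -
  obtain B C where B: "finite B" "finite C" "B \<inter> C = {}" "independent (B \<union> C)"
    "span B = V \<inter> W" "span (B \<union> C) = V" "card B = dim (V \<inter> W)" "card B + card C = dim V"
    by (rule basis_extension[OF subspace_inter[OF assms(1,2)] Int_lower1 assms(1,3)])
  have fs: "fin_span scale {v + w | v w. v \<in> V \<and> w \<in> W}" using fin_span_sum assms by blast
  have ss: "subspace {v + w | v w. v \<in> V \<and> w \<in> W}" using subspace_sums assms by blast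
  have sub: "W \<subseteq> {v + w | v w. v \<in> V \<and> w \<in> W}" 
    using subspace_0[OF assms(1)] by force
  have subV: "V \<subseteq> {v + w | v w. v \<in> V \<and> w \<in> W}" 
    using subspace_0[OF assms(2)] by force
  obtain D where D: "finite D" "independent D" "span D = W" "card D = dim W"
    by (rule basis_extension[OF assms(2) order_refl assms(2,4)]) (metis independent_mono sup_ge1)
  have CD: "C \<inter> D = {}"
  proof (rule ccontr)
    assume "C \<inter> D \<noteq> {}"
    then obtain c where c: "c \<in> C" "c \<in> D" by blast
    then have "c \<in> V" "c \<in> W" using B D span_base by (metis UnCI, metis)
    then have "c \<in> span B" using B by simp
    moreover have "B \<subseteq> (B \<union> C) - {c}" using c B by auto
    ultimately have "c \<in> span ((B \<union> C) - {c})" using span_mono by blast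
    then show False using B(4) c dependent_def by blast
  qed
  have ind: "independent (C \<union> D)"
    unfolding dependent_finite[OF finite_UnI[OF B(2) D(1)]]
  proof (clarify)
    fix r v assume r: "(\<Sum>v\<in>C \<union> D. scale (r v) v) = 0" and v: "v \<in> C \<union> D" "r v \<noteq> 0"
    have eq: "(\<Sum>v\<in>C. scale (r v) v) + (\<Sum>v\<in>D. scale (r v) v) = 0"
      using r CD B D by (simp add: sum.union_disjoint)
    have "(\<Sum>v\<in>C. scale (r v) v) \<in> span (B \<union> C)"
      using finite_sum_in_span span_mono by blast
    moreover have "(\<Sum>v\<in>C. scale (r v) v) = - (\<Sum>v\<in>D. scale (r v) v)"
      using eq by (simp add: eq_neg_iff_add_eq_0)
    then have "(\<Sum>v\<in>C. scale (r v) v) \<in> span D"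
      using finite_sum_in_span span_neg by metis
    ultimately have "(\<Sum>v\<in>C. scale (r v) v) \<in> span B" using B D by auto
    then obtain q where q: "(\<Sum>v\<in>C. scale (r v) v) = (\<Sum>b\<in>B. scale (q b) b)"
      using span_finite_sum B(1) by metis
    have "(\<Sum>v\<in>B \<union> C. scale (if v \<in> C then r v else - q v) v)
       = (\<Sum>v\<in>B. scale (if v \<in> C then r v else - q v) v) + (\<Sum>v\<in>C. scale (if v \<in> C then r v else - q v) v)"
      using B by (simp add: sum.union_disjoint)
    also have "(\<Sum>v\<in>B. scale (if v \<in> C then r v else - q v) v) = - (\<Sum>b\<in>B. scale (q b) b)"
      unfolding sum_negf[symmetric] using B(3) by (intro sum.cong) auto
    finally have "(\<Sum>v\<in>B \<union> C. scale (if v \<in> C then r v else - q v) v) = 0"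
      using q by simp
    then have C0: "r v = 0" if "v \<in> C" for v
      using independent_sum_zero[OF B(4) finite_UnI[OF B(1,2)], of "\<lambda>v. if v \<in> C then r v else - q v" v] that
      by auto
    then have "(\<Sum>v\<in>D. scale (r v) v) = 0" using eq by simp
    then have "r v = 0" if "v \<in> D" for v using that D independent_sum_zero by metis
    then show False using C0 v by auto
  qed
  have "{v + w | v w. v \<in> V \<and> w \<in> W} \<subseteq> span (C \<union> D)"
  proof clarify
    fix v w assume "v \<in> V" "w \<in> W"
    have "B \<subseteq> span (C \<union> D)" 
    proof -
      have "B \<subseteq> span D" using B(5) D(3) span_superset by blast
      then show ?thesis using span_mono[of D "C \<union> D"] by blast
    qed
    then have "span (B \<union> C) \<subseteq> span (C \<union> D)"
      by (intro span_minimal) (auto intro: span_base)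
    moreover have "span D \<subseteq> span (C \<union> D)" by (simp add: span_mono)
    ultimately show "v + w \<in> span (C \<union> D)" using \<open>v \<in> V\<close> \<open>w \<in> W\<close> B D
      by (intro span_add) auto
  qed
  moreover have "C \<union> D \<subseteq> {v + w | v w. v \<in> V \<and> w \<in> W}"
    using sub subV B(6) D(3) span_superset by blast
  ultimately have "dim {v + w | v w. v \<in> V \<and> w \<in> W} = card (C \<union> D)"
    using basis_card_eq_dim[OF _ _ ind] by simp
  also have "\<dots> = card C + card D" using CD B D by (simp add: card_Un_disjoint)
  finally show ?thesis using B D by simp
qed

lemma basis_mod_card:
  assumes "subspace Z" "subspace B" "B \<subseteq> Z" "fin_span scale Z" "basis_mod scale S Z B"
  shows "card S + dim B = dim Z"
proof -
  obtain T where T: "finite T" "independent T" "span T = B" "card T = dim B"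
    by (rule basis_extension[OF assms(2) order_refl assms(2) fin_span_mono[OF assms(3,4)]])
      (metis independent_mono sup_ge1)
  have S: "finite S" "S \<subseteq> Z" 
    and ex1: "\<And>z. z \<in> Z \<Longrightarrow> \<exists>!r. (\<forall>s. s \<notin> S \<longrightarrow> r s = 0) \<and> z - (\<Sum>s\<in>S. scale (r s) s) \<in> B"
    using assms(5) unfolding basis_mod_def by auto
  have uniq: "r = r'" if "z \<in> Z" "\<forall>s. s \<notin> S \<longrightarrow> r s = 0" "z - (\<Sum>s\<in>S. scale (r s) s) \<in> B"
      "\<forall>s. s \<notin> S \<longrightarrow> r' s = 0" "z - (\<Sum>s\<in>S. scale (r' s) s) \<in> B" for z r r'
    using ex1[OF that(1)] that(2-) by (elim ex1E) (metis (no_types))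
  have zero: "r s = 0" if "(\<Sum>s\<in>S. scale (r s) s) \<in> B" "s \<in> S" for r s
  proof -
    define q where "q = (\<lambda>s. if s \<in> S then r s else 0)"
    have "(\<Sum>s\<in>S. scale (q s) s) = (\<Sum>s\<in>S. scale (r s) s)" by (simp add: q_def)
    then have "0 - (\<Sum>s\<in>S. scale (q s) s) \<in> B" using that subspace_neg[OF assms(2)] by simp
    moreover have "(0::'b) - (\<Sum>s\<in>S. scale ((\<lambda>s. 0) s) s) \<in> B" using subspace_0[OF assms(2)] by simp
    moreover have "\<forall>s. s \<notin> S \<longrightarrow> q s = 0" by (simp add: q_def)
    ultimately have "q = (\<lambda>s. 0)" by (intro uniq[OF subspace_0[OF assms(1)], of q]) auto
    then show ?thesis using that by (metis q_def)
  qed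
  have ST: "S \<inter> T = {}"
  proof (rule ccontr)
    assume "S \<inter> T \<noteq> {}"
    then obtain s where s: "s \<in> S" "s \<in> T" by blast
    have "(\<Sum>s'\<in>S. scale ((if s' = s then 1 else 0)) s') = (\<Sum>s'\<in>S. if s' = s then s' else 0)" 
      by (rule sum.cong) auto
    also have "\<dots> = s" using s S by simp
    finally have "(\<Sum>s'\<in>S. scale ((if s' = s then 1 else 0)) s') = s" .
    moreover have "s \<in> B" using s T span_base by metis
    ultimately show False using zero[of "\<lambda>s'. if s' = s then 1 else 0" s] s by simp
  qed
  have ind: "independent (S \<union> T)"
    unfolding dependent_finite[OF finite_UnI[OF S(1) T(1)]]
  proof clarify
    fix r v assume r: "(\<Sum>v\<in>S \<union> T. scale (r v) v) = 0" and v: "v \<in> S \<union> T" "r v \<noteq> 0"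
    have eq: "(\<Sum>v\<in>S. scale (r v) v) + (\<Sum>v\<in>T. scale (r v) v) = 0"
      using r ST S T by (simp add: sum.union_disjoint)
    then have "(\<Sum>v\<in>S. scale (r v) v) = - (\<Sum>v\<in>T. scale (r v) v)"
      by (simp add: eq_neg_iff_add_eq_0)
    then have "(\<Sum>v\<in>S. scale (r v) v) \<in> B"
      using finite_sum_in_span span_neg T(3) by metis
    then have S0: "r v = 0" if "v \<in> S" for v using zero that by blast
    then have "(\<Sum>v\<in>T. scale (r v) v) = 0" using eq by simp
    then have "r v = 0" if "v \<in> T" for v using that T independent_sum_zero by metis
    then show False using S0 v by auto
  qed
  have "Z \<subseteq> span (S \<union> T)"
  proof
    fix z assume "z \<in> Z"
    then obtain r where "z - (\<Sum>s\<in>S. scale (r s) s) \<in> span T" using ex1 T(3) by blast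
    then have "z - (\<Sum>s\<in>S. scale (r s) s) \<in> span (S \<union> T)" using span_mono[of T "S \<union> T"] by auto
    moreover have "(\<Sum>s\<in>S. scale (r s) s) \<in> span (S \<union> T)" 
      using finite_sum_in_span span_mono[of S "S \<union> T"] by blast
    ultimately show "z \<in> span (S \<union> T)" using span_add by fastforce
  qed
  moreover have "S \<union> T \<subseteq> Z" using S T assms(3) span_superset by blast
  ultimately have "dim Z = card (S \<union> T)" using basis_card_eq_dim[OF _ _ ind] by simp
  then show ?thesis using ST S T by (simp add: card_Un_disjoint)
qed

lemma basis_mod_exists:
  assumes "subspace Z" "subspace B" "B \<subseteq> Z" "fin_span scale Z"
  shows "\<exists>S. basis_mod scale S Z B"
proof -
  obtain T S where T: "finite T" "finite S" "T \<inter> S = {}" "independent (T \<union> S)"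
    "span T = B" "span (T \<union> S) = Z" "card T = dim B" "card T + card S = dim Z"
    by (rule basis_extension[OF assms(2,3,1,4)])
  have "\<exists>!r. (\<forall>s. s \<notin> S \<longrightarrow> r s = 0) \<and> z - (\<Sum>s\<in>S. scale (r s) s) \<in> B" if "z \<in> Z" for z
  proof -
    have "finite (T \<union> S)" "z \<in> span (T \<union> S)" using T that by simp_all
    then obtain q where "z = (\<Sum>v\<in>T \<union> S. scale (q v) v)"
      using span_finite_sum by metis
    then have z: "z = (\<Sum>v\<in>T. scale (q v) v) + (\<Sum>v\<in>S. scale (q v) v)"
      using T by (simp add: sum.union_disjoint)
    define r where "r = (\<lambda>s. if s \<in> S then q s else 0)"
    have r: "(\<Sum>s\<in>S. scale (r s) s) = (\<Sum>s\<in>S. scale (q s) s)"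
      by (simp add: r_def)
    show ?thesis
    proof (rule ex1I[of _ r])
      show "(\<forall>s. s \<notin> S \<longrightarrow> r s = 0) \<and> z - (\<Sum>s\<in>S. scale (r s) s) \<in> B"
        unfolding r using z finite_sum_in_span T(5) by (auto simp: r_def)
    next
      fix r' assume r': "(\<forall>s. s \<notin> S \<longrightarrow> r' s = 0) \<and> z - (\<Sum>s\<in>S. scale (r' s) s) \<in> B"
      have "z - (\<Sum>s\<in>S. scale (r s) s) \<in> B"
        unfolding r using z finite_sum_in_span T(5) by auto
      then have "(z - (\<Sum>s\<in>S. scale (r s) s)) - (z - (\<Sum>s\<in>S. scale (r' s) s)) \<in> span T"
        using r' T(5) span_diff by metis
      then have "(\<Sum>s\<in>S. scale (r' s - r s) s) \<in> span T"
        by (simp add: scale_left_diff_distrib sum_subtractf)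
      then obtain p where p: "(\<Sum>s\<in>S. scale (r' s - r s) s) = (\<Sum>v\<in>T. scale (p v) v)"
        using span_finite_sum T(1) by metis
      have "(\<Sum>v\<in>T \<union> S. scale (if v \<in> S then r' v - r v else - p v) v)
        = (\<Sum>v\<in>T. scale (if v \<in> S then r' v - r v else - p v) v) + (\<Sum>v\<in>S. scale (if v \<in> S then r' v - r v else - p v) v)"
        using T by (simp add: sum.union_disjoint)
      also have "(\<Sum>v\<in>T. scale (if v \<in> S then r' v - r v else - p v) v) = - (\<Sum>v\<in>T. scale (p v) v)"
        unfolding sum_negf[symmetric] using T(3) by (intro sum.cong) auto
      finally have "(\<Sum>v\<in>T \<union> S. scale (if v \<in> S then r' v - r v else - p v) v) = 0"
        using p by simp
      then have "r' s = r s" if "s \<in> S" for s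
        using independent_sum_zero[OF T(4) finite_UnI[OF T(1,2)], of "\<lambda>v. if v \<in> S then r' v - r v else - p v" s] that
        by auto
      then show "r' = r" using r' by (auto simp: r_def fun_eq_iff)
    qed
  qed
  moreover have "S \<subseteq> Z" using T(6) span_superset by blast
  ultimately have "basis_mod scale S Z B" unfolding basis_mod_def using T(2) by simp
  then show ?thesis ..
qed

lemma quotient_dim_eq:
  assumes "subspace Z" "subspace B" "B \<subseteq> Z" "fin_span scale Z"
  shows "quotient_dim scale Z B + dim B = dim Z"
proof -
  obtain S where S: "basis_mod scale S Z B" using basis_mod_exists assms by blast
  have "quotient_dim scale Z B = card S"
    unfolding quotient_dim_def
  proof (rule the_equality)
    show "\<exists>S'. basis_mod scale S' Z B \<and> card S' = card S" using S by blast
    fix d assume "\<exists>S'. basis_mod scale S' Z B \<and> card S' = d"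
    then show "d = card S" using basis_mod_card[OF assms] S by (metis add_right_cancel)
  qed
  then show ?thesis using basis_mod_card[OF assms S] by simp
qed

lemma dim_le_spanning_mod:
  assumes "fin_span scale Z" "subspace B" "finite S" "\<And>z. z \<in> Z \<Longrightarrow> \<exists>s\<in>span S. z - s \<in> B" "fin_span scale B"
  shows "dim Z \<le> dim B + card S"
proof -
  obtain T where T: "T \<subseteq> B" "independent T" "B \<subseteq> span T" "card T = dim B"
    using basis_exists by blast
  have finT: "finite T" using T assms independent_finite by blast
  have "Z \<subseteq> span (T \<union> S)"
  proof
    fix z assume "z \<in> Z"
    then obtain s where s: "s \<in> span S" "z - s \<in> span T" using assms(4) T(3) by blast
    then have "s \<in> span (T \<union> S)" "z - s \<in> span (T \<union> S)"
      using span_mono[of S "T \<union> S"] span_mono[of T "T \<union> S"] by blast+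
    then have "s + (z - s) \<in> span (T \<union> S)" by (rule span_add)
    then show "z \<in> span (T \<union> S)" by simp
  qed
  then have "dim Z \<le> card (T \<union> S)" using finT assms dim_le_card by blast
  also have "\<dots> \<le> card T + card S" by (rule card_Un_le)
  finally show ?thesis using T by simp
qed

end

context vector_space_pair
begin

lemma fin_span_image:
  assumes "Vector_Spaces.linear s1 s2 f" "fin_span s1 V"
  shows "fin_span s2 (f ` V)"
proof -
  obtain T where T: "finite T" "V \<subseteq> vs1.span T" using assms fin_span_def by blast
  then have "f ` V \<subseteq> vs2.span (f ` T)"
    using linear_span_image[OF assms(1), of T] by blast
  then show ?thesis using T fin_span_def by blast
qed

lemma rank_nullity:
  assumes f: "Vector_Spaces.linear s1 s2 f" and Z: "vs1.subspace Z" "fin_span s1 Z"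
  shows "vs2.dim (f ` Z) + vs1.dim {z \<in> Z. f z = 0} = vs1.dim Z"
proof -
  have lf: "f (x + y) = f x + f y" "f (s1 r x) = s2 r (f x)" "f 0 = 0" for x y r
    using f by (simp_all add: linear_add linear_scale linear_0)
  have ker: "vs1.subspace {z \<in> Z. f z = 0}"
    using Z unfolding vs1.subspace_def by (auto simp: lf)
  obtain B C where B: "finite B" "finite C" "B \<inter> C = {}" "vs1.independent (B \<union> C)"
    "vs1.span B = {z \<in> Z. f z = 0}" "vs1.span (B \<union> C) = Z" "card B = vs1.dim {z \<in> Z. f z = 0}"
    "card B + card C = vs1.dim Z"
    by (rule vs1.basis_extension[OF ker _ Z]) auto
  have key: "r c = 0" if "(\<Sum>c\<in>C. s2 (r c) (f c)) = 0" "c \<in> C" for r c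
  proof -
    have "f (\<Sum>c\<in>C. s1 (r c) c) = 0" using that f by (simp add: linear_sum linear_scale)
    moreover have "(\<Sum>c\<in>C. s1 (r c) c) \<in> Z" 
      using vs1.finite_sum_in_span B(6) vs1.span_mono[of C "B \<union> C"] by blast
    ultimately have "(\<Sum>c\<in>C. s1 (r c) c) \<in> vs1.span B" using B by auto
    then obtain q where q: "(\<Sum>c\<in>C. s1 (r c) c) = (\<Sum>v\<in>B. s1 (q v) v)"
      using vs1.span_finite_sum B(1) by metis
    have "(\<Sum>v\<in>B \<union> C. s1 (if v \<in> C then r v else - q v) v)
       = (\<Sum>v\<in>B. s1 (if v \<in> C then r v else - q v) v) + (\<Sum>v\<in>C. s1 (if v \<in> C then r v else - q v) v)"
      using B by (simp add: sum.union_disjoint)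
    also have "(\<Sum>v\<in>B. s1 (if v \<in> C then r v else - q v) v) = - (\<Sum>b\<in>B. s1 (q b) b)"
      unfolding sum_negf[symmetric] using B(3) by (intro sum.cong) auto
    finally have "(\<Sum>v\<in>B \<union> C. s1 (if v \<in> C then r v else - q v) v) = 0"
      using q by simp
    then show "r c = 0"
      using vs1.independent_sum_zero[OF B(4) finite_UnI[OF B(1,2)], of "\<lambda>v. if v \<in> C then r v else - q v" c] that
      by auto
  qed
  have inj: "inj_on f C"
  proof (rule inj_onI, rule ccontr)
    fix x y assume xy: "x \<in> C" "y \<in> C" "f x = f y" "x \<noteq> y"
    define r :: "'b \<Rightarrow> 'a" where "r = (\<lambda>c. if c = x then 1 else if c = y then - 1 else 0)"
    have "(\<Sum>c\<in>C. s2 (r c) (f c)) = (\<Sum>c\<in>C. (if c = x then f c else 0) + (if c = y then - f c else 0))"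
      using xy by (intro sum.cong) (auto simp: r_def)
    also have "\<dots> = 0" unfolding sum.distrib using B(2) xy by simp
    finally show False using key xy r_def by (metis one_neq_zero)
  qed
  have "vs2.independent (f ` C)"
    unfolding vs2.dependent_finite[OF finite_imageI[OF B(2)]]
  proof clarify
    fix r c assume r: "(\<Sum>v\<in>f ` C. s2 (r v) v) = 0" "c \<in> C" "r (f c) \<noteq> 0"
    then have "(\<Sum>v\<in>C. s2 (r (f v)) (f v)) = 0" using inj by (simp add: sum.reindex)
    then show False using key[of "\<lambda>v. r (f v)"] r by blast
  qed
  moreover have "f ` Z \<subseteq> vs2.span (f ` C)"
  proof clarify
    fix z assume "z \<in> Z"
    then have "finite (B \<union> C)" "z \<in> vs1.span (B \<union> C)" using B by simp_all
    then obtain q where "z = (\<Sum>v\<in>B \<union> C. s1 (q v) v)"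
      using vs1.span_finite_sum by metis
    then have z: "z = (\<Sum>v\<in>B. s1 (q v) v) + (\<Sum>v\<in>C. s1 (q v) v)"
      using B by (simp add: sum.union_disjoint)
    have "(\<Sum>v\<in>B. s1 (q v) v) \<in> {z \<in> Z. f z = 0}" using B(5) vs1.finite_sum_in_span by metis
    then have "f z = (\<Sum>v\<in>C. s2 (q v) (f v))" using z lf f by (simp add: linear_sum linear_scale)
    also have "\<dots> \<in> vs2.span (f ` C)"
      by (intro vs2.span_sum vs2.span_scale vs2.span_base) auto
    finally show "f z \<in> vs2.span (f ` C)" .
  qed
  moreover have "f ` C \<subseteq> f ` Z" using B(6) vs1.span_superset by blast
  ultimately have "vs2.dim (f ` Z) = card (f ` C)" using vs2.basis_card_eq_dim by metis
  then show ?thesis using B inj by (simp add: card_image)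
qed

lemma dim_image_inj:
  assumes "Vector_Spaces.linear s1 s2 f" "vs1.subspace Z" "fin_span s1 Z" "\<And>z. z \<in> Z \<Longrightarrow> f z = 0 \<Longrightarrow> z = 0"
  shows "vs2.dim (f ` Z) = vs1.dim Z"
proof -
  have "f 0 = 0" using linear_0[OF assms(1)] .
  then have "{z \<in> Z. f z = 0} = {0}" using assms(4) vs1.subspace_0[OF assms(2)] by auto
  moreover have "vs1.dim {0} = 0" using vs1.dim_span[of "{}"] vs1.dim_eq_card_independent[OF vs1.independent_empty] 
    by (simp add: vs1.span_empty)
  ultimately show ?thesis using rank_nullity[OF assms(1-3)] by simp
qed

text \<open>Counts a preimage modulo a subspace; cycles of a quotient complex and the maps between homology groups are of this form.
The map from \<open>Z\<close> to the quotient by \<open>B\<close> has the left summand as its image, up to \<open>B\<close>, and the right one as its kernel.\<close>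

lemma dim_preimage:
  assumes f: "Vector_Spaces.linear s1 s2 f" and Z: "vs1.subspace Z" "fin_span s1 Z"
    and B: "vs2.subspace B" "fin_span s2 B"
  shows "vs2.dim {f z + b | z b. z \<in> Z \<and> b \<in> B} + vs1.dim {z \<in> Z. f z \<in> B}
    = vs1.dim Z + vs2.dim B"
proof -
  have lf: "f (x + y) = f x + f y" "f (s1 r x) = s2 r (f x)" "f 0 = 0" for x y r
    using f by (simp_all add: linear_add linear_scale linear_0)
  have sP: "vs1.subspace {z \<in> Z. f z \<in> B}"
    using Z B unfolding vs1.subspace_def vs2.subspace_def by (auto simp: lf)
  have fZ: "vs2.subspace (f ` Z)" using linear_subspace_image[OF f Z(1)] .
  have "f ` {z \<in> Z. f z \<in> B} = f ` Z \<inter> B" by auto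
  then have "vs2.dim (f ` Z \<inter> B) + vs1.dim {z \<in> {z \<in> Z. f z \<in> B}. f z = 0} = vs1.dim {z \<in> Z. f z \<in> B}"
    using rank_nullity[OF f sP vs1.fin_span_mono[OF _ Z(2)]] by auto
  moreover have "{z \<in> {z \<in> Z. f z \<in> B}. f z = 0} = {z \<in> Z. f z = 0}"
    using vs2.subspace_0[OF B(1)] by auto
  moreover have "vs2.dim {v + w | v w. v \<in> f ` Z \<and> w \<in> B} + vs2.dim (f ` Z \<inter> B) = vs2.dim (f ` Z) + vs2.dim B"
    using vs2.dim_sum_Int[OF fZ B(1) fin_span_image[OF f Z(2)] B(2)] .
  moreover have "{v + w | v w. v \<in> f ` Z \<and> w \<in> B} = {f z + b | z b. z \<in> Z \<and> b \<in> B}" by blast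
  ultimately show ?thesis using rank_nullity[OF f Z] by simp
qed

end

section \<open>The exterior algebra\<close>

(* Sums of functions are kept folded, so that the laws of vector spaces apply to them. *)

declare plus_fun_def [simp del] zero_fun_def [simp del] 

interpretation ext: vector_space "ext_scale :: 'k::field \<Rightarrow> 'k ext \<Rightarrow> 'k ext"
  by unfold_locales (auto simp: ext_scale_def fun_eq_iff algebra_simps)

lemma ext_scale_apply [simp]: "ext_scale r u F = r * u F"
  by (simp add: ext_scale_def)

lemma sum_fun_apply: "(\<Sum>x\<in>A. f x) y = (\<Sum>x\<in>A. f x y)"
  by (induct A rule: infinite_finite_induct) simp_all

lemma ext_mono_apply: "ext_mono F H = (if H = F then 1 else 0)"
  by (simp add: ext_mono_def)

lemma wedge_infinite: "infinite H \<Longrightarrow> wedge u v H = 0"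
  by (simp add: wedge_def)

lemma wedge_add_left: "wedge (u + u') v = wedge u v + wedge u' v"
  by (simp add: wedge_def fun_eq_iff algebra_simps sum.distrib)

lemma wedge_add_right: "wedge u (v + v') = wedge u v + wedge u v'"
  by (simp add: wedge_def fun_eq_iff algebra_simps sum.distrib)

lemma wedge_zero_left [simp]: "wedge 0 v = 0"
  by (simp add: wedge_def fun_eq_iff)

lemma wedge_zero_right [simp]: "wedge u 0 = 0"
  by (simp add: wedge_def fun_eq_iff)

lemma wedge_scale_left: "wedge (ext_scale r u) v = ext_scale r (wedge u v)"
  by (simp add: wedge_def fun_eq_iff sum_distrib_left mult_ac)

lemma wedge_scale_right: "wedge u (ext_scale r v) = ext_scale r (wedge u v)"
  by (simp add: wedge_def fun_eq_iff sum_distrib_left mult_ac)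

lemma wedge_minus_left: "wedge (- u) v = - wedge u v"
  using wedge_scale_left[of "-1" u v] by simp

lemma wedge_minus_right: "wedge u (- v) = - wedge u v"
  using wedge_scale_right[of u "-1" v] by simp

lemma wedge_sum_left: "wedge (\<Sum>x\<in>A. f x) v = (\<Sum>x\<in>A. wedge (f x) v)"
  using sum_comp_morphism[of "\<lambda>u. wedge u v" f A] by (simp add: wedge_add_left o_def)

lemma wedge_sum_right: "wedge u (\<Sum>x\<in>A. f x) = (\<Sum>x\<in>A. wedge u (f x))"
  using sum_comp_morphism[of "wedge u" f A] by (simp add: wedge_add_right o_def)

lemma wedge_nonzeroE:
  assumes "wedge u v H \<noteq> 0"
  obtains F where "finite H" "F \<subseteq> H" "u F \<noteq> 0" "v (H - F) \<noteq> 0"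
proof -
  have "finite H" using assms wedge_infinite by blast
  obtain F where "F \<in> Pow H" "shuffle_sign F (H - F) * u F * v (H - F) \<noteq> 0"
    using assms unfolding wedge_def by (meson sum.not_neutral_contains_not_neutral)
  then show thesis using that[of F] \<open>finite H\<close> by auto
qed

lemma finite_inversions: "finite F \<Longrightarrow> finite G \<Longrightarrow> finite {(a, b). a \<in> F \<and> b \<in> G \<and> b < (a::nat)}"
  by (rule finite_subset[of _ "F \<times> G"]) auto

lemma shuffle_sign_Un_left:
  assumes "finite A" "finite B" "finite C" "A \<inter> B = {}"
  shows "shuffle_sign (A \<union> B) C = (shuffle_sign A C * shuffle_sign B C :: 'k::field)"
proof -
  have "{(a, b). a \<in> A \<union> B \<and> b \<in> C \<and> b < a} =
    {(a, b). a \<in> A \<and> b \<in> C \<and> b < a} \<union> {(a, b). a \<in> B \<and> b \<in> C \<and> b < a}" by auto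
  moreover have "{(a, b). a \<in> A \<and> b \<in> C \<and> b < a} \<inter> {(a, b). a \<in> B \<and> b \<in> C \<and> b < a} = {}"
    using assms by auto
  ultimately show ?thesis using assms
    by (simp add: shuffle_sign_def power_add card_Un_disjoint finite_inversions)
qed

lemma shuffle_sign_Un_right:
  assumes "finite A" "finite B" "finite C" "B \<inter> C = {}"
  shows "shuffle_sign A (B \<union> C) = (shuffle_sign A B * shuffle_sign A C :: 'k::field)"
proof -
  have "{(a, b). a \<in> A \<and> b \<in> B \<union> C \<and> b < a} =
    {(a, b). a \<in> A \<and> b \<in> B \<and> b < a} \<union> {(a, b). a \<in> A \<and> b \<in> C \<and> b < a}" by auto
  moreover have "{(a, b). a \<in> A \<and> b \<in> B \<and> b < a} \<inter> {(a, b). a \<in> A \<and> b \<in> C \<and> b < a} = {}"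
    using assms by auto
  ultimately show ?thesis using assms
    by (simp add: shuffle_sign_def power_add card_Un_disjoint finite_inversions)
qed

lemma shuffle_sign_nonzero [simp]: "shuffle_sign F G \<noteq> (0::'k::field)"
  by (simp add: shuffle_sign_def)

lemma shuffle_sign_sorted: "(\<And>a b. a \<in> F \<Longrightarrow> b \<in> G \<Longrightarrow> a \<le> b) \<Longrightarrow> shuffle_sign F G = 1"
proof -
  assume "\<And>a b. a \<in> F \<Longrightarrow> b \<in> G \<Longrightarrow> a \<le> b"
  then have "{(a, b). a \<in> F \<and> b \<in> G \<and> b < a} = {}" by (auto simp: not_less)
  then show ?thesis by (simp only: shuffle_sign_def card.empty power_0)
qed

lemma shuffle_sign_singletons: "shuffle_sign {l} {m} = (if m < l then - 1 else 1)"
proof -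
  have "{(a, b). a \<in> {l} \<and> b \<in> {m} \<and> b < a} = (if m < l then {(l, m)} else {})" by auto
  then show ?thesis by (simp add: shuffle_sign_def)
qed

text \<open>Both sides are sums over the ordered partitions of \<open>H\<close> into three parts; the signs agree since the inversions of three
consecutive blocks split into the inversions of the pairs of blocks.\<close>

lemma wedge_assoc: "wedge (wedge u v) w = wedge u (wedge v (w :: 'k::field ext))"
proof
  fix H :: "nat set"
  show "wedge (wedge u v) w H = wedge u (wedge v w) H"
  proof (cases "finite H")
    case False
    then show ?thesis by (simp add: wedge_infinite)
  next
    case True
    have "wedge (wedge u v) w H = (\<Sum>X\<in>Pow H. \<Sum>F\<in>Pow X. shuffle_sign X (H - X) *
        (shuffle_sign F (X - F) * u F * v (X - F)) * w (H - X))"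
      unfolding wedge_def by (simp add: sum_distrib_left sum_distrib_right)
    also have "\<dots> = (\<Sum>(X, F)\<in>(SIGMA X:Pow H. Pow X). shuffle_sign X (H - X) *
        (shuffle_sign F (X - F) * u F * v (X - F)) * w (H - X))"
      by (rule sum.Sigma) (use True in \<open>auto dest: finite_subset\<close>)
    also have "\<dots> = (\<Sum>(F, G)\<in>(SIGMA F:Pow H. Pow (H - F)). shuffle_sign F (H - F) * u F *
        (shuffle_sign G (H - F - G) * v G * w (H - F - G)))"
    proof (rule sum.reindex_bij_witness[of _ "\<lambda>(F, G). (F \<union> G, F)" "\<lambda>(X, F). (F, X - F)"])
      fix p assume p: "p \<in> (SIGMA X:Pow H. Pow X)"
      obtain X F where XF: "p = (X, F)" by fastforce
      have sub: "X \<subseteq> H" "F \<subseteq> X" using p XF by auto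
      have fin: "finite X" "finite F" "finite (H - X)" "finite (X - F)" using sub True by (auto intro: finite_subset)
      have X: "F \<union> (X - F) = X" "(X - F) \<union> (H - X) = H - F" using sub by auto
      have "shuffle_sign X (H - X) = (shuffle_sign F (H - X) * shuffle_sign (X - F) (H - X) :: 'k)"
        using shuffle_sign_Un_left[of F "X - F" "H - X"] fin X by auto
      moreover have "shuffle_sign F (H - F) = (shuffle_sign F (X - F) * shuffle_sign F (H - X) :: 'k)"
        using shuffle_sign_Un_right[of F "X - F" "H - X"] fin X by auto
      moreover have "H - F - (X - F) = H - X" using sub by auto
      ultimately show "(case (case p of (X, F) \<Rightarrow> (F, X - F)) of
          (F, G) \<Rightarrow> shuffle_sign F (H - F) * u F * (shuffle_sign G (H - F - G) * v G * w (H - F - G))) =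
         (case p of (X, F) \<Rightarrow> shuffle_sign X (H - X) * (shuffle_sign F (X - F) * u F * v (X - F)) * w (H - X))"
        by (simp add: XF mult_ac)
    qed auto
    also have "\<dots> = (\<Sum>F\<in>Pow H. \<Sum>G\<in>Pow (H - F). shuffle_sign F (H - F) * u F *
        (shuffle_sign G (H - F - G) * v G * w (H - F - G)))"
      by (rule sum.Sigma[symmetric]) (use True in auto)
    also have "\<dots> = wedge u (wedge v w) H"
      unfolding wedge_def by (simp add: sum_distrib_left)
    finally show ?thesis .
  qed
qed

lemma wedge_mono_left:
  "wedge (ext_mono F) u H = (if finite H \<and> F \<subseteq> H then shuffle_sign F (H - F) * u (H - F) else 0)"
proof (cases "finite H")
  case True
  have "wedge (ext_mono F) u H = (\<Sum>X\<in>Pow H. if X = F then shuffle_sign X (H - X) * u (H - X) else 0)"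
    unfolding wedge_def by (rule sum.cong) (auto simp: ext_mono_apply)
  then show ?thesis using True by simp
qed (simp add: wedge_infinite)

lemma wedge_mono_right:
  "wedge u (ext_mono F) H = (if finite H \<and> F \<subseteq> H then shuffle_sign (H - F) F * u (H - F) else 0)"
proof (cases "finite H \<and> F \<subseteq> H")
  case True
  have "wedge u (ext_mono F) H = (\<Sum>X\<in>Pow H. if X = H - F then shuffle_sign X (H - X) * u X else 0)"
    unfolding wedge_def using True by (intro sum.cong) (auto simp: ext_mono_apply)
  also have "\<dots> = shuffle_sign (H - F) (H - (H - F)) * u (H - F)" using True by simp
  also have "H - (H - F) = F" using True by auto
  finally show ?thesis using True by simp
next
  case False
  have "wedge u (ext_mono F) H = 0" if "finite H"
    unfolding wedge_def using False that by (intro sum.neutral) (auto simp: ext_mono_apply)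
  then show ?thesis using False wedge_infinite by auto
qed

lemma wedge_mono_mono:
  "wedge (ext_mono F) (ext_mono G) = (if finite F \<and> finite G \<and> F \<inter> G = {}
     then ext_scale (shuffle_sign F G) (ext_mono (F \<union> G)) else (0 :: 'k::field ext))"
proof
  fix H
  show "wedge (ext_mono F) (ext_mono G) H = (if finite F \<and> finite G \<and> F \<inter> G = {}
     then ext_scale (shuffle_sign F G) (ext_mono (F \<union> G)) else (0 :: 'k ext)) H"
  proof (cases "finite H \<and> F \<subseteq> H \<and> H - F = G")
    case True
    then have "H = F \<union> G" "finite F" "finite G" "F \<inter> G = {}" "(F \<union> G) - F = G" by (auto dest: finite_subset)
    then show ?thesis by (simp add: wedge_mono_left ext_mono_apply)
  next
    case False
    then have "\<not> (H = F \<union> G \<and> finite F \<and> finite G \<and> F \<inter> G = {})" by auto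
    then show ?thesis using False by (auto simp: wedge_mono_left ext_mono_apply)
  qed
qed

lemma wedge_one_left: "u \<in> ext_alg n \<Longrightarrow> wedge (ext_mono {}) u = u"
  by (auto simp: fun_eq_iff wedge_mono_left shuffle_sign_def ext_alg_def) (meson finite_atLeastAtMost finite_subset)+

lemma wedge_one_right: "u \<in> ext_alg n \<Longrightarrow> wedge u (ext_mono {}) = u"
  by (auto simp: fun_eq_iff wedge_mono_right shuffle_sign_def ext_alg_def) (meson finite_atLeastAtMost finite_subset)+

lemma ext_subspaces [simp]: 
  "ext.subspace (ext_alg n :: 'a::field ext set)" "ext.subspace (ext_deg n d :: 'a::field ext set)"
proof -
  have *: "ext.subspace {u :: 'a ext. \<forall>F. u F \<noteq> 0 \<longrightarrow> P F}" for P
  proof (rule ext.subspaceI)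
    fix x y :: "'a ext" assume xy: "x \<in> {u. \<forall>F. u F \<noteq> 0 \<longrightarrow> P F}" "y \<in> {u. \<forall>F. u F \<noteq> 0 \<longrightarrow> P F}"
    have "P F" if "(x + y) F \<noteq> 0" for F
    proof (cases "x F = 0")
      case True
      then show ?thesis using that xy by simp
    next
      case False
      then show ?thesis using xy by simp
    qed
    then show "x + y \<in> {u. \<forall>F. u F \<noteq> 0 \<longrightarrow> P F}" by blast
  qed simp_all
  show "ext.subspace (ext_alg n :: 'a ext set)" unfolding ext_alg_def by (rule *)
  show "ext.subspace (ext_deg n d :: 'a ext set)" unfolding ext_deg_def by (rule *)
qed

lemma ext_deg_subset: "ext_deg n d \<subseteq> ext_alg n"
  by (auto simp: ext_deg_def ext_alg_def)

lemma ext_mono_in: "F \<subseteq> {1..n} \<Longrightarrow> ext_mono F \<in> ext_alg n"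
  "F \<subseteq> {1..n} \<Longrightarrow> ext_mono F \<in> ext_deg n (card F)"
  by (auto simp: ext_alg_def ext_deg_def ext_mono_def)

lemma wedge_in_ext_alg: "u \<in> ext_alg n \<Longrightarrow> v \<in> ext_alg n \<Longrightarrow> wedge u v \<in> ext_alg n"
  by (fastforce simp: ext_alg_def elim!: wedge_nonzeroE)

lemma wedge_in_ext_deg:
  assumes "u \<in> ext_deg n d" "v \<in> ext_deg n e"
  shows "wedge u v \<in> ext_deg n (d + e)"
proof -
  have "H \<subseteq> {1..n} \<and> card H = d + e" if H: "wedge u v H \<noteq> 0" for H
  proof -
    obtain F where F: "finite H" "F \<subseteq> H" "u F \<noteq> 0" "v (H - F) \<noteq> 0" using H by (rule wedge_nonzeroE)
    then have "F \<subseteq> {1..n}" "card F = d" "H - F \<subseteq> {1..n}" "card (H - F) = e"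
      using assms by (auto simp: ext_deg_def)
    moreover have "card H = card F + card (H - F)" using F
      by (simp add: card_Diff_subset card_mono finite_subset)
    ultimately show ?thesis using F by auto
  qed
  then show ?thesis by (simp add: ext_deg_def)
qed

lemma ext_expansion:
  assumes "u \<in> ext_alg n"
  shows "u = (\<Sum>F\<in>Pow {1..n}. ext_scale (u F) (ext_mono F))"
proof
  fix H
  have "(\<Sum>F\<in>Pow {1..n}. ext_scale (u F) (ext_mono F)) H = (\<Sum>F\<in>Pow {1..n}. if F = H then u F else 0)"
    unfolding sum_fun_apply by (rule sum.cong) (auto simp: ext_mono_apply)
  also have "\<dots> = u H" using assms by (auto simp: ext_alg_def)
  finally show "u H = (\<Sum>F\<in>Pow {1..n}. ext_scale (u F) (ext_mono F)) H" by simp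
qed

lemma deg_one_expansion:
  assumes "u \<in> ext_deg n 1"
  shows "u = (\<Sum>l\<in>{1..n}. ext_scale (u {l}) (ext_mono {l}))"
proof
  fix H
  have "(\<Sum>l\<in>{1..n}. ext_scale (u {l}) (ext_mono {l})) H = (\<Sum>l\<in>{1..n}. if H = {l} then u H else 0)"
    unfolding sum_fun_apply by (rule sum.cong) (auto simp: ext_mono_apply)
  also have "\<dots> = u H"
  proof (cases "u H = 0")
    case True
    have "(\<Sum>l\<in>{1..n}. if H = {l} then u H else 0) = (\<Sum>l\<in>{1..n}. 0)"
      by (rule sum.cong) (simp_all only: True if_cancel)
    then show ?thesis using True by simp
  next
    case False
    then obtain m where "H = {m}" "m \<in> {1..n}" using assms unfolding ext_deg_def
      by (auto simp: card_1_singleton_iff)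
    then show ?thesis by simp
  qed
  finally show "u H = (\<Sum>l\<in>{1..n}. ext_scale (u {l}) (ext_mono {l})) H" by simp
qed

lemma lin_form_deg_one [simp]: "lin_form n A k \<in> ext_deg n 1"
  unfolding lin_form_def
  by (intro ext.subspace_sum ext.subspace_scale ext_subspaces) (simp add: ext_deg_def ext_mono_def)

lemma lin_form_apply: "lin_form n A k {l} = (if l \<in> {1..n} then A $$ (k - 1, l - 1) else 0)"
  by (simp add: lin_form_def sum_fun_apply ext_mono_apply if_distrib cong: if_cong)

lemma alternating_double_sum:
  fixes f :: "'a \<Rightarrow> 'a \<Rightarrow> 'b::ab_group_add"
  assumes "finite S" "\<And>l. l \<in> S \<Longrightarrow> f l l = 0" "\<And>l m. l \<in> S \<Longrightarrow> m \<in> S \<Longrightarrow> f l m = - f m l"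
  shows "(\<Sum>l\<in>S. \<Sum>m\<in>S. f l m) = 0"
  using assms
proof (induct S)
  case (insert x S)
  have "(\<Sum>l\<in>S. f l x) = - (\<Sum>l\<in>S. f x l)"
    unfolding sum_negf[symmetric] by (intro sum.cong refl insert(5)) simp_all
  moreover have "(\<Sum>l\<in>S. \<Sum>m\<in>S. f l m) = 0"
  proof (rule insert(3))
    show "f l l = 0" if "l \<in> S" for l by (rule insert(4)) (use that in simp)
    show "f l m = - f m l" if "l \<in> S" "m \<in> S" for l m by (rule insert(5)) (use that in simp_all)
  qed
  moreover have "f x x = 0" by (rule insert(4)) simp
  ultimately show ?case by (simp add: insert(1,2) sum.distrib)
qed (rule sum.empty)

lemma wedge_square_zero:
  assumes "u \<in> ext_deg n 1"
  shows "wedge u u = (0 :: 'k::field ext)"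
proof -
  have "wedge u u = (\<Sum>l\<in>{1..n}. \<Sum>m\<in>{1..n}. ext_scale (u {l} * u {m}) (wedge (ext_mono {m}) (ext_mono {l})))"
    by (subst (1 2) deg_one_expansion[OF assms])
      (simp only: wedge_sum_left wedge_sum_right wedge_scale_left wedge_scale_right ext.scale_scale ext.scale_sum_right)
  also have "\<dots> = 0"
    by (rule alternating_double_sum)
      (auto simp: wedge_mono_mono shuffle_sign_singletons insert_commute mult.commute)
  finally show ?thesis .
qed

lemma wedge_anticommute:
  assumes "u \<in> ext_deg n 1" "v \<in> ext_deg n 1"
  shows "wedge u v = - wedge v (u :: 'k::field ext)"
proof -
  have "u + v \<in> ext_deg n 1" using assms ext.subspace_add ext_subspaces by blast
  then have "wedge (u + v) (u + v) = 0" by (rule wedge_square_zero)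
  then show ?thesis using assms
    by (simp add: wedge_add_left wedge_add_right wedge_square_zero eq_neg_iff_add_eq_0 add.commute)
qed

lemma wedge_anticommute_left:
  assumes "u \<in> ext_deg n 1" "v \<in> ext_deg n 1"
  shows "wedge u (wedge v X) = - wedge v (wedge u (X :: 'k::field ext))"
proof -
  have "wedge u (wedge v X) = wedge (wedge u v) X" by (simp only: wedge_assoc)
  also have "wedge u v = - wedge v u" using assms by (rule wedge_anticommute)
  also have "wedge (- wedge v u) X = - wedge v (wedge u X)" by (simp only: wedge_minus_left wedge_assoc)
  finally show ?thesis .
qed

section \<open>Linear substitutions\<close>

definition subst_mono :: "nat \<Rightarrow> 'k::field mat \<Rightarrow> nat set \<Rightarrow> 'k ext" where
  "subst_mono n g F = foldr wedge (map (lin_form n g) (sorted_list_of_set F)) (ext_mono {})"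

lemma lin_subst_alt: "lin_subst n g u = (\<Sum>F\<in>Pow {1..n}. ext_scale (u F) (subst_mono n g F))"
  by (simp add: lin_subst_def subst_mono_def)

lemma subst_mono_empty [simp]: "subst_mono n g {} = ext_mono {}"
  by (simp add: subst_mono_def)

lemma subst_mono_insert:
  assumes "finite F" "\<And>x. x \<in> F \<Longrightarrow> k < x"
  shows "subst_mono n g (insert k F) = wedge (lin_form n g k) (subst_mono n g F)"
proof -
  have "sorted_list_of_set (insert k F) = k # sorted_list_of_set F"
    using assms by (subst sorted_list_of_set_insert) (auto intro!: insort_is_Cons less_imp_le)
  then show ?thesis by (simp add: subst_mono_def)
qed

lemma subst_mono_deg: "finite F \<Longrightarrow> subst_mono n g F \<in> ext_deg n (card F)"
proof (induct F rule: finite_linorder_min_induct)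
  case empty
  show ?case by (auto simp: ext_deg_def ext_mono_def)
next
  case (insert b A)
  then have "b \<notin> A" by auto
  then show ?case using insert wedge_in_ext_deg[OF lin_form_deg_one insert(3), of g b]
    by (simp add: subst_mono_insert)
qed

lemma lin_subst_add: "lin_subst n g (u + v) = lin_subst n g u + lin_subst n g v"
  by (simp add: lin_subst_alt ext.scale_left_distrib sum.distrib)

lemma lin_subst_scale: "lin_subst n g (ext_scale r u) = ext_scale r (lin_subst n g u)"
  by (simp add: lin_subst_alt ext.scale_sum_right)

lemma lin_subst_zero [simp]: "lin_subst n g 0 = 0"
  by (simp add: lin_subst_alt)

lemma lin_subst_minus: "lin_subst n g (- u) = - lin_subst n g u"
  using lin_subst_scale[of n g "-1" u] by simp

lemma lin_subst_linear: "Vector_Spaces.linear ext_scale ext_scale (lin_subst n g)"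
  by (auto simp: Vector_Spaces.linear_iff ext.vector_space_axioms lin_subst_add lin_subst_scale)

lemma lin_subst_sum: "lin_subst n g (\<Sum>x\<in>A. f x) = (\<Sum>x\<in>A. lin_subst n g (f x))"
  using sum_comp_morphism[of "lin_subst n g" f A] by (simp add: lin_subst_add o_def)

lemma lin_subst_mono: 
  assumes "F \<subseteq> {1..n}"
  shows "lin_subst n g (ext_mono F) = subst_mono n g F"
proof -
  have "lin_subst n g (ext_mono F) = (\<Sum>H\<in>Pow {1..n}. if H = F then subst_mono n g H else 0)"
    unfolding lin_subst_alt by (rule sum.cong) (auto simp: ext_mono_apply)
  then show ?thesis using assms by simp
qed

lemma lin_subst_one [simp]: "lin_subst n g (ext_mono {}) = ext_mono {}"
  by (simp add: lin_subst_mono)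

lemma lin_subst_in_deg:
  assumes "u \<in> ext_deg n d"
  shows "lin_subst n g u \<in> ext_deg n d"
  unfolding lin_subst_alt
proof (rule ext.subspace_sum[OF ext_subspaces(2)])
  fix F assume "F \<in> Pow {1..n}"
  then have F: "finite F" using finite_subset by auto
  show "ext_scale (u F) (subst_mono n g F) \<in> ext_deg n d"
  proof (cases "u F = 0")
    case False
    then have "card F = d" using assms by (auto simp: ext_deg_def)
    then show ?thesis using subst_mono_deg[OF F] ext.subspace_scale[OF ext_subspaces(2)] by blast
  qed (simp add: ext.subspace_0)
qed

lemma lin_subst_in_alg: "lin_subst n g u \<in> ext_alg n"
  unfolding lin_subst_alt
proof (intro ext.subspace_sum ext.subspace_scale)
  fix F assume "F \<in> Pow {1..n}"
  then have "finite F" using finite_subset by auto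
  then show "subst_mono n g F \<in> ext_alg n" using subst_mono_deg ext_deg_subset by blast
qed auto

text \<open>The first step towards multiplicativity of the substitution. Sorting \<open>e\<^sub>k\<close> into its place in \<open>e\<^sub>F\<close> uses only that
linear forms square to zero and anticommute, and their images do so as well.\<close>

lemma wedge_lin_form_subst_mono:
  assumes "finite F" "F \<subseteq> {1..n}" "k \<in> {1..n}"
  shows "lin_subst n g (wedge (ext_mono {k}) (ext_mono F)) = wedge (lin_form n g k) (subst_mono n g F)"
  using assms
proof (induct F arbitrary: k rule: finite_linorder_min_induct)
  case empty
  have "subst_mono n g {k} = wedge (lin_form n g k) (ext_mono {})" using subst_mono_insert[of "{}" k n g] by simp
  then show ?case using empty by (simp add: wedge_mono_mono shuffle_sign_def lin_subst_mono)
next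
  case (insert f F)
  have f: "f \<in> {1..n}" "F \<subseteq> {1..n}" and fF: "f \<notin> F" using insert by auto
  have min: "ext_mono (insert x A) = wedge (ext_mono {x}) (ext_mono A :: 'a ext)"
    if "finite A" "\<And>y. y \<in> A \<Longrightarrow> x < y" for x and A :: "nat set"
  proof -
    have "x \<notin> A" using that by blast
    moreover have "shuffle_sign {x} A = (1 :: 'a)" by (rule shuffle_sign_sorted) (use that in force)
    ultimately show ?thesis using that by (simp add: wedge_mono_mono)
  qed
  consider "k < f" | "k = f" | "f < k" by linarith
  then show ?case
  proof cases
    case 1
    then have "\<And>x. x \<in> insert f F \<Longrightarrow> k < x" using insert by force
    then have "wedge (ext_mono {k}) (ext_mono (insert f F)) = (ext_mono (insert k (insert f F)) :: 'a ext)"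
      "subst_mono n g (insert k (insert f F)) = wedge (lin_form n g k) (subst_mono n g (insert f F))"
      using min[of "insert f F" k] subst_mono_insert[of "insert f F" k n g] insert by auto
    then show ?thesis using lin_subst_mono[of "insert k (insert f F)" n g] insert by simp
  next
    case 2
    have "wedge (ext_mono {k}) (ext_mono (insert f F)) = (0 :: 'a ext)"
      using 2 by (simp add: wedge_mono_mono)
    moreover have "wedge (lin_form n g k) (subst_mono n g (insert f F)) = 0"
      using 2 insert by (simp add: subst_mono_insert wedge_assoc[symmetric] wedge_square_zero[OF lin_form_deg_one])
    ultimately show ?thesis by (simp only: lin_subst_zero)
  next
    case 3
    have anti: "wedge (ext_mono {k}) (wedge (ext_mono {f}) X) = - wedge (ext_mono {f}) (wedge (ext_mono {k}) X)"
      for X :: "'a ext"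
    proof -
      have "ext_mono {k} \<in> ext_deg n 1" "ext_mono {f} \<in> ext_deg n 1"
        using ext_mono_in(2)[of "{k}" n] ext_mono_in(2)[of "{f}" n] f insert by auto
      then show ?thesis by (rule wedge_anticommute_left)
    qed
    have anti': "wedge (lin_form n g k) (wedge (lin_form n g f) X) = - wedge (lin_form n g f) (wedge (lin_form n g k) X)"
      for X by (rule wedge_anticommute_left) (rule lin_form_deg_one)+
    have IH: "lin_subst n g (wedge (ext_mono {k}) (ext_mono F)) = wedge (lin_form n g k) (subst_mono n g F)"
      using insert f by blast
    have "lin_subst n g (wedge (ext_mono {f}) (wedge (ext_mono {k}) (ext_mono F)))
       = wedge (lin_form n g f) (lin_subst n g (wedge (ext_mono {k}) (ext_mono F)))"
    proof (cases "k \<in> F")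
      case True
      then show ?thesis by (simp add: wedge_mono_mono)
    next
      case False
      have *: "finite (insert k F)" "insert k F \<subseteq> {1..n}" "insert f (insert k F) \<subseteq> {1..n}"
        "\<And>y. y \<in> insert k F \<Longrightarrow> f < y" using 3 insert by auto
      have "wedge (ext_mono {k}) (ext_mono F) = ext_scale (shuffle_sign {k} F) (ext_mono (insert k F) :: 'a ext)"
        using False insert by (simp add: wedge_mono_mono)
      moreover have "lin_subst n g (wedge (ext_mono {f}) (ext_mono (insert k F)))
          = wedge (lin_form n g f) (lin_subst n g (ext_mono (insert k F)))"
        using min[OF *(1,4)] subst_mono_insert[OF *(1,4)] lin_subst_mono[OF *(2), of g] lin_subst_mono[OF *(3), of g]
        by simp
      ultimately show ?thesis by (simp add: wedge_scale_right lin_subst_scale)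
    qed
    then have eq: "lin_subst n g (wedge (ext_mono {k}) (wedge (ext_mono {f}) (ext_mono F)))
        = wedge (lin_form n g k) (wedge (lin_form n g f) (subst_mono n g F))"
      unfolding anti[of "ext_mono F"] anti' lin_subst_minus IH by simp
    have "ext_mono (insert f F) = wedge (ext_mono {f}) (ext_mono F :: 'a ext)"
      by (rule min) (use insert in auto)
    moreover have "subst_mono n g (insert f F) = wedge (lin_form n g f) (subst_mono n g F)"
      by (rule subst_mono_insert) (use insert in auto)
    ultimately show ?thesis using eq by simp
  qed
qed

lemma lin_subst_wedge_var:
  assumes "k \<in> {1..n}" "u \<in> ext_alg n"
  shows "lin_subst n g (wedge (ext_mono {k}) u) = wedge (lin_form n g k) (lin_subst n g u)"
proof -
  have "lin_subst n g (wedge (ext_mono {k}) u) =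
    (\<Sum>F\<in>Pow {1..n}. ext_scale (u F) (lin_subst n g (wedge (ext_mono {k}) (ext_mono F))))"
    by (subst ext_expansion[OF assms(2)]) (simp add: wedge_sum_right lin_subst_sum wedge_scale_right lin_subst_scale)
  also have "\<dots> = (\<Sum>F\<in>Pow {1..n}. ext_scale (u F) (wedge (lin_form n g k) (subst_mono n g F)))"
  proof (rule sum.cong[OF refl])
    fix F assume "F \<in> Pow {1..n}"
    then have "finite F" "F \<subseteq> {1..n}" using finite_subset by auto
    then show "ext_scale (u F) (lin_subst n g (wedge (ext_mono {k}) (ext_mono F))) =
         ext_scale (u F) (wedge (lin_form n g k) (subst_mono n g F))"
      using wedge_lin_form_subst_mono assms(1) by metis
  qed
  also have "\<dots> = wedge (lin_form n g k) (lin_subst n g u)"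
    by (simp add: lin_subst_alt wedge_sum_right wedge_scale_right)
  finally show ?thesis .
qed

lemma lin_subst_wedge_mono:
  assumes "finite F" "F \<subseteq> {1..n}" "u \<in> ext_alg n"
  shows "lin_subst n g (wedge (ext_mono F) u) = wedge (subst_mono n g F) (lin_subst n g u)"
  using assms
proof (induct F rule: finite_linorder_min_induct)
  case empty
  then show ?case using wedge_one_left[OF empty(2)] wedge_one_left[OF lin_subst_in_alg, of n g u] by simp
next
  case (insert b A)
  have "b \<notin> A" using insert by blast
  moreover have "shuffle_sign {b} A = (1 :: 'a)" by (rule shuffle_sign_sorted) (use insert in force)
  ultimately have "ext_mono (insert b A) = wedge (ext_mono {b}) (ext_mono A :: 'a ext)"
    using insert by (simp add: wedge_mono_mono)
  then have "lin_subst n g (wedge (ext_mono (insert b A)) u)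
     = lin_subst n g (wedge (ext_mono {b}) (wedge (ext_mono A) u))" by (simp add: wedge_assoc)
  also have "\<dots> = wedge (lin_form n g b) (lin_subst n g (wedge (ext_mono A) u))"
    using insert by (intro lin_subst_wedge_var wedge_in_ext_alg ext_mono_in) auto
  finally show ?case using insert by (simp add: subst_mono_insert wedge_assoc)
qed

lemma lin_subst_wedge:
  assumes "u \<in> ext_alg n" "v \<in> ext_alg n"
  shows "lin_subst n g (wedge u v) = wedge (lin_subst n g u) (lin_subst n g v)"
proof -
  have "lin_subst n g (wedge u v) =
    (\<Sum>F\<in>Pow {1..n}. ext_scale (u F) (lin_subst n g (wedge (ext_mono F) v)))"
    by (subst ext_expansion[OF assms(1)]) (simp add: wedge_sum_left lin_subst_sum wedge_scale_left lin_subst_scale)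
  also have "\<dots> = (\<Sum>F\<in>Pow {1..n}. ext_scale (u F) (wedge (subst_mono n g F) (lin_subst n g v)))"
  proof (rule sum.cong[OF refl])
    fix F assume "F \<in> Pow {1..n}"
    then have "finite F" "F \<subseteq> {1..n}" using finite_subset by auto
    then show "ext_scale (u F) (lin_subst n g (wedge (ext_mono F) v)) =
         ext_scale (u F) (wedge (subst_mono n g F) (lin_subst n g v))"
      using lin_subst_wedge_mono assms(2) by metis
  qed
  also have "\<dots> = wedge (lin_subst n g u) (lin_subst n g v)"
    by (simp add: lin_subst_alt wedge_sum_left wedge_scale_left)
  finally show ?thesis .
qed

lemma lin_subst_var:
  assumes "k \<in> {1..n}"
  shows "lin_subst n g (ext_mono {k}) = lin_form n g k"
proof -
  have "subst_mono n g {k} = wedge (lin_form n g k) (ext_mono {})" using subst_mono_insert[of "{}" k n g] by simp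
  then show ?thesis using assms lin_subst_mono[of "{k}" n g] wedge_one_right[of "lin_form n g k" n]
    subsetD[OF ext_deg_subset lin_form_deg_one] by (metis empty_subsetI insert_subset)
qed

lemma lin_subst_lin_form:
  assumes "h \<in> carrier_mat p n" "g \<in> carrier_mat n n" "k \<in> {1..p}"
  shows "lin_subst n g (lin_form n h k) = lin_form n (h * g) k"
proof -
  have "lin_subst n g (lin_form n h k) = (\<Sum>l\<in>{1..n}. ext_scale (h $$ (k - 1, l - 1)) (lin_form n g l))"
    unfolding lin_form_def[of n h k] by (simp add: lin_subst_sum lin_subst_scale lin_subst_var)
  also have "\<dots> = (\<Sum>l\<in>{1..n}. \<Sum>m\<in>{1..n}. ext_scale (h $$ (k - 1, l - 1) * g $$ (l - 1, m - 1)) (ext_mono {m}))"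
    unfolding lin_form_def by (simp add: ext.scale_sum_right)
  also have "\<dots> = (\<Sum>m\<in>{1..n}. ext_scale (\<Sum>l\<in>{1..n}. h $$ (k - 1, l - 1) * g $$ (l - 1, m - 1)) (ext_mono {m}))"
    by (subst sum.swap) (simp add: ext.scale_sum_left)
  also have "\<dots> = (\<Sum>m\<in>{1..n}. ext_scale ((h * g) $$ (k - 1, m - 1)) (ext_mono {m}))"
  proof (rule sum.cong[OF refl])
    fix m assume m: "m \<in> {1..n}"
    then have "k - 1 < p" "m - 1 < n" using assms(3) by auto
    then have "(h * g) $$ (k - 1, m - 1) = (\<Sum>l = 0..<n. h $$ (k - 1, l) * g $$ (l, m - 1))"
      using assms by (simp add: scalar_prod_def)
    also have "\<dots> = (\<Sum>l\<in>{1..n}. h $$ (k - 1, l - 1) * g $$ (l - 1, m - 1))"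
      by (rule sum.reindex_bij_witness[of _ "\<lambda>l. l - 1" Suc]) auto
    finally show "ext_scale (\<Sum>l\<in>{1..n}. h $$ (k - 1, l - 1) * g $$ (l - 1, m - 1)) (ext_mono {m}) =
         ext_scale ((h * g) $$ (k - 1, m - 1)) (ext_mono {m})" by simp
  qed
  finally show ?thesis unfolding lin_form_def .
qed

lemma lin_subst_subst_mono:
  assumes "h \<in> carrier_mat n n" "g \<in> carrier_mat n n" "finite F" "F \<subseteq> {1..n}"
  shows "lin_subst n g (subst_mono n h F) = subst_mono n (h * g) F"
  using assms(3,4)
proof (induct F rule: finite_linorder_min_induct)
  case (insert b A)
  have "lin_subst n g (wedge (lin_form n h b) (subst_mono n h A))
    = wedge (lin_subst n g (lin_form n h b)) (lin_subst n g (subst_mono n h A))"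
    using subsetD[OF ext_deg_subset lin_form_deg_one] subsetD[OF ext_deg_subset subst_mono_deg[OF insert(1)]]
    by (intro lin_subst_wedge)
  then show ?case using insert assms(1,2) by (simp add: subst_mono_insert lin_subst_lin_form)
qed simp

lemma lin_subst_compose:
  assumes "h \<in> carrier_mat n n" "g \<in> carrier_mat n n"
  shows "lin_subst n g (lin_subst n h u) = lin_subst n (h * g) u"
  unfolding lin_subst_alt[of n h] lin_subst_alt[of n "h * g"] lin_subst_sum lin_subst_scale
proof (rule sum.cong[OF refl])
  fix F :: "nat set" assume "F \<in> Pow {1..n}"
  then have "finite F" "F \<subseteq> {1..n}" using finite_subset by auto
  then show "ext_scale (u F) (lin_subst n g (subst_mono n h F)) = ext_scale (u F) (subst_mono n (h * g) F)"
    using lin_subst_subst_mono assms by metis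
qed

lemma lin_subst_id:
  assumes "u \<in> ext_alg n"
  shows "lin_subst n (1\<^sub>m n) u = u"
proof -
  have v: "lin_form n (1\<^sub>m n) k = (ext_mono {k} :: 'a ext)" if k: "k \<in> {1..n}" for k
  proof -
    have "lin_form n (1\<^sub>m n) k = (\<Sum>l\<in>{1..n}. if l = k then (ext_mono {l} :: 'a ext) else 0)"
      unfolding lin_form_def using k by (intro sum.cong) auto
    then show ?thesis using k by simp
  qed
  have "subst_mono n (1\<^sub>m n) F = (ext_mono F :: 'a ext)" if "finite F" "F \<subseteq> {1..n}" for F
    using that
  proof (induct F rule: finite_linorder_min_induct)
    case (insert b A)
    have "b \<notin> A" using insert by blast
    moreover have "shuffle_sign {b} A = (1 :: 'a)" by (rule shuffle_sign_sorted) (use insert in force)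
    ultimately have "ext_mono (insert b A) = wedge (ext_mono {b}) (ext_mono A :: 'a ext)"
      using insert by (simp add: wedge_mono_mono)
    then show ?case using insert v by (simp add: subst_mono_insert)
  qed simp
  then have "lin_subst n (1\<^sub>m n) u = (\<Sum>F\<in>Pow {1..n}. ext_scale (u F) (ext_mono F))"
    unfolding lin_subst_alt using finite_subset by (intro sum.cong) auto
  then show ?thesis using ext_expansion[OF assms] by simp
qed

section \<open>Spaces of chains and ideals\<close>

interpretation chain: vector_space "chain_scale :: 'k::field \<Rightarrow> 'k chain \<Rightarrow> 'k chain"
  by unfold_locales (auto simp: chain_scale_def ext_scale_def fun_eq_iff algebra_simps)

interpretation ee: vector_space_pair "ext_scale :: 'k::field \<Rightarrow> 'k ext \<Rightarrow> 'k ext" ext_scale ..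
interpretation ec: vector_space_pair "ext_scale :: 'k::field \<Rightarrow> 'k ext \<Rightarrow> 'k ext" chain_scale ..
interpretation cc: vector_space_pair "chain_scale :: 'k::field \<Rightarrow> 'k chain \<Rightarrow> 'k chain" chain_scale ..

lemma chain_scale_apply [simp]: "chain_scale r c a = ext_scale r (c a)"
  by (simp add: chain_scale_def)

text \<open>The coordinate functionals \<open>co\<close> are dual to the family \<open>b\<close>; this computes the dimensions of the spaces spanned by
monomials, in the algebra as well as in the complex.\<close>

lemma (in vector_space) dim_coordinates:
  fixes b :: "'i \<Rightarrow> 'b" and co :: "'i \<Rightarrow> 'b \<Rightarrow> 'a"
  assumes S: "finite S" and V: "\<And>i. i \<in> S \<Longrightarrow> b i \<in> V"
    and ex: "\<And>v. v \<in> V \<Longrightarrow> v = (\<Sum>i\<in>S. scale (co i v) (b i))"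
    and dual: "\<And>i j. i \<in> S \<Longrightarrow> j \<in> S \<Longrightarrow> co i (b j) = (if i = j then 1 else 0)"
    and lin: "\<And>i x y. co i (x + y) = co i x + co i y" "\<And>i r x. co i (scale r x) = r * co i x"
  shows "dim V = card S" "fin_span scale V"
proof -
  have inj: "inj_on b S" by (rule inj_onI) (metis dual one_neq_zero)
  have co_sum: "co i (\<Sum>x\<in>A. f x) = (\<Sum>x\<in>A. co i (f x))" for i A and f :: "'i \<Rightarrow> 'b"
    using sum_comp_morphism[of "co i" f A] lin(2)[of i 0 0] by (simp add: lin o_def)
  have "independent (b ` S)"
    unfolding dependent_finite[OF finite_imageI[OF S]]
  proof clarify
    fix r i assume r: "(\<Sum>v\<in>b ` S. scale (r v) v) = 0" "i \<in> S" "r (b i) \<noteq> 0"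
    have "co i 0 = 0" using lin(2)[of i 0 0] by simp
    then have "0 = co i (\<Sum>j\<in>S. scale (r (b j)) (b j))" using r(1) inj by (simp add: sum.reindex)
    also have "\<dots> = (\<Sum>j\<in>S. if j = i then r (b j) else 0)"
      unfolding co_sum lin by (rule sum.cong) (use dual r in auto)
    also have "\<dots> = r (b i)" using S r by simp
    finally show False using r by simp
  qed
  moreover have sp: "V \<subseteq> span (b ` S)"
  proof
    fix v assume "v \<in> V"
    then have "v = (\<Sum>i\<in>S. scale (co i v) (b i))" by (rule ex)
    also have "\<dots> \<in> span (b ` S)" by (intro span_sum span_scale span_base) auto
    finally show "v \<in> span (b ` S)" .
  qed
  moreover have "b ` S \<subseteq> V" using V by blast
  ultimately have "dim V = card (b ` S)" using basis_card_eq_dim[of "b ` S" V] by simp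
  then show "dim V = card S" using inj by (simp add: card_image)
  show "fin_span scale V" using sp S unfolding fin_span_def by blast
qed

definition ext_coord :: "nat set set \<Rightarrow> 'k::field ext set" where
  "ext_coord S = {u. \<forall>F. u F \<noteq> 0 \<longrightarrow> F \<in> S}"

definition chain_coord :: "((nat \<Rightarrow> nat) \<times> nat set) set \<Rightarrow> 'k::field chain set" where
  "chain_coord S = {c. \<forall>a F. c a F \<noteq> 0 \<longrightarrow> (a, F) \<in> S}"

lemma ext_coord_subspace: "ext.subspace (ext_coord S)"
proof (rule ext.subspaceI)
  fix x y :: "'a ext" assume xy: "x \<in> ext_coord S" "y \<in> ext_coord S"
  have "F \<in> S" if "(x + y) F \<noteq> 0" for F
    using that xy by (cases "x F = 0") (auto simp: ext_coord_def)
  then show "x + y \<in> ext_coord S" by (auto simp: ext_coord_def)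
qed (auto simp: ext_coord_def)

lemma chain_coord_subspace: "chain.subspace (chain_coord S)"
proof (rule chain.subspaceI)
  fix x y :: "'a chain" assume xy: "x \<in> chain_coord S" "y \<in> chain_coord S"
  have "(a, F) \<in> S" if "(x + y) a F \<noteq> 0" for a F
    using that xy by (cases "x a F = 0") (auto simp: chain_coord_def)
  then show "x + y \<in> chain_coord S" by (auto simp: chain_coord_def)
qed (auto simp: chain_coord_def)

lemma dim_ext_coord:
  assumes "finite S"
  shows "ext.dim (ext_coord S :: 'k::field ext set) = card S" "fin_span ext_scale (ext_coord S :: 'k ext set)"
proof -
  have ex: "v = (\<Sum>i\<in>S. ext_scale (v i) (ext_mono i))" if "v \<in> ext_coord S" for v :: "'k ext"
  proof
    fix F
    have "(\<Sum>i\<in>S. ext_scale (v i) (ext_mono i)) F = (\<Sum>i\<in>S. if i = F then v i else 0)"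
      unfolding sum_fun_apply by (rule sum.cong) (auto simp: ext_mono_apply)
    then show "v F = (\<Sum>i\<in>S. ext_scale (v i) (ext_mono i)) F"
      using that assms by (auto simp: ext_coord_def)
  qed
  show "ext.dim (ext_coord S :: 'k ext set) = card S" "fin_span ext_scale (ext_coord S :: 'k ext set)"
    by (rule ext.dim_coordinates[OF assms _ ex]; auto simp: ext_coord_def ext_mono_apply split: if_splits)+
qed

definition chain_mono :: "(nat \<Rightarrow> nat) \<times> nat set \<Rightarrow> 'k::field chain" where
  "chain_mono p = (\<lambda>a F. if (a, F) = p then 1 else 0)"

lemma chain_coord_expansion:
  fixes v :: "'k::field chain"
  assumes "finite S" "v \<in> chain_coord S"
  shows "v = (\<Sum>p\<in>S. chain_scale (v (fst p) (snd p)) (chain_mono p))"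
proof (intro ext)
  fix a F
  have "(\<Sum>p\<in>S. chain_scale (v (fst p) (snd p)) (chain_mono p)) a F =
      (\<Sum>p\<in>S. if p = (a, F) then v a F else 0)"
    unfolding sum_fun_apply by (rule sum.cong) (auto simp: chain_mono_def)
  then show "v a F = (\<Sum>p\<in>S. chain_scale (v (fst p) (snd p)) (chain_mono p)) a F"
    using assms by (auto simp: chain_coord_def)
qed

lemma dim_chain_coord:
  assumes "finite S"
  shows "chain.dim (chain_coord S :: 'k::field chain set) = card S"
    "fin_span chain_scale (chain_coord S :: 'k chain set)"
  by (rule chain.dim_coordinates[OF assms _ chain_coord_expansion[OF assms]];
      auto simp: chain_coord_def chain_mono_def split: if_splits)+

definition chain_index :: "nat \<Rightarrow> nat \<Rightarrow> nat \<Rightarrow> nat \<Rightarrow> ((nat \<Rightarrow> nat) \<times> nat set) set" where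
  "chain_index n m i j = {(a, F). a \<in> exponents m i \<and> F \<subseteq> {1..n} \<and> card F + i = j}"

lemma cartan_chains_coord: "cartan_chains n m i j = chain_coord (chain_index n m i j)"
  by (auto simp: cartan_chains_def chain_coord_def chain_index_def)

lemma finite_exponents: "finite (exponents m i)"
proof (rule finite_subset)
  show "exponents m i \<subseteq> {f. \<forall>x. (x \<in> {1..m} \<longrightarrow> f x \<in> {0..i}) \<and> (x \<notin> {1..m} \<longrightarrow> f x = 0)}"
    by (auto simp: exponents_def intro: member_le_sum)
  show "finite {f. \<forall>x. (x \<in> {1..m} \<longrightarrow> f x \<in> {0..i}) \<and> (x \<notin> {1..m} \<longrightarrow> f x = (0::nat))}"
    by (rule finite_set_of_finite_funs) auto
qed

lemma finite_chain_index: "finite (chain_index n m i j)"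
  by (rule finite_subset[of _ "exponents m i \<times> Pow {1..n}"]) (auto simp: chain_index_def finite_exponents)

lemma cartan_chains_subspace: "chain.subspace (cartan_chains n m i j)"
  by (simp add: cartan_chains_coord chain_coord_subspace)

lemma cartan_chains_fin: "fin_span chain_scale (cartan_chains n m i j)"
  by (simp add: cartan_chains_coord dim_chain_coord finite_chain_index)

lemma graded_idealD:
  assumes "graded_ideal n J"
  shows "J \<subseteq> ext_alg n" "u \<in> J \<Longrightarrow> hom_component d u \<in> J" "u \<in> J \<Longrightarrow> w \<in> ext_alg n \<Longrightarrow> wedge w u \<in> J"
    "u \<in> J \<Longrightarrow> w \<in> ext_alg n \<Longrightarrow> wedge u w \<in> J"
  using assms by (auto simp: graded_ideal_def ext_ideal_def)

lemma ext_ideal_subspace: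
  assumes "ext_ideal n J"
  shows "ext.subspace J"
proof (rule ext.subspaceI)
  fix c :: 'a and x :: "'a ext" assume x: "x \<in> J"
  then have xa: "x \<in> ext_alg n" using assms by (auto simp: ext_ideal_def)
  have "ext_scale c (ext_mono {}) \<in> ext_alg n" by (intro ext.subspace_scale ext_subspaces ext_mono_in) simp
  then have "wedge (ext_scale c (ext_mono {})) x \<in> J" using assms x by (auto simp: ext_ideal_def)
  then show "ext_scale c x \<in> J" by (simp add: wedge_scale_left wedge_one_left[OF xa])
qed (use assms in \<open>auto simp: ext_ideal_def\<close>)

lemma graded_ideal_subspace: "graded_ideal n J \<Longrightarrow> ext.subspace J"
  by (auto simp: graded_ideal_def ext_ideal_subspace)

section \<open>Adjoining a linear form to the Cartan complex\<close>

text \<open>\<open>lower q\<close> removes one factor \<open>x\<^sub>q\<close>, \<open>x\<^sub>q\<^bsup>(a)\<^esup> \<mapsto> x\<^sub>q\<^bsup>(a-1)\<^esup>\<close>, and commutes with the differential; its kernel is the complex of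
the sequence without \<open>v\<^sub>q\<close>. \<open>raise q\<close> is its linear section \<open>x\<^sub>q\<^bsup>(a)\<^esup> \<mapsto> x\<^sub>q\<^bsup>(a+1)\<^esup>\<close>, which commutes with the differential
only up to a multiplication by \<open>v\<^sub>q\<close>.\<close>

definition lower :: "nat \<Rightarrow> 'k chain \<Rightarrow> 'k chain" where
  "lower q c = (\<lambda>b. c (b(q := Suc (b q))))"

definition raise :: "nat \<Rightarrow> 'k::zero chain \<Rightarrow> 'k chain" where
  "raise q c = (\<lambda>a. if a q = 0 then 0 else c (a(q := a q - 1)))"

definition right_mult :: "'k::field ext \<Rightarrow> 'k chain \<Rightarrow> 'k chain" where
  "right_mult w c = (\<lambda>a. wedge (c a) w)"

lemma linear_lower: "Vector_Spaces.linear chain_scale chain_scale (lower q :: 'k::field chain \<Rightarrow> _)"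
  by (auto simp: Vector_Spaces.linear_iff chain.vector_space_axioms lower_def fun_eq_iff)

lemma linear_raise: "Vector_Spaces.linear chain_scale chain_scale (raise q :: 'k::field chain \<Rightarrow> _)"
  by (auto simp: Vector_Spaces.linear_iff chain.vector_space_axioms raise_def fun_eq_iff)

lemma linear_right_mult: "Vector_Spaces.linear chain_scale chain_scale (right_mult w :: 'k::field chain \<Rightarrow> _)"
  by (auto simp: Vector_Spaces.linear_iff chain.vector_space_axioms right_mult_def fun_eq_iff
     wedge_add_left wedge_scale_left)

lemma linear_cartan_diff: "Vector_Spaces.linear chain_scale chain_scale (cartan_diff m v :: 'k::field chain \<Rightarrow> _)"
  by (auto simp: Vector_Spaces.linear_iff chain.vector_space_axioms cartan_diff_def fun_eq_iff
     wedge_add_left wedge_scale_left sum.distrib ext.scale_sum_right)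

lemmas lower_simps = cc.linear_add[OF linear_lower] cc.linear_diff[OF linear_lower] cc.linear_0[OF linear_lower]
lemmas raise_simps = cc.linear_add[OF linear_raise] cc.linear_diff[OF linear_raise] cc.linear_0[OF linear_raise]
lemmas diff_simps = cc.linear_add[OF linear_cartan_diff] cc.linear_diff[OF linear_cartan_diff] 
  cc.linear_0[OF linear_cartan_diff]

lemma lower_raise [simp]: "lower q (raise q c) = c"
  by (simp add: lower_def raise_def fun_eq_iff)

lemma sum_fun_upd:
  fixes k m :: nat and a :: "nat \<Rightarrow> nat"
  assumes "k \<in> {1..m}"
  shows "(\<Sum>l\<in>{1..m}. (a(k := x)) l) + a k = (\<Sum>l\<in>{1..m}. a l) + (x::nat)"
proof -
  have "(\<Sum>l\<in>{1..m}. (a(k := x)) l) = x + (\<Sum>l\<in>{1..m} - {k}. a l)"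
    using assms sum.remove[OF finite_atLeastAtMost assms, of "a(k := x)"] by (simp del: One_nat_def)
  moreover have "(\<Sum>l\<in>{1..m}. a l) = a k + (\<Sum>l\<in>{1..m} - {k}. a l)"
    using assms sum.remove[OF finite_atLeastAtMost assms, of a] by simp
  ultimately show ?thesis by simp
qed

lemma exponents_Suc_iff:
  assumes "k \<in> {1..m}"
  shows "b(k := Suc (b k)) \<in> exponents m (Suc i) \<longleftrightarrow> b \<in> exponents m i"
proof -
  have "(\<Sum>l\<in>{1..m}. (b(k := Suc (b k))) l) = Suc (\<Sum>l\<in>{1..m}. b l)"
    using sum_fun_upd[OF assms, of b "Suc (b k)"] by simp
  moreover have "(\<forall>l. (b(k := Suc (b k))) l \<noteq> 0 \<longrightarrow> l \<in> {1..m}) \<longleftrightarrow> (\<forall>l. b l \<noteq> 0 \<longrightarrow> l \<in> {1..m})"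
    using assms by auto
  ultimately show ?thesis unfolding exponents_def mem_Collect_eq by simp
qed

lemma exponents_zero: "exponents m 0 = {\<lambda>_. 0}"
proof -
  have "a = (\<lambda>_. 0)" if "\<forall>k. a k \<noteq> 0 \<longrightarrow> k \<in> {1..m}" "(\<Sum>k\<in>{1..m}. a k) = 0" for a :: "nat \<Rightarrow> nat"
  proof
    fix k
    have "\<forall>k\<in>{1..m}. a k = 0" using that(2) by (simp add: sum_eq_0_iff del: One_nat_def)
    then show "a k = 0" using that(1) by blast
  qed
  then have "exponents m 0 \<subseteq> {\<lambda>_. 0}" unfolding exponents_def by blast
  moreover have "(\<lambda>_. 0) \<in> exponents m 0" by (simp add: exponents_def)
  ultimately show ?thesis by blast
qed

lemma exponents_restrict: "a \<in> exponents (Suc k) i \<Longrightarrow> a (Suc k) = 0 \<Longrightarrow> a \<in> exponents k i"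
  by (auto simp: exponents_def) (metis le_SucE less_irrefl)

lemma exponents_extend: "a \<in> exponents k i \<Longrightarrow> a \<in> exponents (Suc k) i \<and> a (Suc k) = 0"
  by (auto simp: exponents_def) (meson le_SucI not_less_eq_eq order_refl)+

lemma lower_in:
  assumes "c \<in> cartan_chains n m (Suc i) (Suc j)" "q \<in> {1..m}"
  shows "lower q c \<in> cartan_chains n m i j"
  using exponents_Suc_iff[OF assms(2)] assms(1) unfolding cartan_chains_def lower_def by auto

lemma raise_in:
  assumes "c \<in> cartan_chains n m i j" "q \<in> {1..m}"
  shows "raise q c \<in> cartan_chains n m (Suc i) (Suc j)"
proof -
  have "a \<in> exponents m (Suc i) \<and> F \<subseteq> {1..n} \<and> card F + Suc i = Suc j" if "raise q c a F \<noteq> 0" for a F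
  proof -
    have a: "a q \<noteq> 0" "c (a(q := a q - 1)) F \<noteq> 0" using that by (auto simp: raise_def split: if_splits)
    then have "a(q := a q - 1) \<in> exponents m i" "F \<subseteq> {1..n}" "card F + i = j" using assms
      by (auto simp: cartan_chains_def)
    moreover have "(a(q := a q - 1))(q := Suc ((a(q := a q - 1)) q)) = a" using a by auto
    ultimately show ?thesis using exponents_Suc_iff[OF assms(2), of "a(q := a q - 1)" i] by simp
  qed
  then show ?thesis by (simp add: cartan_chains_def)
qed

lemma chains_Suc_iff:
  "c \<in> cartan_chains n k i j \<longleftrightarrow> c \<in> cartan_chains n (Suc k) i j \<and> lower (Suc k) c = 0"
proof
  assume c: "c \<in> cartan_chains n k i j"
  have "lower (Suc k) c b F = 0" for b F
  proof (rule ccontr)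
    assume "lower (Suc k) c b F \<noteq> 0"
    then have "b(Suc k := Suc (b (Suc k))) \<in> exponents k i" using c by (auto simp: cartan_chains_def lower_def)
    then show False using exponents_extend by fastforce
  qed
  then have "lower (Suc k) c = 0" by (intro ext) simp
  then show "c \<in> cartan_chains n (Suc k) i j \<and> lower (Suc k) c = 0"
    using c exponents_extend by (auto simp: cartan_chains_def)
next
  assume c: "c \<in> cartan_chains n (Suc k) i j \<and> lower (Suc k) c = 0"
  have "a \<in> exponents k i" if "c a F \<noteq> 0" for a F
  proof (rule exponents_restrict)
    show "a \<in> exponents (Suc k) i" using c that by (auto simp: cartan_chains_def)
    show "a (Suc k) = 0"
    proof (rule ccontr)
      assume "a (Suc k) \<noteq> 0"
      then have "lower (Suc k) c (a(Suc k := a (Suc k) - 1)) = c a" by (simp add: lower_def)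
      then show False using c that by simp
    qed
  qed
  then show "c \<in> cartan_chains n k i j" using c by (auto simp: cartan_chains_def)
qed

lemmas chains_SucD = chains_Suc_iff[THEN iffD1, THEN conjunct1] chains_Suc_iff[THEN iffD1, THEN conjunct2]
lemmas chains_SucI = chains_Suc_iff[THEN iffD2, OF conjI]

lemma diff_lower: "cartan_diff m v (lower q c) = lower q (cartan_diff m v c)"
proof
  fix b
  show "cartan_diff m v (lower q c) b = lower q (cartan_diff m v c) b"
    unfolding cartan_diff_def lower_def
  proof (rule sum.cong[OF refl])
    fix k
    have "b(k := Suc (b k), q := Suc ((b(k := Suc (b k))) q)) = b(q := Suc (b q), k := Suc ((b(q := Suc (b q))) k))"
      by (auto simp: fun_eq_iff)
    then show "wedge (c (b(k := Suc (b k), q := Suc ((b(k := Suc (b k))) q)))) (v k) =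
         wedge (c (b(q := Suc (b q), k := Suc ((b(q := Suc (b q))) k)))) (v k)" by simp
  qed
qed

lemma diff_raise:
  assumes "q \<in> {1..m}"
  shows "cartan_diff m v (raise q c) b =
    raise q (cartan_diff m v c) b + (if b q = 0 then wedge (c b) (v q) else (0 :: 'k::field ext))"
proof -
  have split: "cartan_diff m v d b = wedge (d (b(q := Suc (b q)))) (v q) + (\<Sum>k\<in>{1..m} - {q}. wedge (d (b(k := Suc (b k)))) (v k))"
    for d :: "'k chain" and b unfolding cartan_diff_def using assms by (subst sum.remove[of _ q]) auto
  have rest: "raise q c (b(k := Suc (b k))) = (if b q = 0 then 0 else c ((b(q := b q - 1))(k := Suc ((b(q := b q - 1)) k))))"
    if "k \<in> {1..m} - {q}" for k
    using that by (auto simp: raise_def fun_upd_twist)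
  show ?thesis
  proof (cases "b q = 0")
    case True
    have "(\<Sum>k\<in>{1..m} - {q}. wedge (raise q c (b(k := Suc (b k)))) (v k)) = 0"
      using True rest by (intro sum.neutral) simp
    moreover have "raise q c (b(q := Suc (b q))) = c b" by (simp add: raise_def)
    ultimately show ?thesis using True by (simp add: split raise_def)
  next
    case False
    let ?b = "b(q := b q - 1)"
    have "raise q c (b(q := Suc (b q))) = c b" by (simp add: raise_def)
    moreover have "?b(q := Suc (?b q)) = b" using False by simp
    ultimately show ?thesis using False rest
      by (simp add: raise_def[of q "cartan_diff m v c"] split)
  qed
qed

lemma diff_Suc: "c \<in> cartan_chains n k i j \<Longrightarrow> cartan_diff (Suc k) v c = cartan_diff k v c"
proof
  fix b assume "c \<in> cartan_chains n k i j"
  then have "lower (Suc k) c b = 0" by (simp only: chains_SucD(2) zero_fun_apply)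
  then show "cartan_diff (Suc k) v c b = cartan_diff k v c b"
    by (simp add: cartan_diff_def lower_def)
qed

locale lin_seq =
  fixes n M :: nat and v :: "nat \<Rightarrow> 'k::field ext" and J :: "'k ext set"
  assumes J: "graded_ideal n J" and v: "\<And>k. k \<in> {1..M} \<Longrightarrow> v k \<in> ext_deg n 1"
begin

abbreviation "C m i j \<equiv> cartan_chains n m i j :: 'k chain set"
abbreviation "D m i j \<equiv> ideal_chains n m J i j"
abbreviation "Z m i j \<equiv> cartan_cycles n m v J i j"
abbreviation "B m i j \<equiv> cartan_boundaries n m v J i j"
abbreviation "h m i j \<equiv> cartan_homology_dim n m v J i j"
abbreviation "d m \<equiv> cartan_diff m v"

lemma J_simps: "0 \<in> J" "x \<in> J \<Longrightarrow> y \<in> J \<Longrightarrow> x + y \<in> J" "x \<in> J \<Longrightarrow> ext_scale r x \<in> J"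
  "x \<in> J \<Longrightarrow> y \<in> J \<Longrightarrow> x - y \<in> J" "x \<in> J \<Longrightarrow> - x \<in> J"
  using graded_ideal_subspace[OF J] by (auto intro: ext.subspace_0 ext.subspace_add ext.subspace_scale ext.subspace_diff ext.subspace_neg)

lemma v_alg: "k \<in> {1..M} \<Longrightarrow> v k \<in> ext_alg n"
  using v ext_deg_subset by blast

lemma D_subspace: "chain.subspace (D m i j)"
  using cartan_chains_subspace[of n m i j] unfolding ideal_chains_def chain.subspace_def
  by (auto simp: J_simps)

lemma D_sub: "D m i j \<subseteq> C m i j"
  by (auto simp: ideal_chains_def)

lemma Z_sub: "Z m i j \<subseteq> C m i j"
  by (auto simp: cartan_cycles_def)

lemma Z_subspace: "chain.subspace (Z m i j)"
  using cartan_chains_subspace[of n m i j] unfolding cartan_cycles_def chain.subspace_def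
  by (auto simp: J_simps diff_simps cc.linear_scale[OF linear_cartan_diff])

lemma B_alt: "B m i j = {x + y | x y. x \<in> d m ` C m (Suc i) j \<and> y \<in> D m i j}"
  by (auto simp: cartan_boundaries_def)

lemma B_subspace: "chain.subspace (B m i j)"
  unfolding B_alt
  by (intro chain.subspace_sums D_subspace cc.linear_subspace_image linear_cartan_diff cartan_chains_subspace)

lemma Z_fin: "fin_span chain_scale (Z m i j)"
  using chain.fin_span_mono[OF Z_sub cartan_chains_fin] .

lemma diff_in:
  assumes "c \<in> C m (Suc i) j" "m \<le> M"
  shows "d m c \<in> C m i j"
proof -
  have "b \<in> exponents m i \<and> F \<subseteq> {1..n} \<and> card F + i = j" if nz: "d m c b F \<noteq> 0" for b F
  proof -
    obtain k where k: "k \<in> {1..m}" "wedge (c (b(k := Suc (b k)))) (v k) F \<noteq> 0"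
      using nz unfolding cartan_diff_def sum_fun_apply by (meson sum.not_neutral_contains_not_neutral)
    obtain G where G: "finite F" "G \<subseteq> F" "c (b(k := Suc (b k))) G \<noteq> 0" "v k (F - G) \<noteq> 0"
      using k(2) by (rule wedge_nonzeroE)
    have "v k \<in> ext_deg n 1" using v k assms(2) by simp
    then have F: "F - G \<subseteq> {1..n}" "card (F - G) = 1" using G by (auto simp: ext_deg_def)
    have G': "b(k := Suc (b k)) \<in> exponents m (Suc i)" "G \<subseteq> {1..n}" "card G + Suc i = j"
      using G assms(1) by (auto simp: cartan_chains_def)
    have "card F = card G + card (F - G)" using G
      by (simp add: card_Diff_subset card_mono finite_subset)
    then show ?thesis using F G' exponents_Suc_iff[OF k(1)] by auto
  qed
  then show ?thesis by (simp add: cartan_chains_def)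
qed

text \<open>The terms in which two factors \<open>x\<^sub>k\<close> and \<open>x\<^sub>l\<close> are removed cancel in pairs, or vanish for \<open>k = l\<close>, as linear forms
anticommute and square to zero.\<close>

lemma diff_diff:
  assumes "m \<le> M"
  shows "d m (d m c) = 0"
proof
  fix b
  have "d m (d m c) b = (\<Sum>l\<in>{1..m}. \<Sum>k\<in>{1..m}.
      wedge (c ((b(l := Suc (b l)))(k := Suc ((b(l := Suc (b l))) k)))) (wedge (v k) (v l)))"
    by (simp add: cartan_diff_def wedge_sum_left wedge_assoc)
  also have "\<dots> = 0"
  proof (rule alternating_double_sum)
    fix l k assume lk: "l \<in> {1..m}" "k \<in> {1..m}"
    have "wedge (v k) (v l) = - wedge (v l) (v k)"
      using lk assms by (intro wedge_anticommute[of _ n] v) auto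
    moreover have "b(k := Suc (b k), l := Suc ((b(k := Suc (b k))) l)) = b(l := Suc (b l), k := Suc ((b(l := Suc (b l))) k))"
      by (auto simp: fun_eq_iff)
    ultimately show "wedge (c (b(l := Suc (b l), k := Suc ((b(l := Suc (b l))) k)))) (wedge (v k) (v l)) =
       - wedge (c (b(k := Suc (b k), l := Suc ((b(k := Suc (b k))) l)))) (wedge (v l) (v k))"
      by (simp only: wedge_minus_right)
  next
    fix l assume "l \<in> {1..m}"
    then have "wedge (v l) (v l) = 0" using assms by (intro wedge_square_zero[of _ n] v) auto
    then show "wedge (c (b(l := Suc (b l), l := Suc ((b(l := Suc (b l))) l)))) (wedge (v l) (v l)) = 0"
      by (simp only: wedge_zero_right)
  qed simp
  finally show "d m (d m c) b = 0 b" by simp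
qed

lemma diff_ideal:
  assumes "\<And>a. c a \<in> J" "m \<le> M"
  shows "d m c b \<in> J"
  unfolding cartan_diff_def
  using assms v_alg by (intro ext.subspace_sum graded_ideal_subspace[OF J] graded_idealD(4)[OF J]) auto

lemma B_sub_Z: 
  assumes "m \<le> M"
  shows "B m i j \<subseteq> Z m i j"
proof
  fix x assume "x \<in> B m i j"
  then obtain c e where x: "x = d m c + e" "c \<in> C m (Suc i) j" "e \<in> D m i j"
    by (auto simp: cartan_boundaries_def)
  have "e \<in> C m i j" using x(3) D_sub by blast
  then have "x \<in> C m i j" using x diff_in assms cartan_chains_subspace chain.subspace_add by metis
  moreover have "d m x b \<in> J" for b
    using x(3) diff_ideal[of e m b] assms by (simp add: x(1) diff_simps diff_diff ideal_chains_def)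
  ultimately show "x \<in> Z m i j" by (simp add: cartan_cycles_def)
qed

lemma h_eq: "m \<le> M \<Longrightarrow> h m i j + chain.dim (B m i j) = chain.dim (Z m i j)"
  unfolding cartan_homology_dim_def
  by (rule chain.quotient_dim_eq[OF Z_subspace B_subspace B_sub_Z Z_fin])

lemma diff_C0: "c \<in> C m 0 j \<Longrightarrow> d m c = 0"
proof
  fix b assume c: "c \<in> C m 0 j"
  have "c (b(k := Suc (b k))) = 0" for k
  proof (rule ccontr)
    assume "c (b(k := Suc (b k))) \<noteq> 0"
    then obtain F where "c (b(k := Suc (b k))) F \<noteq> 0" by (auto simp: fun_eq_iff)
    then have "b(k := Suc (b k)) = (\<lambda>_. 0)" using c exponents_zero by (auto simp: cartan_chains_def)
    then show False by (metis fun_upd_same nat.distinct(1))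
  qed
  then show "d m c b = 0 b" by (simp add: cartan_diff_def)
qed

lemma Z0: "Z m 0 j = C m 0 j"
  using diff_C0 J_simps by (auto simp: cartan_cycles_def)

lemma C0: "C m 0 j = C m' 0 j"
  by (simp add: cartan_chains_def exponents_zero)

lemma D0: "D m 0 j = D m' 0 j"
  by (simp add: ideal_chains_def C0[of m j m'])

lemma CI: "x \<in> C m i j \<Longrightarrow> y \<in> C m i j \<Longrightarrow> x + y \<in> C m i j" "x \<in> C m i j \<Longrightarrow> y \<in> C m i j \<Longrightarrow> x - y \<in> C m i j"
  using cartan_chains_subspace chain.subspace_add chain.subspace_diff by blast+

lemma DI: "x \<in> D m i j \<Longrightarrow> y \<in> D m i j \<Longrightarrow> x + y \<in> D m i j" "x \<in> D m i j \<Longrightarrow> y \<in> D m i j \<Longrightarrow> x - y \<in> D m i j"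
  "0 \<in> D m i j"
  using D_subspace chain.subspace_add chain.subspace_diff chain.subspace_0 by blast+

lemma BI: "c \<in> C m (Suc i) j \<Longrightarrow> e \<in> D m i j \<Longrightarrow> d m c + e \<in> B m i j"
  by (auto simp: cartan_boundaries_def)

lemma BE: assumes "x \<in> B m i j" obtains c e where "x = d m c + e" "c \<in> C m (Suc i) j" "e \<in> D m i j"
  using assms by (auto simp: cartan_boundaries_def)

lemma C_mono: "C k i j \<subseteq> C (Suc k) i j" using chains_SucD(1) by blast

lemma D_mono: "D k i j \<subseteq> D (Suc k) i j" using C_mono by (auto simp: ideal_chains_def)

lemma Z_mono: "Z k i j \<subseteq> Z (Suc k) i j" 
proof
  fix x assume x: "x \<in> Z k i j"
  then have "x \<in> C k i j" by (simp add: cartan_cycles_def)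
  then show "x \<in> Z (Suc k) i j" using x subsetD[OF C_mono] diff_Suc[of x n k i j v] by (auto simp: cartan_cycles_def)
qed

lemma B_mono: "B k i j \<subseteq> B (Suc k) i j"
proof (rule subsetI, erule BE)
  fix x c e assume "x = d k c + e" "c \<in> C k (Suc i) j" "e \<in> D k i j"
  then show "x \<in> B (Suc k) i j"
    using BI[of c "Suc k" i j e] subsetD[OF C_mono] subsetD[OF D_mono] diff_Suc[of c n k "Suc i" j v] by metis
qed

lemma D_lower: "x \<in> D m (Suc i) (Suc j) \<Longrightarrow> q \<in> {1..m} \<Longrightarrow> lower q x \<in> D m i j"
  using lower_in[of x n m i j q] unfolding ideal_chains_def by (auto simp: lower_def)

lemma D_raise: "x \<in> D m i j \<Longrightarrow> q \<in> {1..m} \<Longrightarrow> raise q x \<in> D m (Suc i) (Suc j)"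
  using raise_in[of x n m i j q] J_simps by (auto simp: ideal_chains_def raise_def)

lemma Z_lower: "x \<in> Z m (Suc i) (Suc j) \<Longrightarrow> q \<in> {1..m} \<Longrightarrow> lower q x \<in> Z m i j"
proof -
  assume x: "x \<in> Z m (Suc i) (Suc j)" and q: "q \<in> {1..m}"
  have "d m (lower q x) b \<in> J" for b
    unfolding diff_lower lower_def[of q "d m x"] using x by (simp only: cartan_cycles_def mem_Collect_eq)
  then show "lower q x \<in> Z m i j"
    using x q lower_in[of x n m i j q] by (simp add: cartan_cycles_def)
qed

lemma Z_kernel: "Z k i j = {z \<in> Z (Suc k) i j. lower (Suc k) z = 0}"
proof (intro equalityI subsetI)
  fix x assume "x \<in> Z k i j"
  then show "x \<in> {z \<in> Z (Suc k) i j. lower (Suc k) z = 0}"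
    using subsetD[OF Z_mono, of x k i j] chains_SucD(2)[of x n k i j] subsetD[OF Z_sub, of x k i j] by simp
next
  fix x assume x: "x \<in> {z \<in> Z (Suc k) i j. lower (Suc k) z = 0}"
  have "x \<in> C k i j" by (rule chains_SucI) (use x in \<open>auto simp: cartan_cycles_def\<close>)
  moreover from this have "d (Suc k) x = d k x" by (rule diff_Suc)
  ultimately show "x \<in> Z k i j" using x by (simp add: cartan_cycles_def)
qed

text \<open>Exactness at \<open>H\<^bsub>i+1\<^esub>(k+1)\<close>: a class that becomes zero after removing one factor \<open>x\<^bsub>k+1\<^esub>\<close> comes from the shorter
sequence. If \<open>lower z\<close> is bounded by \<open>y\<close>, then subtracting from \<open>z\<close> the boundary of \<open>raise y\<close> removes \<open>x\<^bsub>k+1\<^esub>\<close> from \<open>z\<close>.\<close>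

lemma lower_kernel_B:
  assumes k: "Suc k \<le> M"
  shows "{z \<in> Z (Suc k) (Suc i) (Suc j). lower (Suc k) z \<in> B (Suc k) i j} =
    {x + y | x y. x \<in> Z k (Suc i) (Suc j) \<and> y \<in> B (Suc k) (Suc i) (Suc j)}" (is "?L = ?R")
proof
  let ?q = "Suc k"
  have q: "?q \<in> {1..?q}" by simp
  show "?L \<subseteq> ?R"
  proof clarify
    fix z assume z: "z \<in> Z ?q (Suc i) (Suc j)" "lower ?q z \<in> B ?q i j"
    obtain y e where ye: "lower ?q z = d ?q y + e" "y \<in> C ?q (Suc i) j" "e \<in> D ?q i j"
      using z(2) by (rule BE)
    have b: "d ?q (raise ?q y) + raise ?q e \<in> B ?q (Suc i) (Suc j)"
      using ye by (intro BI raise_in D_raise) auto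
    define x where "x = z - (d ?q (raise ?q y) + raise ?q e)"
    have "x \<in> Z ?q (Suc i) (Suc j)" unfolding x_def
      using z(1) b B_sub_Z[OF k] Z_subspace chain.subspace_diff by blast
    moreover have "lower ?q x = 0"
      by (simp add: x_def lower_simps diff_lower[symmetric] ye(1))
    ultimately have "x \<in> Z k (Suc i) (Suc j)" using Z_kernel[of k "Suc i" "Suc j"] by blast
    moreover have "z = x + (d ?q (raise ?q y) + raise ?q e)" by (simp add: x_def)
    ultimately show "\<exists>x y. z = x + y \<and> x \<in> Z k (Suc i) (Suc j) \<and> y \<in> B ?q (Suc i) (Suc j)"
      using b by blast
  qed
  show "?R \<subseteq> ?L"
  proof clarify
    fix x y assume x: "x \<in> Z k (Suc i) (Suc j)" and y: "y \<in> B ?q (Suc i) (Suc j)"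
    have "x + y \<in> Z ?q (Suc i) (Suc j)"
      using x y Z_mono B_sub_Z[OF k] Z_subspace chain.subspace_add by blast
    moreover obtain c e where ce: "y = d ?q c + e" "c \<in> C ?q (Suc (Suc i)) (Suc j)" "e \<in> D ?q (Suc i) (Suc j)"
      using y by (rule BE)
    have "lower ?q (x + y) = d ?q (lower ?q c) + lower ?q e"
      using x Z_kernel[of k "Suc i" "Suc j"] by (simp add: lower_simps ce(1) diff_lower)
    moreover have "d ?q (lower ?q c) + lower ?q e \<in> B ?q i j"
      using ce by (intro BI lower_in D_lower) auto
    ultimately show "x + y \<in> Z ?q (Suc i) (Suc j) \<and> lower ?q (x + y) \<in> B ?q i j" by simp
  qed
qed

text \<open>The preimage, among the cycles, of the image of \<open>H\<^bsub>i+1\<^esub>(q)\<close> in \<open>H\<^sub>i(q)\<close>.\<close>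

definition lower_cycles :: "nat \<Rightarrow> nat \<Rightarrow> nat \<Rightarrow> 'k chain set" where
  "lower_cycles q i j = {lower q z + b | z b. z \<in> Z q (Suc i) (Suc j) \<and> b \<in> B q i j}"

lemma long_exact_dim:
  assumes k: "Suc k \<le> M"
  shows "h (Suc k) (Suc i) (Suc j) + chain.dim (Z k (Suc i) (Suc j) \<inter> B (Suc k) (Suc i) (Suc j))
      + chain.dim (B (Suc k) i j) = chain.dim (lower_cycles (Suc k) i j) + chain.dim (Z k (Suc i) (Suc j))"
proof -
  have k': "k \<le> M" using k by simp
  have Bf: "fin_span chain_scale (B m i' j')" if "m \<le> M" for m i' j'
    using chain.fin_span_mono[OF B_sub_Z[OF that] Z_fin] .
  show ?thesis
    using cc.dim_preimage[OF linear_lower Z_subspace Z_fin B_subspace Bf[OF k], of "Suc k" "Suc k" "Suc i" "Suc j" i j]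
      chain.dim_sum_Int[OF Z_subspace B_subspace Z_fin Bf[OF k], of k "Suc i" "Suc j" "Suc i" "Suc j"]
      h_eq[OF k, of "Suc i" "Suc j"] h_eq[OF k, of i j]
    unfolding lower_kernel_B[OF k] lower_cycles_def by linarith
qed

lemma lower_cycles_sub: 
  assumes "Suc k \<le> M"
  shows "lower_cycles (Suc k) i j \<subseteq> Z (Suc k) i j"
proof
  fix x assume "x \<in> lower_cycles (Suc k) i j"
  then obtain z b where "x = lower (Suc k) z + b" "z \<in> Z (Suc k) (Suc i) (Suc j)" "b \<in> B (Suc k) i j"
    by (auto simp: lower_cycles_def)
  moreover have "lower (Suc k) z \<in> Z (Suc k) i j" by (rule Z_lower) (use calculation in auto)
  ultimately show "x \<in> Z (Suc k) i j"
    using B_sub_Z[OF assms] Z_subspace chain.subspace_add by blast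
qed

lemma B_Suc_Int: "k \<le> M \<Longrightarrow> B k i j \<subseteq> Z k i j \<inter> B (Suc k) i j"
  using B_mono B_sub_Z by blast

text \<open>The long exact sequence bounds the dimension of \<open>H\<^bsub>i+1\<^esub>(k+1)\<close> by those of its two neighbours. Equality holds if and
only if the maps into \<open>H\<^bsub>i+1\<^esub>(k+1)\<close> and out of it are injective and surjective, respectively.\<close>

theorem homology_step_le:
  assumes k: "Suc k \<le> M"
  shows "h (Suc k) (Suc i) (Suc j) \<le> h k (Suc i) (Suc j) + h (Suc k) i j"
proof -
  have "chain.dim (lower_cycles (Suc k) i j) \<le> chain.dim (Z (Suc k) i j)"
    by (rule chain.dim_subset[OF lower_cycles_sub[OF k] Z_fin])
  moreover have "chain.dim (B k (Suc i) (Suc j)) \<le> chain.dim (Z k (Suc i) (Suc j) \<inter> B (Suc k) (Suc i) (Suc j))"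
    using k by (intro chain.dim_subset B_Suc_Int chain.fin_span_mono[OF _ Z_fin]) auto
  ultimately show ?thesis
    using long_exact_dim[OF k, of i j] h_eq[OF k, of i j] h_eq[of k "Suc i" "Suc j"] k by linarith
qed

lemma diff_raise_C0:
  assumes u: "u \<in> C m 0 j" and q: "q \<in> {1..m}"
  shows "d m (raise q u) = right_mult (v q) u"
proof
  fix b
  have "raise q (d m u) = 0" using diff_C0[OF u] by (simp add: raise_simps)
  moreover have "u b = 0" if "b q \<noteq> 0"
  proof (rule ccontr)
    assume "u b \<noteq> 0"
    then obtain F where "u b F \<noteq> 0" by (auto simp: fun_eq_iff)
    then have "b = (\<lambda>_. 0)" using u exponents_zero by (auto simp: cartan_chains_def)
    then show False using that by simp
  qed
  ultimately show "d m (raise q u) b = right_mult (v q) u b"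
    by (auto simp: diff_raise[OF q] right_mult_def)
qed

text \<open>Exactness at \<open>H\<^sub>0(k+1)\<close>, the quotient of \<open>E\<close> by \<open>J\<close> and the forms: the elements of \<open>E\<close> that represent the image of \<open>H\<^sub>1(k+1)\<close>
are those whose product with \<open>v\<^bsub>k+1\<^esub>\<close> vanishes in \<open>H\<^sub>0(k)\<close>.\<close>

lemma lower_cycles_0:
  assumes k: "Suc k \<le> M"
  shows "lower_cycles (Suc k) 0 j = {u \<in> C k 0 j. right_mult (v (Suc k)) u \<in> B k 0 (Suc j)}"
proof -
  let ?q = "Suc k"
  have q: "?q \<in> {1..?q}" by simp
  have k': "k \<le> M" using k by simp
  note key = diff_raise_C0[OF _ q]
  show ?thesis
  proof
    show "lower_cycles ?q 0 j \<subseteq> {u \<in> C k 0 j. right_mult (v ?q) u \<in> B k 0 (Suc j)}"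
    proof
      fix x assume "x \<in> lower_cycles ?q 0 j"
      then obtain z b where zb: "x = lower ?q z + b" "z \<in> Z ?q (Suc 0) (Suc j)" "b \<in> B ?q 0 j"
        by (auto simp: lower_cycles_def)
      obtain y e where ye: "b = d ?q y + e" "y \<in> C ?q (Suc 0) j" "e \<in> D ?q 0 j" using zb(3) by (rule BE)
      define w where "w = z + d ?q (raise ?q y) + raise ?q e"
      have "d ?q (raise ?q y) + raise ?q e \<in> B ?q (Suc 0) (Suc j)"
        using ye by (intro BI raise_in D_raise) auto
      then have w: "w \<in> Z ?q (Suc 0) (Suc j)" unfolding w_def
        using zb(2) B_sub_Z[OF k] Z_subspace chain.subspace_add by (metis (no_types, lifting) add.assoc subsetD)
      have x: "x = lower ?q w" unfolding w_def
        by (simp add: lower_simps diff_lower[symmetric] zb(1) ye(1) add.assoc)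
      have wC: "w \<in> C ?q (Suc 0) (Suc j)" using w Z_sub by blast
      have xC: "x \<in> C ?q 0 j" unfolding x using lower_in[OF wC q] .
      define w0 where "w0 = w - raise ?q x"
      have "w0 \<in> C ?q (Suc 0) (Suc j)" unfolding w0_def using wC raise_in[OF xC q] by (rule CI)
      moreover have "lower ?q w0 = 0" by (simp add: w0_def lower_simps x)
      ultimately have w0: "w0 \<in> C k (Suc 0) (Suc j)" by (rule chains_SucI)
      have "right_mult (v ?q) x = d k (- w0) + d ?q w"
        using key[OF xC] diff_Suc[OF w0, of v] cc.linear_neg[OF linear_cartan_diff, of k v w0]
        by (simp add: w0_def diff_simps algebra_simps)
      moreover have "- w0 \<in> C k (Suc 0) (Suc j)" using w0 cartan_chains_subspace chain.subspace_neg by blast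
      moreover have "d ?q w \<in> D k 0 (Suc j)"
        unfolding D0[of k "Suc j" ?q] using w wC diff_in[OF _ k] by (auto simp: ideal_chains_def cartan_cycles_def)
      ultimately have "right_mult (v ?q) x \<in> B k 0 (Suc j)" using BI by metis
      then show "x \<in> {u \<in> C k 0 j. right_mult (v ?q) u \<in> B k 0 (Suc j)}" using xC C0 by blast
    qed
    show "{u \<in> C k 0 j. right_mult (v ?q) u \<in> B k 0 (Suc j)} \<subseteq> lower_cycles ?q 0 j"
    proof clarify
      fix u assume u: "u \<in> C k 0 j" "right_mult (v ?q) u \<in> B k 0 (Suc j)"
      have uq: "u \<in> C ?q 0 j" using u C_mono by blast
      obtain y e where ye: "right_mult (v ?q) u = d k y + e" "y \<in> C k (Suc 0) (Suc j)" "e \<in> D k 0 (Suc j)"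
        using u(2) by (rule BE)
      define z where "z = raise ?q u - y"
      have "z \<in> C ?q (Suc 0) (Suc j)" unfolding z_def using ye(2) C_mono raise_in[OF uq q] CI(2) by blast
      moreover have "d ?q z = e" 
        using key[OF uq] ye(1) diff_Suc[OF ye(2), of v] by (simp add: z_def diff_simps)
      then have "d ?q z b \<in> J" for b using ye(3) by (simp add: ideal_chains_def)
      ultimately have "z \<in> Z ?q (Suc 0) (Suc j)" by (simp add: cartan_cycles_def)
      moreover have "u = lower ?q z + 0"
        using chains_SucD(2)[OF ye(2)] by (simp add: z_def lower_simps)
      ultimately show "u \<in> lower_cycles ?q 0 j" unfolding lower_cycles_def
        using B_subspace chain.subspace_0 by blast
    qed
  qed
qed

lemma B0_Suc: 
  assumes k: "Suc k \<le> M"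
  shows "{right_mult (v (Suc k)) u + b | u b. u \<in> C k 0 j \<and> b \<in> B k 0 (Suc j)} = B (Suc k) 0 (Suc j)"
proof -
  let ?q = "Suc k"
  have q: "?q \<in> {1..?q}" by simp
  note key = diff_raise_C0[OF _ q]
  show ?thesis
  proof safe
    fix u b assume u: "u \<in> C k 0 j" and b: "b \<in> B k 0 (Suc j)"
    have uq: "u \<in> C ?q 0 j" using u C_mono by blast
    have "d ?q (raise ?q u) + 0 \<in> B ?q 0 (Suc j)" using raise_in[OF uq q] by (intro BI DI)
    then have "right_mult (v ?q) u \<in> B ?q 0 (Suc j)" using key[OF uq] by simp
    then show "right_mult (v ?q) u + b \<in> B ?q 0 (Suc j)"
      using b B_mono B_subspace chain.subspace_add by blast
  next
    fix x assume "x \<in> B ?q 0 (Suc j)"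
    then obtain c e where ce: "x = d ?q c + e" "c \<in> C ?q (Suc 0) (Suc j)" "e \<in> D ?q 0 (Suc j)" by (rule BE)
    define u where "u = lower ?q c"
    have uq: "u \<in> C ?q 0 j" unfolding u_def using lower_in[OF ce(2) q] .
    have "c - raise ?q u \<in> C ?q (Suc 0) (Suc j)" using ce(2) raise_in[OF uq q] by (rule CI)
    then have ck: "c - raise ?q u \<in> C k (Suc 0) (Suc j)" by (rule chains_SucI) (simp add: lower_simps u_def)
    then have "d k (c - raise ?q u) + e \<in> B k 0 (Suc j)" using ce(3) D0 by (intro BI) auto
    moreover have "x = right_mult (v ?q) u + (d k (c - raise ?q u) + e)"
      using key[OF uq] diff_Suc[OF ck, of v] by (simp add: ce(1) diff_simps algebra_simps)
    ultimately show "\<exists>u b. x = right_mult (v ?q) u + b \<and> u \<in> C k 0 j \<and> b \<in> B k 0 (Suc j)"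
      using uq C0 by blast
  qed
qed

text \<open>The end \<open>H\<^sub>1(k) \<rightarrow> H\<^sub>1(k+1) \<rightarrow> H\<^sub>0(k+1) \<rightarrow> H\<^sub>0(k) \<rightarrow> H\<^sub>0(k+1) \<rightarrow> 0\<close> of the long exact sequence, where the third map is
multiplication by \<open>v\<^bsub>k+1\<^esub>\<close>.\<close>

lemma homology_one_dim:
  assumes k: "Suc k \<le> M"
  shows "h (Suc k) 1 (Suc j) + h k 0 (Suc j) + chain.dim (Z k 1 (Suc j) \<inter> B (Suc k) 1 (Suc j))
    = h (Suc k) 0 j + h (Suc k) 0 (Suc j) + chain.dim (Z k 1 (Suc j))"
proof -
  have k': "k \<le> M" using k by simp
  have Bf: "fin_span chain_scale (B m i' j')" if "m \<le> M" for m i' j'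
    using chain.fin_span_mono[OF B_sub_Z[OF that] Z_fin] .
  have "chain.dim (B (Suc k) 0 (Suc j)) + chain.dim (lower_cycles (Suc k) 0 j)
    = chain.dim (C k 0 j) + chain.dim (B k 0 (Suc j))"
    using cc.dim_preimage[OF linear_right_mult cartan_chains_subspace cartan_chains_fin B_subspace Bf[OF k'],
        of "v (Suc k)" n k 0 j 0 "Suc j"]
    unfolding B0_Suc[OF k] lower_cycles_0[OF k] .
  then show ?thesis
    using long_exact_dim[OF k, of 0 j] h_eq[OF k, of 0 j] h_eq[OF k, of 0 "Suc j"] h_eq[OF k', of 0 "Suc j"]
      C0[of k j "Suc k"] C0[of k "Suc j" "Suc k"]
    by (simp add: Z0)
qed

theorem homology_one_le:
  assumes k: "Suc k \<le> M"
  shows "h (Suc k) 1 (Suc j) + h k 0 (Suc j) \<le> h k 1 (Suc j) + h (Suc k) 0 j + h (Suc k) 0 (Suc j)"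
proof -
  have "chain.dim (B k 1 (Suc j)) \<le> chain.dim (Z k 1 (Suc j) \<inter> B (Suc k) 1 (Suc j))"
    using k by (intro chain.dim_subset B_Suc_Int chain.fin_span_mono[OF _ Z_fin]) auto
  then show ?thesis using homology_one_dim[OF k, of j] h_eq[of k 1 "Suc j"] k by linarith
qed

end

section \<open>Strongly stable ideals along the last variables\<close>

text \<open>A family that is both an upset and shifted describes a strongly stable monomial ideal.\<close>

definition shifted :: "nat set set \<Rightarrow> bool" where
  "shifted N \<longleftrightarrow> (\<forall>F\<in>N. \<forall>j\<in>F. \<forall>i. 1 \<le> i \<longrightarrow> i < j \<longrightarrow> i \<notin> F \<longrightarrow> insert i (F - {j}) \<in> N)"

definition slice :: "nat \<Rightarrow> nat \<Rightarrow> nat set set" where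
  "slice m d = {F. F \<subseteq> {1..m} \<and> card F = d}"

definition upset :: "nat \<Rightarrow> nat set set \<Rightarrow> bool" where
  "upset n S \<longleftrightarrow> S \<subseteq> Pow {1..n} \<and> (\<forall>F\<in>S. \<forall>G. F \<subseteq> G \<longrightarrow> G \<subseteq> {1..n} \<longrightarrow> G \<in> S)"

lemma upset_graded_ideal:
  assumes "upset n S"
  shows "graded_ideal n (ext_coord S :: 'k::field ext set)"
proof -
  have up: "H \<in> S" if "F \<in> S" "F \<subseteq> H" "H \<subseteq> {1..n}" for F H
    using assms that unfolding upset_def by blast
  have sub: "F \<subseteq> {1..n}" if "F \<in> S" for F using assms that unfolding upset_def by blast
  have mult: "wedge w u \<in> ext_coord S \<and> wedge u w \<in> ext_coord S" if u: "u \<in> ext_coord S" and w: "w \<in> ext_alg n"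
    for u w :: "'k ext"
  proof -
    have "H \<in> S" if nz: "wedge w u H \<noteq> 0" for H
    proof -
      obtain F where F: "finite H" "F \<subseteq> H" "w F \<noteq> 0" "u (H - F) \<noteq> 0" using nz by (rule wedge_nonzeroE)
      then have "H - F \<in> S" "F \<subseteq> {1..n}" using u w by (auto simp: ext_coord_def ext_alg_def)
      then show ?thesis using up[of "H - F" H] sub[of "H - F"] F by blast
    qed
    moreover have "H \<in> S" if nz: "wedge u w H \<noteq> 0" for H
    proof -
      obtain F where F: "finite H" "F \<subseteq> H" "u F \<noteq> 0" "w (H - F) \<noteq> 0" using nz by (rule wedge_nonzeroE)
      then have "F \<in> S" "H - F \<subseteq> {1..n}" using u w by (auto simp: ext_coord_def ext_alg_def)
      then show ?thesis using up[of F H] sub[of F] F by blast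
    qed
    ultimately show ?thesis by (simp add: ext_coord_def)
  qed
  have subalg: "ext_coord S \<subseteq> (ext_alg n :: 'k ext set)" using sub by (auto simp: ext_coord_def ext_alg_def)
  show ?thesis unfolding graded_ideal_def ext_ideal_def
  proof (intro conjI ballI allI)
    fix u :: "'k ext" and d assume u: "u \<in> ext_coord S"
    then show "hom_component d u \<in> ext_coord S" by (simp add: ext_coord_def hom_component_def)
    fix v :: "'k ext" assume "v \<in> ext_coord S"
    with u show "u + v \<in> ext_coord S" by (rule ext.subspace_add[OF ext_coord_subspace])
  qed (use mult subalg ext.subspace_0[OF ext_coord_subspace] in simp_all)
qed

definition last_vars :: "nat \<Rightarrow> nat \<Rightarrow> 'k::field ext" where
  "last_vars n k = ext_mono {n + 1 - k}"

lemma last_vars_deg: "k \<in> {1..n} \<Longrightarrow> last_vars n k \<in> ext_deg n 1"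
proof -
  assume "k \<in> {1..n}"
  then have "{n + 1 - k} \<subseteq> {1..n}" by auto
  then show ?thesis unfolding last_vars_def using ext_mono_in(2)[of "{n + 1 - k}" n] by simp
qed

context lin_seq
begin

lemma C_zero: 
  assumes "m = 0 \<or> j < i" "0 < i" shows "C m i j = {0}"
proof -
  have "c a F = 0" if "c \<in> C m i j" for c a F
  proof (rule ccontr)
    assume "c a F \<noteq> 0"
    then have "a \<in> exponents m i" "card F + i = j" using that by (auto simp: cartan_chains_def)
    then show False using assms by (auto simp: exponents_def)
  qed
  then have "C m i j \<subseteq> {0}" by (auto simp: fun_eq_iff)
  then show ?thesis using chain.subspace_0[OF cartan_chains_subspace] by blast
qed

lemma h_zero: 
  assumes "m = 0 \<or> j < i" "0 < i" "m \<le> M" shows "h m i j = 0"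
proof -
  have "Z m i j \<subseteq> chain.span {}" using Z_sub[of m i j] C_zero[OF assms(1,2)] chain.span_empty by auto
  then have "chain.dim (Z m i j) \<le> card ({} :: 'k chain set)" by (rule chain.dim_le_card) simp
  then show ?thesis using h_eq[OF assms(3), of i j] by simp
qed

text \<open>The bounds of \<open>homology_one_le\<close> telescope: the difference \<open>h\<^sub>k(1, j + 1) - h\<^sub>k(0, j + 1)\<close> grows by at most \<open>h\<^sub>k(0, j)\<close> when
the \<open>k\<close>-th form is adjoined.\<close>

lemma h_one_bound:
  assumes "k \<le> M"
  shows "h k 1 (Suc j) + h 0 0 (Suc j) \<le> h k 0 (Suc j) + (\<Sum>s\<in>{1..k}. h s 0 j)"
  using assms
proof (induct k)
  case 0
  then show ?case using h_zero[of 0 "Suc j" 1] by simp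
next
  case (Suc k)
  then show ?case using homology_one_le[OF Suc(2), of j] by simp
qed

end

locale stable_seq =
  fixes n :: nat and S :: "nat set set"
  assumes S: "upset n S" "shifted S"
begin

sublocale lin_seq n n "last_vars n" "ext_coord S :: 'k::field ext set"
  by unfold_locales (use upset_graded_ideal[OF S(1)] last_vars_deg in auto)

text \<open>Let \<open>x\<^sub>s\<close> be the first divided power variable that occurs in \<open>x\<^bsup>(a)\<^esup>\<close>. The coefficient of \<open>x\<^bsup>(a)\<^esup>\<close> is required to be
annihilated, modulo the ideal, by \<open>e\<^sub>1, \<dots>, e\<^bsub>n+1-s\<^esub>\<close>. The differential multiplies it only by forms \<open>e\<^bsub>n+1-k\<^esub>\<close> with
\<open>k \<ge> s\<close>, so a good chain of positive degree is a cycle, term by term.\<close>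

definition good :: "'k::field chain \<Rightarrow> bool" where
  "good c \<longleftrightarrow> (\<forall>a s. 0 < a s \<longrightarrow> 1 \<le> s \<longrightarrow> (\<forall>t<s. a t = 0) \<longrightarrow>
     (\<forall>l\<in>{1..n + 1 - s}. wedge (c a) (ext_mono {l}) \<in> ext_coord S))"

lemma good_add: 
  fixes x y :: "'k::field chain"
  assumes "good x" "good y"
  shows "good (x + y)"
  unfolding good_def
proof (intro allI impI ballI)
  fix a :: "nat \<Rightarrow> nat" and s l :: nat
  assume "0 < a s" "1 \<le> s" "\<forall>t<s. a t = 0" "l \<in> {1..n + 1 - s}"
  then have "wedge (x a) (ext_mono {l}) + wedge (y a) (ext_mono {l}) \<in> ext_coord S"
    using assms unfolding good_def by (intro ext.subspace_add[OF ext_coord_subspace]) blast+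
  then show "wedge ((x + y) a) (ext_mono {l}) \<in> ext_coord S"
    by (simp only: plus_fun_apply[of x y a] wedge_add_left)
qed

lemma good_zero: "good (0 :: 'k::field chain)"
  using ext.subspace_0[OF ext_coord_subspace, of S] by (auto simp: good_def)

lemma good_cycle:
  fixes c :: "'k::field chain"
  assumes c: "c \<in> C m (Suc i) j" "good c" and m: "m \<le> n"
  shows "cartan_diff m (last_vars n) c b \<in> ext_coord S"
  unfolding cartan_diff_def
proof (rule ext.subspace_sum[OF ext_coord_subspace])
  fix k assume k: "k \<in> {1..m}"
  let ?a = "b(k := Suc (b k))"
  show "wedge (c ?a) (last_vars n k) \<in> ext_coord S"
  proof (cases "c ?a = 0")
    case True
    then show ?thesis by (simp add: ext.subspace_0[OF ext_coord_subspace])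
  next
    case False
    then obtain F where "c ?a F \<noteq> 0" by (auto simp: fun_eq_iff)
    then have a: "?a \<in> exponents m (Suc i)" using c by (auto simp: cartan_chains_def)
    define s where "s = (LEAST s. 0 < ?a s)"
    have s: "0 < ?a s" unfolding s_def by (rule LeastI[of _ k]) simp
    have least: "?a t = 0" if "t < s" for t using not_less_Least[of t "\<lambda>s. 0 < ?a s"] that s_def by simp
    have "s \<le> k" unfolding s_def by (rule Least_le) simp
    moreover have "1 \<le> s" using a s by (auto simp: exponents_def)
    moreover have "n + 1 - k \<in> {1..n + 1 - s}" using k m \<open>s \<le> k\<close> by auto
    ultimately show ?thesis using c(2) s least unfolding good_def last_vars_def by blast
  qed
qed

text \<open>In positive degree, raising the last variable does not change the first variable that occurs; so good cycles can be
lifted along \<open>lower q\<close>.\<close>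

lemma good_raise:
  fixes c :: "'k::field chain"
  assumes c: "c \<in> C q i j" "good c" "0 < i"
  shows "good (raise q c)"
  unfolding good_def
proof (intro allI impI ballI)
  fix a :: "nat \<Rightarrow> nat" and s l :: nat
  assume s: "0 < a s" "1 \<le> s" "\<forall>t<s. a t = 0" and l: "l \<in> {1..n + 1 - s}"
  let ?a = "a(q := a q - 1)"
  show "wedge (raise q c a) (ext_mono {l}) \<in> ext_coord S"
  proof (cases "a q = 0 \<or> c ?a = 0")
    case True
    then have "raise q c a = 0" by (auto simp: raise_def)
    then show ?thesis by (simp add: ext.subspace_0[OF ext_coord_subspace])
  next
    case False
    then obtain F where "c ?a F \<noteq> 0" by (auto simp: fun_eq_iff)
    then have ex: "?a \<in> exponents q i" using c by (auto simp: cartan_chains_def)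
    have "s \<le> q" using s(3) False by (meson not_less)
    have "0 < ?a s"
    proof (cases "s = q")
      case True
      have "\<exists>k\<in>{1..q}. 0 < ?a k"
      proof (rule ccontr)
        assume "\<not> (\<exists>k\<in>{1..q}. 0 < ?a k)"
        then have "(\<Sum>k\<in>{1..q}. ?a k) = 0" by (intro sum.neutral ballI) (meson gr0I)
        then show False using ex c(3) by (simp add: exponents_def)
      qed
      then obtain k where k: "k \<in> {1..q}" "0 < ?a k" by blast
      have "k = q"
      proof (rule ccontr)
        assume "k \<noteq> q"
        then show False using k s(3) True by auto
      qed
      then show ?thesis using k True by simp
    qed (use s in simp)
    moreover have "\<forall>t<s. ?a t = 0" using s(3) by auto
    ultimately have "wedge (c ?a) (ext_mono {l}) \<in> ext_coord S" using c(2) s(2) l unfolding good_def by blast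
    then show ?thesis using False by (simp add: raise_def)
  qed
qed

lemma B0_coord:
  assumes m: "m \<le> n"
  shows "(B m 0 j :: 'k::field chain set) =
    chain_coord {(a, F). a = (\<lambda>_. 0) \<and> F \<in> slice n j \<and> (F \<in> S \<or> (\<exists>k\<in>{1..m}. n + 1 - k \<in> F))}"
    (is "_ = chain_coord ?T")
proof
  show "(B m 0 j :: 'k chain set) \<subseteq> chain_coord ?T"
  proof
    fix x :: "'k chain" assume x: "x \<in> B m 0 j"
    then obtain c e where ce: "x = cartan_diff m (last_vars n) c + e" "c \<in> C m (Suc 0) j" "e \<in> D m 0 j" by (rule BE)
    have "(a, F) \<in> ?T" if nz: "x a F \<noteq> 0" for a F
    proof -
      have "x \<in> C m 0 j" using x B_sub_Z[OF m] Z_sub by blast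
      then have a: "a = (\<lambda>_. 0)" "F \<in> slice n j" using nz exponents_zero by (auto simp: cartan_chains_def slice_def)
      have "F \<in> S \<or> (\<exists>k\<in>{1..m}. n + 1 - k \<in> F)"
      proof (cases "e a F = 0")
        case True
        then have "cartan_diff m (last_vars n) c a F \<noteq> 0" using nz ce(1) by simp
        then obtain k where k: "k \<in> {1..m}" "wedge (c (a(k := Suc (a k)))) (last_vars n k) F \<noteq> 0"
          unfolding cartan_diff_def sum_fun_apply by (meson sum.not_neutral_contains_not_neutral)
        then show ?thesis unfolding last_vars_def wedge_mono_right by (auto split: if_splits)
      next
        case False
        then show ?thesis using ce(3) by (auto simp: ideal_chains_def ext_coord_def)
      qed
      then show ?thesis using a by blast
    qed
    then show "x \<in> chain_coord ?T" by (auto simp: chain_coord_def)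
  qed
  show "chain_coord ?T \<subseteq> (B m 0 j :: 'k chain set)"
  proof
    fix x :: "'k chain" assume x: "x \<in> chain_coord ?T"
    have fin: "finite ?T"
      by (rule finite_subset[of _ "{\<lambda>_. 0} \<times> Pow {1..n}"]) (auto simp: slice_def)
    have "chain_mono p \<in> (B m 0 j :: 'k chain set)" if p: "p \<in> ?T" for p
    proof -
      obtain F where F: "p = (\<lambda>_. 0, F)" "F \<in> slice n j" using p by blast
      have Fs: "F \<subseteq> {1..n}" "card F = j" "finite F" using F finite_subset by (auto simp: slice_def)
      show ?thesis
      proof (cases "F \<in> S")
        case True
        have "chain_mono p \<in> D m 0 j"
          using True Fs by (auto simp: ideal_chains_def cartan_chains_def chain_mono_def F(1) exponents_zero ext_coord_def
             split: if_splits)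
        then have "cartan_diff m (last_vars n) 0 + chain_mono p \<in> B m 0 j"
          by (intro BI chain.subspace_0 cartan_chains_subspace)
        then show ?thesis by (simp add: diff_simps)
      next
        case False
        then obtain k where k: "k \<in> {1..m}" "n + 1 - k \<in> F" using p F(1) by auto
        let ?x = "n + 1 - k" and ?e = "(\<lambda>_. 0)(k := Suc 0) :: nat \<Rightarrow> nat"
        let ?G = "F - {?x}"
        let ?s = "shuffle_sign ?G {?x} :: 'k"
        have s1: "?e \<in> exponents m (Suc 0)"
          using exponents_Suc_iff[OF k(1), of "\<lambda>_. 0" 0] exponents_zero by simp
        have cG: "card ?G + Suc 0 = j" using Fs k card.remove[of F ?x] by simp
        define c :: "'k chain" where "c = chain_scale (inverse ?s) (chain_mono (?e, ?G))"
        have "chain_mono (?e, ?G) \<in> (C m (Suc 0) j :: 'k chain set)"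
          using s1 cG Fs by (auto simp: cartan_chains_def chain_mono_def split: if_splits)
        then have c: "c \<in> C m (Suc 0) j" unfolding c_def by (intro chain.subspace_scale cartan_chains_subspace)
        have "cartan_diff m (last_vars n) c b H = chain_mono p b H" for b H
        proof (cases "b = (\<lambda>_. 0)")
          case True
          have e: "b(l := Suc (b l)) = ?e \<longleftrightarrow> l = k" for l using True by (auto simp: fun_eq_iff)
          have cm: "chain_mono (?e, ?G) (b(l := Suc (b l))) = (if l = k then ext_mono ?G else (0 :: 'k ext))" for l
            unfolding chain_mono_def prod.inject e by (auto simp: fun_eq_iff ext_mono_apply)
          have "cartan_diff m (last_vars n) c b = (\<Sum>l\<in>{1..m}. if l = k then
              ext_scale (inverse ?s) (wedge (ext_mono ?G) (last_vars n k)) else 0)"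
            unfolding cartan_diff_def c_def chain_scale_apply cm wedge_scale_left by (rule sum.cong) auto
          also have "\<dots> = ext_scale (inverse ?s) (wedge (ext_mono ?G) (last_vars n k))" using k by simp
          also have "\<dots> = ext_mono F"
            unfolding last_vars_def using Fs k by (simp add: wedge_mono_mono insert_absorb)
          finally show ?thesis using True by (simp add: F(1) chain_mono_def ext_mono_apply)
        next
          case False
          have "cartan_diff m (last_vars n) c b = 0"
          proof -
            have "cartan_diff m (last_vars n) c \<in> C m 0 j" by (rule diff_in[OF c m])
            then have "cartan_diff m (last_vars n) c b F = 0" for F
              using False exponents_zero by (auto simp: cartan_chains_def)
            then show ?thesis by (auto simp: fun_eq_iff)
          qed
          then show ?thesis using False by (simp add: F(1) chain_mono_def)
        qed
        then have "chain_mono p = cartan_diff m (last_vars n) c + 0" by (simp add: fun_eq_iff)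
        then show ?thesis using BI[OF c DI(3)] by simp
      qed
    qed
    then have "(\<Sum>p\<in>?T. chain_scale (x (fst p) (snd p)) (chain_mono p)) \<in> (B m 0 j :: 'k chain set)"
      by (intro chain.subspace_sum chain.subspace_scale B_subspace)
    then show "x \<in> B m 0 j" using chain_coord_expansion[OF fin x] by simp
  qed
qed

text \<open>The quotient of \<open>E\<close> by the ideal and the last \<open>m\<close> variables has the remaining monomials as a basis.\<close>

lemma h0_card:
  assumes m: "m \<le> n"
  shows "cartan_homology_dim n m (last_vars n) (ext_coord S :: 'k::field ext set) 0 j = card {F \<in> slice (n - m) j. F \<notin> S}"
proof -
  let ?T = "{(a :: nat \<Rightarrow> nat, F). a = (\<lambda>_. 0) \<and> F \<in> slice n j \<and> (F \<in> S \<or> (\<exists>k\<in>{1..m}. n + 1 - k \<in> F))}"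
  let ?A = "{F \<in> slice n j. F \<in> S \<or> (\<exists>k\<in>{1..m}. n + 1 - k \<in> F)}"
  have fin: "finite (slice n j)" by (rule finite_subset[of _ "Pow {1..n}"]) (auto simp: slice_def)
  have T: "?T = Pair (\<lambda>_. 0) ` ?A" by auto
  have cT: "card ?T = card ?A" unfolding T by (rule card_image) (simp add: inj_on_def)
  have C: "chain_index n m 0 j = Pair (\<lambda>_. 0) ` slice n j"
    by (auto simp: chain_index_def exponents_zero slice_def)
  have cC: "card (chain_index n m 0 j) = card (slice n j)" unfolding C by (rule card_image) (simp add: inj_on_def)
  have "chain.dim (B m 0 j :: 'k chain set) = card ?A"
    unfolding B0_coord[OF m] cT[symmetric] by (rule dim_chain_coord) (use fin in \<open>simp add: T\<close>)
  moreover have "chain.dim (C m 0 j :: 'k chain set) = card (slice n j)"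
    unfolding cartan_chains_coord cC[symmetric] by (rule dim_chain_coord[OF finite_chain_index])
  moreover have "card (slice n j) = card ?A + card (slice n j - ?A)"
    using fin by (metis (no_types, lifting) card_Diff_subset card_mono finite_subset le_add_diff_inverse mem_Collect_eq subsetI)
  moreover have "slice n j - ?A = {F \<in> slice (n - m) j. F \<notin> S}"
  proof -
    have "(F \<subseteq> {1..n} \<and> (\<forall>k\<in>{1..m}. n + 1 - k \<notin> F)) \<longleftrightarrow> F \<subseteq> {1..n - m}" for F
    proof safe
      fix x assume F: "F \<subseteq> {1..n}" "\<forall>k\<in>{1..m}. n + 1 - k \<notin> F" "x \<in> F"
      have "x \<le> n - m"
      proof (rule ccontr)
        assume "\<not> x \<le> n - m"
        then have "n + 1 - x \<in> {1..m}" "n + 1 - (n + 1 - x) = x" using F m by auto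
        then show False using F by metis
      qed
      then show "x \<in> {1..n - m}" using F by auto
    next
      fix x assume F: "F \<subseteq> {1..n - m}" "x \<in> F"
      show "x \<in> {1..n}" using subsetD[OF F] by auto
    next
      fix k assume "F \<subseteq> {1..n - m}" "k \<in> {1..m}" "n + 1 - k \<in> F"
      then show False using m by fastforce
    qed
    then show ?thesis by (auto simp: slice_def)
  qed
  ultimately show ?thesis using h_eq[OF m, of 0 j, where ?'k = 'k] by (simp add: Z0)
qed

text \<open>Remove one factor \<open>x\<^sub>q\<close> of the last variable. The result has lower degree, so by induction it has a good representative,
whose lift is a good cycle; after subtracting it, the class comes from the shorter sequence. The case in which the result
has degree zero is the place where strong stability enters.\<close>

lemma good_representative:
  fixes z :: "'k::field chain"
  assumes "m \<le> n" "0 < i" "z \<in> Z m i j"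
  shows "\<exists>w x. w \<in> C m i j \<and> good w \<and> x \<in> B m i j \<and> z = w + x"
  using assms
proof (induct m arbitrary: i j z)
  case 0
  then have "z = 0" using C_zero[of 0 j i] Z_sub by blast
  then show ?case using good_zero chain.subspace_0[OF B_subspace] chain.subspace_0[OF cartan_chains_subspace] by force
next
  case (Suc k)
  let ?q = "Suc k"
  have q: "?q \<in> {1..?q}" "?q \<le> n" "k \<le> n" using Suc by auto
  note IH = Suc(1)[OF q(3)]
  show ?case using Suc(3,4)
  proof (induct i arbitrary: j z)
    case (Suc i)
    show ?case
    proof (cases j)
      case 0
      then have "z = 0" using C_zero[of ?q j "Suc i"] Z_sub Suc by blast
      then show ?thesis using good_zero chain.subspace_0[OF B_subspace] chain.subspace_0[OF cartan_chains_subspace] by force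
    next
      case j: (Suc j')
      have z: "z \<in> Z ?q (Suc i) (Suc j')" using Suc j by simp
      have lz: "lower ?q z \<in> Z ?q i j'" by (rule Z_lower[OF z q(1)])
      have "\<exists>w x. w \<in> C ?q i j' \<and> good (raise ?q w) \<and> x \<in> B ?q i j' \<and> lower ?q z = w + x"
      proof (cases "0 < i")
        case True
        then show ?thesis using Suc(1)[OF True lz] good_raise by blast
      next
        case False
        then have i: "i = 0" by simp
        define u where "u = lower ?q z"
        \<comment> \<open>modulo boundaries only the monomials without the last \<open>q\<close> variables matter\<close>
        define w :: "'k chain" where "w = (\<lambda>a F. if F \<subseteq> {1..n - ?q} then u a F else 0)"
        have uC: "u \<in> C ?q 0 j'" using lz Z_sub i u_def by blast
        then have wC: "w \<in> C ?q 0 j'" by (auto simp: cartan_chains_def w_def)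
        let ?x = "n + 1 - ?q"
        \<comment> \<open>in the differential of \<open>z\<close> the coefficient of \<open>F \<union> {x}\<close> comes from the factor \<open>x\<^sub>q\<close> alone, since the other
          forms \<open>e\<^bsub>n+1-l\<^esub>\<close> have larger indices than all elements of \<open>F \<union> {x}\<close>; as \<open>z\<close> is a cycle, \<open>F \<union> {x}\<close> lies in \<open>S\<close>\<close>
        have ins: "insert ?x F \<in> S" if F: "F \<subseteq> {1..n - ?q}" "u (\<lambda>_. 0) F \<noteq> 0" for F
        proof -
          let ?H = "insert ?x F"
          have xF: "?x \<notin> F"
          proof
            assume "?x \<in> F"
            from subsetD[OF F(1) this] q(2) show False by auto
          qed
          moreover have "finite F" using F(1) finite_subset by blast
          ultimately have xF: "?x \<notin> F" "finite F" by blast+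
          have dz: "cartan_diff ?q (last_vars n) z (\<lambda>_. 0) \<in> ext_coord S"
            using z by (simp add: cartan_cycles_def)
          have "cartan_diff ?q (last_vars n) z (\<lambda>_. 0) ?H = (\<Sum>l\<in>{1..?q}. if l = ?q then
              wedge (z ((\<lambda>_. 0)(?q := Suc 0))) (ext_mono {?x}) ?H else 0)"
            unfolding cartan_diff_def sum_fun_apply
          proof (rule sum.cong[OF refl])
            fix l assume l: "l \<in> {1..?q}"
            have "n + 1 - l \<notin> ?H" if "l \<noteq> ?q"
            proof
              assume "n + 1 - l \<in> ?H"
              moreover have "n + 1 - l > ?x" using that l q(2) by auto
              ultimately show False using F(1) by auto
            qed
            then show "wedge (z ((\<lambda>_. 0)(l := Suc 0))) (last_vars n l) ?H =
              (if l = ?q then wedge (z ((\<lambda>_. 0)(?q := Suc 0))) (ext_mono {?x}) ?H else 0)"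
              unfolding last_vars_def by (auto simp: wedge_mono_right)
          qed
          also have "\<dots> = wedge (z ((\<lambda>_. 0)(?q := Suc 0))) (ext_mono {?x}) ?H" by simp
          also have "\<dots> \<noteq> 0" using xF F(2) by (simp add: wedge_mono_right u_def lower_def)
          finally show ?thesis using dz by (simp add: ext_coord_def)
        qed
        have "good (raise ?q w)"
          unfolding good_def
        proof (intro allI impI ballI)
          fix a :: "nat \<Rightarrow> nat" and s l :: nat assume s: "0 < a s" "1 \<le> s" "\<forall>t<s. a t = 0" and l: "l \<in> {1..n + 1 - s}"
          let ?a = "a(?q := a ?q - 1)"
          show "wedge (raise ?q w a) (ext_mono {l}) \<in> ext_coord S"
          proof (cases "a ?q = 0 \<or> w ?a = 0")
            case True
            then have "raise ?q w a = 0" by (auto simp: raise_def)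
            then show ?thesis by (simp add: ext.subspace_0[OF ext_coord_subspace])
          next
            case False
            then obtain F where "w ?a F \<noteq> 0" by (auto simp: fun_eq_iff)
            then have a0: "?a = (\<lambda>_. 0)" using wC exponents_zero by (auto simp: cartan_chains_def)
            then have "a t = 0" if "t \<noteq> ?q" for t using that by (metis fun_upd_other)
            then have sq: "s = ?q" using s(1) by (metis less_irrefl)
            have "wedge (w (\<lambda>_. 0)) (ext_mono {l}) \<in> ext_coord S"
              unfolding ext_coord_def
            proof (intro CollectI allI impI)
              fix H assume "wedge (w (\<lambda>_. 0)) (ext_mono {l}) H \<noteq> 0"
              then have H: "l \<in> H" "w (\<lambda>_. 0) (H - {l}) \<noteq> 0" by (auto simp: wedge_mono_right split: if_splits)
              define F where "F = H - {l}"
              have F: "F \<subseteq> {1..n - ?q}" "u (\<lambda>_. 0) F \<noteq> 0" using H by (auto simp: F_def w_def split: if_splits)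
              have HF: "H = insert l F" "l \<notin> F" using H by (auto simp: F_def)
              have xS: "insert ?x F \<in> S" by (rule ins[OF F])
              have xF: "?x \<notin> F"
              proof
                assume "?x \<in> F"
                from subsetD[OF F(1) this] q(2) show False by auto
              qed
              show "H \<in> S"
              proof (cases "l = ?x")
                case True
                then show ?thesis using xS HF by simp
              next
                case False
                \<comment> \<open>exchanging \<open>x\<close> for the smaller \<open>l\<close> stays in \<open>S\<close>\<close>
                then have "1 \<le> l" "l < ?x" "l \<notin> insert ?x F" using l sq HF by auto
                then have "insert l (insert ?x F - {?x}) \<in> S" using S(2) xS unfolding shifted_def by blast
                then show ?thesis using HF xF by simp
              qed
            qed
            then show ?thesis using False a0 by (simp add: raise_def)
          qed
        qed
        moreover have "u - w \<in> B ?q 0 j'"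
          unfolding B0_coord[OF q(2)] chain_coord_def
        proof (rule CollectI, intro allI impI)
          fix a F assume "(u - w) a F \<noteq> 0"
          then have "u a F \<noteq> w a F" by simp
          then have "u a F \<noteq> 0" "\<not> F \<subseteq> {1..n - ?q}" by (auto simp: w_def split: if_splits)
          then have a: "a = (\<lambda>_. 0)" "F \<subseteq> {1..n}" "card F = j'" using uC exponents_zero by (auto simp: cartan_chains_def)
          obtain x where x: "x \<in> F" "x \<notin> {1..n - ?q}" using \<open>\<not> F \<subseteq> {1..n - ?q}\<close> by blast
          then have "n + 1 - x \<in> {1..?q}" "n + 1 - (n + 1 - x) = x" using a(2) q(2) by (auto simp: not_le)
          then have "\<exists>k\<in>{1..?q}. n + 1 - k \<in> F" using x by metis
          moreover have "F \<in> slice n j'" using a by (simp add: slice_def)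
          ultimately show "(a, F) \<in> {(a, F). a = (\<lambda>_. 0) \<and> F \<in> slice n j' \<and> (F \<in> S \<or> (\<exists>k\<in>{1..?q}. n + 1 - k \<in> F))}"
            using a(1) by blast
        qed
        ultimately show ?thesis using wC unfolding i u_def[symmetric]
          by (intro exI[of _ w] exI[of _ "u - w"]) simp
      qed
      then obtain w x where w: "w \<in> C ?q i j'" "good (raise ?q w)" and x: "x \<in> B ?q i j'" "lower ?q z = w + x" by blast
      obtain y e where ye: "x = cartan_diff ?q (last_vars n) y + e" "y \<in> C ?q (Suc i) j'" "e \<in> D ?q i j'" using x(1) by (rule BE)
      define X where "X = cartan_diff ?q (last_vars n) (raise ?q y) + raise ?q e"
      have X: "X \<in> B ?q (Suc i) (Suc j')" unfolding X_def using ye q by (intro BI raise_in D_raise)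
      have rw: "raise ?q w \<in> C ?q (Suc i) (Suc j')" by (rule raise_in[OF w(1) q(1)])
      have "raise ?q w \<in> Z ?q (Suc i) (Suc j')" using good_cycle[OF rw w(2) q(2)] rw by (simp add: cartan_cycles_def)
      then have "z - raise ?q w - X \<in> Z ?q (Suc i) (Suc j')"
        using z X B_sub_Z[OF q(2)] by (intro chain.subspace_diff[OF Z_subspace]) auto
      moreover have "lower ?q (z - raise ?q w - X) = 0"
        by (simp add: lower_simps X_def diff_lower[symmetric] x(2) ye(1))
      ultimately have "z - raise ?q w - X \<in> Z k (Suc i) (Suc j')" using Z_kernel[of k "Suc i" "Suc j'"] by blast
      then obtain w' x' where w': "w' \<in> C k (Suc i) (Suc j')" "good w'" "x' \<in> B k (Suc i) (Suc j')"
        "z - raise ?q w - X = w' + x'" using IH[OF zero_less_Suc] by blast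
      have "z = (raise ?q w + w') + (X + x')" using w'(4) by (simp add: algebra_simps)
      moreover have "raise ?q w + w' \<in> C ?q (Suc i) (Suc j')" using rw w'(1) C_mono CI(1) by blast
      moreover have "X + x' \<in> B ?q (Suc i) (Suc j')"
        using X w'(3) B_mono chain.subspace_add[OF B_subspace] by blast
      ultimately show ?thesis using good_add[OF w(2) w'(2)] j by blast
    qed
  qed simp
qed

text \<open>Surjectivity of \<open>H\<^bsub>i+1\<^esub>(k+1) \<rightarrow> H\<^sub>i(k+1)\<close> for positive \<open>i\<close>: a good representative lifts to a good chain, which is again
a cycle.\<close>

lemma lower_cycles_all:
  assumes k: "Suc k \<le> n" "0 < i"
  shows "(lower_cycles (Suc k) i j :: 'k::field chain set) = Z (Suc k) i j"
proof
  let ?q = "Suc k"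
  have q: "?q \<in> {1..?q}" by simp
  show "(lower_cycles (Suc k) i j :: 'k chain set) \<subseteq> Z (Suc k) i j" by (rule lower_cycles_sub[OF k(1)])
  show "(Z (Suc k) i j :: 'k chain set) \<subseteq> lower_cycles (Suc k) i j"
  proof
    fix z :: "'k chain" assume "z \<in> Z ?q i j"
    then obtain w x where w: "w \<in> C ?q i j" "good w" "x \<in> B ?q i j" "z = w + x"
      using good_representative[OF k] by blast
    have rw: "raise ?q w \<in> C ?q (Suc i) (Suc j)" by (rule raise_in[OF w(1) q])
    have "raise ?q w \<in> Z ?q (Suc i) (Suc j)"
      using good_cycle[OF rw good_raise[OF w(1,2) k(2)] k(1)] rw by (simp add: cartan_cycles_def)
    moreover have "z = lower ?q (raise ?q w) + x" using w(4) by simp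
    ultimately show "z \<in> lower_cycles ?q i j" unfolding lower_cycles_def using w(3) by blast
  qed
qed

text \<open>Injectivity of \<open>H\<^bsub>i+1\<^esub>(k) \<rightarrow> H\<^bsub>i+1\<^esub>(k+1)\<close>. If \<open>x\<close> is bounded by \<open>y\<close> in the longer complex, then \<open>lower y\<close> is a cycle,
and subtracting from \<open>y\<close> the lift of a good representative of \<open>lower y\<close> changes the boundary only by elements with
coefficients in the ideal and removes the last variable from \<open>y\<close>.\<close>

lemma Z_Int_B:
  assumes k: "Suc k \<le> n"
  shows "Z k (Suc i) (Suc j) \<inter> B (Suc k) (Suc i) (Suc j) = (B k (Suc i) (Suc j) :: 'k::field chain set)"
proof
  let ?q = "Suc k" and ?d = "cartan_diff (Suc k) (last_vars n)"
  have q: "?q \<in> {1..?q}" by simp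
  show "(B k (Suc i) (Suc j) :: 'k chain set) \<subseteq> Z k (Suc i) (Suc j) \<inter> B (Suc k) (Suc i) (Suc j)"
    by (rule B_Suc_Int) (use k in simp)
  show "Z k (Suc i) (Suc j) \<inter> B (Suc k) (Suc i) (Suc j) \<subseteq> (B k (Suc i) (Suc j) :: 'k chain set)"
  proof
    fix x :: "'k chain" assume x: "x \<in> Z k (Suc i) (Suc j) \<inter> B ?q (Suc i) (Suc j)"
    then obtain y e where ye: "x = ?d y + e" "y \<in> C ?q (Suc (Suc i)) (Suc j)" "e \<in> D ?q (Suc i) (Suc j)"
      using BE by blast
    have xk: "x \<in> C k (Suc i) (Suc j)" using x Z_sub by blast
    have lx: "lower ?q x = 0" using x Z_kernel[of k "Suc i" "Suc j"] by blast
    have ly: "lower ?q y \<in> C ?q (Suc i) j" by (rule lower_in[OF ye(2) q])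
    have "?d (lower ?q y) = - lower ?q e"
      using lx by (simp add: ye(1) lower_simps diff_lower eq_neg_iff_add_eq_0)
    moreover have le: "lower ?q e \<in> D ?q i j" by (rule D_lower[OF ye(3) q])
    ultimately have "?d (lower ?q y) b \<in> ext_coord S" for b
      using J_simps(5)[of "lower ?q e b"] le by (simp add: ideal_chains_def)
    then have "lower ?q y \<in> Z ?q (Suc i) j" using ly by (simp add: cartan_cycles_def)
    then obtain w t where w: "w \<in> C ?q (Suc i) j" "good w" and t: "t \<in> B ?q (Suc i) j" "lower ?q y = w + t"
      using good_representative[OF k zero_less_Suc] by blast
    obtain s f where sf: "t = ?d s + f" "s \<in> C ?q (Suc (Suc i)) j" "f \<in> D ?q (Suc i) j" using t(1) by (rule BE)
    have rw: "raise ?q w \<in> C ?q (Suc (Suc i)) (Suc j)" by (rule raise_in[OF w(1) q])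
    define p where "p = y - raise ?q w - ?d (raise ?q s) - raise ?q f"
    have rf: "raise ?q f \<in> D ?q (Suc (Suc i)) (Suc j)" by (rule D_raise[OF sf(3) q])
    have "p \<in> C ?q (Suc (Suc i)) (Suc j)" unfolding p_def
      using ye(2) rw diff_in[OF raise_in[OF sf(2) q] k] rf D_sub by (intro CI(2)) auto
    moreover have "lower ?q p = 0"
      by (simp add: p_def lower_simps diff_lower[symmetric] t(2) sf(1))
    ultimately have p: "p \<in> C k (Suc (Suc i)) (Suc j)" by (rule chains_SucI)
    have eq: "x - ?d p = ?d (raise ?q w) + ?d (raise ?q f) + e"
      by (simp add: p_def diff_simps ye(1) diff_diff[OF k] algebra_simps)
    have "x - ?d p \<in> D k (Suc i) (Suc j)"
    proof -
      have "?d p \<in> C k (Suc i) (Suc j)"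
        unfolding diff_Suc[OF p] using k by (intro diff_in[OF p]) auto
      then have "x - ?d p \<in> C k (Suc i) (Suc j)" using xk CI(2) by blast
      moreover have "(x - ?d p) a \<in> ext_coord S" for a
      proof -
        have "?d (raise ?q w) a \<in> ext_coord S"
          by (rule good_cycle[OF rw good_raise[OF w(1,2)] k]) simp
        moreover have "?d (raise ?q f) a \<in> ext_coord S"
          by (rule diff_ideal[OF _ k]) (use rf in \<open>simp add: ideal_chains_def\<close>)
        moreover have "e a \<in> ext_coord S" using ye(3) by (simp add: ideal_chains_def)
        ultimately show ?thesis unfolding eq plus_fun_apply[of _ _ a] by (intro J_simps(2))
      qed
      ultimately show ?thesis by (simp add: ideal_chains_def)
    qed
    then have "cartan_diff k (last_vars n) p + (x - ?d p) \<in> B k (Suc i) (Suc j)" using p by (intro BI)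
    then show "x \<in> B k (Suc i) (Suc j)" using diff_Suc[OF p] by simp
  qed
qed

lemma homology_step_eq:
  assumes k: "Suc k \<le> n" "0 < i"
  shows "cartan_homology_dim n (Suc k) (last_vars n) (ext_coord S :: 'k::field ext set) (Suc i) (Suc j)
     = cartan_homology_dim n k (last_vars n) (ext_coord S :: 'k ext set) (Suc i) (Suc j)
      + cartan_homology_dim n (Suc k) (last_vars n) (ext_coord S :: 'k ext set) i j"
  using long_exact_dim[OF k(1), of i j, where ?'k = 'k] h_eq[OF k(1), of i j, where ?'k = 'k]
    h_eq[of k "Suc i" "Suc j", where ?'k = 'k] k
  unfolding lower_cycles_all[OF k] Z_Int_B[OF k(1)] by linarith

lemma homology_one_eq:
  assumes k: "Suc k \<le> n"
  shows "cartan_homology_dim n (Suc k) (last_vars n) (ext_coord S :: 'k::field ext set) 1 (Suc j)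
      + cartan_homology_dim n k (last_vars n) (ext_coord S :: 'k ext set) 0 (Suc j)
     = cartan_homology_dim n k (last_vars n) (ext_coord S :: 'k ext set) 1 (Suc j)
      + cartan_homology_dim n (Suc k) (last_vars n) (ext_coord S :: 'k ext set) 0 j
      + cartan_homology_dim n (Suc k) (last_vars n) (ext_coord S :: 'k ext set) 0 (Suc j)"
  using homology_one_dim[OF k, of j, where ?'k = 'k] h_eq[of k 1 "Suc j", where ?'k = 'k] k
    Z_Int_B[OF k, of 0 j, where ?'k = 'k] by simp

lemma h_one_eq:
  assumes "k \<le> n"
  shows "cartan_homology_dim n k (last_vars n) (ext_coord S :: 'k::field ext set) 1 (Suc j)
      + cartan_homology_dim n 0 (last_vars n) (ext_coord S :: 'k ext set) 0 (Suc j)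
     = cartan_homology_dim n k (last_vars n) (ext_coord S :: 'k ext set) 0 (Suc j)
      + (\<Sum>s\<in>{1..k}. cartan_homology_dim n s (last_vars n) (ext_coord S :: 'k ext set) 0 j)"
  using assms
proof (induct k)
  case 0
  then show ?case using h_zero[of 0 "Suc j" 1, where ?'k = 'k] by simp
next
  case (Suc k)
  then show ?case using homology_one_eq[OF Suc(2), of j, where ?'k = 'k] by simp
qed

text \<open>The induction runs over the homological degree and, within it, over the length of the sequence; both sides satisfy
the same recursion, with an inequality for \<open>J\<close> and an equality for the strongly stable ideal.\<close>

theorem homology_comparison:
  fixes J :: "'k::field ext set"
  assumes J: "lin_seq n n v J"
    and zero: "\<And>k j. 1 \<le> k \<Longrightarrow> k \<le> n \<Longrightarrow> cartan_homology_dim n k v J 0 j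
        \<le> cartan_homology_dim n k (last_vars n) (ext_coord S :: 'k ext set) 0 j"
    and hilb: "\<And>j. cartan_homology_dim n 0 v J 0 j = cartan_homology_dim n 0 (last_vars n) (ext_coord S :: 'k ext set) 0 j"
    and k: "k \<le> n"
  shows "cartan_homology_dim n k v J i j \<le> cartan_homology_dim n k (last_vars n) (ext_coord S :: 'k ext set) i j"
proof -
  interpret J: lin_seq n n v J by (rule J)
  let ?h = "\<lambda>k i j. cartan_homology_dim n k (last_vars n) (ext_coord S :: 'k ext set) i j"
  have one: "J.h k 1 j \<le> ?h k 1 j" if k: "k \<le> n" for k j
  proof (cases j)
    case 0
    then show ?thesis using J.h_zero[of k j 1] k by simp
  next
    case (Suc j')
    have "(\<Sum>s\<in>{1..k}. J.h s 0 j') \<le> (\<Sum>s\<in>{1..k}. ?h s 0 j')" using k by (intro sum_mono zero) auto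
    moreover have "J.h k 0 (Suc j') \<le> ?h k 0 (Suc j')" using zero[of k "Suc j'"] hilb[of "Suc j'"] k by (cases k) auto
    ultimately show ?thesis unfolding Suc
      using J.h_one_bound[OF k, of j'] h_one_eq[OF k, of j', where ?'k = 'k] hilb[of "Suc j'"] by linarith
  qed
  have "J.h k (Suc i) j \<le> ?h k (Suc i) j" if "k \<le> n" for k i j
    using that
  proof (induct i arbitrary: k j)
    case 0
    then show ?case using one by simp
  next
    case (Suc i)
    show ?case using Suc(2)
    proof (induct k arbitrary: j)
      case 0
      then show ?case using J.h_zero[of 0 j "Suc (Suc i)"] by simp
    next
      case (Suc k)
      show ?case
      proof (cases j)
        case 0
        then show ?thesis using J.h_zero[of "Suc k" j "Suc (Suc i)"] Suc by simp
      next
        case j: (Suc j')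
        have "J.h (Suc k) (Suc (Suc i)) (Suc j') \<le> J.h k (Suc (Suc i)) (Suc j') + J.h (Suc k) (Suc i) j'"
          using Suc by (intro J.homology_step_le) simp
        also have "\<dots> \<le> ?h k (Suc (Suc i)) (Suc j') + ?h (Suc k) (Suc i) j'"
          using Suc.hyps Suc.prems \<open>\<And>k j. k \<le> n \<Longrightarrow> J.h k (Suc i) j \<le> ?h k (Suc i) j\<close> by (intro add_mono) auto
        also have "\<dots> = ?h (Suc k) (Suc (Suc i)) (Suc j')"
          using Suc by (intro homology_step_eq[symmetric]) auto
        finally show ?thesis using j by simp
      qed
    qed
  qed
  then show ?thesis using zero[of k j] hilb[of j] k by (cases i; cases k) auto
qed

end

section \<open>Generic matrices\<close>

lemma poly_fun_sum:
  assumes "\<And>x. x \<in> S \<Longrightarrow> poly_fun p n (f x)"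
  shows "poly_fun p n (\<lambda>A. \<Sum>x\<in>S. f x A)"
  using assms
proof (induct S rule: infinite_finite_induct)
  case (insert x F)
  then have "poly_fun p n (\<lambda>A. f x A + (\<Sum>x\<in>F. f x A))" by (intro poly_fun.add) auto
  then show ?case using insert(1,2) by simp
qed (simp_all add: poly_fun.const)

lemma poly_fun_prod:
  assumes "\<And>x. x \<in> S \<Longrightarrow> poly_fun p n (f x)"
  shows "poly_fun p n (\<lambda>A. \<Prod>x\<in>S. f x A)"
  using assms
proof (induct S rule: infinite_finite_induct)
  case (insert x F)
  then have "poly_fun p n (\<lambda>A. f x A * (\<Prod>x\<in>F. f x A))" by (intro poly_fun.mult) auto
  then show ?case using insert(1,2) by simp
qed (simp_all add: poly_fun.const)

lemma poly_fun_diff: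
  assumes "poly_fun p n f" "poly_fun p n g"
  shows "poly_fun p n (\<lambda>A. f A - g A)"
proof -
  have "poly_fun p n (\<lambda>A. f A + (- 1) * g A)" using assms by (intro poly_fun.add poly_fun.mult poly_fun.const)
  then show ?thesis by simp
qed

definition mat_line :: "nat \<Rightarrow> nat \<Rightarrow> 'k::field mat \<Rightarrow> 'k mat \<Rightarrow> 'k \<Rightarrow> 'k mat" where
  "mat_line p n A B t = mat p n (\<lambda>(i, j). A $$ (i, j) + t * (B $$ (i, j) - A $$ (i, j)))"

lemma mat_line_carrier [simp]: "mat_line p n A B t \<in> carrier_mat p n"
  by (simp add: mat_line_def)

lemma mat_line_ends:
  assumes "A \<in> carrier_mat p n" "B \<in> carrier_mat p n"
  shows "mat_line p n A B 0 = A" "mat_line p n A B 1 = B"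
  using assms by (auto simp: mat_line_def)

lemma poly_fun_line:
  assumes "poly_fun p n f"
  shows "\<exists>q. \<forall>t. poly q t = f (mat_line p n A B t)"
  using assms
proof induct
  case (const r)
  show ?case by (rule exI[of _ "[:r:]"]) simp
next
  case (entry k l)
  then show ?case
    by (intro exI[of _ "[:A $$ (k, l), B $$ (k, l) - A $$ (k, l):]"]) (simp add: mat_line_def mult.commute)
next
  case (add f g)
  then obtain q q' where "\<forall>t. poly q t = f (mat_line p n A B t)" "\<forall>t. poly q' t = g (mat_line p n A B t)" by blast
  then show ?case by (intro exI[of _ "q + q'"]) simp
next
  case (mult f g)
  then obtain q q' where "\<forall>t. poly q t = f (mat_line p n A B t)" "\<forall>t. poly q' t = g (mat_line p n A B t)" by blast
  then show ?case by (intro exI[of _ "q * q'"]) simp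
qed

text \<open>A line through a point of a principal open set leaves the set in only finitely many points, the zeros of a nonzero
polynomial in one variable.\<close>

lemma poly_fun_line_nonzero:
  fixes A B :: "'k::field mat"
  assumes "infinite (UNIV :: 'k set)" "poly_fun p n f" "A \<in> carrier_mat p n" "f A \<noteq> 0"
  shows "finite {t. f (mat_line p n A B t) = 0}"
proof -
  obtain q where q: "\<forall>t. poly q t = f (mat_line p n A B t)" using poly_fun_line[OF assms(2)] by blast
  have "mat_line p n A B 0 = A" using assms(3) by (auto simp: mat_line_def)
  then have "poly q 0 \<noteq> 0" using q assms by simp
  then have "q \<noteq> 0" by auto
  then show ?thesis using poly_roots_finite[of q] q by simp
qed

text \<open>A property holds generically if it holds on a nonempty principal open set. These sets form a basis of the Zariski
topology, and a single polynomial is easier to combine than a family of them.\<close>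

definition for_generic :: "nat \<Rightarrow> nat \<Rightarrow> ('k::field mat \<Rightarrow> bool) \<Rightarrow> bool" where
  "for_generic p n P \<longleftrightarrow> (\<exists>f. poly_fun p n f \<and> (\<exists>A\<in>carrier_mat p n. f A \<noteq> 0) \<and>
     (\<forall>A\<in>carrier_mat p n. f A \<noteq> 0 \<longrightarrow> P A))"

lemma for_generic_mono: 
  "for_generic p n P \<Longrightarrow> (\<And>A. A \<in> carrier_mat p n \<Longrightarrow> P A \<Longrightarrow> Q A) \<Longrightarrow> for_generic p n Q"
  unfolding for_generic_def by meson

lemma for_generic_ex: "for_generic p n P \<Longrightarrow> \<exists>A\<in>carrier_mat p n. P A"
  unfolding for_generic_def by blast

lemma for_generic_all: "(\<And>A. A \<in> carrier_mat p n \<Longrightarrow> P A) \<Longrightarrow> for_generic p n P"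
  unfolding for_generic_def using poly_fun.const[of p n 1] zero_carrier_mat[of p n]
  by (intro exI[of _ "\<lambda>_. 1"]) auto

text \<open>Non-empty Zariski open sets meet since a line through points of both meets them in cofinitely
  many points.\<close>

lemma for_generic_conj:
  fixes P Q :: "'k::field mat \<Rightarrow> bool"
  assumes inf: "infinite (UNIV :: 'k set)" and "for_generic p n P" "for_generic p n Q"
  shows "for_generic p n (\<lambda>A. P A \<and> Q A)"
proof -
  obtain f A where f: "poly_fun p n f" "A \<in> carrier_mat p n" "f A \<noteq> 0" "\<And>X. X \<in> carrier_mat p n \<Longrightarrow> f X \<noteq> 0 \<Longrightarrow> P X"
    using assms(2) unfolding for_generic_def by blast
  obtain g B where g: "poly_fun p n g" "B \<in> carrier_mat p n" "g B \<noteq> 0" "\<And>X. X \<in> carrier_mat p n \<Longrightarrow> g X \<noteq> 0 \<Longrightarrow> Q X"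
    using assms(3) unfolding for_generic_def by blast
  obtain q where q: "\<forall>t. poly q t = f (mat_line p n A B t)" using poly_fun_line[OF f(1)] by blast
  obtain r where r: "\<forall>t. poly r t = g (mat_line p n A B t)" using poly_fun_line[OF g(1)] by blast
  have "poly q 0 \<noteq> 0" "poly r 1 \<noteq> 0" using q r f g mat_line_ends[OF f(2) g(2)] by simp_all
  then have "q * r \<noteq> 0" by auto
  then have "finite {t. poly (q * r) t = 0}" by (rule poly_roots_finite)
  then obtain t where "poly (q * r) t \<noteq> 0" using inf ex_new_if_finite by blast
  then have "f (mat_line p n A B t) * g (mat_line p n A B t) \<noteq> 0" using q r by simp
  then show ?thesis unfolding for_generic_def
    using f(4) g(4) by (intro exI[of _ "\<lambda>A. f A * g A"] conjI poly_fun.mult[OF f(1) g(1)]) auto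
qed

lemma for_generic_finite:
  fixes P :: "'i \<Rightarrow> 'k::field mat \<Rightarrow> bool"
  assumes inf: "infinite (UNIV :: 'k set)" and "finite S" "\<And>i. i \<in> S \<Longrightarrow> for_generic p n (P i)"
  shows "for_generic p n (\<lambda>A. \<forall>i\<in>S. P i A)"
  using assms(2,3)
proof (induct S)
  case empty
  show ?case by (rule for_generic_all) simp
next
  case (insert x F)
  then have "for_generic p n (\<lambda>A. P x A \<and> (\<forall>i\<in>F. P i A))" by (intro for_generic_conj[OF inf]) auto
  then show ?case by simp
qed

lemma zariski_open_generic:
  assumes "zariski_open p n U" "U \<noteq> {}"
  shows "for_generic p n (\<lambda>A. A \<in> U)"
  using assms unfolding zariski_open_def for_generic_def by blast

lemma generic_zariski_open:
  assumes "for_generic p n P"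
  obtains U where "zariski_open p n U" "U \<noteq> {}" "U \<subseteq> carrier_mat p n" "\<And>A. A \<in> U \<Longrightarrow> P A"
proof -
  obtain f A where f: "poly_fun p n f" "A \<in> carrier_mat p n" "f A \<noteq> 0" "\<And>X. X \<in> carrier_mat p n \<Longrightarrow> f X \<noteq> 0 \<Longrightarrow> P X"
    using assms unfolding for_generic_def by blast
  show thesis
    by (rule that[of "{A \<in> carrier_mat p n. f A \<noteq> 0}"])
      (use f in \<open>auto simp: zariski_open_def intro: exI[of _ "{f}"]\<close>)
qed

definition trunc_mat :: "nat \<Rightarrow> nat \<Rightarrow> 'k mat \<Rightarrow> 'k mat" where
  "trunc_mat k n A = mat k n (\<lambda>(i, j). A $$ (i, j))"

lemma for_generic_trunc:
  assumes "for_generic k n P" "k \<le> p"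
  shows "for_generic p n (\<lambda>A. P (trunc_mat k n A))"
proof -
  obtain f B where f: "poly_fun k n f" "B \<in> carrier_mat k n" "f B \<noteq> 0" "\<And>X. X \<in> carrier_mat k n \<Longrightarrow> f X \<noteq> 0 \<Longrightarrow> P X"
    using assms unfolding for_generic_def by blast
  have "poly_fun p n (\<lambda>A. f (trunc_mat k n A))"
    using f(1)
  proof induct
    case (entry i l)
    then have "poly_fun p n (\<lambda>A. A $$ (i, l))" using assms(2) by (intro poly_fun.entry) auto
    then show ?case using entry by (simp add: trunc_mat_def)
  qed (auto intro: poly_fun.intros)
  moreover define X where "X = mat p n (\<lambda>(i, j). if i < k then B $$ (i, j) else 0)"
  have "trunc_mat k n X = B" using f(2) assms(2) by (auto simp: trunc_mat_def X_def)
  then have "f (trunc_mat k n X) \<noteq> 0" using f by simp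
  moreover have "X \<in> carrier_mat p n" by (simp add: X_def)
  moreover have "trunc_mat k n A \<in> carrier_mat k n" for A :: "'a mat" by (simp add: trunc_mat_def)
  ultimately show ?thesis unfolding for_generic_def using f(4) by blast
qed

section \<open>Semicontinuity of ranks\<close>

context vector_space
begin

text \<open>Linear independence is an open condition. Gaussian elimination without divisions keeps all coordinates polynomial: the
last vector is used to clear one coordinate, in which it does not vanish at \<open>A0\<close>, from the others, and the pivots are
multiplied up to the polynomial \<open>f\<close>.\<close>

lemma independent_family_open:
  fixes vs :: "nat \<Rightarrow> 'a mat \<Rightarrow> 'b" and co :: "'s \<Rightarrow> 'b \<Rightarrow> 'a"
  assumes lin: "\<And>s x y. co s (x + y) = co s x + co s y" "\<And>s r x. co s (scale r x) = r * co s x"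
    and sep: "\<And>x. (\<And>s. co s x = 0) \<Longrightarrow> x = 0"
    and "\<And>i s. i < r \<Longrightarrow> poly_fun p n (\<lambda>A. co s (vs i A))"
    and "\<And>c. (\<Sum>i<r. scale (c i) (vs i A0)) = 0 \<Longrightarrow> \<forall>i<r. c i = 0"
  shows "\<exists>f. poly_fun p n f \<and> f A0 \<noteq> 0 \<and>
    (\<forall>A c. f A \<noteq> 0 \<longrightarrow> (\<Sum>i<r. scale (c i) (vs i A)) = 0 \<longrightarrow> (\<forall>i<r. c i = 0))"
  using assms(4,5)
proof (induct r arbitrary: vs)
  case 0
  show ?case by (rule exI[of _ "\<lambda>_. 1"]) (simp add: poly_fun.const)
next
  case (Suc r)
  have co0: "co s 0 = 0" for s using lin(2)[of s 0 0] by simp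
  have codiff: "co s (x - y) = co s x - co s y" for s x y
    using lin(1)[of s "x - y" y] by simp
  have cosum: "co s (\<Sum>i\<in>I. g i) = (\<Sum>i\<in>I. co s (g i))" for s I and g :: "nat \<Rightarrow> 'b"
    using sum_comp_morphism[of "co s" g I] lin co0 by (simp add: o_def)
  have "vs r A0 \<noteq> 0"
  proof
    assume "vs r A0 = 0"
    then have "(\<Sum>i<Suc r. scale (if i = r then 1 else 0) (vs i A0)) = 0" by simp
    then have "\<forall>i<Suc r. (if i = r then 1 else 0 :: 'a) = 0" by (rule Suc(3))
    then show False by (metis lessI one_neq_zero)
  qed
  then obtain s where s: "co s (vs r A0) \<noteq> 0" using sep by blast
  define w where "w i A = scale (co s (vs r A)) (vs i A) - scale (co s (vs i A)) (vs r A)" for i A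
  have sumw: "(\<Sum>i<r. scale (c i) (w i A)) = scale (co s (vs r A)) (\<Sum>i<r. scale (c i) (vs i A))
      - scale (\<Sum>i<r. c i * co s (vs i A)) (vs r A)" for c A
    unfolding w_def scale_right_diff_distrib sum_subtractf scale_scale scale_sum_right scale_sum_left
    by (simp add: mult.commute)
  have "poly_fun p n (\<lambda>A. co s' (w i A))" if "i < r" for i s'
    unfolding w_def codiff lin using that by (intro poly_fun_diff poly_fun.mult Suc(2)) auto
  moreover have "\<forall>i<r. c i = 0" if c: "(\<Sum>i<r. scale (c i) (w i A0)) = 0" for c
  proof -
    define c' where "c' i = (if i = r then - (\<Sum>i<r. c i * co s (vs i A0)) else co s (vs r A0) * c i)" for i
    have "(\<Sum>i<Suc r. scale (c' i) (vs i A0)) = (\<Sum>i<r. scale (co s (vs r A0) * c i) (vs i A0)) 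
        - scale (\<Sum>i<r. c i * co s (vs i A0)) (vs r A0)"
      unfolding sum.lessThan_Suc by (simp add: c'_def)
    also have "\<dots> = 0" using c unfolding sumw scale_sum_right scale_scale .
    finally have "\<forall>i<Suc r. c' i = 0" by (rule Suc(3))
    then have c0: "c' i = 0" if "i < r" for i using that by simp
    have "co s (vs r A0) * c i = 0" if "i < r" for i using c0[OF that] that by (simp add: c'_def)
    then show ?thesis using s by simp
  qed
  ultimately obtain f where f: "poly_fun p n f" "f A0 \<noteq> 0"
    "\<And>A c. f A \<noteq> 0 \<Longrightarrow> (\<Sum>i<r. scale (c i) (w i A)) = 0 \<Longrightarrow> \<forall>i<r. c i = 0"
    using Suc(1)[of w] by blast
  show ?case
  proof (intro exI[of _ "\<lambda>A. f A * co s (vs r A)"] conjI allI impI)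
    show "poly_fun p n (\<lambda>A. f A * co s (vs r A))" using f(1) Suc(2) by (intro poly_fun.mult) auto
    show "f A0 * co s (vs r A0) \<noteq> 0" using f(2) s by simp
    fix A c i assume A: "f A * co s (vs r A) \<noteq> 0" and c: "(\<Sum>i<Suc r. scale (c i) (vs i A)) = 0" and i: "i < Suc r"
    have e1: "(\<Sum>i<r. scale (c i) (vs i A)) = - scale (c r) (vs r A)"
      using c by (simp add: eq_neg_iff_add_eq_0)
    then have "co s (\<Sum>i<r. scale (c i) (vs i A)) = co s (scale (- c r) (vs r A))" by simp
    then have e2: "(\<Sum>i<r. c i * co s (vs i A)) = - c r * co s (vs r A)" by (simp only: cosum lin)
    have "(\<Sum>i<r. scale (c i) (w i A)) = 0" unfolding sumw e1 e2 by (simp add: mult.commute)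
    then have z: "\<forall>i<r. c i = 0" using f(3)[of A c] A by simp
    then have "scale (c r) (vs r A) = 0" using c by simp
    moreover have "vs r A \<noteq> 0" using A co0 by auto
    ultimately show "c i = 0" using z i by (auto simp: less_Suc_eq)
  qed
qed

lemma dim_open:
  fixes g :: "'i \<Rightarrow> 'a mat \<Rightarrow> 'b" and co :: "'s \<Rightarrow> 'b \<Rightarrow> 'a"
  assumes lin: "\<And>s x y. co s (x + y) = co s x + co s y" "\<And>s r x. co s (scale r x) = r * co s x"
    and sep: "\<And>x. (\<And>s. co s x = 0) \<Longrightarrow> x = 0"
    and I: "finite I" and poly: "\<And>i s. i \<in> I \<Longrightarrow> poly_fun p n (\<lambda>A. co s (g i A))"
  shows "\<exists>f. poly_fun p n f \<and> f A0 \<noteq> 0 \<and>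
    (\<forall>A. f A \<noteq> 0 \<longrightarrow> dim (span ((\<lambda>i. g i A0) ` I)) \<le> dim (span ((\<lambda>i. g i A) ` I)))"
proof -
  define r where "r = dim ((\<lambda>i. g i A0) ` I)"
  obtain B where B: "B \<subseteq> (\<lambda>i. g i A0) ` I" "independent B" "card B = r"
    using basis_exists[of "(\<lambda>i. g i A0) ` I"] r_def by metis
  have finB: "finite B" using B I finite_surj by blast
  obtain b where b: "bij_betw b {..<r} B"
    using ex_bij_betw_nat_finite[OF finB] B(3) by (auto simp: atLeast0LessThan)
  have "\<exists>i\<in>I. g i A0 = b k" if "k < r" for k
  proof -
    have "b k \<in> B" using b that by (auto simp: bij_betw_def)
    then show ?thesis using B(1) by force
  qed
  then obtain ix where ix: "\<And>k. k < r \<Longrightarrow> ix k \<in> I \<and> g (ix k) A0 = b k" by metis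
  have "\<exists>f. poly_fun p n f \<and> f A0 \<noteq> 0 \<and>
    (\<forall>A c. f A \<noteq> 0 \<longrightarrow> (\<Sum>i<r. scale (c i) (g (ix i) A)) = 0 \<longrightarrow> (\<forall>i<r. c i = 0))"
  proof (rule independent_family_open[OF lin sep, where vs = "\<lambda>k. g (ix k)"])
    show "poly_fun p n (\<lambda>A. co s (g (ix i) A))" if "i < r" for i s using poly ix that by blast
    fix c :: "nat \<Rightarrow> 'a" assume c: "(\<Sum>i<r. scale (c i) (g (ix i) A0)) = 0"
    have "(\<Sum>v\<in>B. scale (c (inv_into {..<r} b v)) v) = (\<Sum>i<r. scale (c (inv_into {..<r} b (b i))) (b i))"
      using b by (intro sum.reindex_bij_betw[symmetric])
    also have "\<dots> = (\<Sum>i<r. scale (c i) (g (ix i) A0))"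
      using b ix by (intro sum.cong) (auto simp: bij_betw_def inv_into_f_f)
    finally have "(\<Sum>v\<in>B. scale (c (inv_into {..<r} b v)) v) = 0" using c by simp
    then have cB: "c (inv_into {..<r} b v) = 0" if "v \<in> B" for v 
      using independent_sum_zero[OF B(2) finB, of "\<lambda>v. c (inv_into {..<r} b v)"] that by blast
    show "\<forall>i<r. c i = 0"
    proof (intro allI impI)
      fix i assume i: "i < r"
      have inj: "inj_on b {..<r}" and "b i \<in> B" using b i by (auto simp: bij_betw_def)
      then show "c i = 0" using cB[of "b i"] i by (simp add: inv_into_f_f)
    qed
  qed
  then obtain f where f: "poly_fun p n f" "f A0 \<noteq> 0"
    "\<And>A c. f A \<noteq> 0 \<Longrightarrow> (\<Sum>i<r. scale (c i) (g (ix i) A)) = 0 \<Longrightarrow> \<forall>i<r. c i = 0" by blast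
  have "r \<le> dim (span ((\<lambda>i. g i A) ` I))" if A: "f A \<noteq> 0" for A
  proof -
    let ?v = "\<lambda>k. g (ix k) A"
    have inj: "inj_on ?v {..<r}"
    proof (rule inj_onI, rule ccontr)
      fix x y assume xy: "x \<in> {..<r}" "y \<in> {..<r}" "?v x = ?v y" "x \<noteq> y"
      define c :: "nat \<Rightarrow> 'a" where "c = (\<lambda>i. if i = x then 1 else if i = y then - 1 else 0)"
      have "(\<Sum>i<r. scale (c i) (?v i)) = (\<Sum>i<r. (if i = x then ?v i else 0) + (if i = y then - ?v i else 0))"
        using xy by (intro sum.cong) (auto simp: c_def)
      also have "\<dots> = 0" unfolding sum.distrib using xy by simp
      finally have "c x = 0" using f(3)[OF A] xy by blast
      then show False by (simp add: c_def)
    qed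
    have "independent (?v ` {..<r})"
      unfolding dependent_finite[OF finite_imageI[OF finite_lessThan]]
    proof clarify
      fix c k assume c: "(\<Sum>v\<in>?v ` {..<r}. scale (c v) v) = 0" "k < r" "c (?v k) \<noteq> 0"
      then have "(\<Sum>i<r. scale (c (?v i)) (?v i)) = 0" using inj by (simp add: sum.reindex)
      then show False using f(3)[OF A, of "\<lambda>i. c (?v i)"] c by blast
    qed
    moreover have "?v ` {..<r} \<subseteq> span ((\<lambda>i. g i A) ` I)" using ix by (auto intro!: span_base)
    moreover have "fin_span scale (span ((\<lambda>i. g i A) ` I))" unfolding fin_span_def using I by blast
    ultimately have "card (?v ` {..<r}) \<le> dim (span ((\<lambda>i. g i A) ` I))" by (rule independent_card_le_dim)
    then show ?thesis using inj by (simp add: card_image)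
  qed
  then show ?thesis using f(1,2) r_def by auto
qed

text \<open>The dimensions are bounded, hence the maximum is attained, and by semicontinuity it is attained on a neighbourhood.\<close>

lemma max_dim_generic:
  fixes g :: "'i \<Rightarrow> 'a mat \<Rightarrow> 'b" and co :: "'s \<Rightarrow> 'b \<Rightarrow> 'a"
  assumes lin: "\<And>s x y. co s (x + y) = co s x + co s y" "\<And>s r x. co s (scale r x) = r * co s x"
    and sep: "\<And>x. (\<And>s. co s x = 0) \<Longrightarrow> x = 0"
    and I: "finite I" and poly: "\<And>i s. i \<in> I \<Longrightarrow> poly_fun p n (\<lambda>A. co s (g i A))"
  shows "for_generic p n (\<lambda>A. \<forall>B\<in>carrier_mat p n.
    dim (span ((\<lambda>i. g i B) ` I)) \<le> dim (span ((\<lambda>i. g i A) ` I)))"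
proof -
  let ?r = "\<lambda>A. dim (span ((\<lambda>i. g i A) ` I))"
  have bound: "?r A \<le> card I" for A
    by (rule order_trans[OF dim_le_card[OF order_refl] card_image_le]) (use I in simp_all)
  have fin: "finite (?r ` carrier_mat p n)"
    by (rule finite_subset[of _ "{..card I}"]) (use bound in auto)
  have "carrier_mat p n \<noteq> ({} :: 'a mat set)" using zero_carrier_mat by blast
  then have "Max (?r ` carrier_mat p n) \<in> ?r ` carrier_mat p n" using fin by (intro Max_in) auto
  then obtain A0 where A0: "A0 \<in> carrier_mat p n" "?r A0 = Max (?r ` carrier_mat p n)" by auto
  have le: "?r B \<le> ?r A0" if "B \<in> carrier_mat p n" for B
    unfolding A0(2) using fin that by (intro Max_ge) auto
  obtain f where f: "poly_fun p n f" "f A0 \<noteq> 0" "\<And>A. f A \<noteq> 0 \<Longrightarrow> ?r A0 \<le> ?r A"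
  proof -
    have "\<exists>f. poly_fun p n f \<and> f A0 \<noteq> 0 \<and> (\<forall>A. f A \<noteq> 0 \<longrightarrow> ?r A0 \<le> ?r A)"
      by (rule dim_open[OF lin sep I poly])
    then show thesis using that by blast
  qed
  show ?thesis unfolding for_generic_def
  proof (intro exI[of _ f] conjI bexI[of _ A0] ballI impI)
    fix A B :: "'a mat" assume "f A \<noteq> 0" and B: "B \<in> carrier_mat p n"
    then show "?r B \<le> ?r A" using order_trans[OF le[OF B] f(3)] by blast
  qed (use f A0 in simp_all)
qed

end

section \<open>Cartan-Betti numbers as minima\<close>

lemma poly_fun_lin_form:
  assumes "k \<in> {1..p}"
  shows "poly_fun p n (\<lambda>A. lin_form n A k H)"
  unfolding lin_form_def sum_fun_apply ext_scale_apply
  by (intro poly_fun_sum poly_fun.mult poly_fun.const poly_fun.entry) (use assms in auto)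

lemma poly_fun_cartan_diff: "poly_fun p n (\<lambda>A. cartan_diff p (lin_form n A) c b H)"
  unfolding cartan_diff_def sum_fun_apply wedge_def
  by (intro poly_fun_sum poly_fun.mult poly_fun.const poly_fun_lin_form)

context lin_seq
begin

lemma B_span:
  assumes "D m i j = chain.span T"
  shows "B m i j = chain.span (d m ` chain_mono ` chain_index n m (Suc i) j \<union> T)"
proof
  let ?G = "d m ` chain_mono ` chain_index n m (Suc i) j"
  show "B m i j \<subseteq> chain.span (?G \<union> T)"
  proof
    fix x assume "x \<in> B m i j"
    then obtain c e where ce: "x = d m c + e" "c \<in> C m (Suc i) j" "e \<in> D m i j" by (rule BE)
    have "c = (\<Sum>p\<in>chain_index n m (Suc i) j. chain_scale (c (fst p) (snd p)) (chain_mono p))"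
      using ce(2) chain_coord_expansion[OF finite_chain_index] unfolding cartan_chains_coord by blast
    then have "d m c = d m (\<Sum>p\<in>chain_index n m (Suc i) j. chain_scale (c (fst p) (snd p)) (chain_mono p))" by simp
    also have "\<dots> = (\<Sum>p\<in>chain_index n m (Suc i) j. chain_scale (c (fst p) (snd p)) (d m (chain_mono p)))"
      by (simp only: cc.linear_sum[OF linear_cartan_diff] cc.linear_scale[OF linear_cartan_diff])
    also have "\<dots> \<in> chain.span (?G \<union> T)"
      by (intro chain.span_sum chain.span_scale chain.span_base) auto
    finally have "d m c \<in> chain.span (?G \<union> T)" .
    moreover have "e \<in> chain.span (?G \<union> T)" using ce(3) assms chain.span_mono[of T "?G \<union> T"] by blast
    ultimately show "x \<in> chain.span (?G \<union> T)" unfolding ce(1) by (rule chain.span_add)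
  qed
  have "d m (chain_mono q) \<in> B m i j" if "q \<in> chain_index n m (Suc i) j" for q
  proof -
    have "chain_mono q \<in> C m (Suc i) j" using that
      by (auto simp: cartan_chains_coord chain_coord_def chain_mono_def split: if_splits)
    then have "d m (chain_mono q) + 0 \<in> B m i j" by (intro BI DI)
    then show ?thesis by simp
  qed
  moreover have "x \<in> B m i j" if "x \<in> T" for x
  proof -
    have "x \<in> D m i j" using that assms chain.span_base by blast
    then have "d m 0 + x \<in> B m i j" by (intro BI chain.subspace_0 cartan_chains_subspace)
    then show ?thesis by (simp add: diff_simps)
  qed
  ultimately show "chain.span (?G \<union> T) \<subseteq> B m i j"
    by (intro chain.span_minimal B_subspace) auto
qed

lemma B_fin: "m \<le> M \<Longrightarrow> fin_span chain_scale (B m i j)"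
  using chain.fin_span_mono[OF B_sub_Z Z_fin] .

lemma D_sub_B: "D m i j \<subseteq> B m i j"
proof
  fix x assume "x \<in> D m i j"
  then have "d m 0 + x \<in> B m i j" by (intro BI chain.subspace_0 cartan_chains_subspace)
  then show "x \<in> B m i j" by (simp add: diff_simps)
qed

lemma rank_eq: "m \<le> M \<Longrightarrow> cartan_rank n m v J i j + chain.dim (D m i j) = chain.dim (B m i j)"
  unfolding cartan_rank_def by (rule chain.quotient_dim_eq[OF B_subspace D_subspace D_sub_B B_fin])

lemma Z_Suc_dim: 
  assumes "m \<le> M"
  shows "chain.dim (B m i j) + chain.dim (Z m (Suc i) j) = chain.dim (C m (Suc i) j) + chain.dim (D m i j)"
proof -
  have "{d m z + b | z b. z \<in> C m (Suc i) j \<and> b \<in> D m i j} = B m i j"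
    by (auto simp: cartan_boundaries_def)
  moreover have "{z \<in> C m (Suc i) j. d m z \<in> D m i j} = Z m (Suc i) j"
    using diff_in assms by (auto simp: cartan_cycles_def ideal_chains_def)
  ultimately show ?thesis
    using cc.dim_preimage[OF linear_cartan_diff cartan_chains_subspace cartan_chains_fin D_subspace,
        of m i j m v n m "Suc i" j] chain.fin_span_mono[OF D_sub cartan_chains_fin] by auto
qed

text \<open>With the dimensions of the chain spaces fixed, the homology is the smaller the larger the boundary spaces are.\<close>

lemma h_rank_Suc:
  assumes "m \<le> M"
  shows "h m (Suc i) j + chain.dim (B m (Suc i) j) + chain.dim (B m i j) = chain.dim (C m (Suc i) j) + chain.dim (D m i j)"
  using Z_Suc_dim[OF assms, of i j] h_eq[OF assms, of "Suc i" j] by linarith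

lemma h_rank_0:
  assumes "m \<le> M"
  shows "h m 0 j + chain.dim (B m 0 j) = chain.dim (C m 0 j)"
  using h_eq[OF assms, of 0 j] by (simp add: Z0)

end

lemma lin_seq_lin_form: "graded_ideal n J \<Longrightarrow> lin_seq n M (lin_form n A) J"
  by unfold_locales (simp_all only: lin_form_deg_one)

text \<open>The boundary spaces contain the fixed space of chains with coefficients in \<open>J\<close>; so their dimensions and the ranks of
the differentials differ by constants.\<close>

definition boundary_dim :: "nat \<Rightarrow> nat \<Rightarrow> 'k::field ext set \<Rightarrow> 'k mat \<Rightarrow> nat \<Rightarrow> nat \<Rightarrow> nat" where
  "boundary_dim n p J A i j = chain.dim (cartan_boundaries n p (lin_form n A) J i j)"

text \<open>The bound \<open>N\<close> may exceed the number \<open>p\<close> of forms, so that initial segments of different lengths can be subjected to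
one and the same condition.\<close>

definition max_rank :: "nat \<Rightarrow> nat \<Rightarrow> 'k::field ext set \<Rightarrow> nat \<Rightarrow> 'k mat \<Rightarrow> bool" where
  "max_rank n p J N A \<longleftrightarrow> A \<in> carrier_mat p n \<and>
     (\<forall>i\<le>N. \<forall>j. \<forall>B\<in>carrier_mat p n. boundary_dim n p J B i j \<le> boundary_dim n p J A i j)"

lemma max_boundary_dim_generic:
  fixes J :: "'k::field ext set"
  assumes J: "graded_ideal n J"
  shows "for_generic p n (\<lambda>A. \<forall>B\<in>carrier_mat p n. boundary_dim n p J B i j \<le> boundary_dim n p J A i j)"
proof -
  interpret L: lin_seq n p "lin_form n Q" J for Q by (rule lin_seq_lin_form[OF J])
  obtain T where T: "finite T" "chain.span T = ideal_chains n p J i j"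
  proof -
    obtain T where T: "T \<subseteq> ideal_chains n p J i j" "chain.independent T" "ideal_chains n p J i j \<subseteq> chain.span T"
      using chain.basis_exists by metis
    have "finite T" 
      using chain.independent_finite[OF T(2,1) chain.fin_span_mono[OF L.D_sub[of p i j] cartan_chains_fin]] .
    moreover have "chain.span T \<subseteq> ideal_chains n p J i j" using T(1) L.D_subspace chain.span_minimal by blast
    ultimately show thesis using that T(3) by blast
  qed
  define g :: "((nat \<Rightarrow> nat) \<times> nat set) + 'k chain \<Rightarrow> 'k mat \<Rightarrow> 'k chain" where
    "g x A = (case x of Inl q \<Rightarrow> cartan_diff p (lin_form n A) (chain_mono q) | Inr t \<Rightarrow> t)" for x A
  define I where "I = Inl ` chain_index n p (Suc i) j \<union> Inr ` T"
  have sp: "cartan_boundaries n p (lin_form n A) J i j = chain.span ((\<lambda>x. g x A) ` I)" for A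
  proof -
    have "(\<lambda>x. g x A) ` I = cartan_diff p (lin_form n A) ` chain_mono ` chain_index n p (Suc i) j \<union> T"
      unfolding I_def image_Un image_image g_def by simp
    then show ?thesis using L.B_span[OF T(2)[symmetric], of A] by simp
  qed
  show ?thesis unfolding boundary_dim_def sp
  proof (rule chain.max_dim_generic[where co = "\<lambda>s c. c (fst s) (snd s)"])
    show "finite I" unfolding I_def using T(1) finite_chain_index by blast
    fix x s assume "x \<in> I"
    show "poly_fun p n (\<lambda>A. g x A (fst s) (snd s))"
      unfolding g_def by (cases x) (simp_all add: poly_fun_cartan_diff poly_fun.const)
  next
    fix x :: "'k chain" assume "\<And>s. x (fst s) (snd s) = 0"
    then have "x a b = 0" for a b by (metis fst_conv snd_conv)
    then show "x = 0" by (simp add: fun_eq_iff)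
  qed simp_all
qed

text \<open>Only finitely many internal degrees \<open>j\<close> are relevant: beyond \<open>n + N\<close> the chain spaces are zero.\<close>

lemma max_rank_generic:
  fixes J :: "'k::field ext set"
  assumes inf: "infinite (UNIV :: 'k set)" and J: "graded_ideal n J"
  shows "for_generic p n (max_rank n p J N)"
proof -
  interpret L: lin_seq n p "lin_form n Q" J for Q by (rule lin_seq_lin_form[OF J])
  have "for_generic p n (\<lambda>A. \<forall>x\<in>{..N} \<times> {..n + N}. \<forall>B\<in>carrier_mat p n.
      boundary_dim n p J B (fst x) (snd x) \<le> boundary_dim n p J A (fst x) (snd x))"
    by (rule for_generic_finite[OF inf]) (auto intro: max_boundary_dim_generic[OF J])
  then show ?thesis
  proof (rule for_generic_mono)
    fix A :: "'k mat" assume A: "A \<in> carrier_mat p n" and max: "\<forall>x\<in>{..N} \<times> {..n + N}. \<forall>B\<in>carrier_mat p n.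
      boundary_dim n p J B (fst x) (snd x) \<le> boundary_dim n p J A (fst x) (snd x)"
    have "boundary_dim n p J B i j \<le> boundary_dim n p J A i j" if "i \<le> N" "B \<in> carrier_mat p n" for i j B
    proof (cases "j \<le> n + N")
      case True
      then show ?thesis using max that by auto
    next
      case False
      have "chain_index n p i j = {}"
      proof (rule ccontr)
        assume "chain_index n p i j \<noteq> {}"
        then obtain F where F: "F \<subseteq> {1..n}" "card F + i = j" by (auto simp: chain_index_def)
        have "card F \<le> n" using card_mono[OF _ F(1)] by simp
        then show False using F(2) False that(1) by simp
      qed
      then have "chain.dim (cartan_chains n p i j :: 'k chain set) = 0"
        unfolding cartan_chains_coord using dim_chain_coord[of "{}"] by simp
      moreover have "boundary_dim n p J B i j \<le> chain.dim (cartan_chains n p i j :: 'k chain set)"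
        unfolding boundary_dim_def using L.B_sub_Z[of p B i j] L.Z_sub[of p B i j]
        by (intro chain.dim_subset cartan_chains_fin) auto
      ultimately show ?thesis by simp
    qed
    then show "max_rank n p J N A" using A by (simp add: max_rank_def)
  qed
qed

lemma max_rank_min_homology:
  fixes J :: "'k::field ext set"
  assumes J: "graded_ideal n J" and A: "max_rank n p J N A" and B: "B \<in> carrier_mat p n" and i: "i \<le> N"
  shows "cartan_homology_dim n p (lin_form n A) J i j \<le> cartan_homology_dim n p (lin_form n B) J i j"
proof -
  interpret L: lin_seq n p "lin_form n Q" J for Q by (rule lin_seq_lin_form[OF J])
  have le: "boundary_dim n p J B i' j \<le> boundary_dim n p J A i' j" if "i' \<le> N" for i'
    using A B that by (simp add: max_rank_def)
  show ?thesis
  proof (cases i)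
    case 0
    then show ?thesis using L.h_rank_0[of p A j] L.h_rank_0[of p B j] le[of 0] unfolding boundary_dim_def by simp
  next
    case (Suc i')
    then show ?thesis using L.h_rank_Suc[of p A i' j] L.h_rank_Suc[of p B i' j] le[of i'] le[of i] i
      unfolding boundary_dim_def by simp
  qed
qed

theorem cartan_betti_eq:
  fixes J :: "'k::field ext set"
  assumes inf: "infinite (UNIV :: 'k set)" and J: "graded_ideal n J" 
    and A: "max_rank n p J N A" and i: "i \<le> p" and N: "p \<le> N"
  shows "cartan_betti n J i j p = cartan_homology_dim n p (lin_form n A) J i j"
proof -
  interpret L: lin_seq n p "lin_form n Q" J for Q by (rule lin_seq_lin_form[OF J])
  have rank: "cartan_rank n p (lin_form n B) J i j \<le> cartan_rank n p (lin_form n X) J i j \<longleftrightarrow>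
     boundary_dim n p J B i j \<le> boundary_dim n p J X i j" for B X i j
    using L.rank_eq[of p B i j] L.rank_eq[of p X i j] unfolding boundary_dim_def by linarith
  have mr: "max_rank n p J p X" if "cartan_generic_set n p J U" "X \<in> U" for U X
    using that unfolding cartan_generic_set_def max_rank_def rank zariski_open_def by blast
  have Ap: "max_rank n p J p A" using A N by (auto simp: max_rank_def)
  have eq: "cartan_homology_dim n p (lin_form n X) J i j = cartan_homology_dim n p (lin_form n A) J i j"
    if "max_rank n p J p X" for X
  proof -
    have "X \<in> carrier_mat p n" "A \<in> carrier_mat p n" using that Ap by (auto simp: max_rank_def)
    then show ?thesis using max_rank_min_homology[OF J that _ i, of A j] max_rank_min_homology[OF J Ap _ i, of X j]
      by (intro antisym)
  qed
  obtain U where U: "zariski_open p n U" "U \<noteq> {}" "U \<subseteq> carrier_mat p n" "\<And>X. X \<in> U \<Longrightarrow> max_rank n p J p X"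
    using generic_zariski_open[OF max_rank_generic[OF inf J, of p p]] by blast
  have gU: "cartan_generic_set n p J U"
    unfolding cartan_generic_set_def rank using U unfolding max_rank_def by blast
  have "(THE d. \<exists>U. cartan_generic_set n p J U \<and> (\<forall>A\<in>U. cartan_homology_dim n p (lin_form n A) J i j = d))
    = cartan_homology_dim n p (lin_form n A) J i j"
  proof (rule the_equality)
    show "\<exists>U. cartan_generic_set n p J U \<and>
      (\<forall>X\<in>U. cartan_homology_dim n p (lin_form n X) J i j = cartan_homology_dim n p (lin_form n A) J i j)"
      using gU U(4) eq by blast
    fix d assume "\<exists>U. cartan_generic_set n p J U \<and> (\<forall>A\<in>U. cartan_homology_dim n p (lin_form n A) J i j = d)"
    then obtain V where V: "cartan_generic_set n p J V" "\<And>X. X \<in> V \<Longrightarrow> cartan_homology_dim n p (lin_form n X) J i j = d" by blast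
    then obtain X where "X \<in> V" unfolding cartan_generic_set_def by blast
    then show "d = cartan_homology_dim n p (lin_form n A) J i j" using V mr eq by metis
  qed
  then show ?thesis using i by (simp add: cartan_betti_def)
qed

lemma cartan_homology_dim_cong:
  assumes "\<And>k. k \<in> {1..m} \<Longrightarrow> v k = w k"
  shows "cartan_homology_dim n m v J i j = cartan_homology_dim n m w J i j"
proof -
  have "cartan_diff m v = cartan_diff m w"
    by (intro ext) (simp add: cartan_diff_def assms)
  then show ?thesis by (simp add: cartan_homology_dim_def cartan_cycles_def cartan_boundaries_def)
qed

lemma lin_form_trunc: "k \<in> {1..p} \<Longrightarrow> lin_form n (trunc_mat p n A) k = lin_form n A k"
  unfolding lin_form_def by (rule sum.cong) (auto simp: trunc_mat_def)

text \<open>The comparison by induction on the length needs one sequence all of whose initial segments are generic.\<close>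

lemma generic_flag:
  fixes J :: "'k::field ext set"
  assumes inf: "infinite (UNIV :: 'k set)" and J: "graded_ideal n J"
  shows "for_generic n n (\<lambda>A. \<forall>k\<in>{0..n}. max_rank n k J N (trunc_mat k n A))"
  by (intro for_generic_finite[OF inf] for_generic_trunc max_rank_generic[OF inf J]) auto

section \<open>Lexsegments and shifted families\<close>

definition lexseg :: "nat \<Rightarrow> nat \<Rightarrow> nat set set \<Rightarrow> bool" where
  "lexseg m d L \<longleftrightarrow> L \<subseteq> slice m d \<and> (\<forall>F\<in>L. \<forall>G\<in>slice m d. lex_greater G F \<longrightarrow> G \<in> L)"

text \<open>The sets with one element more that contain a member of the family; in terms of monomials, the products of the members with
the variables.\<close>

definition up_shadow :: "nat \<Rightarrow> nat set set \<Rightarrow> nat set set" where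
  "up_shadow m M = {insert j F | j F. F \<in> M \<and> j \<in> {1..m} - F}"

lemma finite_slice [simp]: "finite (slice m d)"
  by (rule finite_subset[of _ "Pow {1..m}"]) (auto simp: slice_def)

lemma slice_finite: "F \<in> slice m d \<Longrightarrow> finite F"
  by (auto simp: slice_def intro: finite_subset)

lemma sliceD: "F \<in> slice m d \<Longrightarrow> F \<subseteq> {1..m} \<and> card F = d \<and> finite F"
  using slice_finite[of F m d] by (simp add: slice_def)

lemma lexsegD: "lexseg m d L \<Longrightarrow> F \<in> L \<Longrightarrow> F \<in> slice m d"
  by (auto simp: lexseg_def)

lemma lex_greater_iff:
  assumes "finite F" "finite G" "card F = card G"
  shows "lex_greater G F \<longleftrightarrow> (\<exists>s. s \<in> G \<and> s \<notin> F \<and> (\<forall>x<s. x \<in> F \<longleftrightarrow> x \<in> G))"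
proof
  assume l: "lex_greater G F"
  let ?S = "(F - G) \<union> (G - F)"
  have fin: "finite ?S" "?S \<noteq> {}" using assms l by (auto simp: lex_greater_def)
  have "Min ?S \<in> ?S" "Min ?S \<in> G" using Min_in[OF fin] l by (auto simp: lex_greater_def)
  moreover have "x \<in> F \<longleftrightarrow> x \<in> G" if "x < Min ?S" for x
  proof (rule ccontr)
    assume "\<not> (x \<in> F \<longleftrightarrow> x \<in> G)"
    then have "x \<in> ?S" by blast
    then show False using Min_le[OF fin(1)] that by (meson leD)
  qed
  ultimately show "\<exists>s. s \<in> G \<and> s \<notin> F \<and> (\<forall>x<s. x \<in> F \<longleftrightarrow> x \<in> G)" by (intro exI[of _ "Min ?S"]) auto
next
  assume "\<exists>s. s \<in> G \<and> s \<notin> F \<and> (\<forall>x<s. x \<in> F \<longleftrightarrow> x \<in> G)"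
  then obtain s where s: "s \<in> G" "s \<notin> F" "\<And>x. x < s \<Longrightarrow> x \<in> F \<longleftrightarrow> x \<in> G" by blast
  have "Min ((F - G) \<union> (G - F)) = s"
    by (rule Min_eqI) (use assms s in \<open>auto simp: not_less[symmetric]\<close>)
  then show "lex_greater G F" using s assms by (auto simp: lex_greater_def)
qed

lemma lex_greater_total:
  assumes "finite F" "finite G" "card F = card G" "F \<noteq> G"
  shows "lex_greater G F \<or> lex_greater F G"
proof -
  have ne: "(F - G) \<union> (G - F) \<noteq> {}" "finite ((F - G) \<union> (G - F))" using assms by auto
  have "Min ((F - G) \<union> (G - F)) \<in> F \<or> Min ((F - G) \<union> (G - F)) \<in> G" using Min_in[OF ne(2,1)] by auto
  then show ?thesis using assms by (auto simp: lex_greater_def Un_commute)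
qed

lemma lex_greater_trans:
  assumes "finite F" "finite G" "finite H" "lex_greater H G" "lex_greater G F"
  shows "lex_greater H F"
proof -
  have c: "card F = card G" "card G = card H" "card F = card H" using assms by (auto simp: lex_greater_def)
  obtain s where s: "s \<in> H" "s \<notin> G" "\<forall>x<s. x \<in> G \<longleftrightarrow> x \<in> H"
    using assms(4) lex_greater_iff[OF assms(2,3) c(2)] by blast
  obtain t where t: "t \<in> G" "t \<notin> F" "\<forall>x<t. x \<in> F \<longleftrightarrow> x \<in> G"
    using assms(5) lex_greater_iff[OF assms(1,2) c(1)] by blast
  have "min s t \<in> H \<and> min s t \<notin> F \<and> (\<forall>x<min s t. x \<in> F \<longleftrightarrow> x \<in> H)"
    using s t by (cases s t rule: linorder_cases) (auto simp: min_def)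
  then show ?thesis using lex_greater_iff[OF assms(1,3) c(3)] by blast
qed

lemma lexseg_comparable:
  assumes "lexseg m d L" "lexseg m d L'" "card L \<le> card L'"
  shows "L \<subseteq> L'"
proof (rule ccontr)
  assume "\<not> L \<subseteq> L'"
  then obtain F where F: "F \<in> L" "F \<notin> L'" by blast
  have fin: "finite L" "finite L'" using assms finite_slice by (auto simp: lexseg_def intro: finite_subset)
  have "L' \<subseteq> L"
  proof
    fix G assume G: "G \<in> L'"
    have sl: "F \<in> slice m d" "G \<in> slice m d" using F G assms(1,2) by (auto simp: lexseg_def)
    have "card F = card G" "F \<noteq> G" using sl F G by (auto simp: slice_def)
    then have "lex_greater G F \<or> lex_greater F G"
      using lex_greater_total[OF slice_finite[OF sl(1)] slice_finite[OF sl(2)]] by blast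
    then show "G \<in> L" using F G sl assms(1,2) unfolding lexseg_def by blast
  qed
  then have "L' \<subset> L" using F by blast
  then show False using psubset_card_mono[OF fin(1)] assms(3) by (meson leD)
qed

lemma lexseg_exists:
  assumes "N \<le> card (slice m d)"
  shows "\<exists>L. lexseg m d L \<and> card L = N"
  using assms
proof (induct N)
  case 0
  show ?case by (rule exI[of _ "{}"]) (simp add: lexseg_def)
next
  case (Suc N)
  then obtain L where L: "lexseg m d L" "card L = N" by auto
  have fL: "finite L" using L finite_slice by (auto simp: lexseg_def intro: finite_subset)
  have "slice m d - L \<noteq> {}"
  proof
    assume "slice m d - L = {}"
    then have "card (slice m d) \<le> card L" using fL by (intro card_mono) auto
    then show False using Suc L by simp
  qed
  moreover have "finite (slice m d - L)" by simp
  moreover have "\<exists>F\<in>S. \<forall>G\<in>S. \<not> lex_greater G F" if "finite S" "S \<noteq> {}" "S \<subseteq> slice m d" for S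
    using that
  proof (induct S rule: finite_ne_induct)
    case (singleton x)
    then show ?case by (auto simp: lex_greater_def)
  next
    case (insert x S)
    then obtain F where F: "F \<in> S" "\<forall>G\<in>S. \<not> lex_greater G F" by auto
    have fin: "finite x" "finite F" "\<And>G. G \<in> S \<Longrightarrow> finite G" using insert F slice_finite by blast+
    show ?case
    proof (cases "lex_greater x F")
      case True
      have "\<not> lex_greater G x" if "G \<in> insert x S" for G
        using that True F lex_greater_trans[OF fin(2,1) fin(3)[of G]] by (auto simp: lex_greater_def[of x x])
      then show ?thesis by blast
    qed (use F in blast)
  qed
  ultimately obtain F where F: "F \<in> slice m d - L" "\<And>G. G \<in> slice m d - L \<Longrightarrow> \<not> lex_greater G F"
    by (metis Diff_subset)
  have "lexseg m d (insert F L)" using L F by (auto simp: lexseg_def)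
  moreover have "card (insert F L) = Suc N" using F L fL by simp
  ultimately show ?case by blast
qed

lemma lexseg_shifted:
  assumes L: "lexseg m d L"
  shows "shifted L"
  unfolding shifted_def
proof (intro ballI allI impI)
  fix F j i assume F: "F \<in> L" "j \<in> F" "1 \<le> i" "i < j" "i \<notin> F"
  have sF: "F \<subseteq> {1..m}" "card F = d" "finite F" using sliceD[OF lexsegD[OF L F(1)]] by blast+
  have c: "card (insert i (F - {j})) = card F" 
    using card.remove[OF sF(3) F(2)] sF(3) F(5) by (simp add: card_insert_if)
  have "j \<in> {1..m}" using sF(1) F(2) by blast
  then have "i \<le> m" using F(4) by simp
  then have "insert i (F - {j}) \<in> slice m d" using sF F c by (auto simp: slice_def)
  moreover have "lex_greater (insert i (F - {j})) F"
    using lex_greater_iff[of F "insert i (F - {j})"] c sF F by (auto intro!: exI[of _ i])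
  ultimately show "insert i (F - {j}) \<in> L" using F L by (auto simp: lexseg_def)
qed

lemma up_shadow_slice: "M \<subseteq> slice m d \<Longrightarrow> up_shadow m M \<subseteq> slice m (Suc d)"
proof
  fix G assume M: "M \<subseteq> slice m d" and "G \<in> up_shadow m M"
  then obtain j F where G: "G = insert j F" "F \<in> M" "j \<in> {1..m} - F" by (auto simp: up_shadow_def)
  then show "G \<in> slice m (Suc d)" using M slice_finite[of F m d] by (auto simp: slice_def)
qed

text \<open>If \<open>G\<close> arises from \<open>F\<close> by adding \<open>j\<close> and \<open>j\<close> is not the maximum of \<open>G\<close>, then \<open>G\<close> without its maximum arises from \<open>F\<close> by
exchanging the maximum for the smaller \<open>j\<close>.\<close>

lemma shadow_remove_max:
  assumes "shifted M" "M \<subseteq> slice m d" "G \<in> up_shadow m M"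
  shows "G - {Max G} \<in> M" "Max G \<in> G" "finite G" "G \<noteq> {}"
proof -
  obtain j F where G: "G = insert j F" "F \<in> M" "j \<in> {1..m} - F" using assms by (auto simp: up_shadow_def)
  have fin: "finite F" using G assms slice_finite by blast
  show fG: "finite G" "G \<noteq> {}" using fin G by auto
  show mx: "Max G \<in> G" using Max_in[OF fG] .
  show "G - {Max G} \<in> M"
  proof (cases "j = Max G")
    case True
    then show ?thesis using G by (simp add: insert_Diff_if)
  next
    case False
    then have "j < Max G" "Max G \<in> F" using G mx Max_ge[OF fG(1), of j] by auto
    moreover have "insert j (F - {Max G}) = G - {Max G}" using G False by auto
    ultimately show ?thesis using assms(1) G unfolding shifted_def by fastforce
  qed
qed

text \<open>Since each member \<open>G\<close> of the shadow is determined by its maximum \<open>k + 1\<close> and by \<open>G - {k + 1} \<subseteq> {1..k}\<close>, the size of the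
shadow is expressed by the numbers of members in the initial intervals.\<close>

lemma up_shadow_card:
  assumes M: "shifted M" "M \<subseteq> slice m d"
  shows "card (up_shadow m M) = (\<Sum>k<m. card {F \<in> M. F \<subseteq> {1..k}})"
proof -
  let ?P = "SIGMA k:{..<m}. {F \<in> M. F \<subseteq> {1..k}}"
  have fM: "finite M" using M finite_subset finite_slice by blast
  have "bij_betw (\<lambda>(k, F). insert (Suc k) F) ?P (up_shadow m M)"
  proof (rule bij_betw_byWitness[where f' = "\<lambda>G. (Max G - 1, G - {Max G})"])
    have key: "Max (insert (Suc k) F) = Suc k \<and> Suc k \<notin> F" if "F \<in> M" "F \<subseteq> {1..k}" for k F
    proof -
      have "finite F" using that M slice_finite by blast
      then show ?thesis using that by (auto intro!: Max_eqI)
    qed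
    show "\<forall>p\<in>?P. (\<lambda>G. (Max G - 1, G - {Max G})) ((\<lambda>(k, F). insert (Suc k) F) p) = p"
      using key by (auto simp del: Max_insert)
    show "(\<lambda>(k, F). insert (Suc k) F) ` ?P \<subseteq> up_shadow m M"
    proof (rule image_subsetI, clarsimp simp del: One_nat_def)
      fix k F assume "k < m" "F \<in> M" "F \<subseteq> {1..k}"
      then have "F \<in> M" "Suc k \<in> {1..m} - F" using key[of F k] by auto
      then show "insert (Suc k) F \<in> up_shadow m M" unfolding up_shadow_def by blast
    qed
    have G: "Max G \<in> {1..m} \<and> G - {Max G} \<in> M \<and> G - {Max G} \<subseteq> {1..Max G - 1} \<and> insert (Max G) G = G"
      if "G \<in> up_shadow m M" for G
    proof -
      note s = shadow_remove_max[OF M that]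
      have sub: "G \<subseteq> {1..m}" using up_shadow_slice[OF M(2)] that by (auto simp: slice_def)
      have "x \<in> {1..Max G - 1}" if "x \<in> G - {Max G}" for x
      proof -
        have "x \<le> Max G" using s(3) that by simp
        moreover have "x \<noteq> Max G" "x \<in> {1..m}" using that sub by auto
        ultimately show ?thesis by simp
      qed
      then have "G - {Max G} \<subseteq> {1..Max G - 1}" by blast
      moreover have "Max G \<in> {1..m}" using subsetD[OF sub s(2)] .
      moreover have "insert (Max G) G = G" using s(2) by (rule insert_absorb)
      ultimately show ?thesis using s(1) by blast
    qed
    show "\<forall>G\<in>up_shadow m M. (\<lambda>(k, F). insert (Suc k) F) (Max G - 1, G - {Max G}) = G"
      using G by fastforce
    show "(\<lambda>G. (Max G - 1, G - {Max G})) ` up_shadow m M \<subseteq> ?P"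
      using G by fastforce
  qed
  then have "card (up_shadow m M) = card ?P" by (simp add: bij_betw_same_card)
  also have "\<dots> = (\<Sum>k<m. card {F \<in> M. F \<subseteq> {1..k}})" using fM by (subst card_SigmaI) auto
  finally show ?thesis .
qed

lemma up_shadow_lexseg:
  assumes L: "lexseg m d L"
  shows "lexseg m (Suc d) (up_shadow m L)"
  unfolding lexseg_def
proof (intro conjI ballI impI)
  have Ls: "L \<subseteq> slice m d" using L by (simp add: lexseg_def)
  show "up_shadow m L \<subseteq> slice m (Suc d)" using up_shadow_slice Ls .
  fix G H assume G: "G \<in> up_shadow m L" and H: "H \<in> slice m (Suc d)" and lg: "lex_greater H G"
  note s = shadow_remove_max[OF lexseg_shifted[OF L] Ls G]
  have fH: "finite H" "H \<noteq> {}" "card H = card G" "H \<subseteq> {1..m}" 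
    using sliceD[OF H] lg by (auto simp: lex_greater_def)
  have mH: "Max H \<in> H" using Max_in fH by blast
  obtain t where t: "t \<in> H" "t \<notin> G" "\<And>x. x < t \<Longrightarrow> x \<in> G \<longleftrightarrow> x \<in> H"
    using lg lex_greater_iff[of G H] s fH by auto
  have c: "card (H - {Max H}) = d" "card (G - {Max G}) = d" 
    using H mH fH s by (auto simp: slice_def)
  have tG: "t < Max G"
  proof (rule ccontr)
    assume n: "\<not> t < Max G"
    have "G \<subseteq> H - {t}"
    proof
      fix x assume x: "x \<in> G"
      then have "x \<le> Max G" using s by simp
      then have "x < t" using n x t(2) by (metis le_neq_implies_less le_trans not_less)
      then show "x \<in> H - {t}" using t(3) x by auto
    qed
    then have "card G \<le> card (H - {t})" using fH by (intro card_mono) auto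
    then show False using fH t(1) by (metis card_Diff1_less leD)
  qed
  have "H - {Max H} \<in> L"
  proof (cases "t < Max H")
    case True
    have "lex_greater (H - {Max H}) (G - {Max G})"
      using lex_greater_iff[of "G - {Max G}" "H - {Max H}"] c s fH t tG True
      by (auto intro!: exI[of _ t])
    moreover have "H - {Max H} \<in> slice m d" using c fH by (auto simp: slice_def)
    ultimately show ?thesis using L s(1) by (auto simp: lexseg_def)
  next
    case False
    then have tH: "t = Max H" using t(1) fH by (meson Max_ge le_neq_implies_less)
    have "H - {Max H} \<subseteq> G - {Max G}"
    proof
      fix x assume x: "x \<in> H - {Max H}"
      then have "x < t" using tH fH by (metis Diff_iff Max_ge insertI1 le_neq_implies_less singletonI)
      then show "x \<in> G - {Max G}" using t(3) x tG by auto
    qed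
    then have "H - {Max H} = G - {Max G}" using c s by (intro card_subset_eq) auto
    then show ?thesis using s by simp
  qed
  moreover have "H = insert (Max H) (H - {Max H})" "Max H \<in> {1..m} - (H - {Max H})"
    using mH subsetD[OF fH(4) mH] by (auto simp del: Max_in)
  ultimately show "H \<in> up_shadow m L" unfolding up_shadow_def by blast
qed

definition low :: "nat \<Rightarrow> nat set set \<Rightarrow> nat" where
  "low k N = card {F \<in> N. F \<subseteq> {1..k}}"

text \<open>The statement of the theorem below, named for the induction on \<open>m\<close>, in which it is used through its consequence for
shadows.\<close>

definition low_minimal :: "nat \<Rightarrow> bool" where
  "low_minimal m \<longleftrightarrow> (\<forall>d N L k. N \<subseteq> slice m d \<longrightarrow> shifted N \<longrightarrow> lexseg m d L \<longrightarrow> card L \<le> card N \<longrightarrow>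
     low k L \<le> low k N)"

text \<open>The sizes of shadows are sums of the numbers \<open>low k\<close>; so minimality of the latter makes the shadow of the lexsegment
the smallest. Being a lexsegment itself, it is then contained in any lexsegment that is large enough.\<close>

lemma kruskal_katona_step:
  assumes lm: "low_minimal m"
    and M: "M \<subseteq> slice m d" "shifted M" and N: "N \<subseteq> slice m (Suc d)" "up_shadow m M \<subseteq> N"
    and L: "lexseg m d L" "card L \<le> card M" and L': "lexseg m (Suc d) L'" "card N \<le> card L'"
  shows "up_shadow m L \<subseteq> L'"
proof (rule lexseg_comparable[OF up_shadow_lexseg[OF L(1)] L'(1)])
  have Ls: "L \<subseteq> slice m d" using L by (simp add: lexseg_def)
  have fN: "finite N" using N finite_subset finite_slice by blast
  have "card (up_shadow m L) = (\<Sum>k<m. low k L)"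
    unfolding low_def by (rule up_shadow_card[OF lexseg_shifted[OF L(1)] Ls])
  also have "\<dots> \<le> (\<Sum>k<m. low k M)"
    using lm M L unfolding low_minimal_def by (intro sum_mono) blast
  also have "\<dots> = card (up_shadow m M)"
    unfolding low_def by (rule up_shadow_card[OF M(2,1), symmetric])
  also have "\<dots> \<le> card N" using N fN by (intro card_mono)
  finally show "card (up_shadow m L) \<le> card L'" using L' by simp
qed

definition link :: "nat \<Rightarrow> nat set set \<Rightarrow> nat set set" where
  "link x N = {F. x \<notin> F \<and> insert x F \<in> N}"

definition deletion :: "nat \<Rightarrow> nat set set \<Rightarrow> nat set set" where
  "deletion x N = {F \<in> N. x \<notin> F}"

lemma slice_split:
  assumes "N \<subseteq> slice (Suc m) (Suc d)"
  shows "deletion (Suc m) N \<subseteq> slice m (Suc d)" "link (Suc m) N \<subseteq> slice m d"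
    "card N = card (deletion (Suc m) N) + card (link (Suc m) N)"
proof -
  have fN: "finite N" using assms finite_subset finite_slice by blast
  have "x \<in> {1..Suc m} \<Longrightarrow> x \<noteq> Suc m \<Longrightarrow> x \<in> {1..m}" for x by auto
  then show "deletion (Suc m) N \<subseteq> slice m (Suc d)"
    using assms unfolding deletion_def slice_def by blast
  show "link (Suc m) N \<subseteq> slice m d"
  proof
    fix F assume "F \<in> link (Suc m) N"
    then have F: "Suc m \<notin> F" "insert (Suc m) F \<subseteq> {1..Suc m}" "card (insert (Suc m) F) = Suc d"
      using assms by (auto simp: link_def slice_def)
    then have "finite F" by (meson finite_atLeastAtMost finite_insert finite_subset)
    moreover have "x \<in> {1..m}" if "x \<in> F" for x
      using that F(1,2) by (metis atLeastAtMost_iff insertCI le_SucE subsetD)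
    ultimately show "F \<in> slice m d" using F by (auto simp: slice_def)
  qed
  have "N = deletion (Suc m) N \<union> insert (Suc m) ` link (Suc m) N"
  proof (intro equalityI subsetI)
    fix F assume F: "F \<in> N"
    show "F \<in> deletion (Suc m) N \<union> insert (Suc m) ` link (Suc m) N"
    proof (cases "Suc m \<in> F")
      case True
      then have "F = insert (Suc m) (F - {Suc m})" "F - {Suc m} \<in> link (Suc m) N"
        using F by (auto simp: link_def insert_absorb)
      then show ?thesis by blast
    qed (use F in \<open>simp add: deletion_def\<close>)
  qed (auto simp: deletion_def link_def)
  moreover have "deletion (Suc m) N \<inter> insert (Suc m) ` link (Suc m) N = {}" by (auto simp: deletion_def)
  moreover have "inj_on (insert (Suc m)) (link (Suc m) N)"
    by (rule inj_onI) (metis (mono_tags, lifting) insert_ident link_def mem_Collect_eq)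
  moreover have "finite (deletion (Suc m) N)" "finite (link (Suc m) N)"
    using fN finite_subset[OF \<open>link (Suc m) N \<subseteq> slice m d\<close>] by (auto simp: deletion_def)
  ultimately show "card N = card (deletion (Suc m) N) + card (link (Suc m) N)"
    by (metis card_Un_disjoint card_image finite_imageI)
qed

text \<open>For a shifted family the last inclusion holds because the largest element \<open>m + 1\<close> of a member may be exchanged for any
element that the member does not contain.\<close>

lemma shifted_split:
  assumes "shifted N" "N \<subseteq> slice (Suc m) (Suc d)"
  shows "shifted (deletion (Suc m) N)" "shifted (link (Suc m) N)"
    "up_shadow m (link (Suc m) N) \<subseteq> deletion (Suc m) N"
proof -
  show "shifted (deletion (Suc m) N)"
    unfolding shifted_def
  proof (intro ballI allI impI)
    fix F j i assume F: "F \<in> deletion (Suc m) N" "j \<in> F" "1 \<le> i" "i < j" "i \<notin> F"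
    then have "insert i (F - {j}) \<in> N" using assms unfolding shifted_def deletion_def by blast
    moreover have "j \<in> {1..m}" using F(1,2) slice_split(1)[OF assms(2)] unfolding slice_def by blast
    then have "i \<noteq> Suc m" using F(4) by simp
    ultimately show "insert i (F - {j}) \<in> deletion (Suc m) N" using F by (auto simp: deletion_def)
  qed
  show "shifted (link (Suc m) N)"
    unfolding shifted_def
  proof (intro ballI allI impI)
    fix F j i assume F: "F \<in> link (Suc m) N" "j \<in> F" "1 \<le> i" "i < j" "i \<notin> F"
    have Fm: "F \<subseteq> {1..m}" using F(1) slice_split(2)[OF assms(2)] unfolding slice_def by blast
    then have i: "i \<noteq> Suc m" "j \<noteq> Suc m" using F(4) subsetD[OF Fm F(2)] by auto
    have "insert i (insert (Suc m) F - {j}) \<in> N"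
      using assms(1) F i unfolding shifted_def link_def by blast
    moreover have "insert i (insert (Suc m) F - {j}) = insert (Suc m) (insert i (F - {j}))" using i by auto
    ultimately show "insert i (F - {j}) \<in> link (Suc m) N" using F i by (auto simp: link_def)
  qed
  show "up_shadow m (link (Suc m) N) \<subseteq> deletion (Suc m) N"
  proof
    fix G assume "G \<in> up_shadow m (link (Suc m) N)"
    then obtain j F where G: "G = insert j F" "F \<in> link (Suc m) N" "j \<in> {1..m} - F" by (auto simp: up_shadow_def)
    then have "insert j (insert (Suc m) F - {Suc m}) \<in> N"
      using assms(1) unfolding shifted_def link_def by fastforce
    moreover have "insert (Suc m) F - {Suc m} = F" using G by (auto simp: link_def)
    ultimately show "G \<in> deletion (Suc m) N" using G by (auto simp: deletion_def link_def)
  qed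
qed

lemma lexseg_split:
  assumes "lexseg (Suc m) (Suc d) L"
  shows "lexseg m (Suc d) (deletion (Suc m) L)"
  unfolding lexseg_def
proof (intro conjI ballI impI)
  have s: "L \<subseteq> slice (Suc m) (Suc d)" using assms by (simp add: lexseg_def)
  show "deletion (Suc m) L \<subseteq> slice m (Suc d)" using slice_split(1)[OF s] .
  fix F G assume "F \<in> deletion (Suc m) L" "G \<in> slice m (Suc d)" "lex_greater G F"
  moreover have "G \<in> slice (Suc m) (Suc d)" "Suc m \<notin> G" using calculation by (auto simp: slice_def)
  ultimately show "G \<in> deletion (Suc m) L" using assms by (auto simp: deletion_def lexseg_def)
qed

text \<open>If the deletion of \<open>L\<close> were larger than \<open>A\<close>, it would contain a set \<open>V\<close> outside \<open>A\<close>. For \<open>W \<in> B\<close> all sets \<open>W \<union> {j}\<close> lie in \<open>A\<close>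
and hence precede \<open>V\<close>; for the largest possible \<open>j\<close> this forces \<open>W \<union> {m + 1}\<close> to precede \<open>V\<close> as well. So \<open>B\<close> is contained
in the link of \<open>L\<close>, and \<open>L\<close> has more than \<open>card A + card B\<close> elements.\<close>

lemma lexseg_deletion_le:
  assumes L: "lexseg (Suc m) (Suc d) L"
    and A: "lexseg m (Suc d) A" and B: "B \<subseteq> slice m d" "up_shadow m B \<subseteq> A"
    and card: "card L \<le> card A + card B"
  shows "card (deletion (Suc m) L) \<le> card A"
proof (rule ccontr)
  assume n: "\<not> card (deletion (Suc m) L) \<le> card A"
  have Ls: "L \<subseteq> slice (Suc m) (Suc d)" using L by (simp add: lexseg_def)
  have As: "A \<subseteq> slice m (Suc d)" using A by (simp add: lexseg_def)
  have fin: "finite (deletion (Suc m) L)" "finite A" "finite B" "finite (link (Suc m) L)"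
    using slice_split(1,2)[OF Ls] As B finite_subset finite_slice by blast+
  have sub: "A \<subset> deletion (Suc m) L"
    using lexseg_comparable[OF A lexseg_split[OF L]] n by (metis nat_le_linear psubsetI order_refl)
  then obtain V where V: "V \<in> L" "Suc m \<notin> V" "V \<notin> A" by (auto simp: deletion_def)
  then have Vs: "V \<in> slice m (Suc d)" using slice_split(1)[OF Ls] by (auto simp: deletion_def)
  have "B \<subseteq> link (Suc m) L"
  proof
    fix W assume W: "W \<in> B"
    then have Ws: "W \<subseteq> {1..m}" "card W = d" "finite W" using sliceD[OF subsetD[OF B(1)]] by blast+
    have fV: "finite V" "V \<subseteq> {1..m}" "card V = Suc d" using sliceD[OF Vs] by blast+
    have "{1..m} - W \<noteq> {}"
    proof
      assume "{1..m} - W = {}"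
      then have "W = {1..m}" using Ws by auto
      then have "card V \<le> card W" using fV by (intro card_mono) auto
      then show False using fV Ws by simp
    qed
    then have j: "Max ({1..m} - W) \<in> {1..m} - W" by (intro Max_in) auto
    define j where "j = Max ({1..m} - W)"
    have jW: "j \<in> {1..m}" "j \<notin> W" using j by (auto simp: j_def)
    have above: "x \<in> W" if "j < x" "x \<le> m" for x
      using that Max_ge[of "{1..m} - W" x] by (fastforce simp: j_def)
    have WA: "insert j W \<in> A" using B(2) W jW by (auto simp: up_shadow_def)
    have "Suc m \<notin> W" using Ws(1) by auto
    then have Wn: "insert (Suc m) W \<in> slice (Suc m) (Suc d)" "Suc m \<notin> W" using Ws by (auto simp: slice_def)
    have cW: "card (insert j W) = Suc d" using jW Ws by simp
    have "insert j W \<noteq> V" using WA V by blast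
    then have "lex_greater (insert j W) V"
      using lex_greater_total[of V "insert j W"] cW fV Ws A V WA Vs by (auto simp: lexseg_def)
    then obtain t where t: "t \<in> insert j W" "t \<notin> V" "\<And>x. x < t \<Longrightarrow> x \<in> V \<longleftrightarrow> x \<in> insert j W"
      using lex_greater_iff[of V "insert j W"] fV cW Ws by auto
    have "\<not> lex_greater V (insert (Suc m) W)"
    proof
      assume "lex_greater V (insert (Suc m) W)"
      then obtain s where s: "s \<in> V" "s \<notin> insert (Suc m) W" "\<And>x. x < s \<Longrightarrow> x \<in> insert (Suc m) W \<longleftrightarrow> x \<in> V"
        using lex_greater_iff[of "insert (Suc m) W" V] fV Wn Ws by auto
      have "s \<le> m" using s fV by auto
      have "s \<le> j" using above s \<open>s \<le> m\<close> by (meson insertCI not_less)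
      have "j \<le> t \<or> t < j" by linarith
      then show False
      proof
        assume "t < j"
        then have "t \<in> W" using t(1) by simp
        show False
        proof (cases "t < s")
          case True
          then show False using s(3)[OF True] \<open>t \<in> W\<close> t(2) by simp
        next
          case False
          then have "s < t" using s(1) t(2) by (metis linorder_neqE_nat)
          then have "s \<in> insert j W" using t(3) s(1) by blast
          then show False using s(2) \<open>s < t\<close> \<open>t < j\<close> by simp
        qed
      next
        assume "j \<le> t"
        \<comment> \<open>\<open>W\<close> contains everything above \<open>j\<close>, so \<open>V\<close> is contained in \<open>W \<union> {j}\<close> without \<open>t\<close>, which is too small\<close>
        have "V \<subseteq> insert j W - {t}"
        proof
          fix x assume x: "x \<in> V"
          show "x \<in> insert j W - {t}"
          proof (cases "x < t")
            case True
            then show ?thesis using x t(3) by auto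
          next
            case False
            then have "t < x" using x t(2) by (metis linorder_neqE_nat)
            then show ?thesis using above[of x] x fV(2) \<open>j \<le> t\<close> by auto
          qed
        qed
        then have "card V \<le> card (insert j W - {t})" using Ws by (intro card_mono) auto
        then show False using fV cW t(1) Ws by (metis card_Diff1_less finite_insert leD)
      qed
    qed
    moreover have "insert (Suc m) W \<noteq> V" using V by auto
    ultimately have "lex_greater (insert (Suc m) W) V"
      using lex_greater_total[of V "insert (Suc m) W"] fV Wn Ws by auto
    then have "insert (Suc m) W \<in> L" using L V Wn by (auto simp: lexseg_def)
    then show "W \<in> link (Suc m) L" using Wn by (simp add: link_def)
  qed
  then have "card B \<le> card (link (Suc m) L)" using fin by (intro card_mono)
  then show False using n slice_split(3)[OF Ls] card by linarith
qed

lemma low_deletion: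
  assumes "k \<le> m"
  shows "low k (deletion (Suc m) N) = low k N"
proof -
  have "{F \<in> deletion (Suc m) N. F \<subseteq> {1..k}} = {F \<in> N. F \<subseteq> {1..k}}"
    using assms by (auto simp: deletion_def)
  then show ?thesis by (simp add: low_def)
qed

text \<open>Split a shifted family into the deletion and the link of its largest vertex. Replacing both by lexsegments \<open>A\<close> and \<open>B\<close> of
the same sizes keeps the shadow of \<open>B\<close> inside \<open>A\<close>, by the induction hypothesis for \<open>m\<close>; so the deletion of the lexsegment
\<open>L\<close> is no larger than that of \<open>N\<close>, and the induction hypothesis applies to the two deletions.\<close>

theorem low_minimal: "low_minimal m"
proof (induct m)
  case 0
  have "low k L \<le> low k N" if N: "N \<subseteq> slice 0 d" "lexseg 0 d L" "card L \<le> card N" for d N L k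
  proof -
    have "{F \<in> N. F \<subseteq> {1..k}} = N" "{F \<in> L. F \<subseteq> {1..k}} = L"
      using that by (auto simp: slice_def lexseg_def)
    then show ?thesis using that by (simp add: low_def)
  qed
  then show ?case by (simp add: low_minimal_def)
next
  case (Suc m)
  have "low k L \<le> low k N" if N: "N \<subseteq> slice (Suc m) d" "shifted N" and L: "lexseg (Suc m) d L" "card L \<le> card N"
    for d N L k
  proof (cases "k \<le> m \<and> d \<noteq> 0")
    case True
    then obtain e where d: "d = Suc e" using not0_implies_Suc by blast
    note N = N[unfolded d] and L = L[unfolded d]
    have Ls: "L \<subseteq> slice (Suc m) (Suc e)" using L by (simp add: lexseg_def)
    note sN = slice_split[OF N(1)] shifted_split[OF N(2,1)] 
    obtain A where A: "lexseg m (Suc e) A" "card A = card (deletion (Suc m) N)"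
      using lexseg_exists[of "card (deletion (Suc m) N)" m "Suc e"] card_mono[OF finite_slice sN(1)] by blast
    obtain B where B: "lexseg m e B" "card B = card (link (Suc m) N)"
      using lexseg_exists[of "card (link (Suc m) N)" m e] card_mono[OF finite_slice sN(2)] by blast
    have "up_shadow m B \<subseteq> A"
      by (rule kruskal_katona_step[OF Suc sN(2) sN(5) sN(1) sN(6) B(1) _ A(1)]) (simp_all add: A B)
    then have "card (deletion (Suc m) L) \<le> card (deletion (Suc m) N)"
      using lexseg_deletion_le[OF L(1) A(1)] B L(2) sN(3) A by (auto simp: lexseg_def)
    then have "low k (deletion (Suc m) L) \<le> low k (deletion (Suc m) N)"
      using Suc sN lexseg_split[OF L(1)] unfolding low_minimal_def by blast
    then show ?thesis using True by (simp add: low_deletion)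
  next
    case False
    have "F \<subseteq> {1..k}" if "F \<in> slice (Suc m) d" for F
    proof (cases "d = 0")
      case True
      then have "F = {}" using that slice_finite[OF that] by (simp add: slice_def)
      then show ?thesis by simp
    next
      case d: False
      then show ?thesis using False that by (fastforce simp: slice_def)
    qed
    then have "{F \<in> N. F \<subseteq> {1..k}} = N" "{F \<in> L. F \<subseteq> {1..k}} = L"
      using N L by (auto simp: lexseg_def)
    then show ?thesis using L by (simp add: low_def)
  qed
  then show ?case by (simp add: low_minimal_def)
qed

section \<open>Change of coordinates\<close>

lemma homology_iso:
  fixes \<theta> \<theta>' :: "'k::field chain \<Rightarrow> 'k chain"
  assumes L: "lin_seq n M v J" and L': "lin_seq n M v' J'" and m: "m \<le> M"
    and lin: "Vector_Spaces.linear chain_scale chain_scale \<theta>" "Vector_Spaces.linear chain_scale chain_scale \<theta>'"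
    and inv: "\<And>i j c. c \<in> cartan_chains n m i j \<Longrightarrow> \<theta>' (\<theta> c) = c" "\<And>i j c. c \<in> cartan_chains n m i j \<Longrightarrow> \<theta> (\<theta>' c) = c"
    and C: "\<And>i j c. c \<in> cartan_chains n m i j \<Longrightarrow> \<theta> c \<in> cartan_chains n m i j"
      "\<And>i j c. c \<in> cartan_chains n m i j \<Longrightarrow> \<theta>' c \<in> cartan_chains n m i j"
    and D: "\<And>i j c. c \<in> ideal_chains n m J i j \<Longrightarrow> \<theta> c \<in> ideal_chains n m J' i j"
      "\<And>i j c. c \<in> ideal_chains n m J' i j \<Longrightarrow> \<theta>' c \<in> ideal_chains n m J i j"
    and comm: "\<And>i j c. c \<in> cartan_chains n m i j \<Longrightarrow> cartan_diff m v' (\<theta> c) = \<theta> (cartan_diff m v c)"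
  shows "cartan_homology_dim n m v J i j = cartan_homology_dim n m v' J' i j"
proof -
  interpret L: lin_seq n M v J by fact
  interpret L': lin_seq n M v' J' by fact
  have comm': "L.d m (\<theta>' c) = \<theta>' (L'.d m c)" if c: "c \<in> L.C m (Suc i) j" for i j c
  proof -
    have "\<theta>' (L'.d m c) = \<theta>' (L'.d m (\<theta> (\<theta>' c)))" using inv(2)[OF c] by simp
    also have "\<dots> = \<theta>' (\<theta> (L.d m (\<theta>' c)))" using comm[OF C(2)[OF c]] by simp
    also have "\<dots> = L.d m (\<theta>' c)" using inv(1) L.diff_in[OF C(2)[OF c] m] by blast
    finally show ?thesis by simp
  qed
  have Zf: "\<theta> c \<in> L'.Z m i j" if c: "c \<in> L.Z m i j" for c
  proof (cases i)
    case 0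
    then show ?thesis using c C by (simp add: L.Z0 L'.Z0)
  next
    case (Suc i')
    have cC: "c \<in> L.C m (Suc i') j" using c Suc L.Z_sub by blast
    have "L.d m c \<in> L.D m i' j" using L.diff_in[OF cC m] c by (simp add: ideal_chains_def cartan_cycles_def)
    then have "L'.d m (\<theta> c) \<in> L'.D m i' j" unfolding comm[OF cC] by (rule D(1))
    then show ?thesis using C(1)[OF cC] Suc by (simp add: ideal_chains_def cartan_cycles_def)
  qed
  have Zb: "\<theta>' c \<in> L.Z m i j" if c: "c \<in> L'.Z m i j" for c
  proof (cases i)
    case 0
    then show ?thesis using c C by (simp add: L.Z0 L'.Z0)
  next
    case (Suc i')
    have cC: "c \<in> L.C m (Suc i') j" using c Suc L'.Z_sub by blast
    have "L'.d m c \<in> L'.D m i' j" using L'.diff_in[OF cC m] c by (simp add: ideal_chains_def cartan_cycles_def)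
    then have "L.d m (\<theta>' c) \<in> L.D m i' j" unfolding comm'[OF cC] by (rule D(2))
    then show ?thesis using C(2)[OF cC] Suc by (simp add: ideal_chains_def cartan_cycles_def)
  qed
  have Bf: "\<theta> c \<in> L'.B m i j" if cB: "c \<in> L.B m i j" for c
  proof -
    obtain x e where x: "c = L.d m x + e" "x \<in> L.C m (Suc i) j" "e \<in> L.D m i j" using cB by (rule L.BE)
    have "\<theta> c = L'.d m (\<theta> x) + \<theta> e" by (simp add: x(1) cc.linear_add[OF lin(1)] comm[OF x(2)])
    then show ?thesis using L'.BI[OF C(1)[OF x(2)] D(1)[OF x(3)]] by simp
  qed
  have Bb: "\<theta>' c \<in> L.B m i j" if cB: "c \<in> L'.B m i j" for c
  proof -
    obtain x e where x: "c = L'.d m x + e" "x \<in> L.C m (Suc i) j" "e \<in> L'.D m i j" using cB by (rule L'.BE)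
    have "\<theta>' c = L.d m (\<theta>' x) + \<theta>' e" by (simp add: x(1) cc.linear_add[OF lin(2)] comm'[OF x(2)])
    then show ?thesis using L.BI[OF C(2)[OF x(2)] D(2)[OF x(3)]] by simp
  qed
  have Zim: "\<theta> ` L.Z m i j = L'.Z m i j"
  proof (intro equalityI subsetI)
    fix c assume c: "c \<in> L'.Z m i j"
    then have "c = \<theta> (\<theta>' c)" using inv(2) L'.Z_sub by fastforce
    then show "c \<in> \<theta> ` L.Z m i j" using Zb[OF c] by blast
  qed (use Zf in blast)
  have Bim: "\<theta> ` L.B m i j = L'.B m i j"
  proof (intro equalityI subsetI)
    fix c assume c: "c \<in> L'.B m i j"
    then have "c \<in> L.C m i j" using L'.B_sub_Z[OF m] L'.Z_sub by blast
    then have "c = \<theta> (\<theta>' c)" using inv(2) by simp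
    then show "c \<in> \<theta> ` L.B m i j" using Bb[OF c] by blast
  qed (use Bf in blast)
  have inj: "z = 0" if "z \<in> L.Z m i j" "\<theta> z = 0" for z
  proof -
    have "z = \<theta>' (\<theta> z)" using inv(1) that L.Z_sub by fastforce
    then show ?thesis using that cc.linear_0[OF lin(2)] by simp
  qed
  have "chain.dim (L'.Z m i j) = chain.dim (L.Z m i j)"
    unfolding Zim[symmetric] by (rule cc.dim_image_inj[OF lin(1) L.Z_subspace L.Z_fin inj])
  moreover have "chain.dim (L'.B m i j) = chain.dim (L.B m i j)"
    unfolding Bim[symmetric]
    by (rule cc.dim_image_inj[OF lin(1) L.B_subspace L.B_fin[OF m]]) (use inj L.B_sub_Z[OF m] in blast)
  ultimately show ?thesis using L.h_eq[OF m, of i j] L'.h_eq[OF m, of i j] by simp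
qed

subsection \<open>Substitutions in the coefficients\<close>

lemma homology_subst:
  fixes J :: "'k::field ext set"
  assumes L: "lin_seq n M v J" and L': "lin_seq n M v' J'" and m: "m \<le> M"
    and g: "g \<in> carrier_mat n n" "g' \<in> carrier_mat n n" "g * g' = 1\<^sub>m n" "g' * g = 1\<^sub>m n"
    and J: "\<And>u. u \<in> J \<Longrightarrow> lin_subst n g u \<in> J'" "\<And>u. u \<in> J' \<Longrightarrow> lin_subst n g' u \<in> J"
    and v: "\<And>k. k \<in> {1..m} \<Longrightarrow> lin_subst n g (v k) = v' k"
  shows "cartan_homology_dim n m v J i j = cartan_homology_dim n m v' J' i j"
proof -
  interpret L: lin_seq n M v J by fact
  define \<theta> :: "'k mat \<Rightarrow> 'k chain \<Rightarrow> 'k chain" where "\<theta> h c = (\<lambda>a. lin_subst n h (c a))" for h c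
  have alg: "c a \<in> ext_alg n" if "c \<in> cartan_chains n m i j" for c :: "'k chain" and a i j
    using that by (auto simp: cartan_chains_def ext_alg_def)
  have lin: "Vector_Spaces.linear chain_scale chain_scale (\<theta> h)" for h
  proof -
    have "\<theta> h (x + y) = \<theta> h x + \<theta> h y" "\<theta> h (chain_scale r x) = chain_scale r (\<theta> h x)" for x y r
      by (intro ext; simp add: \<theta>_def lin_subst_add lin_subst_scale)+
    then show ?thesis by (simp add: Vector_Spaces.linear_iff chain.vector_space_axioms)
  qed
  have C: "\<theta> h c \<in> cartan_chains n m i j" if c: "c \<in> cartan_chains n m i j" for h c i j
  proof -
    have "a \<in> exponents m i \<and> F \<subseteq> {1..n} \<and> card F + i = j" if nz: "\<theta> h c a F \<noteq> 0" for a F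
    proof -
      have "c a \<noteq> 0"
      proof
        assume "c a = 0"
        then show False using nz by (simp add: \<theta>_def)
      qed
      then obtain G where "c a G \<noteq> 0" by (auto simp: fun_eq_iff)
      then have "a \<in> exponents m i \<and> G \<subseteq> {1..n} \<and> card G + i = j" using c unfolding cartan_chains_def by blast
      then have a: "a \<in> exponents m i" "i \<le> j" by auto
      have "F \<subseteq> {1..n} \<and> card F = j - i" if "c a F \<noteq> 0" for F
      proof -
        have "F \<subseteq> {1..n} \<and> card F + i = j" using c that unfolding cartan_chains_def by blast
        then show ?thesis by auto
      qed
      then have "c a \<in> ext_deg n (j - i)" by (simp add: ext_deg_def)
      then have "\<theta> h c a \<in> ext_deg n (j - i)" unfolding \<theta>_def by (rule lin_subst_in_deg)
      then show ?thesis using nz a by (auto simp: ext_deg_def)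
    qed
    then show ?thesis by (simp add: cartan_chains_def)
  qed
  have inv: "\<theta> h' (\<theta> h c) = c" if "h * h' = 1\<^sub>m n" "h \<in> carrier_mat n n" "h' \<in> carrier_mat n n" "c \<in> cartan_chains n m i j" for h h' c i j
    unfolding \<theta>_def lin_subst_compose[OF that(2,3)] that(1) lin_subst_id[OF alg[OF that(4)]] ..
  show ?thesis
  proof (rule homology_iso[OF L L' m lin[of g] lin[of g']])
    show "\<theta> g' (\<theta> g c) = c" if "c \<in> cartan_chains n m i j" for i j c using inv[OF g(3,1,2) that] .
    show "\<theta> g (\<theta> g' c) = c" if "c \<in> cartan_chains n m i j" for i j c using inv[OF g(4,2,1) that] .
    show "\<theta> g c \<in> ideal_chains n m J' i j" if "c \<in> ideal_chains n m J i j" for i j c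
      using C[of c i j g] J(1) that unfolding ideal_chains_def \<theta>_def by simp
    show "\<theta> g' c \<in> ideal_chains n m J i j" if "c \<in> ideal_chains n m J' i j" for i j c
      using C[of c i j g'] J(2) that unfolding ideal_chains_def \<theta>_def by simp
    show "cartan_diff m v' (\<theta> g c) = \<theta> g (cartan_diff m v c)" if c: "c \<in> cartan_chains n m i j" for i j c
    proof
      fix b
      have "cartan_diff m v' (\<theta> g c) b = (\<Sum>k\<in>{1..m}. lin_subst n g (wedge (c (b(k := Suc (b k)))) (v k)))"
        unfolding cartan_diff_def \<theta>_def
      proof (rule sum.cong[OF refl])
        fix k assume k: "k \<in> {1..m}"
        then have "v k \<in> ext_alg n" using m L.v_alg by simp
        then show "wedge (lin_subst n g (c (b(k := Suc (b k))))) (v' k) = lin_subst n g (wedge (c (b(k := Suc (b k)))) (v k))"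
          using lin_subst_wedge[OF alg[OF c]] v[OF k] by simp
      qed
      then show "cartan_diff m v' (\<theta> g c) b = \<theta> g (cartan_diff m v c) b"
        by (simp add: \<theta>_def cartan_diff_def lin_subst_sum)
    qed
  qed (use C in blast)+
qed

subsection \<open>Linear recombination of the sequence\<close>

text \<open>Divided powers are dual to polynomials: \<open>c\<close> is regarded as the functional \<open>y^a \<mapsto> c a\<close>, on which
  the lowering operators act as multiplication by the variables. A linear change \<open>y\<^sub>k \<mapsto> \<Sum>\<^sub>l U\<^sub>k\<^sub>l y\<^sub>l\<close> of the
  variables acts by precomposition.\<close>

definition comb_lower :: "nat \<Rightarrow> (nat \<Rightarrow> nat \<Rightarrow> 'k::field) \<Rightarrow> nat \<Rightarrow> 'k chain \<Rightarrow> 'k chain" where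
  "comb_lower m U k c = (\<Sum>l\<in>{1..m}. chain_scale (U k l) (lower l c))"

primrec iter_lower :: "nat \<Rightarrow> (nat \<Rightarrow> nat \<Rightarrow> 'k::field) \<Rightarrow> nat \<Rightarrow> (nat \<Rightarrow> nat) \<Rightarrow> 'k chain \<Rightarrow> 'k chain" where
  "iter_lower m U 0 a c = c"
| "iter_lower m U (Suc k) a c = iter_lower m U k a ((comb_lower m U (Suc k) ^^ a (Suc k)) c)"

definition recombine :: "nat \<Rightarrow> (nat \<Rightarrow> nat \<Rightarrow> 'k::field) \<Rightarrow> 'k chain \<Rightarrow> 'k chain" where
  "recombine m U c = (\<lambda>a. if \<forall>k. a k \<noteq> 0 \<longrightarrow> k \<in> {1..m} then iter_lower m U m a c (\<lambda>_. 0) else 0)"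

lemma lower_commute: "lower k (lower l c) = lower l (lower k c)"
proof
  fix b
  have "b(k := Suc (b k), l := Suc ((b(k := Suc (b k))) l)) = b(l := Suc (b l), k := Suc ((b(l := Suc (b l))) k))"
    by (auto simp: fun_eq_iff)
  then show "lower k (lower l c) b = lower l (lower k c) b" by (simp add: lower_def)
qed

text \<open>The operators commute because multiplications by linear forms do; hence their order in \<open>iter_lower\<close> is immaterial.\<close>

lemma comb_lower_commute: "comb_lower m U k (comb_lower m U l c) = comb_lower m U l (comb_lower m U k c)"
proof -
  have eq: "comb_lower m U k (comb_lower m U l c) =
    (\<Sum>s\<in>{1..m}. \<Sum>t\<in>{1..m}. chain_scale (U k s * U l t) (lower s (lower t c)))" for k l
    unfolding comb_lower_def
    by (simp only: cc.linear_sum[OF linear_lower] cc.linear_scale[OF linear_lower] chain.scale_sum_right chain.scale_scale)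
  then show ?thesis
    unfolding eq[of k l] eq[of l k] by (subst sum.swap) (simp only: mult.commute lower_commute)
qed

lemma iter_lower_Suc:
  assumes "k \<in> {1..r}"
  shows "iter_lower m U r (a(k := Suc (a k))) c = iter_lower m U r a (comb_lower m U k c)"
  using assms
proof (induct r arbitrary: c)
  case (Suc r)
  show ?case
  proof (cases "k = Suc r")
    case True
    have "iter_lower m U r (a(k := x)) c = iter_lower m U r a c" if "r < k" for c x r
      using that by (induct r arbitrary: c) auto
    then show ?thesis unfolding True iter_lower.simps fun_upd_same
      by (simp add: funpow_swap1 del: fun_upd_apply)
  next
    case False
    have "comb_lower m U k ((comb_lower m U (Suc r) ^^ x) c) = (comb_lower m U (Suc r) ^^ x) (comb_lower m U k c)" for x
    proof (induct x)
      case (Suc x)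
      show ?case by (simp add: comb_lower_commute[of m U k] Suc)
    qed simp
    then show ?thesis using False Suc by auto
  qed
qed simp

lemma recombine_zero: "recombine m U c (\<lambda>_. 0) = c (\<lambda>_. 0)"
proof -
  have "iter_lower m U k (\<lambda>_. 0) c = c" for k by (induct k arbitrary: c) simp_all
  then show ?thesis by (simp add: recombine_def)
qed

text \<open>Together with \<open>recombine_zero\<close> this determines \<open>recombine\<close>, and all its properties follow by induction on the degree.\<close>

lemma recombine_Suc:
  assumes "k \<in> {1..m}"
  shows "recombine m U c (a(k := Suc (a k))) = recombine m U (comb_lower m U k c) a"
proof -
  have "(\<forall>l. (a(k := Suc (a k))) l \<noteq> 0 \<longrightarrow> l \<in> {1..m}) \<longleftrightarrow> (\<forall>l. a l \<noteq> 0 \<longrightarrow> l \<in> {1..m})" using assms by auto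
  then show ?thesis unfolding recombine_def iter_lower_Suc[OF assms] by simp
qed

lemma recombine_outside: "a \<notin> exponents m e \<Longrightarrow> (\<Sum>k\<in>{1..m}. a k) = e \<Longrightarrow> recombine m U c a = 0"
  by (auto simp: recombine_def exponents_def)

lemma exponents_SucE:
  assumes "a \<in> exponents m (Suc e)"
  obtains k b where "k \<in> {1..m}" "b \<in> exponents m e" "a = b(k := Suc (b k))"
proof -
  have "\<exists>k\<in>{1..m}. a k \<noteq> 0"
  proof (rule ccontr)
    assume "\<not> (\<exists>k\<in>{1..m}. a k \<noteq> 0)"
    then have "(\<Sum>k\<in>{1..m}. a k) = 0" by (intro sum.neutral) blast
    then show False using assms by (simp add: exponents_def)
  qed
  then obtain k where k: "k \<in> {1..m}" "a k \<noteq> 0" by blast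
  define b where "b = a(k := a k - 1)"
  have a: "a = b(k := Suc (b k))" using k by (auto simp: b_def)
  then have "b \<in> exponents m e" using assms exponents_Suc_iff[OF k(1), of b e] by simp
  then show thesis using that k(1) a by blast
qed

lemma recombine_outside_zero:
  assumes "\<And>e. a \<notin> exponents m e"
  shows "recombine m U c a = 0"
  using assms[of "\<Sum>k\<in>{1..m}. a k"] by (rule recombine_outside) simp

lemma linear_comb_lower: "Vector_Spaces.linear chain_scale chain_scale (comb_lower m U k :: 'k::field chain \<Rightarrow> _)"
proof -
  have "comb_lower m U k (x + y) = comb_lower m U k x + comb_lower m U k y"
    "comb_lower m U k (chain_scale r x) = chain_scale r (comb_lower m U k x)" for x y :: "'k chain" and r
    unfolding comb_lower_def
    by (simp_all only: cc.linear_add[OF linear_lower] cc.linear_scale[OF linear_lower] chain.scale_right_distrib 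
        sum.distrib chain.scale_sum_right chain.scale_left_commute)
  then show ?thesis by (simp add: Vector_Spaces.linear_iff chain.vector_space_axioms)
qed

lemma linear_recombine: "Vector_Spaces.linear chain_scale chain_scale (recombine m U :: 'k::field chain \<Rightarrow> _)"
proof -
  have add: "recombine m U (x + y) a = recombine m U x a + recombine m U y a" 
    if "a \<in> exponents m e" for x y :: "'k chain" and a e
    using that
  proof (induct e arbitrary: a x y)
    case 0
    then have "a = (\<lambda>_. 0)" using exponents_zero by blast
    then show ?case by (simp only: recombine_zero plus_fun_apply[of x y])
  next
    case (Suc e)
    obtain k b where kb: "k \<in> {1..m}" "b \<in> exponents m e" "a = b(k := Suc (b k))" using Suc(2) by (rule exponents_SucE)
    show ?case unfolding kb(3) recombine_Suc[OF kb(1)] cc.linear_add[OF linear_comb_lower] by (rule Suc(1)[OF kb(2)])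
  qed
  have scale: "recombine m U (chain_scale r x) a = ext_scale r (recombine m U x a)" 
    if "a \<in> exponents m e" for x :: "'k chain" and a e r
    using that
  proof (induct e arbitrary: a x)
    case 0
    then have "a = (\<lambda>_. 0)" using exponents_zero by blast
    then show ?case by (simp only: recombine_zero chain_scale_apply)
  next
    case (Suc e)
    obtain k b where kb: "k \<in> {1..m}" "b \<in> exponents m e" "a = b(k := Suc (b k))" using Suc(2) by (rule exponents_SucE)
    show ?case unfolding kb(3) recombine_Suc[OF kb(1)] cc.linear_scale[OF linear_comb_lower] by (rule Suc(1)[OF kb(2)])
  qed
  have "recombine m U (x + y) = recombine m U x + recombine m U y"
    "recombine m U (chain_scale r x) = chain_scale r (recombine m U x)" for x y :: "'k chain" and r
  proof -
    show "recombine m U (x + y) = recombine m U x + recombine m U y"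
    proof
      fix a
      show "recombine m U (x + y) a = (recombine m U x + recombine m U y) a"
        using add[of a _ x y] recombine_outside_zero[of a m U x] recombine_outside_zero[of a m U y] 
          recombine_outside_zero[of a m U "x + y"]
        by (cases "\<exists>e. a \<in> exponents m e") auto
    qed
    show "recombine m U (chain_scale r x) = chain_scale r (recombine m U x)"
    proof
      fix a
      show "recombine m U (chain_scale r x) a = chain_scale r (recombine m U x) a"
        using scale[of a _ r x] recombine_outside_zero[of a m U x] recombine_outside_zero[of a m U "chain_scale r x"]
        by (cases "\<exists>e. a \<in> exponents m e") auto
    qed
  qed
  then show ?thesis by (simp add: Vector_Spaces.linear_iff chain.vector_space_axioms)
qed

lemma recombine_0 [simp]: "recombine m U 0 = 0"
  by (rule cc.linear_0[OF linear_recombine])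

lemma recombine_inverse:
  fixes c :: "'k::field chain"
  assumes W: "\<And>k s. k \<in> {1..m} \<Longrightarrow> s \<in> {1..m} \<Longrightarrow> (\<Sum>l\<in>{1..m}. W k l * U l s) = (if k = s then 1 else 0)"
    and c: "c \<in> cartan_chains n m i j"
  shows "recombine m W (recombine m U c) = c"
proof -
  have low: "lower l (recombine m U c) = recombine m U (comb_lower m U l c)" if "l \<in> {1..m}" for l and c :: "'k chain"
    by (intro ext) (simp add: lower_def recombine_Suc[OF that])
  have comm: "comb_lower m W k (recombine m U c) = recombine m U (lower k c)" if k: "k \<in> {1..m}" for k and c :: "'k chain"
  proof -
    have "comb_lower m W k (recombine m U c) = (\<Sum>l\<in>{1..m}. chain_scale (W k l) (recombine m U (comb_lower m U l c)))"
      unfolding comb_lower_def[of m W] by (rule sum.cong) (simp_all add: low)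
    also have "\<dots> = recombine m U (\<Sum>l\<in>{1..m}. chain_scale (W k l) (comb_lower m U l c))"
      by (simp only: cc.linear_sum[OF linear_recombine] cc.linear_scale[OF linear_recombine])
    also have "(\<Sum>l\<in>{1..m}. chain_scale (W k l) (comb_lower m U l c))
      = (\<Sum>s\<in>{1..m}. chain_scale (\<Sum>l\<in>{1..m}. W k l * U l s) (lower s c))"
      unfolding comb_lower_def chain.scale_sum_right chain.scale_scale chain.scale_sum_left by (rule sum.swap)
    also have "\<dots> = (\<Sum>s\<in>{1..m}. if s = k then lower s c else 0)"
      by (rule sum.cong) (use W k in auto)
    also have "\<dots> = lower k c" using k by simp
    finally show ?thesis .
  qed
  have eq: "recombine m W (recombine m U c) a = c a" if "a \<in> exponents m e" for a e and c :: "'k chain"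
    using that
  proof (induct e arbitrary: a c)
    case 0
    then have "a = (\<lambda>_. 0)" using exponents_zero by blast
    then show ?case by (simp only: recombine_zero)
  next
    case (Suc e)
    obtain k b where kb: "k \<in> {1..m}" "b \<in> exponents m e" "a = b(k := Suc (b k))" using Suc(2) by (rule exponents_SucE)
    show ?case unfolding kb(3) recombine_Suc[OF kb(1)] comm[OF kb(1)] Suc(1)[OF kb(2)] lower_def ..
  qed
  show ?thesis
  proof
    fix a
    show "recombine m W (recombine m U c) a = c a"
    proof (cases "\<exists>e. a \<in> exponents m e")
      case True
      then show ?thesis using eq by blast
    next
      case False
      have "c a F = 0" for F using False c by (auto simp: cartan_chains_def)
      then have "c a = 0" by (simp add: fun_eq_iff)
      then show ?thesis using recombine_outside_zero[of a m W] False by metis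
    qed
  qed
qed

lemma comb_lower_in:
  "c \<in> cartan_chains n m (Suc i) (Suc j) \<Longrightarrow> comb_lower m U k c \<in> cartan_chains n m i j"
  unfolding comb_lower_def
  by (intro chain.subspace_sum chain.subspace_scale cartan_chains_subspace lower_in)

lemma comb_lower_zero: "c \<in> cartan_chains n m 0 j \<Longrightarrow> comb_lower m U k c = 0"
proof -
  assume c: "c \<in> cartan_chains n m 0 j"
  have "lower l c = 0" for l
  proof (intro ext)
    fix b F
    have "b(l := Suc (b l)) \<noteq> (\<lambda>_. 0)" by (metis fun_upd_same nat.distinct(1))
    then show "lower l c b F = 0 b F" using c exponents_zero by (auto simp: lower_def cartan_chains_def)
  qed
  then show ?thesis by (simp add: comb_lower_def)
qed

lemma recombine_in:
  fixes c :: "'k::field chain"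
  assumes "c \<in> cartan_chains n m i j"
  shows "recombine m U c \<in> cartan_chains n m i j"
proof -
  have key: "e = i \<and> F \<subseteq> {1..n} \<and> card F + i = j" if "a \<in> exponents m e" "c \<in> cartan_chains n m i j"
    "recombine m U c a F \<noteq> 0" for a e i j F and c :: "'k chain"
    using that
  proof (induct e arbitrary: a c i j)
    case 0
    then have "a = (\<lambda>_. 0)" using exponents_zero by blast
    then have "c (\<lambda>_. 0) F \<noteq> 0" using 0 by (simp add: recombine_zero)
    then have "(\<lambda>_. 0) \<in> exponents m i" "F \<subseteq> {1..n}" "card F + i = j" using 0 by (auto simp: cartan_chains_def)
    then show ?case by (simp add: exponents_def)
  next
    case (Suc e)
    obtain k b where kb: "k \<in> {1..m}" "b \<in> exponents m e" "a = b(k := Suc (b k))" using Suc(2) by (rule exponents_SucE)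
    have nz: "recombine m U (comb_lower m U k c) b F \<noteq> 0" using Suc(4) unfolding kb(3) recombine_Suc[OF kb(1)] .
    show ?case
    proof (cases i)
      case 0
      then have "comb_lower m U k c = 0" using comb_lower_zero Suc(3) by blast
      then show ?thesis using nz by simp
    next
      case i: (Suc i')
      show ?thesis
      proof (cases j)
        case 0
        have "c x G = 0" for x G using Suc(3) i 0 by (auto simp: cartan_chains_def)
        then have "c = 0" by (simp add: fun_eq_iff)
        then have "comb_lower m U k c = 0" using cc.linear_0[OF linear_comb_lower] by blast
        then show ?thesis using nz by simp
      next
        case j: (Suc j')
        have "comb_lower m U k c \<in> cartan_chains n m i' j'" using Suc(3) i j by (intro comb_lower_in) simp
        then show ?thesis using Suc(1)[OF kb(2) _ nz] i j by simp
      qed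
    qed
  qed
  have "a \<in> exponents m i \<and> F \<subseteq> {1..n} \<and> card F + i = j" if nz: "recombine m U c a F \<noteq> 0" for a F
  proof -
    obtain e where e: "a \<in> exponents m e"
      using nz recombine_outside_zero[of a m U c] by (metis zero_fun_apply)
    show ?thesis using key[OF e assms nz] e by simp
  qed
  then show ?thesis by (simp add: cartan_chains_def)
qed

lemma recombine_ideal:
  fixes c :: "'k::field chain"
  assumes J: "ext.subspace J" and c: "\<And>a. c a \<in> J"
  shows "recombine m U c a \<in> J"
proof -
  have "recombine m U c a \<in> J" if "a \<in> exponents m e" "\<And>a. c a \<in> J" for a e and c :: "'k chain"
    using that
  proof (induct e arbitrary: a c)
    case 0
    then have "a = (\<lambda>_. 0)" using exponents_zero by blast
    then show ?case using 0 by (simp add: recombine_zero)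
  next
    case (Suc e)
    obtain k b where kb: "k \<in> {1..m}" "b \<in> exponents m e" "a = b(k := Suc (b k))" using Suc(2) by (rule exponents_SucE)
    have "comb_lower m U k c a = (\<Sum>l\<in>{1..m}. ext_scale (U k l) (c (a(l := Suc (a l)))))" for a
      by (simp add: comb_lower_def sum_fun_apply lower_def)
    then have "comb_lower m U k c a \<in> J" for a
      by (simp only:) (intro ext.subspace_sum[OF J] ext.subspace_scale[OF J] Suc(3))
    then show ?case unfolding kb(3) recombine_Suc[OF kb(1)] by (intro Suc(1)[OF kb(2)])
  qed
  then show ?thesis using c recombine_outside_zero[of a m U c] ext.subspace_0[OF J] by metis
qed

lemma recombine_right_mult:
  fixes c :: "'k::field chain"
  shows "recombine m U (right_mult w c) = right_mult w (recombine m U c)"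
proof
  fix a
  have comb: "comb_lower m U k (right_mult w c) = right_mult w (comb_lower m U k c)" for k and c :: "'k chain"
  proof -
    have "lower l (right_mult w c) = right_mult w (lower l c)" for l by (simp add: lower_def right_mult_def)
    then show ?thesis unfolding comb_lower_def
      by (simp only: cc.linear_sum[OF linear_right_mult] cc.linear_scale[OF linear_right_mult])
  qed
  have eq: "recombine m U (right_mult w c) a = right_mult w (recombine m U c) a" if "a \<in> exponents m e" for a e and c :: "'k chain"
    using that
  proof (induct e arbitrary: a c)
    case 0
    then have "a = (\<lambda>_. 0)" using exponents_zero by blast
    then show ?case by (simp only: recombine_zero right_mult_def)
  next
    case (Suc e)
    obtain k b where kb: "k \<in> {1..m}" "b \<in> exponents m e" "a = b(k := Suc (b k))" using Suc(2) by (rule exponents_SucE)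
    have "right_mult w (recombine m U c) a = right_mult w (recombine m U (comb_lower m U k c)) b"
      unfolding right_mult_def kb(3) recombine_Suc[OF kb(1)] ..
    moreover have "recombine m U (right_mult w c) a = recombine m U (right_mult w (comb_lower m U k c)) b"
      unfolding kb(3) recombine_Suc[OF kb(1)] comb ..
    ultimately show ?case using Suc(1)[OF kb(2), of "comb_lower m U k c"] by (simp only:)
  qed
  show "recombine m U (right_mult w c) a = right_mult w (recombine m U c) a"
  proof (cases "\<exists>e. a \<in> exponents m e")
    case True
    then show ?thesis using eq by blast
  next
    case False
    then have "recombine m U (right_mult w c) a = 0" "recombine m U c a = 0" using recombine_outside_zero by blast+
    then show ?thesis by (simp add: right_mult_def)
  qed
qed

text \<open>The homology depends on the span of the sequence only. Over a field of positive characteristic the divided powers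
cannot be expressed by powers, but the dual description of the change of variables is characteristic free.\<close>

lemma homology_recombine:
  fixes J :: "'k::field ext set"
  assumes L: "lin_seq n M v J" and L': "lin_seq n M v' J" and m: "m \<le> M"
    and W: "\<And>k s. k \<in> {1..m} \<Longrightarrow> s \<in> {1..m} \<Longrightarrow> (\<Sum>l\<in>{1..m}. W k l * U l s) = (if k = s then 1 else 0)"
      "\<And>k s. k \<in> {1..m} \<Longrightarrow> s \<in> {1..m} \<Longrightarrow> (\<Sum>l\<in>{1..m}. U k l * W l s) = (if k = s then 1 else 0)"
    and v: "\<And>l. l \<in> {1..m} \<Longrightarrow> v l = (\<Sum>k\<in>{1..m}. ext_scale (U k l) (v' k))"
  shows "cartan_homology_dim n m v J i j = cartan_homology_dim n m v' J i j"
proof -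
  interpret L: lin_seq n M v J by fact
  have J: "ext.subspace J" using graded_ideal_subspace[OF L.J] .
  have diff_alt: "cartan_diff m w c = (\<Sum>k\<in>{1..m}. right_mult (w k) (lower k c))" for w and c :: "'k chain"
    by (intro ext) (simp add: cartan_diff_def right_mult_def lower_def sum_fun_apply)
  have rm: "right_mult (\<Sum>k\<in>{1..m}. ext_scale (r k) (w k)) c = (\<Sum>k\<in>{1..m}. chain_scale (r k) (right_mult (w k) c))"
    for r w and c :: "'k chain"
    by (intro ext) (simp add: right_mult_def wedge_sum_right wedge_scale_right sum_fun_apply)
  show ?thesis
  proof (rule homology_iso[OF L L' m linear_recombine[of m U] linear_recombine[of m W]])
    show "recombine m W (recombine m U c) = c" if "c \<in> cartan_chains n m i j" for i j and c :: "'k chain"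
      using recombine_inverse[OF W(1) that] .
    show "recombine m U (recombine m W c) = c" if "c \<in> cartan_chains n m i j" for i j and c :: "'k chain"
      using recombine_inverse[OF W(2) that] .
    show "recombine m U c \<in> ideal_chains n m J i j" if "c \<in> ideal_chains n m J i j" for i j c
      using that recombine_in recombine_ideal[OF J] by (auto simp: ideal_chains_def)
    show "recombine m W c \<in> ideal_chains n m J i j" if "c \<in> ideal_chains n m J i j" for i j c
      using that recombine_in recombine_ideal[OF J] by (auto simp: ideal_chains_def)
    fix i j :: nat and c :: "'k chain"
    have low: "lower l (recombine m U c) = recombine m U (comb_lower m U l c)" if "l \<in> {1..m}" for l
      by (intro ext) (simp add: lower_def recombine_Suc[OF that])
    have "cartan_diff m v' (recombine m U c) = (\<Sum>k\<in>{1..m}. recombine m U (right_mult (v' k) (comb_lower m U k c)))"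
      unfolding diff_alt by (rule sum.cong) (simp_all add: low recombine_right_mult)
    also have "\<dots> = recombine m U (\<Sum>k\<in>{1..m}. \<Sum>l\<in>{1..m}. chain_scale (U k l) (right_mult (v' k) (lower l c)))"
      unfolding comb_lower_def
      by (simp only: cc.linear_sum[OF linear_recombine] cc.linear_sum[OF linear_right_mult] cc.linear_scale[OF linear_right_mult])
    also have "(\<Sum>k\<in>{1..m}. \<Sum>l\<in>{1..m}. chain_scale (U k l) (right_mult (v' k) (lower l c))) =
       (\<Sum>l\<in>{1..m}. right_mult (v l) (lower l c))"
      by (subst sum.swap, rule sum.cong[OF refl]) (simp only: v rm)
    finally show "cartan_diff m v' (recombine m U c) = recombine m U (cartan_diff m v c)" unfolding diff_alt .
  qed (use recombine_in in blast)+
qed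

section \<open>Stable ideals along generic sequences\<close>

text \<open>The substitution \<open>e\<^sub>q \<mapsto> e\<^sub>q + \<Sum>\<^bsub>l<q\<^esub> y\<^sub>l e\<^sub>l\<close> that fixes the other variables.\<close>

definition elem_mat :: "nat \<Rightarrow> nat \<Rightarrow> (nat \<Rightarrow> 'k::field) \<Rightarrow> 'k mat" where
  "elem_mat n q y = mat n n (\<lambda>(i, l). (if i = l then 1 else 0) + (if Suc i = q \<and> Suc l < q then y (Suc l) else 0))"

lemma elem_mat_carrier [simp]: "elem_mat n q y \<in> carrier_mat n n"
  by (simp add: elem_mat_def)

lemma elem_mat_inverse: "elem_mat n q y * elem_mat n q (\<lambda>l. - y l) = (1\<^sub>m n :: 'k::field mat)"
proof (rule eq_matI)
  fix i l assume "i < dim_row (1\<^sub>m n :: 'k mat)" "l < dim_col (1\<^sub>m n :: 'k mat)"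
  then have il: "i < n" "l < n" by auto
  define e where "e = (\<lambda>i l :: nat. if Suc i = q \<and> Suc l < q then y (Suc l) else 0)"
  have "(elem_mat n q y * elem_mat n q (\<lambda>l. - y l)) $$ (i, l)
     = (\<Sum>s = 0..<n. ((if i = s then 1 else 0) + e i s) * ((if s = l then 1 else 0) - e s l))"
    using il unfolding elem_mat_def e_def by (auto simp: scalar_prod_def intro!: sum.cong)
  also have "\<dots> = (\<Sum>s = 0..<n. (if s = i then (if s = l then 1 else 0) - e s l else 0) + (if s = l then e i s else 0))"
  proof (rule sum.cong[OF refl])
    fix s
    have "e i s * e s l = 0" by (auto simp: e_def)
    then show "((if i = s then 1 else 0) + e i s) * ((if s = l then 1 else 0) - e s l) =
        (if s = i then (if s = l then 1 else 0) - e s l else 0) + (if s = l then e i s else 0)"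
      by (auto simp: algebra_simps)
  qed
  also have "\<dots> = (if i = l then 1 else 0)" using il unfolding sum.distrib by simp
  finally show "(elem_mat n q y * elem_mat n q (\<lambda>l. - y l)) $$ (i, l) = 1\<^sub>m n $$ (i, l)" using il by simp
qed (simp_all add: elem_mat_def)

lemma lin_form_elem_mat:
  assumes "k \<in> {1..n}"
  shows "lin_form n (elem_mat n q y) k =
    ext_mono {k} + (if k = q then (\<Sum>l\<in>{1..<q}. ext_scale (y l) (ext_mono {l})) else (0 :: 'k::field ext))"
proof -
  have "lin_form n (elem_mat n q y) k =
     (\<Sum>l\<in>{1..n}. (if l = k then ext_mono {l} else 0) + (if k = q \<and> l < q then ext_scale (y l) (ext_mono {l}) else (0 :: 'k ext)))"
    unfolding lin_form_def
  proof (rule sum.cong[OF refl])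
    fix l assume l: "l \<in> {1..n}"
    have "elem_mat n q y $$ (k - 1, l - 1) = (if k = l then 1 else 0) + (if k = q \<and> l < q then y l else 0)"
      unfolding elem_mat_def using l assms by auto
    then show "ext_scale (elem_mat n q y $$ (k - 1, l - 1)) (ext_mono {l}) =
      (if l = k then ext_mono {l} else 0) + (if k = q \<and> l < q then ext_scale (y l) (ext_mono {l}) else (0 :: 'k ext))"
      by (auto simp: ext.scale_left_distrib)
  qed
  also have "\<dots> = ext_mono {k} + (\<Sum>l\<in>{1..n}. if k = q \<and> l < q then ext_scale (y l) (ext_mono {l}) else 0)"
    unfolding sum.distrib using assms by simp
  also have "(\<Sum>l\<in>{1..n}. if k = q \<and> l < q then ext_scale (y l) (ext_mono {l}) else (0 :: 'k ext)) =
     (if k = q then (\<Sum>l\<in>{1..<q}. ext_scale (y l) (ext_mono {l})) else 0)"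
  proof (cases "k = q")
    case True
    have "(\<Sum>l\<in>{1..n}. if k = q \<and> l < q then ext_scale (y l) (ext_mono {l}) else (0 :: 'k ext))
       = (\<Sum>l\<in>{1..<q}. if k = q \<and> l < q then ext_scale (y l) (ext_mono {l}) else (0 :: 'k ext))"
      by (rule sum.mono_neutral_right) (use True assms in auto)
    also have "\<dots> = (\<Sum>l\<in>{1..<q}. ext_scale (y l) (ext_mono {l}))" by (rule sum.cong) (use True in auto)
    finally show ?thesis using True by simp
  next
    case False
    then show ?thesis by simp
  qed
  finally show ?thesis .
qed

lemma elem_subst_mono_fixed:
  assumes "finite F" "F \<subseteq> {1..n}" "q \<notin> F"
  shows "subst_mono n (elem_mat n q y) F = (ext_mono F :: 'k::field ext)"
  using assms
proof (induct F rule: finite_linorder_min_induct)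
  case (insert b A)
  have bA: "b \<notin> A" using insert by blast
  have "shuffle_sign {b} A = (1 :: 'k)" by (rule shuffle_sign_sorted) (use insert in force)
  then have "ext_mono (insert b A) = wedge (ext_mono {b}) (ext_mono A :: 'k ext)"
    using insert bA by (simp add: wedge_mono_mono)
  moreover have "lin_form n (elem_mat n q y) b = (ext_mono {b} :: 'k ext)"
    using insert by (subst lin_form_elem_mat) auto
  ultimately show ?case using insert by (simp add: subst_mono_insert)
qed simp

lemma elem_subst_mono:
  assumes F: "F \<subseteq> {1..n}" "q \<in> F"
  shows "lin_subst n (elem_mat n q y) (ext_mono F) = ext_mono F +
    ext_scale (inverse (shuffle_sign {q} (F - {q})))
      (\<Sum>l\<in>{1..<q}. ext_scale (y l) (wedge (ext_mono {l}) (ext_mono (F - {q})) :: 'k::field ext))"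
proof -
  let ?s = "shuffle_sign {q} (F - {q}) :: 'k" and ?g = "elem_mat n q y"
  have fin: "finite F" using F finite_subset by blast
  have q: "q \<in> {1..n}" using F by blast
  have eq: "ext_mono F = ext_scale (inverse ?s) (wedge (ext_mono {q}) (ext_mono (F - {q})))"
    using F fin by (simp add: wedge_mono_mono insert_absorb)
  have "lin_subst n ?g (wedge (ext_mono {q}) (ext_mono (F - {q})))
     = wedge (lin_form n ?g q) (subst_mono n ?g (F - {q}))"
    by (rule wedge_lin_form_subst_mono) (use fin F q in auto)
  also have "subst_mono n ?g (F - {q}) = ext_mono (F - {q})"
    by (rule elem_subst_mono_fixed) (use fin F in auto)
  also have "lin_form n ?g q = ext_mono {q} + (\<Sum>l\<in>{1..<q}. ext_scale (y l) (ext_mono {l}))"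
    using lin_form_elem_mat[OF q, of q y] by simp
  finally have "lin_subst n ?g (ext_mono F) = ext_scale (inverse ?s) (wedge (ext_mono {q}) (ext_mono (F - {q}))
      + (\<Sum>l\<in>{1..<q}. ext_scale (y l) (wedge (ext_mono {l}) (ext_mono (F - {q})))))"
    by (subst eq) (simp only: lin_subst_scale wedge_add_left wedge_sum_left wedge_scale_left)
  then show ?thesis unfolding ext.scale_right_distrib using eq by simp
qed

text \<open>Each monomial \<open>e\<^sub>F\<close> with \<open>q \<in> F\<close> picks up terms \<open>e\<^sub>l e\<^bsub>F-{q}\<^esub>\<close> with \<open>l < q\<close>, which lie in the ideal by strong stability.\<close>

lemma elem_subst_shifted:
  assumes S: "upset n S" "shifted S" and u: "u \<in> ext_coord S"
  shows "lin_subst n (elem_mat n q y) u \<in> (ext_coord S :: 'k::field ext set)"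
proof -
  have mono: "ext_mono F \<in> (ext_coord S :: 'k ext set)" if "F \<in> S" for F
    using that by (auto simp: ext_coord_def ext_mono_apply split: if_splits)
  have sub: "F \<subseteq> {1..n}" "finite F" if "F \<in> S" for F
  proof -
    show "F \<subseteq> {1..n}" using that S(1) by (auto simp: upset_def)
    then show "finite F" using finite_subset by blast
  qed
  have key: "lin_subst n (elem_mat n q y) (ext_mono F) \<in> (ext_coord S :: 'k ext set)" if F: "F \<in> S" for F
  proof (cases "q \<in> F")
    case False
    then show ?thesis using sub[OF F] mono[OF F] by (simp add: lin_subst_mono elem_subst_mono_fixed)
  next
    case True
    have "wedge (ext_mono {l}) (ext_mono (F - {q})) \<in> (ext_coord S :: 'k ext set)" if l: "l \<in> {1..<q}" for l
    proof (cases "l \<in> F")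
      case True
      then have "{l} \<inter> (F - {q}) \<noteq> {}" using l by auto
      then show ?thesis by (simp add: wedge_mono_mono ext.subspace_0[OF ext_coord_subspace] del: Int_insert_left)
    next
      case False
      then have "insert l (F - {q}) \<in> S" using S(2) F True l unfolding shifted_def by auto
      then show ?thesis using mono[of "insert l (F - {q})"]
        by (auto simp: wedge_mono_mono intro: ext.subspace_scale[OF ext_coord_subspace] ext.subspace_0[OF ext_coord_subspace])
    qed
    then show ?thesis unfolding elem_subst_mono[OF sub(1)[OF F] True]
      by (intro ext.subspace_add[OF ext_coord_subspace] ext.subspace_scale[OF ext_coord_subspace]
          ext.subspace_sum[OF ext_coord_subspace] mono[OF F])
  qed
  have ua: "u \<in> ext_alg n" using u sub(1) by (auto simp: ext_coord_def ext_alg_def)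
  have "lin_subst n (elem_mat n q y) u = (\<Sum>F\<in>Pow {1..n}. ext_scale (u F) (lin_subst n (elem_mat n q y) (ext_mono F)))"
    by (subst ext_expansion[OF ua]) (simp only: lin_subst_sum lin_subst_scale)
  also have "\<dots> \<in> ext_coord S"
  proof (rule ext.subspace_sum[OF ext_coord_subspace])
    fix F
    show "ext_scale (u F) (lin_subst n (elem_mat n q y) (ext_mono F)) \<in> ext_coord S"
      using u key[of F] ext.subspace_scale[OF ext_coord_subspace, of _ S] ext.subspace_0[OF ext_coord_subspace, of S]
      by (cases "u F = 0") (auto simp: ext_coord_def)
  qed
  finally show ?thesis .
qed

lemma units_mat:
  assumes "B \<in> carrier_mat p p" "det B \<noteq> (0 :: 'k::field)"
  obtains W where "W \<in> carrier_mat p p" "W * B = 1\<^sub>m p" "B * W = 1\<^sub>m p"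
  using det_non_zero_imp_unit[OF assms, of undefined] by (auto simp: Units_def ring_mat_def)

lemma mat_mult_entry:
  assumes "X \<in> carrier_mat p p" "Y \<in> carrier_mat p p" "X * Y = 1\<^sub>m p" "k \<in> {1..p}" "s \<in> {1..p}"
  shows "(\<Sum>l\<in>{1..p}. X $$ (k - 1, l - 1) * Y $$ (l - 1, s - 1)) = (if k = s then 1 else (0 :: 'k::field))"
proof -
  have ks: "k - 1 < p" "s - 1 < p" using assms by auto
  have "(\<Sum>l\<in>{1..p}. X $$ (k - 1, l - 1) * Y $$ (l - 1, s - 1)) = (\<Sum>l = 0..<p. X $$ (k - 1, l) * Y $$ (l, s - 1))"
    by (rule sum.reindex_bij_witness[of _ Suc "\<lambda>l. l - 1"]) auto
  also have "\<dots> = (X * Y) $$ (k - 1, s - 1)" using assms(1,2) ks by (simp add: scalar_prod_def)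
  also have "\<dots> = (if k = s then 1 else 0)" unfolding assms(3) using ks assms(4,5) by auto
  finally show ?thesis .
qed

text \<open>The coefficients of \<open>e\<^sub>n, \<dots>, e\<^bsub>n+1-p\<^esub>\<close> in this order. If this block is invertible, the sequence can be recombined so
that it agrees with \<open>e\<^sub>n, \<dots>, e\<^bsub>n+1-p\<^esub>\<close> up to smaller variables.\<close>

definition last_block :: "nat \<Rightarrow> nat \<Rightarrow> 'k mat \<Rightarrow> 'k mat" where
  "last_block n p A = mat p p (\<lambda>(k, s). A $$ (k, n - 1 - s))"

lemma last_block_generic:
  assumes "p \<le> n"
  shows "for_generic p n (\<lambda>A. det (last_block n p A) \<noteq> (0 :: 'k::field))"
proof -
  have "poly_fun p n (\<lambda>A. det (last_block n p A) :: 'k)"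
  proof -
    have c: "last_block n p A \<in> carrier_mat p p" for A :: "'k mat" by (simp add: last_block_def)
    have "poly_fun p n (\<lambda>A. \<Sum>\<pi> | \<pi> permutes {0..<p}. signof \<pi> * (\<Prod>i = 0..<p. (last_block n p A) $$ (i, \<pi> i)) :: 'k)"
    proof (intro poly_fun_sum poly_fun.mult poly_fun.const poly_fun_prod)
      fix \<pi> i assume "\<pi> \<in> {\<pi>. \<pi> permutes {0..<p}}" "i \<in> {0..<p}"
      then have i: "i < p" "\<pi> i < p" using permutes_in_image[of \<pi> "{0..<p}" i] by auto
      then have "poly_fun p n (\<lambda>A :: 'k mat. A $$ (i, n - 1 - \<pi> i))" using assms by (intro poly_fun.entry) auto
      then show "poly_fun p n (\<lambda>A :: 'k mat. last_block n p A $$ (i, \<pi> i))" using i by (simp add: last_block_def)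
    qed
    then show ?thesis unfolding det_def'[OF c] .
  qed
  moreover define A :: "'k mat" where "A = mat p n (\<lambda>(k, l). if k + l = n - 1 then 1 else 0)"
  have "last_block n p A = 1\<^sub>m p" using assms by (intro eq_matI) (auto simp: last_block_def A_def)
  then have "det (last_block n p A) = 1" by simp
  moreover have "A \<in> carrier_mat p n" by (simp add: A_def)
  ultimately show ?thesis unfolding for_generic_def by (intro exI[of _ "\<lambda>A. det (last_block n p A)"] conjI bexI[of _ A]) auto
qed

text \<open>A generic sequence can be moved to the last variables by a recombination of its members followed by
  triangular substitutions, under which a strongly stable ideal is invariant.\<close>

lemma stable_generic_homology:
  fixes A :: "'k::field mat"
  assumes S: "upset n S" "shifted S" and p: "p \<le> n" and A: "A \<in> carrier_mat p n" "det (last_block n p A) \<noteq> 0"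
  shows "cartan_homology_dim n p (lin_form n A) (ext_coord S) i j
    = cartan_homology_dim n p (last_vars n) (ext_coord S :: 'k ext set) i j"
proof -
  let ?J = "ext_coord S :: 'k ext set"
  have J: "graded_ideal n ?J" using upset_graded_ideal[OF S(1)] .
  define B where "B = last_block n p A"
  have B: "B \<in> carrier_mat p p" by (simp add: B_def last_block_def)
  obtain W where W: "W \<in> carrier_mat p p" "W * B = 1\<^sub>m p" "B * W = 1\<^sub>m p"
    using units_mat[OF B] A(2) B_def by blast
  define v where "v s = (\<Sum>k\<in>{1..p}. ext_scale (W $$ (s - 1, k - 1)) (lin_form n A k))" for s
  have v1: "v s \<in> ext_deg n 1" for s unfolding v_def
    by (intro ext.subspace_sum ext.subspace_scale ext_subspaces lin_form_deg_one)
  have Lv: "lin_seq n p v ?J" by unfold_locales (use J v1 in auto)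
  have LA: "lin_seq n p (lin_form n A) ?J" by (rule lin_seq_lin_form[OF J])
  have A_v: "lin_form n A l = (\<Sum>s\<in>{1..p}. ext_scale (B $$ (l - 1, s - 1)) (v s))" if l: "l \<in> {1..p}" for l
  proof -
    have "(\<Sum>s\<in>{1..p}. ext_scale (B $$ (l - 1, s - 1)) (v s)) =
      (\<Sum>k\<in>{1..p}. ext_scale (\<Sum>s\<in>{1..p}. B $$ (l - 1, s - 1) * W $$ (s - 1, k - 1)) (lin_form n A k))"
      unfolding v_def ext.scale_sum_right ext.scale_scale ext.scale_sum_left by (rule sum.swap)
    also have "\<dots> = (\<Sum>k\<in>{1..p}. if k = l then lin_form n A k else 0)"
      by (rule sum.cong) (use mat_mult_entry[OF B W(1,3) l] in auto)
    also have "\<dots> = lin_form n A l" using l by simp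
    finally show ?thesis by simp
  qed
  have "cartan_homology_dim n p (lin_form n A) ?J i j = cartan_homology_dim n p v ?J i j"
  proof (rule homology_recombine[OF LA Lv order_refl, where U = "\<lambda>k l. B $$ (l - 1, k - 1)" and W = "\<lambda>k l. W $$ (l - 1, k - 1)"])
    fix k s assume ks: "k \<in> {1..p}" "s \<in> {1..p}"
    show "(\<Sum>l\<in>{1..p}. W $$ (l - 1, k - 1) * B $$ (s - 1, l - 1)) = (if k = s then 1 else 0)"
      using mat_mult_entry[OF B W(1,3) ks(2,1)] by (simp add: mult.commute)
    show "(\<Sum>l\<in>{1..p}. B $$ (l - 1, k - 1) * W $$ (s - 1, l - 1)) = (if k = s then 1 else 0)"
      using mat_mult_entry[OF W(1) B W(2) ks(2,1)] by (simp add: mult.commute)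
  qed (rule A_v)
  also have "\<dots> = cartan_homology_dim n p (last_vars n) ?J i j"
  proof -
    have coef: "v s {n + 1 - r} = (if s = r then 1 else 0)" if sr: "s \<in> {1..p}" "r \<in> {1..p}" for s r
    proof -
      have "v s {n + 1 - r} = (\<Sum>k\<in>{1..p}. W $$ (s - 1, k - 1) * B $$ (k - 1, r - 1))"
        unfolding v_def sum_fun_apply ext_scale_apply
      proof (rule sum.cong[OF refl])
        fix k assume k: "k \<in> {1..p}"
        have "n + 1 - r \<in> {1..n}" "k - 1 < p" "r - 1 < p" "n + 1 - r - 1 = n - 1 - (r - 1)" using sr k p by auto
        then show "W $$ (s - 1, k - 1) * lin_form n A k {n + 1 - r} = W $$ (s - 1, k - 1) * B $$ (k - 1, r - 1)"
          by (simp add: lin_form_apply B_def last_block_def)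
      qed
      then show ?thesis using mat_mult_entry[OF W(1) B W(2) sr] by simp
    qed
    have v_exp: "v s = ext_mono {n + 1 - s} + (\<Sum>l\<in>{1..n - p}. ext_scale (v s {l}) (ext_mono {l}))" if s: "s \<in> {1..p}" for s
    proof -
      have "v s = (\<Sum>l\<in>{1..n}. ext_scale (v s {l}) (ext_mono {l}))" by (rule deg_one_expansion[OF v1])
      also have "{1..n} = {1..n - p} \<union> {n - p + 1..n}" using p by auto
      also have "(\<Sum>l\<in>{1..n - p} \<union> {n - p + 1..n}. ext_scale (v s {l}) (ext_mono {l})) =
         (\<Sum>l\<in>{1..n - p}. ext_scale (v s {l}) (ext_mono {l})) + (\<Sum>l\<in>{n - p + 1..n}. ext_scale (v s {l}) (ext_mono {l}))"
        by (rule sum.union_disjoint) auto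
      also have "(\<Sum>l\<in>{n - p + 1..n}. ext_scale (v s {l}) (ext_mono {l})) = (\<Sum>l\<in>{n - p + 1..n}. if l = n + 1 - s then ext_mono {l} else 0)"
      proof (rule sum.cong[OF refl])
        fix l assume l: "l \<in> {n - p + 1..n}"
        then have r: "n + 1 - l \<in> {1..p}" "n + 1 - (n + 1 - l) = l" using p by auto
        have "v s {l} = (if s = n + 1 - l then 1 else 0)" using coef[OF s r(1)] r(2) by simp
        moreover have "s = n + 1 - l \<longleftrightarrow> l = n + 1 - s" using l s p by auto
        ultimately show "ext_scale (v s {l}) (ext_mono {l}) = (if l = n + 1 - s then ext_mono {l} else 0)" by simp
      qed
      also have "\<dots> = ext_mono {n + 1 - s}"
      proof -
        have "n + 1 - s \<in> {n - p + 1..n}" using s p by auto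
        then show ?thesis by simp
      qed
      finally show ?thesis by (rule trans[OF _ add.commute])
    qed
    \<comment> \<open>interpolates between the last variables and \<open>v\<close>; one triangular substitution changes one form at a time\<close>
    define w where "w t s = (if s \<le> t then v s else last_vars n s)" for t s
    have "w t k \<in> ext_deg n 1" if k: "k \<in> {1..p}" for t k
    proof -
      have "k \<in> {1..n}" using k p by auto
      then show ?thesis unfolding w_def using v1[of k] last_vars_deg[of k n] by (cases "k \<le> t") simp_all
    qed
    then have Lw: "lin_seq n p (w t) ?J" for t
      by unfold_locales (use J in simp_all)
    have step: "cartan_homology_dim n p (w t) ?J i j = cartan_homology_dim n p (w (Suc t)) ?J i j" if t: "Suc t \<le> p" for t
    proof -
      define q where "q = n - t"
      have q: "q \<in> {1..n}" "q = n + 1 - Suc t" "n - p < q" using t p by (auto simp: q_def)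
      define y where "y l = (if l \<le> n - p then v (Suc t) {l} else 0)" for l
      let ?g = "elem_mat n q y" and ?g' = "elem_mat n q (\<lambda>l. - y l)"
      have gg: "?g * ?g' = 1\<^sub>m n" "?g' * ?g = 1\<^sub>m n"
        using elem_mat_inverse[of n q y] elem_mat_inverse[of n q "\<lambda>l. - y l"] by simp_all
      have fixd: "lin_subst n ?g (ext_mono {l}) = (ext_mono {l} :: 'k ext)" if "l \<in> {1..n}" "l \<noteq> q" for l
        using that by (simp add: lin_subst_var lin_form_elem_mat)
      show ?thesis
      proof (rule homology_subst[OF Lw Lw order_refl elem_mat_carrier elem_mat_carrier gg])
        fix k assume k: "k \<in> {1..p}"
        consider "k \<le> t" | "k = Suc t" | "Suc t < k" by linarith
        then show "lin_subst n ?g (w t k) = w (Suc t) k"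
        proof cases
          case 1
          have "lin_subst n ?g (v k) = v k"
          proof -
            have "n + 1 - k \<in> {1..n}" "n + 1 - k \<noteq> q" using 1 k t p by (auto simp: q_def)
            moreover have "lin_subst n ?g (ext_mono {l}) = (ext_mono {l} :: 'k ext)" if "l \<in> {1..n - p}" for l
              using that q p by (intro fixd) auto
            ultimately show ?thesis
              by (subst (1 2) v_exp[OF k]) (simp add: lin_subst_add lin_subst_sum lin_subst_scale fixd)
          qed
          then show ?thesis using 1 by (simp add: w_def)
        next
          case 2
          have "lin_subst n ?g (ext_mono {q}) = ext_mono {q} + (\<Sum>l\<in>{1..<q}. ext_scale (y l) (ext_mono {l}))"
            using q by (simp add: lin_subst_var lin_form_elem_mat)
          also have "(\<Sum>l\<in>{1..<q}. ext_scale (y l) (ext_mono {l})) = (\<Sum>l\<in>{1..n - p}. ext_scale (y l) (ext_mono {l} :: 'k ext))"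
            by (rule sum.mono_neutral_right) (use q in \<open>auto simp: y_def\<close>)
          also have "\<dots> = (\<Sum>l\<in>{1..n - p}. ext_scale (v k {l}) (ext_mono {l}))"
            by (rule sum.cong) (use 2 in \<open>auto simp: y_def\<close>)
          also have "ext_mono {q} + \<dots> = v k" using v_exp[OF k] 2 q(2) by simp
          finally show ?thesis using 2 q(2) by (simp add: w_def last_vars_def)
        next
          case 3
          have "n + 1 - k \<in> {1..n}" "n + 1 - k \<noteq> q" using 3 k t p by (auto simp: q_def)
          then show ?thesis using 3 fixd by (simp add: w_def last_vars_def)
        qed
      qed (use elem_subst_shifted[OF S] in blast)+
    qed
    have "cartan_homology_dim n p (w 0) ?J i j = cartan_homology_dim n p (w t) ?J i j" if "t \<le> p" for t
      using that by (induct t) (simp_all add: step)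
    then have "cartan_homology_dim n p (w 0) ?J i j = cartan_homology_dim n p (w p) ?J i j" by blast
    moreover have "cartan_homology_dim n p (w 0) ?J i j = cartan_homology_dim n p (last_vars n) ?J i j"
      by (rule cartan_homology_dim_cong) (auto simp: w_def)
    moreover have "cartan_homology_dim n p (w p) ?J i j = cartan_homology_dim n p v ?J i j"
      by (rule cartan_homology_dim_cong) (auto simp: w_def)
    ultimately show ?thesis by simp
  qed
  finally show ?thesis .
qed

text \<open>Among the sequences with maximal ranks there is one whose last block is invertible, and it can be transported to the last
variables.\<close>

theorem cartan_betti_stable:
  assumes inf: "infinite (UNIV :: 'k::field set)" and S: "upset n S" "shifted S" and p: "p \<le> n" and i: "i \<le> p"
  shows "cartan_betti n (ext_coord S :: 'k ext set) i j p = cartan_homology_dim n p (last_vars n) (ext_coord S :: 'k ext set) i j"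
proof -
  have J: "graded_ideal n (ext_coord S :: 'k ext set)" using upset_graded_ideal[OF S(1)] .
  obtain A :: "'k mat" where A: "A \<in> carrier_mat p n" "max_rank n p (ext_coord S) p A" "det (last_block n p A) \<noteq> 0"
    using for_generic_ex[OF for_generic_conj[OF inf max_rank_generic[OF inf J] last_block_generic[OF p]]] by blast
  show ?thesis
    using cartan_betti_eq[OF inf J A(2) i order_refl] stable_generic_homology[OF S p A(1,3)] by simp
qed

text \<open>In homological degree zero a bound for any one sequence is enough, because generic sequences minimise the homology. The
cardinalities are those of the bases of the quotients of the strongly stable ideal by the last variables.\<close>

theorem cartan_betti_le_stable:
  fixes J :: "'k::field ext set"
  assumes inf: "infinite (UNIV :: 'k set)" and J: "graded_ideal n J" and S: "upset n S" "shifted S" and p: "p \<le> n"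
    and zero: "\<And>k j. k \<le> n \<Longrightarrow> \<exists>A\<in>carrier_mat k n. cartan_homology_dim n k (lin_form n A) J 0 j \<le> card {F \<in> slice (n - k) j. F \<notin> S}"
    and hilb: "\<And>j. cartan_homology_dim n 0 v0 J 0 j = card {F \<in> slice n j. F \<notin> S}"
  shows "cartan_betti n J i j p \<le> cartan_betti n (ext_coord S :: 'k ext set) i j p"
proof (cases "i \<le> p")
  case False
  then show ?thesis by (simp add: cartan_betti_def)
next
  case True
  interpret St: stable_seq n S by unfold_locales (fact S)+
  obtain A :: "'k mat" where "\<forall>k\<in>{0..n}. max_rank n k J n (trunc_mat k n A)"
    using for_generic_ex[OF generic_flag[OF inf J, of n]] by blast
  then have A: "\<And>k. k \<le> n \<Longrightarrow> max_rank n k J n (trunc_mat k n A)" by simp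
  have trunc: "cartan_homology_dim n k (lin_form n (trunc_mat k n A)) J i j = cartan_homology_dim n k (lin_form n A) J i j" for k i j
    by (rule cartan_homology_dim_cong) (rule lin_form_trunc)
  have "cartan_betti n J i j p = cartan_homology_dim n p (lin_form n A) J i j"
    using cartan_betti_eq[OF inf J A[OF p] True p] trunc by simp
  also have "\<dots> \<le> cartan_homology_dim n p (last_vars n) (ext_coord S :: 'k ext set) i j"
  proof (rule St.homology_comparison[OF lin_seq_lin_form[OF J] _ _ p])
    fix k j assume k: "1 \<le> k" "k \<le> n"
    obtain B :: "'k mat" where B: "B \<in> carrier_mat k n" "cartan_homology_dim n k (lin_form n B) J 0 j \<le> card {F \<in> slice (n - k) j. F \<notin> S}"
      using zero[OF k(2)] by blast
    show "cartan_homology_dim n k (lin_form n A) J 0 j \<le> cartan_homology_dim n k (last_vars n) (ext_coord S :: 'k ext set) 0 j"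
      using max_rank_min_homology[OF J A[OF k(2)] B(1), where i = 0 and j = j] B(2)
      unfolding trunc St.h0_card[OF k(2), of j, where ?'k = 'k] by linarith
  next
    fix j
    have "cartan_homology_dim n 0 (lin_form n A) J 0 j = cartan_homology_dim n 0 v0 J 0 j"
      by (rule cartan_homology_dim_cong) simp
    then show "cartan_homology_dim n 0 (lin_form n A) J 0 j = cartan_homology_dim n 0 (last_vars n) (ext_coord S :: 'k ext set) 0 j"
      using hilb[of j] St.h0_card[of 0 j, where ?'k = 'k] by simp
  qed
  also have "\<dots> = cartan_betti n (ext_coord S :: 'k ext set) i j p"
    using cartan_betti_stable[OF inf S p True] by simp
  finally show ?thesis .
qed

section \<open>Initial ideals\<close>

lemma mono_hull:
  assumes "upset n S"
  shows "ext_ideal n hull (ext_mono ` S) = (ext_coord S :: 'k::field ext set)"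
proof (rule hull_unique)
  have sub: "F \<subseteq> {1..n}" if "F \<in> S" for F using that assms by (auto simp: upset_def)
  show "ext_mono ` S \<subseteq> (ext_coord S :: 'k ext set)"
    by (auto simp: ext_coord_def ext_mono_apply split: if_splits)
  show "ext_ideal n (ext_coord S :: 'k ext set)"
    using upset_graded_ideal[OF assms, where ?'k = 'k] by (simp add: graded_ideal_def)
  fix t :: "'k ext set" assume t: "ext_mono ` S \<subseteq> t" "ext_ideal n t"
  have st: "ext.subspace t" using ext_ideal_subspace[OF t(2)] .
  show "ext_coord S \<subseteq> t"
  proof
    fix u :: "'k ext" assume u: "u \<in> ext_coord S"
    then have ua: "u \<in> ext_alg n" using sub by (auto simp: ext_coord_def ext_alg_def)
    have "(\<Sum>F\<in>Pow {1..n}. ext_scale (u F) (ext_mono F)) \<in> t"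
    proof (rule ext.subspace_sum[OF st])
      fix F
      show "ext_scale (u F) (ext_mono F) \<in> t"
      proof (cases "F \<in> S")
        case True
        then show ?thesis using t(1) ext.subspace_scale[OF st] by blast
      next
        case False
        then have "u F = 0" using u by (auto simp: ext_coord_def)
        then show ?thesis using ext.subspace_0[OF st] by simp
      qed
    qed
    then show "u \<in> t" using ext_expansion[OF ua] by simp
  qed
qed

locale exterior_order =
  fixes n :: nat and tau :: "nat set \<Rightarrow> nat set \<Rightarrow> bool"
  assumes tau: "term_order n tau"
begin

lemma irrefl: "F \<subseteq> {1..n} \<Longrightarrow> \<not> tau F F"
  using tau by (auto simp: term_order_def irreflp_on_def)

lemma trans: "F \<subseteq> {1..n} \<Longrightarrow> G \<subseteq> {1..n} \<Longrightarrow> H \<subseteq> {1..n} \<Longrightarrow> tau F G \<Longrightarrow> tau G H \<Longrightarrow> tau F H"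
proof -
  have "transp_on (Pow {1..n}) tau" using tau unfolding term_order_def by (elim conjE)
  then show "F \<subseteq> {1..n} \<Longrightarrow> G \<subseteq> {1..n} \<Longrightarrow> H \<subseteq> {1..n} \<Longrightarrow> tau F G \<Longrightarrow> tau G H \<Longrightarrow> tau F H"
    using transp_onD[of "Pow {1..n}" tau F G H] by simp
qed

lemma total: "F \<subseteq> {1..n} \<Longrightarrow> G \<subseteq> {1..n} \<Longrightarrow> F \<noteq> G \<Longrightarrow> tau F G \<or> tau G F"
proof -
  have "totalp_on (Pow {1..n}) tau" using tau unfolding term_order_def by (elim conjE)
  then show "F \<subseteq> {1..n} \<Longrightarrow> G \<subseteq> {1..n} \<Longrightarrow> F \<noteq> G \<Longrightarrow> tau F G \<or> tau G F"
    using totalp_onD[of "Pow {1..n}" tau F G] by simp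
qed

lemma union: 
  "F \<subseteq> {1..n} \<Longrightarrow> G \<subseteq> {1..n} \<Longrightarrow> H \<subseteq> {1..n} \<Longrightarrow> tau F G \<Longrightarrow> F \<inter> H = {} \<Longrightarrow> G \<inter> H = {} \<Longrightarrow> tau (F \<union> H) (G \<union> H)"
proof -
  have "\<forall>F\<in>Pow {1..n}. \<forall>G\<in>Pow {1..n}. \<forall>H\<in>Pow {1..n}.
        tau F G \<longrightarrow> F \<inter> H = {} \<longrightarrow> G \<inter> H = {} \<longrightarrow> tau (F \<union> H) (G \<union> H)"
    using tau unfolding term_order_def by (elim conjE)
  then show "F \<subseteq> {1..n} \<Longrightarrow> G \<subseteq> {1..n} \<Longrightarrow> H \<subseteq> {1..n} \<Longrightarrow> tau F G \<Longrightarrow> F \<inter> H = {} \<Longrightarrow> G \<inter> H = {} \<Longrightarrow> tau (F \<union> H) (G \<union> H)"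
    by simp
qed

lemma variables: "a \<in> {1..n} \<Longrightarrow> b \<in> {1..n} \<Longrightarrow> a < b \<Longrightarrow> tau {b} {a}"
proof -
  have "\<forall>a\<in>{1..n}. \<forall>b\<in>{1..n}. a < b \<longrightarrow> tau {b} {a}"
    using tau unfolding term_order_def by (elim conjE)
  then show "a \<in> {1..n} \<Longrightarrow> b \<in> {1..n} \<Longrightarrow> a < b \<Longrightarrow> tau {b} {a}" by blast
qed

lemma max_exists:
  assumes "finite X" "X \<noteq> {}" "X \<subseteq> Pow {1..n}"
  shows "\<exists>F\<in>X. \<forall>G\<in>X. G \<noteq> F \<longrightarrow> tau G F"
  using assms
proof (induct X rule: finite_ne_induct)
  case (insert x X)
  then obtain F where F: "F \<in> X" "\<forall>G\<in>X. G \<noteq> F \<longrightarrow> tau G F" by auto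
  have s: "x \<subseteq> {1..n}" "F \<subseteq> {1..n}" "\<And>G. G \<in> X \<Longrightarrow> G \<subseteq> {1..n}" "x \<noteq> F" using insert F by auto
  show ?case
  proof (cases "tau x F")
    case True
    then show ?thesis using F by auto
  next
    case False
    then have "tau F x" using total[OF s(1,2,4)] by blast
    then have "tau G x" if "G \<in> X" for G using trans[OF s(3)[OF that] s(2,1)] F that by (cases "G = F") auto
    then show ?thesis by blast
  qed
qed auto

lemma lead_eqI:
  assumes "u \<in> ext_alg n" "u F \<noteq> 0" "\<And>G. u G \<noteq> 0 \<Longrightarrow> G \<noteq> F \<Longrightarrow> tau G F"
  shows "lead_set tau u = F"
  unfolding lead_set_def
proof (rule the_equality)
  fix F' assume F': "u F' \<noteq> 0 \<and> (\<forall>G. u G \<noteq> 0 \<longrightarrow> G \<noteq> F' \<longrightarrow> tau G F')"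
  show "F' = F"
  proof (rule ccontr)
    assume "F' \<noteq> F"
    then have "tau F F'" "tau F' F" using F' assms by metis+
    moreover have "F \<subseteq> {1..n}" "F' \<subseteq> {1..n}" using F' assms by (auto simp: ext_alg_def)
    ultimately show False using trans irrefl by blast
  qed
qed (use assms in blast)

lemma lead_props:
  assumes "u \<in> ext_alg n" "u \<noteq> 0"
  shows "u (lead_set tau u) \<noteq> 0" "lead_set tau u \<subseteq> {1..n}" "u G \<noteq> 0 \<Longrightarrow> G \<noteq> lead_set tau u \<Longrightarrow> tau G (lead_set tau u)"
proof -
  have sub: "{F. u F \<noteq> 0} \<subseteq> Pow {1..n}" using assms(1) by (auto simp: ext_alg_def)
  then have "finite {F. u F \<noteq> 0}" using finite_subset by blast
  moreover have "{F. u F \<noteq> 0} \<noteq> {}" using assms(2) by (auto simp: fun_eq_iff)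
  ultimately obtain F where F: "u F \<noteq> 0" "\<And>G. u G \<noteq> 0 \<Longrightarrow> G \<noteq> F \<Longrightarrow> tau G F" using max_exists[OF _ _ sub] by auto
  then have "lead_set tau u = F" using lead_eqI[OF assms(1)] by blast
  then show "u (lead_set tau u) \<noteq> 0" "lead_set tau u \<subseteq> {1..n}" "u G \<noteq> 0 \<Longrightarrow> G \<noteq> lead_set tau u \<Longrightarrow> tau G (lead_set tau u)"
    using F sub by auto
qed

text \<open>The exponent sets of the initial ideal, if \<open>V\<close> is a graded ideal; the definition is needed for graded pieces as well.\<close>

definition leads :: "'k::field ext set \<Rightarrow> nat set set" where
  "leads V = {lead_set tau u | u. u \<in> V \<and> u \<noteq> 0}"

lemma leads_sub: "V \<subseteq> ext_alg n \<Longrightarrow> leads V \<subseteq> Pow {1..n}"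
  unfolding leads_def using lead_props(2) by blast

lemma leads_iff:
  assumes "V \<subseteq> ext_alg n"
  shows "F \<in> leads V \<longleftrightarrow> (\<exists>u\<in>V. u F \<noteq> 0 \<and> (\<forall>G. u G \<noteq> 0 \<longrightarrow> G \<noteq> F \<longrightarrow> tau G F))"
proof
  assume "F \<in> leads V"
  then obtain u where u: "u \<in> V" "u \<noteq> 0" "F = lead_set tau u" by (auto simp: leads_def)
  then have "u \<in> ext_alg n" using assms by blast
  then show "\<exists>u\<in>V. u F \<noteq> 0 \<and> (\<forall>G. u G \<noteq> 0 \<longrightarrow> G \<noteq> F \<longrightarrow> tau G F)"
    using lead_props[OF _ u(2)] u by blast
next
  assume "\<exists>u\<in>V. u F \<noteq> 0 \<and> (\<forall>G. u G \<noteq> 0 \<longrightarrow> G \<noteq> F \<longrightarrow> tau G F)"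
  then obtain u where u: "u \<in> V" "u F \<noteq> 0" "\<And>G. u G \<noteq> 0 \<Longrightarrow> G \<noteq> F \<Longrightarrow> tau G F" by blast
  have "lead_set tau u = F" using lead_eqI[of u F] u assms by blast
  moreover have "u \<noteq> 0" using u(2) by auto
  ultimately show "F \<in> leads V" using u(1) unfolding leads_def by blast
qed

lemma leads_upset:
  assumes J: "graded_ideal n (J :: 'k::field ext set)"
  shows "upset n (leads J)"
  unfolding upset_def
proof (intro conjI ballI allI impI)
  have Ja: "J \<subseteq> ext_alg n" using graded_idealD(1)[OF J] .
  show "leads J \<subseteq> Pow {1..n}" by (rule leads_sub[OF Ja])
  fix F G assume F: "F \<in> leads J" and FG: "F \<subseteq> G" "G \<subseteq> {1..n}"
  obtain u where u: "u \<in> J" "u F \<noteq> 0" "\<And>X. u X \<noteq> 0 \<Longrightarrow> X \<noteq> F \<Longrightarrow> tau X F" using F leads_iff[OF Ja] by blast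
  define H where "H = G - F"
  have fG: "finite G" using FG finite_subset by blast
  have H: "H \<subseteq> {1..n}" "F \<union> H = G" "F \<inter> H = {}" "G - H = F" "H \<subseteq> G" using FG by (auto simp: H_def)
  have Fs: "F \<subseteq> {1..n}" using FG by blast
  have "wedge (ext_mono H) u \<in> J" using graded_idealD(3)[OF J u(1) ext_mono_in(1)[OF H(1)]] .
  moreover have "wedge (ext_mono H) u G \<noteq> 0" using u(2) H fG by (simp add: wedge_mono_left)
  moreover have "tau X G" if X: "wedge (ext_mono H) u X \<noteq> 0" "X \<noteq> G" for X
  proof -
    have X': "finite X" "H \<subseteq> X" "u (X - H) \<noteq> 0" using X(1) by (auto simp: wedge_mono_left split: if_splits)
    then have XH: "(X - H) \<union> H = X" "(X - H) \<inter> H = {}" by auto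
    have "X - H \<subseteq> {1..n}" using X'(3) u(1) Ja by (auto simp: ext_alg_def)
    moreover have "X - H \<noteq> F" using X(2) XH H by auto
    then have "tau (X - H) F" using u(3) X'(3) by blast
    ultimately have "tau ((X - H) \<union> H) (F \<union> H)" using union[OF _ Fs H(1)] XH H by blast
    then show ?thesis using XH H by simp
  qed
  ultimately show "G \<in> leads J" using leads_iff[OF Ja] by blast
qed

lemma initial_ideal_eq:
  assumes J: "graded_ideal n (J :: 'k::field ext set)"
  shows "initial_ideal n tau J = ext_coord (leads J)"
proof -
  have "{ext_mono (lead_set tau u) | u. u \<in> J \<and> u \<noteq> 0} = (ext_mono ` leads J :: 'k ext set)"
    by (auto simp: leads_def)
  then show ?thesis unfolding initial_ideal_def using mono_hull[OF leads_upset[OF J]] by simp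
qed

text \<open>Reduction by leading terms replaces a monomial by smaller ones and ends because there are finitely many monomials.\<close>

lemma below_induct [consumes 1, case_names less]:
  assumes "F \<subseteq> {1..n}" and step: "\<And>F. F \<subseteq> {1..n} \<Longrightarrow> (\<And>G. G \<subseteq> {1..n} \<Longrightarrow> tau G F \<Longrightarrow> P G) \<Longrightarrow> P F"
  shows "P F"
  using assms(1)
proof (induct "card {G \<in> Pow {1..n}. tau G F}" arbitrary: F rule: less_induct)
  case (less F)
  show ?case
  proof (rule step[OF less(2)])
    fix G assume G: "G \<subseteq> {1..n}" "tau G F"
    have "{H \<in> Pow {1..n}. tau H G} \<subset> {H \<in> Pow {1..n}. tau H F}"
      using trans[OF _ G(1) less(2) _ G(2)] irrefl[OF G(1)] G by blast
    then have "card {H \<in> Pow {1..n}. tau H G} < card {H \<in> Pow {1..n}. tau H F}"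
      by (intro psubset_card_mono) auto
    then show "P G" using less(1) G(1) by blast
  qed
qed

text \<open>A subspace has exactly as many leading sets as dimensions: a nonzero element is detected by its coefficient at its own
leading set, and elements with distinct leading sets are independent.\<close>

lemma leads_dim:
  fixes V :: "'k::field ext set"
  assumes V: "ext.subspace V" "V \<subseteq> ext_alg n"
  shows "ext.dim V = card (leads V)"
proof (rule antisym)
  have finL: "finite (leads V)" using leads_sub[OF V(2)] finite_subset by blast
  have alg: "ext_alg n = (ext_coord (Pow {1..n}) :: 'k ext set)" by (auto simp: ext_alg_def ext_coord_def)
  have Vf: "fin_span ext_scale V"
    using ext.fin_span_mono[OF V(2)] dim_ext_coord(2)[of "Pow {1..n}", where ?'k = 'k] unfolding alg by simp
  define pr :: "'k ext \<Rightarrow> 'k ext" where "pr u = (\<lambda>F. if F \<in> leads V then u F else 0)" for u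
  have pr: "Vector_Spaces.linear ext_scale ext_scale pr"
    by (auto simp: Vector_Spaces.linear_iff ext.vector_space_axioms pr_def fun_eq_iff)
  have "ext.dim (pr ` V) = ext.dim V"
  proof (rule ee.dim_image_inj[OF pr V(1) Vf], rule ccontr)
    fix z assume z: "z \<in> V" "pr z = 0" "z \<noteq> 0"
    have "z \<in> ext_alg n" using z(1) V(2) by blast
    then have "z (lead_set tau z) \<noteq> 0" using lead_props(1) z(3) by blast
    moreover have "lead_set tau z \<in> leads V" using z by (auto simp: leads_def)
    ultimately have "pr z (lead_set tau z) \<noteq> 0" by (simp add: pr_def)
    then show False using z(2) by simp
  qed
  moreover have "pr ` V \<subseteq> ext_coord (leads V)" by (auto simp: pr_def ext_coord_def split: if_splits)
  ultimately show "ext.dim V \<le> card (leads V)"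
    using ext.dim_subset[of "pr ` V" "ext_coord (leads V)"] dim_ext_coord[OF finL, where ?'k = 'k] by simp
  have "\<exists>u. u \<in> V \<and> u F \<noteq> 0 \<and> (\<forall>G. u G \<noteq> 0 \<longrightarrow> G \<noteq> F \<longrightarrow> tau G F)" if "F \<in> leads V" for F
    using that leads_iff[OF V(2)] by blast
  then obtain w where w: "\<And>F. F \<in> leads V \<Longrightarrow> w F \<in> V \<and> w F F \<noteq> 0 \<and> (\<forall>G. w F G \<noteq> 0 \<longrightarrow> G \<noteq> F \<longrightarrow> tau G F)"
    by metis
  have wl: "lead_set tau (w F) = F" if "F \<in> leads V" for F
    using w[OF that] V(2) lead_eqI[of "w F" F] by blast
  have inj: "inj_on w (leads V)" by (rule inj_onI) (metis wl)
  have "ext.independent (w ` leads V)"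
    unfolding ext.dependent_finite[OF finite_imageI[OF finL]]
  proof clarify
    fix c F assume c: "(\<Sum>v\<in>w ` leads V. ext_scale (c v) v) = 0" "F \<in> leads V" "c (w F) \<noteq> 0"
    then have s: "(\<Sum>G\<in>leads V. ext_scale (c (w G)) (w G)) = 0" using inj by (simp add: sum.reindex)
    let ?X = "{G \<in> leads V. c (w G) \<noteq> 0}"
    have "?X \<subseteq> Pow {1..n}" using leads_sub[OF V(2)] by blast
    moreover have "finite ?X" "?X \<noteq> {}" using finL c by auto
    ultimately obtain H where H: "H \<in> ?X" "\<forall>G\<in>?X. G \<noteq> H \<longrightarrow> tau G H" using max_exists by meson
    have Hs: "H \<subseteq> {1..n}" using H(1) leads_sub[OF V(2)] by blast
    have "0 = (\<Sum>G\<in>leads V. ext_scale (c (w G)) (w G)) H" using s by simp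
    also have "\<dots> = (\<Sum>G\<in>leads V. if G = H then c (w H) * w H H else 0)"
      unfolding sum_fun_apply ext_scale_apply
    proof (rule sum.cong[OF refl])
      fix G assume G: "G \<in> leads V"
      show "c (w G) * w G H = (if G = H then c (w H) * w H H else 0)"
      proof (cases "G = H \<or> c (w G) = 0")
        case False
        then have t: "tau G H" using H(2) G by blast
        have "w G H = 0"
        proof (rule ccontr)
          assume "w G H \<noteq> 0"
          then have "tau H G" using w[OF G] False by blast
          then show False using t trans[OF Hs _ Hs] irrefl[OF Hs] leads_sub[OF V(2)] G by blast
        qed
        then show ?thesis using False by simp
      qed auto
    qed
    also have "\<dots> = c (w H) * w H H" using H(1) finL by simp
    also have "\<dots> \<noteq> 0" using H(1) w[of H] by simp
    finally show False by simp
  qed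
  then have "card (w ` leads V) \<le> ext.dim V"
    using w by (intro ext.independent_card_le_dim[OF _ _ Vf]) auto
  then show "card (leads V) \<le> ext.dim V" using inj by (simp add: card_image)
qed

lemma ext_deg_Int_leads:
  assumes J: "graded_ideal n (J :: 'k::field ext set)"
  shows "leads (J \<inter> ext_deg n d) = {F \<in> leads J. card F = d}"
proof -
  have Ja: "J \<subseteq> ext_alg n" using graded_idealD(1)[OF J] .
  have "F \<in> leads (J \<inter> ext_deg n d)" if F: "F \<in> leads J" "card F = d" for F
  proof -
    obtain u where u: "u \<in> J" "u F \<noteq> 0" "\<And>X. u X \<noteq> 0 \<Longrightarrow> X \<noteq> F \<Longrightarrow> tau X F" using F leads_iff[OF Ja] by blast
    have "hom_component d u \<in> J \<inter> ext_deg n d"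
      using graded_idealD(2)[OF J u(1)] u(1) Ja by (auto simp: hom_component_def ext_deg_def ext_alg_def split: if_splits)
    moreover have "hom_component d u F \<noteq> 0" using u(2) F(2) by (simp add: hom_component_def)
    moreover have "tau X F" if "hom_component d u X \<noteq> 0" "X \<noteq> F" for X
      using that u(3) by (auto simp: hom_component_def split: if_splits)
    moreover have "J \<inter> ext_deg n d \<subseteq> ext_alg n" using Ja by blast
    ultimately show ?thesis using leads_iff by blast
  qed
  moreover have "F \<in> leads J \<and> card F = d" if "F \<in> leads (J \<inter> ext_deg n d)" for F
  proof -
    have "J \<inter> ext_deg n d \<subseteq> ext_alg n" using Ja by blast
    then have "\<exists>u\<in>J \<inter> ext_deg n d. u F \<noteq> 0 \<and> (\<forall>X. u X \<noteq> 0 \<longrightarrow> X \<noteq> F \<longrightarrow> tau X F)"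
      using that by (simp only: leads_iff)
    then obtain u where u: "u \<in> J \<inter> ext_deg n d" "u F \<noteq> 0" "\<forall>X. u X \<noteq> 0 \<longrightarrow> X \<noteq> F \<longrightarrow> tau X F"
      by auto
    have "u \<in> ext_deg n d" using u(1) by simp
    then have "card F = d" using u(2) unfolding ext_deg_def by blast
    moreover have "F \<in> leads J" unfolding leads_iff[OF Ja]
      by (rule bexI[of _ u]) (use u in simp_all)
    ultimately show ?thesis by simp
  qed
  ultimately show ?thesis by blast
qed

lemma hilbert_leads:
  assumes J: "graded_ideal n (J :: 'k::field ext set)"
  shows "hilbert_fun n J d = card {F \<in> leads J. card F = d}"
  unfolding hilbert_fun_def ext_deg_Int_leads[OF J, symmetric]
  by (rule leads_dim[OF ext.subspace_inter[OF graded_ideal_subspace[OF J] ext_subspaces(2)]])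
    (use graded_idealD(1)[OF J] in blast)

end

lemma hilbert_ext_coord:
  assumes "S \<subseteq> Pow {1..n}"
  shows "hilbert_fun n (ext_coord S :: 'k::field ext set) d = card {F \<in> S. card F = d}"
proof -
  have "ext_coord S \<inter> ext_deg n d = (ext_coord {F \<in> S. card F = d} :: 'k ext set)"
    using assms by (auto simp: ext_coord_def ext_deg_def)
  moreover have "finite S" using assms by (rule finite_subset) simp
  then have "finite {F \<in> S. card F = d}" by simp
  ultimately show ?thesis by (simp add: hilbert_fun_def dim_ext_coord)
qed

lemma h0_hilbert:
  assumes J: "graded_ideal n (J :: 'k::field ext set)"
  shows "cartan_homology_dim n 0 v J 0 j + hilbert_fun n J j = card (slice n j)"
proof -
  interpret L: lin_seq n 0 v J by unfold_locales (use J in auto)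
  have fin: "finite (slice n j)" by simp
  have d0: "cartan_diff 0 v c = 0" for c :: "'k chain" by (intro ext) (simp add: cartan_diff_def)
  have "L.B 0 0 j = L.D 0 0 j"
  proof (intro equalityI subsetI)
    fix x assume "x \<in> L.B 0 0 j"
    then obtain c e where "x = cartan_diff 0 v c + e" "c \<in> L.C 0 (Suc 0) j" "e \<in> L.D 0 0 j" by (rule L.BE)
    then show "x \<in> L.D 0 0 j" by (simp add: d0)
  qed (use L.D_sub_B in blast)
  moreover have "chain.dim (L.D 0 0 j) = hilbert_fun n J j"
  proof -
    define \<iota> :: "'k ext \<Rightarrow> 'k chain" where "\<iota> u = (\<lambda>a. if a = (\<lambda>_. 0) then u else 0)" for u
    have lin: "Vector_Spaces.linear ext_scale chain_scale \<iota>"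
    proof -
      have "\<iota> (x + y) = \<iota> x + \<iota> y" "\<iota> (ext_scale r x) = chain_scale r (\<iota> x)" for x y r
        by (intro ext; simp add: \<iota>_def)+
      then show ?thesis by (simp add: Vector_Spaces.linear_iff ext.vector_space_axioms chain.vector_space_axioms)
    qed
    have "\<iota> ` (J \<inter> ext_deg n j) = L.D 0 0 j"
    proof (intro equalityI subsetI)
      fix c assume "c \<in> \<iota> ` (J \<inter> ext_deg n j)"
      then obtain u where u: "c = \<iota> u" "u \<in> J" "u \<in> ext_deg n j" by blast
      have "c a F \<noteq> 0 \<longrightarrow> a \<in> exponents 0 0 \<and> F \<subseteq> {1..n} \<and> card F + 0 = j" for a F
        using u(1,3) exponents_zero by (auto simp: \<iota>_def ext_deg_def)
      moreover have "c a \<in> J" for a using u L.J_simps(1) by (simp add: \<iota>_def)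
      ultimately show "c \<in> L.D 0 0 j" by (simp add: ideal_chains_def cartan_chains_def)
    next
      fix c assume c: "c \<in> L.D 0 0 j"
      then have cz: "c a F \<noteq> 0 \<Longrightarrow> a = (\<lambda>_. 0) \<and> F \<subseteq> {1..n} \<and> card F = j" for a F
        using exponents_zero by (auto simp: ideal_chains_def cartan_chains_def)
      have "c (\<lambda>_. 0) \<in> J \<inter> ext_deg n j" using c cz by (auto simp: ideal_chains_def ext_deg_def)
      moreover have "c = \<iota> (c (\<lambda>_. 0))"
      proof (intro ext)
        fix a F
        show "c a F = \<iota> (c (\<lambda>_. 0)) a F" using cz[of a F] by (cases "a = (\<lambda>_. 0)") (auto simp: \<iota>_def)
      qed
      ultimately show "c \<in> \<iota> ` (J \<inter> ext_deg n j)" by blast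
    qed
    moreover have "chain.dim (\<iota> ` (J \<inter> ext_deg n j)) = ext.dim (J \<inter> ext_deg n j)"
    proof (rule ec.dim_image_inj[OF lin])
      show "ext.subspace (J \<inter> ext_deg n j)"
        by (rule ext.subspace_inter[OF graded_ideal_subspace[OF J] ext_subspaces(2)])
      have "J \<inter> ext_deg n j \<subseteq> ext_coord (Pow {1..n})" by (auto simp: ext_deg_def ext_coord_def)
      then show "fin_span ext_scale (J \<inter> ext_deg n j)"
        using ext.fin_span_mono dim_ext_coord(2)[of "Pow {1..n}", where ?'k = 'k] by blast
      fix z :: "'k ext" assume "\<iota> z = 0"
      then have "\<iota> z (\<lambda>_. 0) = 0" by simp
      then show "z = 0" by (simp add: \<iota>_def)
    qed
    ultimately show ?thesis by (simp add: hilbert_fun_def)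
  qed
  moreover have "chain.dim (L.C 0 0 j) = card (slice n j)"
  proof -
    have "chain_index n 0 0 j = Pair (\<lambda>_. 0) ` slice n j"
      by (auto simp: chain_index_def exponents_zero slice_def)
    then have "card (chain_index n 0 0 j) = card (slice n j)" by (simp add: card_image inj_on_def)
    then show ?thesis unfolding cartan_chains_coord using dim_chain_coord(1)[OF finite_chain_index] by metis
  qed
  ultimately show ?thesis using L.h_eq[of 0 0 j] by (simp add: L.Z0)
qed

text \<open>Modulo \<open>J\<close> and the last \<open>k\<close> variables, a monomial vanishes if it contains one of these variables, and it is a
combination of smaller monomials if its exponent set leads an element of \<open>J\<close>; so the remaining monomials span.\<close>

lemma (in exterior_order) h0_le_leads:
  fixes J :: "'k::field ext set"
  assumes J: "graded_ideal n J" and k: "k \<le> n"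
  shows "cartan_homology_dim n k (last_vars n) J 0 j \<le> card {F \<in> slice (n - k) j. F \<notin> leads J}"
proof -
  interpret L: lin_seq n n "last_vars n" J by unfold_locales (use J last_vars_deg in auto)
  interpret E: stable_seq n "{}" by unfold_locales (auto simp: upset_def shifted_def)
  have Ja: "J \<subseteq> ext_alg n" using graded_idealD(1)[OF J] .
  let ?N = "{F \<in> slice (n - k) j. F \<notin> leads J}"
  let ?m = "\<lambda>F. chain_mono (\<lambda>_. 0, F) :: 'k chain"
  define W where "W = {x + y | x y. x \<in> chain.span (?m ` ?N) \<and> y \<in> L.B k 0 j}"
  have sW: "chain.subspace W" unfolding W_def by (intro chain.subspace_sums chain.subspace_span L.B_subspace)
  have BW: "y \<in> W" if "y \<in> L.B k 0 j" for y
    unfolding W_def using that chain.span_zero[of "?m ` ?N"] by (metis (mono_tags, lifting) add_0 mem_Collect_eq)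
  have top: "?m F \<in> L.B k 0 j" if F: "F \<in> slice n j" "s \<in> {1..k}" "n + 1 - s \<in> F" for F s
  proof -
    have "?m F \<in> (E.B k 0 j :: 'k chain set)"
      unfolding E.B0_coord[OF k] using F by (auto simp: chain_coord_def chain_mono_def split: if_splits)
    then obtain c e where ce: "?m F = cartan_diff k (last_vars n) c + e" "c \<in> L.C k (Suc 0) j"
      "e \<in> ideal_chains n k (ext_coord {} :: 'k ext set) 0 j" by (rule E.BE)
    have "e \<in> L.D k 0 j"
    proof -
      have "e a = 0" for a using ce(3) by (auto simp: ideal_chains_def ext_coord_def fun_eq_iff)
      then show ?thesis using ce(3) L.J_simps(1) by (simp add: ideal_chains_def)
    qed
    then show ?thesis unfolding ce(1) using ce(2) by (intro L.BI)
  qed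
  have mono: "F \<in> slice n j \<longrightarrow> ?m F \<in> W" if "F \<subseteq> {1..n}" for F
    using that
  proof (induct F rule: below_induct)
    case (less F)
    show ?case
    proof
      assume F: "F \<in> slice n j"
      show "?m F \<in> W"
      proof (cases "\<exists>s\<in>{1..k}. n + 1 - s \<in> F")
        case True
        then show ?thesis using top[OF F] BW by blast
      next
        case notop: False
        show ?thesis
        proof (cases "F \<in> leads J")
          case True
          then have "F \<in> leads (J \<inter> ext_deg n j)" using F by (simp add: ext_deg_Int_leads[OF J] slice_def)
          moreover have "J \<inter> ext_deg n j \<subseteq> ext_alg n" using Ja by blast
          ultimately obtain u where u: "u \<in> J" "u \<in> ext_deg n j" "u F \<noteq> 0" "\<And>X. u X \<noteq> 0 \<Longrightarrow> X \<noteq> F \<Longrightarrow> tau X F"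
            using leads_iff by (metis IntD1 IntD2)
          define c :: "'k chain" where "c = (\<lambda>a. if a = (\<lambda>_. 0) then u else 0)"
          have cD: "c \<in> L.D k 0 j"
          proof -
            have "c a G \<noteq> 0 \<longrightarrow> a \<in> exponents k 0 \<and> G \<subseteq> {1..n} \<and> card G + 0 = j" for a G
              using u(2) exponents_zero by (auto simp: c_def ext_deg_def)
            moreover have "c a \<in> J" for a using u(1) L.J_simps(1) by (simp add: c_def)
            ultimately show ?thesis by (simp add: ideal_chains_def cartan_chains_def)
          qed
          have cW: "c \<in> W" using cD L.D_sub_B BW by blast
          have "c \<in> chain_coord (Pair (\<lambda>_. 0) ` slice n j)"
            using u(2) by (auto simp: c_def chain_coord_def ext_deg_def slice_def split: if_splits)
          then have "c = (\<Sum>p\<in>Pair (\<lambda>_. 0) ` slice n j. chain_scale (c (fst p) (snd p)) (chain_mono p))"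
            by (intro chain_coord_expansion) auto
          also have "\<dots> = (\<Sum>G\<in>slice n j. chain_scale (u G) (?m G))"
            by (subst sum.reindex) (auto simp: inj_on_def c_def)
          also have "\<dots> = chain_scale (u F) (?m F) + (\<Sum>G\<in>slice n j - {F}. chain_scale (u G) (?m G))"
            using F by (intro sum.remove) auto
          finally have eq: "chain_scale (u F) (?m F) = c - (\<Sum>G\<in>slice n j - {F}. chain_scale (u G) (?m G))"
            by (simp add: eq_diff_eq)
          have "(\<Sum>G\<in>slice n j - {F}. chain_scale (u G) (?m G)) \<in> W"
          proof (rule chain.subspace_sum[OF sW])
            fix G assume G: "G \<in> slice n j - {F}"
            show "chain_scale (u G) (?m G) \<in> W"
            proof (cases "u G = 0")
              case True
              then show ?thesis using chain.subspace_0[OF sW] by simp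
            next
              case False
              have "tau G F" "G \<subseteq> {1..n}" "G \<in> slice n j" using u(4)[OF False] G by (auto simp: slice_def)
              then have "?m G \<in> W" using less(2) by blast
              then show ?thesis by (rule chain.subspace_scale[OF sW])
            qed
          qed
          then have "chain_scale (u F) (?m F) \<in> W" unfolding eq using cW by (intro chain.subspace_diff[OF sW])
          then have "chain_scale (inverse (u F)) (chain_scale (u F) (?m F)) \<in> W" by (rule chain.subspace_scale[OF sW])
          then show ?thesis using u(3) by simp
        next
          case False
          have "F \<subseteq> {1..n - k}"
          proof
            fix x assume x: "x \<in> F"
            then have x1: "x \<in> {1..n}" using F by (auto simp: slice_def)
            show "x \<in> {1..n - k}"
            proof (rule ccontr)
              assume "x \<notin> {1..n - k}"
              then have "n + 1 - x \<in> {1..k}" "n + 1 - (n + 1 - x) = x" using x1 k by auto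
              then show False using notop x by metis
            qed
          qed
          then have "F \<in> ?N" using F False by (simp add: slice_def)
          then have "?m F \<in> chain.span (?m ` ?N)" by (intro chain.span_base) blast
          moreover have "0 \<in> L.B k 0 j" using chain.subspace_0[OF L.B_subspace] .
          ultimately show ?thesis unfolding W_def by (metis (mono_tags, lifting) add.right_neutral mem_Collect_eq)
        qed
      qed
    qed
  qed
  have "chain.dim (L.Z k 0 j) \<le> chain.dim (L.B k 0 j) + card (?m ` ?N)"
  proof (rule chain.dim_le_spanning_mod[OF L.Z_fin L.B_subspace _ _ L.B_fin[OF k]])
    show "finite (?m ` ?N)" by simp
    fix z assume "z \<in> L.Z k 0 j"
    then have "z \<in> chain_coord (Pair (\<lambda>_. 0) ` slice n j)"
      unfolding L.Z0 cartan_chains_def using exponents_zero by (auto simp: chain_coord_def slice_def)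
    then have "z = (\<Sum>p\<in>Pair (\<lambda>_. 0) ` slice n j. chain_scale (z (fst p) (snd p)) (chain_mono p))"
      by (intro chain_coord_expansion) auto
    also have "\<dots> = (\<Sum>G\<in>slice n j. chain_scale (z (\<lambda>_. 0) G) (?m G))"
      by (subst sum.reindex) (auto simp: inj_on_def)
    also have "\<dots> \<in> W"
    proof (intro chain.subspace_sum[OF sW] chain.subspace_scale[OF sW])
      fix G assume G: "G \<in> slice n j"
      then have "G \<subseteq> {1..n}" by (simp add: slice_def)
      then show "?m G \<in> W" using mono G by blast
    qed
    finally obtain x y where "z = x + y" "x \<in> chain.span (?m ` ?N)" "y \<in> L.B k 0 j" unfolding W_def by blast
    then show "\<exists>s\<in>chain.span (?m ` ?N). z - s \<in> L.B k 0 j" by (intro bexI[of _ x]) auto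
  qed
  also have "card (?m ` ?N) \<le> card ?N" by (rule card_image_le) simp
  finally show ?thesis using L.h_eq[OF k, of 0 j] by linarith
qed

section \<open>Generic initial ideals\<close>

lemma lin_subst_hom_component: "lin_subst n g (hom_component d u) = hom_component d (lin_subst n g u)"
proof
  fix H
  have "lin_subst n g (hom_component d u) H = (\<Sum>F\<in>Pow {1..n}. (if card F = d then u F else 0) * subst_mono n g F H)"
    by (simp add: lin_subst_alt sum_fun_apply hom_component_def)
  also have "\<dots> = (\<Sum>F\<in>Pow {1..n}. if card H = d then u F * subst_mono n g F H else 0)"
  proof (rule sum.cong[OF refl])
    fix F assume "F \<in> Pow {1..n}"
    then have "finite F" using finite_subset by auto
    then have "subst_mono n g F H \<noteq> 0 \<Longrightarrow> card H = card F" using subst_mono_deg[of F n g] by (simp add: ext_deg_def)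
    then show "(if card F = d then u F else 0) * subst_mono n g F H = (if card H = d then u F * subst_mono n g F H else 0)"
      by (cases "subst_mono n g F H = 0") auto
  qed
  also have "\<dots> = hom_component d (lin_subst n g u) H"
    by (simp add: lin_subst_alt sum_fun_apply hom_component_def)
  finally show "lin_subst n g (hom_component d u) H = hom_component d (lin_subst n g u) H" .
qed

lemma graded_ideal_subst:
  fixes J :: "'k::field ext set"
  assumes J: "graded_ideal n J" and g: "g \<in> carrier_mat n n" "g' \<in> carrier_mat n n" "g' * g = 1\<^sub>m n"
  shows "graded_ideal n (lin_subst n g ` J)"
  unfolding graded_ideal_def ext_ideal_def
proof (intro conjI ballI allI)
  have Ja: "J \<subseteq> ext_alg n" using graded_idealD(1)[OF J] .
  show "lin_subst n g ` J \<subseteq> ext_alg n" using lin_subst_in_alg by blast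
  show "0 \<in> lin_subst n g ` J" using ext.subspace_0[OF graded_ideal_subspace[OF J]] by (metis imageI lin_subst_zero)
  fix u assume "u \<in> lin_subst n g ` J"
  then obtain x where x: "u = lin_subst n g x" "x \<in> J" by blast
  {
    fix v assume "v \<in> lin_subst n g ` J"
    then obtain y where "v = lin_subst n g y" "y \<in> J" by blast
    then show "u + v \<in> lin_subst n g ` J"
      using x ext.subspace_add[OF graded_ideal_subspace[OF J]] by (metis imageI lin_subst_add)
  next
    fix d
    show "hom_component d u \<in> lin_subst n g ` J"
      unfolding x(1) lin_subst_hom_component[symmetric] using graded_idealD(2)[OF J x(2)] by blast
  next
    fix w :: "'k ext" assume w: "w \<in> ext_alg n"
    define w' where "w' = lin_subst n g' w"
    have w': "w = lin_subst n g w'" "w' \<in> ext_alg n"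
      unfolding w'_def using lin_subst_compose[OF g(2,1), of w] lin_subst_id[OF w] g(3) lin_subst_in_alg by simp_all
    have "x \<in> ext_alg n" using x(2) Ja by blast
    then have "wedge w u = lin_subst n g (wedge w' x)" "wedge u w = lin_subst n g (wedge x w')"
      unfolding x(1) w'(1) using lin_subst_wedge[OF w'(2), of x g] lin_subst_wedge[OF _ w'(2), of x g] by simp_all
    then show "wedge w u \<in> lin_subst n g ` J" "wedge u w \<in> lin_subst n g ` J"
      using graded_idealD(3,4)[OF J x(2) w'(2)] by blast+
  }
qed

lemma poly_fun_subst_mono:
  assumes "finite F" "F \<subseteq> {1..n}"
  shows "poly_fun n n (\<lambda>g. subst_mono n g F H)"
  using assms
proof (induct F arbitrary: H rule: finite_linorder_min_induct)
  case empty
  show ?case by (simp add: poly_fun.const)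
next
  case (insert b A)
  have "subst_mono n g (insert b A) = wedge (lin_form n g b) (subst_mono n g A)" for g :: "'a mat"
    by (rule subst_mono_insert) (use insert in auto)
  then show ?case unfolding wedge_def
    using insert by (simp only:) (intro poly_fun_sum poly_fun.mult poly_fun.const poly_fun_lin_form, auto)
qed

lemma poly_fun_lin_subst: "poly_fun n n (\<lambda>g. lin_subst n g u H)"
  unfolding lin_subst_alt sum_fun_apply ext_scale_apply
proof (intro poly_fun_sum poly_fun.mult poly_fun.const)
  fix F :: "nat set" assume "F \<in> Pow {1..n}"
  then show "poly_fun n n (\<lambda>g. subst_mono n g F H)" using finite_subset by (intro poly_fun_subst_mono) auto
qed

definition proj_on :: "nat set set \<Rightarrow> 'k::field ext \<Rightarrow> 'k ext" where
  "proj_on T u = (\<lambda>F. if F \<in> T then u F else 0)"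

lemma linear_proj_on: "Vector_Spaces.linear ext_scale ext_scale (proj_on T :: 'k::field ext \<Rightarrow> _)"
  by (auto simp: Vector_Spaces.linear_iff ext.vector_space_axioms proj_on_def fun_eq_iff)

lemma det_generic: "for_generic n n (\<lambda>g. det g \<noteq> (0 :: 'k::field))"
proof -
  define f where "f A = (\<Sum>\<pi> | \<pi> permutes {0..<n}. signof \<pi> * (\<Prod>i = 0..<n. A $$ (i, \<pi> i)))" for A :: "'k mat"
  have "poly_fun n n f" unfolding f_def
  proof (intro poly_fun_sum poly_fun.mult poly_fun.const poly_fun_prod)
    fix \<pi> i assume "\<pi> \<in> {\<pi>. \<pi> permutes {0..<n}}" "i \<in> {0..<n}"
    then show "poly_fun n n (\<lambda>A :: 'k mat. A $$ (i, \<pi> i))"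
      using permutes_in_image[of \<pi> "{0..<n}" i] by (intro poly_fun.entry) auto
  qed
  moreover have f: "det A = f A" if "A \<in> carrier_mat n n" for A
    unfolding f_def by (rule det_def'[OF that])
  moreover have "f (1\<^sub>m n) \<noteq> 0" using f[OF one_carrier_mat] det_one[of n] by simp
  ultimately show ?thesis unfolding for_generic_def using one_carrier_mat by metis
qed

lemma det_GL:
  assumes "g \<in> carrier_mat n n" "det g \<noteq> (0 :: 'k::field)"
  shows "g \<in> GL n"
proof -
  obtain W where W: "W \<in> carrier_mat n n" "W * g = 1\<^sub>m n" "g * W = 1\<^sub>m n" using units_mat[OF assms] by blast
  then have "inverts_mat g W" "inverts_mat W g" using assms(1) by (auto simp: inverts_mat_def)
  then have "invertible_mat g" using assms(1) unfolding invertible_mat_def square_mat.simps by auto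
  then show ?thesis using assms(1) by (simp add: GL_def)
qed

lemma GL_inverse:
  assumes "g \<in> GL n"
  obtains g' where "g' \<in> carrier_mat n n" "g * g' = (1\<^sub>m n :: 'k::field mat)" "g' * g = 1\<^sub>m n"
proof -
  have g: "g \<in> carrier_mat n n" "invertible_mat g" using assms by (auto simp: GL_def)
  then obtain B where B: "g * B = 1\<^sub>m (dim_row g)" "B * g = 1\<^sub>m (dim_row B)"
    by (auto simp: invertible_mat_def inverts_mat_def)
  have "dim_row B = n"
  proof -
    have "dim_col (B * g) = n" using g by simp
    then show ?thesis unfolding B(2) by simp
  qed
  moreover have "dim_col B = n"
  proof -
    have "dim_col (g * B) = dim_row g" unfolding B(1) by simp
    then show ?thesis using g by simp
  qed
  ultimately have "B \<in> carrier_mat n n" by auto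
  moreover have "g * B = 1\<^sub>m n" "B * g = 1\<^sub>m n" using B g \<open>dim_row B = n\<close> by auto
  ultimately show thesis using that by blast
qed

context exterior_order
begin

definition proj_dim :: "'k::field ext set \<Rightarrow> nat set set \<Rightarrow> 'k mat \<Rightarrow> nat" where
  "proj_dim J T g = ext.dim (proj_on T ` lin_subst n g ` J)"

text \<open>An element of \<open>V\<close> leads with \<open>F\<close> if it vanishes at all monomials above \<open>F\<close> but not at \<open>F\<close>. Such an element exists if and
only if the kernels of the two projections differ, and their dimensions are complementary to those of the images. In this
form the leading sets depend on ranks only.\<close>

lemma leads_proj_dim:
  fixes V :: "'k::field ext set"
  assumes V: "ext.subspace V" "V \<subseteq> ext_alg n" and F: "F \<subseteq> {1..n}"
  shows "F \<in> leads V \<longleftrightarrow> ext.dim (proj_on {G \<in> Pow {1..n}. tau F G} ` V) < ext.dim (proj_on {G \<in> Pow {1..n}. G = F \<or> tau F G} ` V)"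
proof -
  let ?A = "{G \<in> Pow {1..n}. tau F G}" and ?B = "{G \<in> Pow {1..n}. G = F \<or> tau F G}"
  have alg: "ext_alg n = (ext_coord (Pow {1..n}) :: 'k ext set)" by (auto simp: ext_alg_def ext_coord_def)
  have Vf: "fin_span ext_scale V"
    using ext.fin_span_mono[OF V(2)] dim_ext_coord(2)[of "Pow {1..n}", where ?'k = 'k] unfolding alg by simp
  let ?K = "\<lambda>T. {z \<in> V. proj_on T z = 0}"
  have kz: "z \<in> ?K T \<longleftrightarrow> z \<in> V \<and> (\<forall>G\<in>T. z G = 0)" for z T
    by (auto simp: proj_on_def fun_eq_iff)
  have sK: "ext.subspace (?K T)" for T
  proof -
    have "?K T = V \<inter> {z. proj_on T z = 0}" by blast
    then show ?thesis using ext.subspace_inter[OF V(1) ee.linear_subspace_kernel[OF linear_proj_on]] by simp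
  qed
  have fK: "fin_span ext_scale (?K T)" for T using ext.fin_span_mono[OF _ Vf, of "?K T"] by blast
  have sub: "?K ?B \<subseteq> ?K ?A"
  proof
    fix z assume "z \<in> ?K ?B"
    then have "z \<in> V" "\<forall>G\<in>?B. z G = 0" unfolding kz by blast+
    then have "z \<in> V \<and> (\<forall>G\<in>?A. z G = 0)" by simp
    then show "z \<in> ?K ?A" unfolding kz .
  qed
  have rn: "ext.dim (proj_on T ` V) + ext.dim (?K T) = ext.dim V" for T
    using ee.rank_nullity[OF linear_proj_on V(1) Vf] .
  have "F \<in> leads V \<longleftrightarrow> ?K ?A \<noteq> ?K ?B"
  proof
    assume "F \<in> leads V"
    then obtain u where u: "u \<in> V" "u F \<noteq> 0" "\<forall>G. u G \<noteq> 0 \<longrightarrow> G \<noteq> F \<longrightarrow> tau G F" using leads_iff[OF V(2)] by blast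
    have "u G = 0" if "G \<in> ?A" for G
    proof (rule ccontr)
      assume nz: "u G \<noteq> 0"
      have "G \<noteq> F" using that irrefl[OF F] by blast
      then have "tau G F" using u(3) nz by blast
      then show False using that trans[OF F _ F, of G] irrefl[OF F] by blast
    qed
    then have "u \<in> ?K ?A" using kz u(1) by blast
    moreover have "u \<notin> ?K ?B" using kz[of u ?B] u(2) F by blast
    ultimately show "?K ?A \<noteq> ?K ?B" by blast
  next
    assume "?K ?A \<noteq> ?K ?B"
    then obtain u where u: "u \<in> ?K ?A" "u \<notin> ?K ?B" using sub by blast
    have uV: "u \<in> V" using u(1) by simp
    obtain G where "G \<in> ?B" "u G \<noteq> 0" using u(2) kz[of u ?B] uV by blast
    then have uF: "u F \<noteq> 0" using u(1) kz[of u ?A] by blast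
    have "tau G F" if "u G \<noteq> 0" "G \<noteq> F" for G
    proof -
      have "G \<subseteq> {1..n}" using uV V(2) that(1) by (auto simp: ext_alg_def)
      moreover have "G \<notin> ?A" using u(1) kz[of u ?A] that(1) by blast
      ultimately show ?thesis using total[OF F, of G] that(2) by auto
    qed
    then show "F \<in> leads V" unfolding leads_iff[OF V(2)] using uV uF by blast
  qed
  also have "\<dots> \<longleftrightarrow> ext.dim (?K ?B) < ext.dim (?K ?A)"
  proof
    assume ne: "?K ?A \<noteq> ?K ?B"
    obtain X Y where XY: "finite X" "finite Y" "X \<inter> Y = {}" "ext.independent (X \<union> Y)" "ext.span X = ?K ?B"
      "ext.span (X \<union> Y) = ?K ?A" "card X = ext.dim (?K ?B)" "card X + card Y = ext.dim (?K ?A)"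
      by (rule ext.basis_extension[OF sK sub sK fK])
    have "Y \<noteq> {}" using ne XY(5,6) by auto
    then have "0 < card Y" using XY(2) by (simp add: card_gt_0_iff)
    then show "ext.dim (?K ?B) < ext.dim (?K ?A)" using XY(7,8) by linarith
  next
    assume less: "ext.dim (?K ?B) < ext.dim (?K ?A)"
    show "?K ?A \<noteq> ?K ?B"
    proof
      assume "?K ?A = ?K ?B"
      then have "ext.dim (?K ?A) = ext.dim (?K ?B)" by (rule arg_cong)
      with less show False by linarith
    qed
  qed
  also have "\<dots> \<longleftrightarrow> ext.dim (proj_on ?A ` V) < ext.dim (proj_on ?B ` V)"
    using rn[of ?A] rn[of ?B] by linarith
  finally show ?thesis .
qed

lemma proj_dim_generic:
  fixes J :: "'k::field ext set"
  assumes J: "graded_ideal n J"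
  shows "for_generic n n (\<lambda>g. \<forall>h\<in>carrier_mat n n. proj_dim J T h \<le> proj_dim J T g)"
proof -
  have sJ: "ext.subspace J" using graded_ideal_subspace[OF J] .
  have alg: "ext_alg n = (ext_coord (Pow {1..n}) :: 'k ext set)" by (auto simp: ext_alg_def ext_coord_def)
  have Jf: "fin_span ext_scale J"
    using ext.fin_span_mono[OF graded_idealD(1)[OF J]] dim_ext_coord(2)[of "Pow {1..n}", where ?'k = 'k] unfolding alg by simp
  obtain b where b: "b \<subseteq> J" "ext.independent b" "J \<subseteq> ext.span b"
    using ext.basis_exists by metis
  have fb: "finite b" using ext.independent_finite[OF b(2,1) Jf] .
  have "ext.span b \<subseteq> J" using b(1) sJ by (intro ext.span_minimal)
  then have span: "J = ext.span b" using b(3) by (rule subset_antisym[rotated])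
  have eq: "proj_dim J T g = ext.dim (ext.span ((\<lambda>x. proj_on T (lin_subst n g x)) ` b))" for g :: "'k mat"
  proof -
    have "proj_on T ` lin_subst n g ` J = ext.span (proj_on T ` lin_subst n g ` b)"
      unfolding span
      by (simp only: ee.linear_span_image[OF linear_proj_on] ee.linear_span_image[OF lin_subst_linear])
    then show ?thesis by (simp add: proj_dim_def image_image)
  qed
  show ?thesis unfolding eq
  proof (rule ext.max_dim_generic[where co = "\<lambda>H u. u H"])
    show "finite b" by fact
    fix x H
    show "poly_fun n n (\<lambda>g. proj_on T (lin_subst n g x) H)"
      unfolding proj_on_def by (cases "H \<in> T") (simp_all add: poly_fun_lin_subst poly_fun.const)
  next
    fix x :: "'k ext" assume "\<And>s. x s = 0"
    then show "x = 0" by (simp add: fun_eq_iff)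
  qed simp_all
qed

definition gin_generic :: "'k::field ext set \<Rightarrow> 'k mat \<Rightarrow> bool" where
  "gin_generic J g \<longleftrightarrow> g \<in> GL n \<and> (\<forall>T\<in>Pow (Pow {1..n}). \<forall>h\<in>carrier_mat n n. proj_dim J T h \<le> proj_dim J T g)"

lemma gin_generic_generic:
  fixes J :: "'k::field ext set"
  assumes inf: "infinite (UNIV :: 'k set)" and J: "graded_ideal n J"
  shows "for_generic n n (gin_generic J)"
proof -
  have "for_generic n n (\<lambda>g. \<forall>T\<in>Pow (Pow {1..n}). \<forall>h\<in>carrier_mat n n. proj_dim J T h \<le> proj_dim J T g)"
    by (rule for_generic_finite[OF inf _ proj_dim_generic[OF J]]) simp
  then have "for_generic n n (\<lambda>g. det g \<noteq> 0 \<and> (\<forall>T\<in>Pow (Pow {1..n}). \<forall>h\<in>carrier_mat n n. proj_dim J T h \<le> proj_dim J T g))"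
    by (rule for_generic_conj[OF inf det_generic])
  then show ?thesis
    by (rule for_generic_mono) (use det_GL in \<open>unfold gin_generic_def, blast\<close>)
qed

text \<open>All the ranks that determine the leading sets take their maximal values at both \<open>g\<close> and \<open>h\<close>.\<close>

lemma gin_generic_leads:
  fixes J :: "'k::field ext set"
  assumes J: "graded_ideal n J" and g: "gin_generic J g" "gin_generic J h"
  shows "leads (lin_subst n g ` J) = leads (lin_subst n h ` J)"
proof -
  have sub: "ext.subspace (lin_subst n x ` J)" "lin_subst n x ` J \<subseteq> ext_alg n" for x
    using ee.linear_subspace_image[OF lin_subst_linear graded_ideal_subspace[OF J]] lin_subst_in_alg by blast+
  have car: "g \<in> carrier_mat n n" "h \<in> carrier_mat n n" using g by (auto simp: gin_generic_def GL_def)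
  have eq: "proj_dim J T g = proj_dim J T h" if "T \<subseteq> Pow {1..n}" for T
    using g car that unfolding gin_generic_def by (intro antisym) blast+
  have "F \<in> leads (lin_subst n g ` J) \<longleftrightarrow> F \<in> leads (lin_subst n h ` J)" if F: "F \<subseteq> {1..n}" for F
  proof -
    have "{G \<in> Pow {1..n}. tau F G} \<subseteq> Pow {1..n}" "{G \<in> Pow {1..n}. G = F \<or> tau F G} \<subseteq> Pow {1..n}" by blast+
    then show ?thesis unfolding leads_proj_dim[OF sub F] proj_dim_def[symmetric] by (simp only: eq)
  qed
  then show ?thesis using leads_sub[OF sub(2)[of g]] leads_sub[OF sub(2)[of h]] by blast
qed

theorem gin_eq:
  fixes J :: "'k::field ext set"
  assumes inf: "infinite (UNIV :: 'k set)" and J: "graded_ideal n J" and g: "gin_generic J g"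
  shows "gin n tau J = ext_coord (leads (lin_subst n g ` J))"
proof -
  have init: "initial_ideal n tau (lin_subst n h ` J) = ext_coord (leads (lin_subst n g ` J))" if h: "gin_generic J h" for h
  proof -
    have hG: "h \<in> GL n" "h \<in> carrier_mat n n" using h by (auto simp: gin_generic_def GL_def)
    obtain h' where "h' \<in> carrier_mat n n" "h * h' = 1\<^sub>m n" "h' * h = 1\<^sub>m n" using GL_inverse[OF hG(1)] by blast
    then have "graded_ideal n (lin_subst n h ` J)" using graded_ideal_subst[OF J hG(2)] by blast
    then have "initial_ideal n tau (lin_subst n h ` J) = ext_coord (leads (lin_subst n h ` J))" by (rule initial_ideal_eq)
    then show ?thesis unfolding gin_generic_leads[OF J h g] .
  qed
  show ?thesis unfolding gin_def
  proof (rule the_equality)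
    obtain U where U: "zariski_open n n U" "U \<noteq> {}" "U \<subseteq> carrier_mat n n" "\<And>A. A \<in> U \<Longrightarrow> gin_generic J A"
      using generic_zariski_open[OF gin_generic_generic[OF inf J]] by blast
    have "U \<subseteq> GL n" using U(4) by (auto simp: gin_generic_def)
    then show "\<exists>U. zariski_open n n U \<and> U \<noteq> {} \<and> U \<subseteq> GL n \<and>
      (\<forall>h\<in>U. initial_ideal n tau (lin_subst n h ` J) = ext_coord (leads (lin_subst n g ` J)))"
      using U init by blast
    fix I assume "\<exists>U. zariski_open n n U \<and> U \<noteq> {} \<and> U \<subseteq> GL n \<and> (\<forall>h\<in>U. initial_ideal n tau (lin_subst n h ` J) = I)"
    then obtain V where V: "zariski_open n n V" "V \<noteq> {}" "\<forall>h\<in>V. initial_ideal n tau (lin_subst n h ` J) = I" by blast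
    obtain h where "h \<in> V" "gin_generic J h"
      using for_generic_ex[OF for_generic_conj[OF inf zariski_open_generic[OF V(1,2)] gin_generic_generic[OF inf J]]] by blast
    then show "I = ext_coord (leads (lin_subst n g ` J))" using V(3) init by blast
  qed
qed

text \<open>The transvection \<open>e\<^sub>j \<mapsto> e\<^sub>j + t e\<^sub>i\<close> adds to \<open>u\<close> its terms with \<open>j\<close> exchanged for \<open>i\<close>. The exchange increases monomials and
preserves their order, so that its result at the leading set \<open>F\<close> exceeds all other terms, old and new; in particular it is
not cancelled.\<close>

lemma transvection_lead:
  fixes u :: "'k::field ext"
  assumes u: "u \<in> ext_alg n" "u F \<noteq> 0" "\<And>G. u G \<noteq> 0 \<Longrightarrow> G \<noteq> F \<Longrightarrow> tau G F"
    and ij: "j \<in> F" "1 \<le> i" "i < j" "i \<notin> F" and t: "t \<noteq> 0"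
  shows "lin_subst n (elem_mat n j (\<lambda>l. if l = i then t else 0)) u (insert i (F - {j})) \<noteq> 0"
    "lin_subst n (elem_mat n j (\<lambda>l. if l = i then t else 0)) u H \<noteq> 0 \<Longrightarrow> H \<noteq> insert i (F - {j}) \<Longrightarrow> tau H (insert i (F - {j}))"
proof -
  let ?g = "elem_mat n j (\<lambda>l. if l = i then t else 0)" and ?F = "insert i (F - {j})"
  have Fs: "F \<subseteq> {1..n}" using u(1,2) by (auto simp: ext_alg_def)
  have ijn: "i \<in> {1..n}" "j \<in> {1..n}" using ij subsetD[OF Fs ij(1)] by auto
  have Fs': "?F \<subseteq> {1..n}" using Fs ijn by auto
  have FF: "tau F ?F"
  proof -
    have "tau ({j} \<union> (F - {j})) ({i} \<union> (F - {j}))"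
      using ijn ij Fs by (intro union variables) auto
    then show ?thesis using ij(1) by (simp add: insert_absorb)
  qed
  define E where "E G = ext_scale (inverse (shuffle_sign {j} (G - {j})))
      (ext_scale t (wedge (ext_mono {i}) (ext_mono (G - {j}))) :: 'k ext)" for G
  have sm: "lin_subst n ?g (ext_mono G) = ext_mono G + (if j \<in> G then E G else 0)" if G: "G \<subseteq> {1..n}" for G
  proof (cases "j \<in> G")
    case True
    have "(\<Sum>l\<in>{1..<j}. ext_scale (if l = i then t else 0) (wedge (ext_mono {l}) (ext_mono (G - {j})))) =
      (\<Sum>l\<in>{1..<j}. if l = i then ext_scale t (wedge (ext_mono {l}) (ext_mono (G - {j}))) else (0 :: 'k ext))"
      by (rule sum.cong) auto
    also have "\<dots> = ext_scale t (wedge (ext_mono {i}) (ext_mono (G - {j})))" using ij by simp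
    finally show ?thesis unfolding elem_subst_mono[OF G True] E_def using True by simp
  next
    case False
    have "finite G" using G finite_subset by blast
    then show ?thesis using False G by (simp add: lin_subst_mono elem_subst_mono_fixed)
  qed
  have E_supp: "j \<in> G \<and> i \<notin> G \<and> X = insert i (G - {j})" if "j \<in> G" "E G X \<noteq> 0" for G X
    using that ij(3) unfolding E_def wedge_mono_mono by (auto simp: ext_mono_apply split: if_splits)
  have val: "lin_subst n ?g u X = (\<Sum>G\<in>Pow {1..n}. u G * (ext_mono G X + (if j \<in> G then E G X else 0)))" for X
  proof -
    have "lin_subst n ?g u = (\<Sum>G\<in>Pow {1..n}. ext_scale (u G) (lin_subst n ?g (ext_mono G)))"
      by (subst ext_expansion[OF u(1)]) (simp only: lin_subst_sum lin_subst_scale)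
    then have "lin_subst n ?g u X = (\<Sum>G\<in>Pow {1..n}. u G * lin_subst n ?g (ext_mono G) X)"
      by (simp add: sum_fun_apply)
    also have "\<dots> = (\<Sum>G\<in>Pow {1..n}. u G * (ext_mono G X + (if j \<in> G then E G X else 0)))"
      by (rule sum.cong) (simp_all add: sm)
    finally show ?thesis .
  qed
  show "lin_subst n ?g u ?F \<noteq> 0"
  proof -
    have "u ?F = 0"
    proof (rule ccontr)
      assume "u ?F \<noteq> 0"
      then have "tau ?F F" using u(3)[of ?F] ij by blast
      then show False using trans[OF Fs Fs' Fs FF] irrefl[OF Fs] by blast
    qed
    have "lin_subst n ?g u ?F = (\<Sum>G\<in>Pow {1..n}. if G = F then u F * E F ?F else 0)"
      unfolding val
    proof (rule sum.cong[OF refl])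
      fix G
      consider "G = F" | "G = ?F" | "G \<noteq> F" "G \<noteq> ?F" by blast
      then show "u G * (ext_mono G ?F + (if j \<in> G then E G ?F else 0)) = (if G = F then u F * E F ?F else 0)"
      proof cases
        case 1
        have "?F \<noteq> F" using ij by blast
        then show ?thesis using 1 ij(1) by (simp add: ext_mono_apply)
      next
        case 2
        have "?F \<noteq> F" using ij by blast
        then show ?thesis unfolding 2 \<open>u ?F = 0\<close> by simp
      next
        case 3
        have "E G ?F = 0" if "j \<in> G"
        proof (rule ccontr)
          assume "E G ?F \<noteq> 0"
          then have "i \<notin> G" "?F = insert i (G - {j})" using E_supp[OF that] by blast+
          then have "F - {j} = G - {j}" using ij(4) by (metis Diff_insert_absorb Diff_iff)
          then have "F = G" using that ij(1) by (metis insert_Diff)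
          then show False using 3 by blast
        qed
        then show ?thesis using 3 by (simp add: ext_mono_apply)
      qed
    qed
    also have "\<dots> = u F * E F ?F" using Fs by simp
    also have "\<dots> \<noteq> 0"
    proof -
      have "finite F" using Fs finite_subset by blast
      moreover have "{i} \<inter> (F - {j}) = {}" using ij by blast
      ultimately show ?thesis using u(2) t unfolding E_def wedge_mono_mono by (simp add: ext_mono_apply)
    qed
    finally show ?thesis .
  qed
  assume H: "lin_subst n ?g u H \<noteq> 0" "H \<noteq> ?F"
  then obtain G where G: "G \<subseteq> {1..n}" "u G * (ext_mono G H + (if j \<in> G then E G H else 0)) \<noteq> 0"
    unfolding val by (metis (no_types, lifting) PowD sum.neutral)
  then have uG: "u G \<noteq> 0" by auto
  have GF: "G = F \<or> tau G F" using u(3) uG by blast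
  show "tau H ?F"
  proof (cases "H = G")
    case True
    then show ?thesis using GF FF trans[OF G(1) Fs Fs'] by blast
  next
    case False
    then have "j \<in> G" "E G H \<noteq> 0" using G(2) by (auto simp: ext_mono_apply split: if_splits)
    then have GH: "j \<in> G" "i \<notin> G" "H = insert i (G - {j})" using E_supp by blast+
    then have "G \<noteq> F" using H(2) by blast
    then have GF': "tau G F" using GF by blast
    have sub: "G - {j} \<subseteq> {1..n}" "F - {j} \<subseteq> {1..n}" using G(1) Fs by auto
    have "G - {j} \<noteq> F - {j}" using GH(1) ij(1) \<open>G \<noteq> F\<close> by (metis insert_Diff)
    have "\<not> tau (F - {j}) (G - {j})"
    proof
      assume "tau (F - {j}) (G - {j})"
      then have "tau ((F - {j}) \<union> {j}) ((G - {j}) \<union> {j})" using ijn sub by (intro union) auto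
      moreover have "(F - {j}) \<union> {j} = F" "(G - {j}) \<union> {j} = G" using GH(1) ij(1) by auto
      ultimately have "tau F G" by simp
      then show False using GF' trans[OF Fs G(1) Fs] irrefl[OF Fs] by blast
    qed
    then have "tau (G - {j}) (F - {j})" using total[OF sub \<open>G - {j} \<noteq> F - {j}\<close>] by blast
    then have "tau ((G - {j}) \<union> {i}) ((F - {j}) \<union> {i})" using ijn sub GH(2) ij(4) by (intro union) auto
    then show ?thesis unfolding GH(3) by simp
  qed
qed

lemma elem_mat_line:
  fixes g :: "'k::field mat"
  assumes g: "g \<in> carrier_mat n n"
  shows "g * elem_mat n j (\<lambda>l. if l = i then t else 0) = mat_line n n g (g * elem_mat n j (\<lambda>l. if l = i then 1 else 0)) t"
proof (rule eq_matI)
  have entry: "(g * elem_mat n j (\<lambda>l. if l = i then t else 0)) $$ (a, b) = g $$ (a, b) + t * (if Suc b = i \<and> Suc b < j \<and> j \<le> n then g $$ (a, j - 1) else 0)"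
    if ab: "a < n" "b < n" for a b and t :: 'k
  proof -
    have "(g * elem_mat n j (\<lambda>l. if l = i then t else 0)) $$ (a, b) =
       (\<Sum>s = 0..<n. g $$ (a, s) * ((if s = b then 1 else 0) + (if Suc s = j \<and> Suc b < j then (if Suc b = i then t else 0) else 0)))"
      using g ab by (simp add: scalar_prod_def elem_mat_def)
    also have "\<dots> = (\<Sum>s = 0..<n. (if s = b then g $$ (a, s) else 0) + (if s = j - 1 then (if Suc b = i \<and> Suc b < j then t * g $$ (a, s) else 0) else 0))"
      by (rule sum.cong) (auto simp: algebra_simps)
    also have "\<dots> = g $$ (a, b) + t * (if Suc b = i \<and> Suc b < j \<and> j \<le> n then g $$ (a, j - 1) else 0)"
      unfolding sum.distrib using ab by auto
    finally show ?thesis .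
  qed
  fix a b assume "a < dim_row (mat_line n n g (g * elem_mat n j (\<lambda>l. if l = i then 1 else 0)) t)"
    "b < dim_col (mat_line n n g (g * elem_mat n j (\<lambda>l. if l = i then 1 else 0)) t)"
  then have ab: "a < n" "b < n" by (auto simp: mat_line_def)
  show "(g * elem_mat n j (\<lambda>l. if l = i then t else 0)) $$ (a, b) =
    mat_line n n g (g * elem_mat n j (\<lambda>l. if l = i then 1 else 0)) t $$ (a, b)"
    unfolding mat_line_def using ab entry[OF ab, of t] entry[OF ab, of 1] by simp
qed (use g in \<open>auto simp: mat_line_def elem_mat_def\<close>)

text \<open>The products of a generic matrix with the transvections for varying \<open>t\<close> form a line through that matrix. So almost all
of them are generic and yield the same leading sets, while the transvection exhibits the exchanged set among these. The
argument is independent of the characteristic and of the term order.\<close>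

theorem gin_shifted:
  fixes J :: "'k::field ext set"
  assumes inf: "infinite (UNIV :: 'k set)" and J: "graded_ideal n J" and g0: "gin_generic J g0"
  shows "shifted (leads (lin_subst n g0 ` J))"
proof -
  obtain f g where f: "poly_fun n n f" "g \<in> carrier_mat n n" "f g \<noteq> 0" "\<And>h. h \<in> carrier_mat n n \<Longrightarrow> f h \<noteq> 0 \<Longrightarrow> gin_generic J h"
    using gin_generic_generic[OF inf J] unfolding for_generic_def by blast
  have sub: "lin_subst n h ` J \<subseteq> ext_alg n" for h using lin_subst_in_alg by blast
  have "insert i (F - {j}) \<in> leads (lin_subst n g ` J)"
    if F: "F \<in> leads (lin_subst n g ` J)" "j \<in> F" "1 \<le> i" "i < j" "i \<notin> F" for F i j
  proof -
    let ?e = "\<lambda>t :: 'k. elem_mat n j (\<lambda>l. if l = i then t else 0)"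
    obtain u where u: "u \<in> lin_subst n g ` J" "u F \<noteq> 0" "\<And>X. u X \<noteq> 0 \<Longrightarrow> X \<noteq> F \<Longrightarrow> tau X F"
      using iffD1[OF leads_iff[OF sub[of g], of F] F(1)] by blast
    have ua: "u \<in> ext_alg n" using u(1) sub by blast
    have "finite ({t. f (mat_line n n g (g * ?e 1) t) = 0} \<union> {0})"
      using poly_fun_line_nonzero[OF inf f(1,2,3)] by simp
    then obtain t where t: "f (mat_line n n g (g * ?e 1) t) \<noteq> 0" "t \<noteq> 0"
      using ex_new_if_finite[OF inf] by blast
    have line: "g * ?e t = mat_line n n g (g * ?e 1) t" by (rule elem_mat_line[OF f(2)])
    have "gin_generic J (g * ?e t)"
      unfolding line by (rule f(4)[OF _ t(1)]) (simp add: mat_line_def)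
    then have eq: "leads (lin_subst n (g * ?e t) ` J) = leads (lin_subst n g ` J)"
      by (rule gin_generic_leads[OF J _ f(4)[OF f(2,3)]])
    obtain x where x: "x \<in> J" "u = lin_subst n g x" using u(1) by blast
    have "lin_subst n (?e t) u = lin_subst n (g * ?e t) x"
      unfolding x(2) by (rule lin_subst_compose[OF f(2) elem_mat_carrier])
    then have "lin_subst n (?e t) u \<in> lin_subst n (g * ?e t) ` J" using x(1) by blast
    then have "insert i (F - {j}) \<in> leads (lin_subst n (g * ?e t) ` J)"
      by (intro iffD2[OF leads_iff[OF sub[of "g * ?e t"]]] bexI[of _ "lin_subst n (?e t) u"])
        (intro conjI allI impI transvection_lead[OF ua u(2,3) F(2-5) t(2)])
    then show ?thesis using eq by simp
  qed
  then have "shifted (leads (lin_subst n g ` J))" unfolding shifted_def by blast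
  moreover have "leads (lin_subst n g0 ` J) = leads (lin_subst n g ` J)"
    using gin_generic_leads[OF J g0 f(4)[OF f(2,3)]] .
  ultimately show ?thesis by simp
qed

lemma gin_hilbert:
  fixes J :: "'k::field ext set"
  assumes J: "graded_ideal n J" and g: "g \<in> GL n"
  shows "hilbert_fun n J d = card {F \<in> leads (lin_subst n g ` J). card F = d}"
proof -
  have gc: "g \<in> carrier_mat n n" using g by (simp add: GL_def)
  obtain g' where g': "g' \<in> carrier_mat n n" "g * g' = 1\<^sub>m n" "g' * g = 1\<^sub>m n" using GL_inverse[OF g] by blast
  have Ja: "J \<subseteq> ext_alg n" using graded_idealD(1)[OF J] .
  have J': "graded_ideal n (lin_subst n g ` J)" using graded_ideal_subst[OF J gc g'(1,3)] .
  have inv: "lin_subst n g' (lin_subst n g u) = u" if "u \<in> ext_alg n" for u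
    using lin_subst_compose[OF gc g'(1), of u] lin_subst_id[OF that] g'(2) by simp
  have im: "lin_subst n g ` (J \<inter> ext_deg n d) = lin_subst n g ` J \<inter> ext_deg n d"
  proof (intro equalityI subsetI)
    fix y assume "y \<in> lin_subst n g ` J \<inter> ext_deg n d"
    then obtain x where x: "y = lin_subst n g x" "x \<in> J" "y \<in> ext_deg n d" by blast
    have "x = lin_subst n g' y" using inv x(1,2) Ja by fastforce
    then have "x \<in> ext_deg n d" using lin_subst_in_deg[OF x(3)] by simp
    then show "y \<in> lin_subst n g ` (J \<inter> ext_deg n d)" using x by blast
  qed (use lin_subst_in_deg in blast)
  have "ext.dim (lin_subst n g ` (J \<inter> ext_deg n d)) = ext.dim (J \<inter> ext_deg n d)"
  proof (rule ee.dim_image_inj[OF lin_subst_linear])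
    show "ext.subspace (J \<inter> ext_deg n d)"
      by (rule ext.subspace_inter[OF graded_ideal_subspace[OF J] ext_subspaces(2)])
    have "J \<inter> ext_deg n d \<subseteq> ext_coord (Pow {1..n})" by (auto simp: ext_deg_def ext_coord_def)
    then show "fin_span ext_scale (J \<inter> ext_deg n d)"
      using ext.fin_span_mono dim_ext_coord(2)[of "Pow {1..n}", where ?'k = 'k] by blast
    fix z assume z: "z \<in> J \<inter> ext_deg n d" "lin_subst n g z = 0"
    then show "z = 0" using inv[of z] Ja by auto
  qed
  then have "hilbert_fun n J d = hilbert_fun n (lin_subst n g ` J) d" by (simp add: hilbert_fun_def im)
  then show ?thesis using hilbert_leads[OF J'] by simp
qed

text \<open>The witness consists of the forms that \<open>g\<close> maps to the last variables; it transports \<open>h0_le_leads\<close> from \<open>g(J)\<close> to \<open>J\<close>.\<close>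

lemma gin_zero_bound:
  fixes J :: "'k::field ext set"
  assumes J: "graded_ideal n J" and g: "g \<in> GL n" and k: "k \<le> n"
  shows "\<exists>A\<in>carrier_mat k n. cartan_homology_dim n k (lin_form n A) J 0 j \<le> card {F \<in> slice (n - k) j. F \<notin> leads (lin_subst n g ` J)}"
proof -
  have gc: "g \<in> carrier_mat n n" using g by (simp add: GL_def)
  obtain g' where g': "g' \<in> carrier_mat n n" "g * g' = 1\<^sub>m n" "g' * g = 1\<^sub>m n" using GL_inverse[OF g] by blast
  let ?J = "lin_subst n g ` J"
  have J': "graded_ideal n ?J" using graded_ideal_subst[OF J gc g'(1,3)] .
  define E :: "'k mat" where "E = mat k n (\<lambda>(s, l). if s + l = n - 1 then 1 else 0)"
  have E: "E \<in> carrier_mat k n" by (simp add: E_def)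
  have E_form: "lin_form n E s = last_vars n s" if s: "s \<in> {1..k}" for s
  proof -
    have "lin_form n E s = (\<Sum>l\<in>{1..n}. if l = n + 1 - s then ext_mono {l} else (0 :: 'k ext))"
      unfolding lin_form_def
    proof (rule sum.cong[OF refl])
      fix l assume l: "l \<in> {1..n}"
      have "(s - 1 + (l - 1) = n - 1) \<longleftrightarrow> l = n + 1 - s" using l s k by auto
      then show "ext_scale (E $$ (s - 1, l - 1)) (ext_mono {l}) = (if l = n + 1 - s then ext_mono {l} else (0 :: 'k ext))"
        using l s by (auto simp: E_def)
    qed
    also have "n + 1 - s \<in> {1..n}" using s k by auto
    then have "(\<Sum>l\<in>{1..n}. if l = n + 1 - s then ext_mono {l} else (0 :: 'k ext)) = ext_mono {n + 1 - s}" by simp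
    finally show ?thesis by (simp add: last_vars_def)
  qed
  define A where "A = E * g'"
  have A: "A \<in> carrier_mat k n" unfolding A_def using E g'(1) by simp
  have Ag: "A * g = E" unfolding A_def using assoc_mult_mat[OF E g'(1) gc] g'(3) E by simp
  have "cartan_homology_dim n k (lin_form n A) J 0 j = cartan_homology_dim n k (last_vars n) ?J 0 j"
  proof (rule homology_subst[OF lin_seq_lin_form[OF J, of n] _ k gc g'])
    show "lin_seq n n (last_vars n) ?J" by unfold_locales (use J' last_vars_deg in auto)
    show "lin_subst n g' u \<in> J" if u: "u \<in> ?J" for u
    proof -
      obtain x where x: "u = lin_subst n g x" "x \<in> J" using u by blast
      then have "lin_subst n g' u = x"
        using lin_subst_compose[OF gc g'(1), of x] lin_subst_id[of x n] g'(2) graded_idealD(1)[OF J] by auto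
      then show ?thesis using x by simp
    qed
    show "lin_subst n g (lin_form n A s) = last_vars n s" if "s \<in> {1..k}" for s
      using lin_subst_lin_form[OF A gc that] Ag E_form[OF that] by simp
  qed simp
  then have "cartan_homology_dim n k (lin_form n A) J 0 j \<le> card {F \<in> slice (n - k) j. F \<notin> leads ?J}"
    using h0_le_leads[OF J' k, of j] by (rule ord_eq_le_trans)
  then show ?thesis using A by (rule bexI)
qed

end

section \<open>Squarefree lexsegment ideals\<close>

definition lex_family :: "nat \<Rightarrow> nat set set \<Rightarrow> nat \<Rightarrow> nat set set" where
  "lex_family n S d = (SOME L. lexseg n d L \<and> card L = card {F \<in> S. card F = d})"

lemma lex_family:
  assumes "S \<subseteq> Pow {1..n}"
  shows "lexseg n d (lex_family n S d)" "card (lex_family n S d) = card {F \<in> S. card F = d}"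
proof -
  have "{F \<in> S. card F = d} \<subseteq> slice n d" using assms by (auto simp: slice_def)
  then have "card {F \<in> S. card F = d} \<le> card (slice n d)" by (intro card_mono finite_slice)
  then have "\<exists>L. lexseg n d L \<and> card L = card {F \<in> S. card F = d}" by (rule lexseg_exists)
  then have "lexseg n d (lex_family n S d) \<and> card (lex_family n S d) = card {F \<in> S. card F = d}"
    unfolding lex_family_def by (rule someI_ex)
  then show "lexseg n d (lex_family n S d)" "card (lex_family n S d) = card {F \<in> S. card F = d}" by auto
qed

definition lex_upset :: "nat \<Rightarrow> nat set set \<Rightarrow> nat set set" where
  "lex_upset n S = (\<Union>d. lex_family n S d)"

lemma lex_upset_degree:
  assumes "S \<subseteq> Pow {1..n}"
  shows "{F \<in> lex_upset n S. card F = d} = lex_family n S d"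
proof -
  have "F \<in> lex_family n S e \<Longrightarrow> card F = e" for F e
    using lex_family(1)[OF assms, of e] by (auto simp: lexseg_def slice_def)
  then show ?thesis by (auto simp: lex_upset_def)
qed

lemma upset_degree_shifted:
  assumes "upset n S" "shifted S"
  shows "shifted {F \<in> S. card F = d}" "{F \<in> S. card F = d} \<subseteq> slice n d"
    "up_shadow n {F \<in> S. card F = d} \<subseteq> {F \<in> S. card F = Suc d}"
proof -
  have sub: "F \<subseteq> {1..n}" "finite F" if "F \<in> S" for F
  proof -
    show "F \<subseteq> {1..n}" using that assms(1) by (auto simp: upset_def)
    then show "finite F" using finite_subset by blast
  qed
  show "{F \<in> S. card F = d} \<subseteq> slice n d" using sub by (auto simp: slice_def)
  show "shifted {F \<in> S. card F = d}"
    unfolding shifted_def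
  proof (intro ballI allI impI)
    fix F j i assume F: "F \<in> {F \<in> S. card F = d}" "j \<in> F" "1 \<le> i" "i < j" "i \<notin> F"
    have "insert i (F - {j}) \<in> S" using F assms(2) unfolding shifted_def by blast
    moreover have "card (insert i (F - {j})) = card F"
      using card.remove[of F j] sub(2)[of F] F by (simp add: card_insert_if)
    ultimately show "insert i (F - {j}) \<in> {F \<in> S. card F = d}" using F(1) by simp
  qed
  show "up_shadow n {F \<in> S. card F = d} \<subseteq> {F \<in> S. card F = Suc d}"
  proof
    fix G assume "G \<in> up_shadow n {F \<in> S. card F = d}"
    then obtain j F where G: "G = insert j F" "F \<in> S" "card F = d" "j \<in> {1..n} - F" by (auto simp: up_shadow_def)
    have "F \<subseteq> G" "G \<subseteq> {1..n}" using G sub(1)[OF G(2)] by auto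
    then have "G \<in> S" using assms(1) G(2) unfolding upset_def by blast
    then show "G \<in> {F \<in> S. card F = Suc d}" using G sub(2)[OF G(2)] by simp
  qed
qed

text \<open>Each degree component of \<open>S\<close> contains the shadow of the preceding one, and \<open>kruskal_katona_step\<close> transfers this to the
lexsegments of the same sizes.\<close>

lemma lex_upset_upset:
  assumes S: "upset n S" "shifted S"
  shows "upset n (lex_upset n S)"
proof -
  have Sn: "S \<subseteq> Pow {1..n}" using S(1) by (simp add: upset_def)
  have sl: "lex_family n S d \<subseteq> slice n d" for d using lex_family(1)[OF Sn, of d] by (simp add: lexseg_def)
  have step: "up_shadow n (lex_family n S d) \<subseteq> lex_family n S (Suc d)" for d
    by (rule kruskal_katona_step[OF low_minimal upset_degree_shifted(2)[OF S] upset_degree_shifted(1)[OF S]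
        upset_degree_shifted(2)[OF S] upset_degree_shifted(3)[OF S] lex_family(1)[OF Sn] _ lex_family(1)[OF Sn]])
      (simp_all add: lex_family(2)[OF Sn])
  have ins: "insert x F \<in> lex_upset n S" if F: "F \<in> lex_upset n S" "x \<in> {1..n}" for F x
  proof (cases "x \<in> F")
    case True
    then show ?thesis using F by (simp add: insert_absorb)
  next
    case False
    obtain d where "F \<in> lex_family n S d" using F(1) by (auto simp: lex_upset_def)
    then have "insert x F \<in> up_shadow n (lex_family n S d)" using False F(2) unfolding up_shadow_def by blast
    then show ?thesis using step by (auto simp: lex_upset_def)
  qed
  have add: "F \<union> X \<in> lex_upset n S" if "finite X" "F \<in> lex_upset n S" "X \<subseteq> {1..n}" for F X
    using that by (induct X) (use ins in auto)
  have "lex_upset n S \<subseteq> Pow {1..n}" using sl by (force simp: lex_upset_def slice_def)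
  moreover have "G \<in> lex_upset n S" if "F \<in> lex_upset n S" "F \<subseteq> G" "G \<subseteq> {1..n}" for F G
  proof -
    have "finite G" using that(3) finite_subset by blast
    then have "F \<union> G \<in> lex_upset n S" using add that by blast
    then show ?thesis using that(2) by (simp add: Un_absorb1)
  qed
  ultimately show ?thesis unfolding upset_def by blast
qed

lemma lex_upset_shifted:
  assumes Sn: "S \<subseteq> Pow {1..n}"
  shows "shifted (lex_upset n S)"
  using lexseg_shifted[OF lex_family(1)[OF Sn]] unfolding shifted_def lex_upset_def by blast

lemma ext_mono_coord: "ext_mono F \<in> (ext_coord S :: 'k::field ext set) \<longleftrightarrow> F \<in> S"
  by (auto simp: ext_coord_def ext_mono_apply split: if_splits)

lemma monomial_ideal_coord:
  assumes "monomial_ideal n (L :: 'k::field ext set)"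
  obtains S where "upset n S" "L = ext_coord S"
proof -
  obtain S0 where S0: "S0 \<subseteq> Pow {1..n}" "L = ext_ideal n hull (ext_mono ` S0)" using assms unfolding monomial_ideal_def by blast
  define S where "S = {G \<in> Pow {1..n}. \<exists>F\<in>S0. F \<subseteq> G}"
  have S: "upset n S" unfolding upset_def S_def by blast
  have "ext_ideal n hull (ext_mono ` S0) = (ext_coord S :: 'k ext set)"
  proof (rule hull_unique)
    have "S0 \<subseteq> S" using S0(1) unfolding S_def by blast
    then show "ext_mono ` S0 \<subseteq> (ext_coord S :: 'k ext set)" using ext_mono_coord[of _ S, where ?'k = 'k] by blast
    show "ext_ideal n (ext_coord S :: 'k ext set)" using upset_graded_ideal[OF S, where ?'k = 'k] by (simp add: graded_ideal_def)
    fix t :: "'k ext set" assume t: "ext_mono ` S0 \<subseteq> t" "ext_ideal n t"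
    have "ext_mono ` S \<subseteq> t"
    proof clarify
      fix G assume "G \<in> S"
      then obtain F where F: "F \<in> S0" "F \<subseteq> G" "G \<subseteq> {1..n}" by (auto simp: S_def)
      have "finite G" using F(3) finite_subset by blast
      then have fin: "finite F" "finite (G - F)" "F \<union> (G - F) = G" "F \<inter> (G - F) = {}" using F(2) finite_subset by auto
      have "ext_mono (G - F) \<in> (ext_alg n :: 'k ext set)" using F by (intro ext_mono_in) blast
      then have "wedge (ext_mono F) (ext_mono (G - F)) \<in> t" using t F(1) unfolding ext_ideal_def by blast
      then have "ext_scale (shuffle_sign F (G - F)) (ext_mono G) \<in> t" using fin by (simp add: wedge_mono_mono)
      then have "ext_scale (inverse (shuffle_sign F (G - F))) (ext_scale (shuffle_sign F (G - F)) (ext_mono G)) \<in> t"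
        by (rule ext.subspace_scale[OF ext_ideal_subspace[OF t(2)]])
      then show "ext_mono G \<in> t" by simp
    qed
    then have "ext_ideal n hull (ext_mono ` S) \<subseteq> t" using t(2) by (rule hull_minimal)
    then show "ext_coord S \<subseteq> t" using mono_hull[OF S, where ?'k = 'k] by simp
  qed
  then show thesis using that S S0(2) by blast
qed

theorem lex_ideal_eq:
  fixes J :: "'k::field ext set"
  assumes S: "upset n S" "shifted S" and hilb: "\<And>d. hilbert_fun n J d = card {F \<in> S. card F = d}"
  shows "lex_ideal n J = ext_coord (lex_upset n S)"
proof -
  have Sn: "S \<subseteq> Pow {1..n}" using S(1) by (simp add: upset_def)
  let ?L = "lex_upset n S"
  have L: "upset n ?L" by (rule lex_upset_upset[OF S])
  have Ln: "?L \<subseteq> Pow {1..n}" using L by (simp add: upset_def)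
  show ?thesis unfolding lex_ideal_def
  proof (rule the_equality)
    have "monomial_ideal n (ext_coord ?L :: 'k ext set)"
      unfolding monomial_ideal_def using Ln mono_hull[OF L, where ?'k = 'k] by blast
    moreover have "G \<in> ?L" if F: "F \<in> ?L" and G: "G \<in> Pow {1..n}" "lex_greater G F" for F G
    proof -
      obtain d where d: "F \<in> lex_family n S d" using F by (auto simp: lex_upset_def)
      then have "card F = d" using lex_family(1)[OF Sn, of d] by (auto simp: lexseg_def slice_def)
      then have "G \<in> slice n d" using G by (auto simp: slice_def lex_greater_def)
      then show ?thesis using lex_family(1)[OF Sn, of d] d G(2) by (auto simp: lexseg_def lex_upset_def)
    qed
    ultimately have "lexsegment_ideal n (ext_coord ?L :: 'k ext set)"
      unfolding lexsegment_ideal_def ext_mono_coord by blast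
    moreover have "hilbert_fun n (ext_coord ?L :: 'k ext set) = hilbert_fun n J"
      by (rule ext) (simp add: hilbert_ext_coord[OF Ln] lex_upset_degree[OF Sn] lex_family(2)[OF Sn] hilb)
    ultimately show "lexsegment_ideal n (ext_coord ?L :: 'k ext set) \<and> hilbert_fun n (ext_coord ?L :: 'k ext set) = hilbert_fun n J" by blast
    fix L' assume L': "lexsegment_ideal n L' \<and> hilbert_fun n L' = hilbert_fun n J"
    then obtain T where T: "upset n T" "L' = ext_coord T"
      using monomial_ideal_coord unfolding lexsegment_ideal_def by blast
    have Tn: "T \<subseteq> Pow {1..n}" using T(1) by (simp add: upset_def)
    have eq: "{F \<in> T. card F = d} = lex_family n S d" for d
    proof -
      have "lexseg n d {F \<in> T. card F = d}"
        unfolding lexseg_def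
      proof (intro conjI ballI impI)
        show "{F \<in> T. card F = d} \<subseteq> slice n d" using Tn by (auto simp: slice_def)
        fix F G assume "F \<in> {F \<in> T. card F = d}" "G \<in> slice n d" "lex_greater G F"
        moreover have "F \<in> Pow {1..n}" "G \<in> Pow {1..n}" using calculation Tn by (auto simp: slice_def)
        ultimately have "ext_mono G \<in> L'"
          using L' unfolding lexsegment_ideal_def T(2) ext_mono_coord by blast
        then show "G \<in> {F \<in> T. card F = d}"
          using \<open>G \<in> slice n d\<close> unfolding T(2) ext_mono_coord by (simp add: slice_def)
      qed
      moreover have "card {F \<in> T. card F = d} = card (lex_family n S d)"
      proof -
        have "card {F \<in> T. card F = d} = hilbert_fun n L' d"
          unfolding T(2) by (rule hilbert_ext_coord[OF Tn, symmetric])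
        then show ?thesis using L' hilb lex_family(2)[OF Sn] by simp
      qed
      ultimately show ?thesis
        using lexseg_comparable[of n d _ "lex_family n S d"] lexseg_comparable[of n d "lex_family n S d"]
          lex_family(1)[OF Sn, of d] by (intro subset_antisym) auto
    qed
    have "T = ?L"
    proof (intro equalityI subsetI)
      fix F assume "F \<in> T"
      then have "F \<in> {F' \<in> T. card F' = card F}" by simp
      then show "F \<in> ?L" unfolding eq by (auto simp: lex_upset_def)
    next
      fix F assume "F \<in> ?L"
      then obtain d where "F \<in> lex_family n S d" by (auto simp: lex_upset_def)
      then show "F \<in> T" unfolding eq[symmetric] by simp
    qed
    then show "L' = ext_coord ?L" using T(2) by simp
  qed
qed

text \<open>The complement within \<open>slice m j\<close> is largest for the lexsegment since the lexsegment has the fewest members there.\<close>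

lemma lex_upset_low:
  assumes S: "upset n S" "shifted S" and m: "m \<le> n"
  shows "card {F \<in> slice m j. F \<notin> S} \<le> card {F \<in> slice m j. F \<notin> lex_upset n S}"
proof -
  have Sn: "S \<subseteq> Pow {1..n}" using S(1) by (simp add: upset_def)
  have split: "card {F \<in> slice m j. F \<notin> T} + low m {F \<in> T. card F = j} = card (slice m j)" for T
  proof -
    have "{F \<in> {F \<in> T. card F = j}. F \<subseteq> {1..m}} = {F \<in> slice m j. F \<in> T}" by (auto simp: slice_def)
    moreover have "card {F \<in> slice m j. F \<notin> T} + card {F \<in> slice m j. F \<in> T} = card ({F \<in> slice m j. F \<notin> T} \<union> {F \<in> slice m j. F \<in> T})"
      by (rule card_Un_disjoint[symmetric]) auto
    moreover have "{F \<in> slice m j. F \<notin> T} \<union> {F \<in> slice m j. F \<in> T} = slice m j" by blast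
    ultimately show ?thesis by (simp add: low_def)
  qed
  have "low m (lex_family n S j) \<le> low m {F \<in> S. card F = j}"
    using low_minimal[of n, unfolded low_minimal_def, rule_format,
        OF upset_degree_shifted(2,1)[OF S, of j] lex_family(1)[OF Sn, of j]] lex_family(2)[OF Sn, of j] by simp
  then show ?thesis using split[of S] split[of "lex_upset n S"] unfolding lex_upset_degree[OF Sn] by linarith
qed

theorem theorem2p9:
  fixes n :: nat
    and J :: "'k::field ext set"
    and tau :: "nat set \<Rightarrow> nat set \<Rightarrow> bool"
  assumes "infinite (UNIV :: 'k set)"
    and "graded_ideal n J"
    and "term_order n tau"
  shows "(\<forall>i j p. 1 \<le> p \<longrightarrow> p \<le> n \<longrightarrow>
            cartan_betti n J i j p \<le> cartan_betti n (gin n tau J) i j p) \<and>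
         (\<forall>i j p. 1 \<le> p \<longrightarrow> p \<le> n \<longrightarrow>
            cartan_betti n J i j p \<le> cartan_betti n (lex_ideal n J) i j p)"
proof -
  note inf = assms(1) and J = assms(2)
  interpret exterior_order n tau by unfold_locales (rule assms(3))
  obtain g where g: "gin_generic J g" using for_generic_ex[OF gin_generic_generic[OF inf J]] by blast
  then have gG: "g \<in> GL n" "g \<in> carrier_mat n n" by (auto simp: gin_generic_def GL_def)
  obtain g' where g': "g' \<in> carrier_mat n n" "g' * g = 1\<^sub>m n" using GL_inverse[OF gG(1)] by blast
  define S where "S = leads (lin_subst n g ` J)"
  have S: "upset n S" "shifted S"
    unfolding S_def using leads_upset[OF graded_ideal_subst[OF J gG(2) g']] gin_shifted[OF inf J g] by blast+
  have Sn: "S \<subseteq> Pow {1..n}" using S(1) by (simp add: upset_def)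
  have hilb: "hilbert_fun n J d = card {F \<in> S. card F = d}" for d
    unfolding S_def by (rule gin_hilbert[OF J gG(1)])
  have le: "cartan_betti n J i j p \<le> cartan_betti n (ext_coord T :: 'k ext set) i j p"
    if T: "upset n T" "shifted T" and hT: "\<And>d. card {F \<in> T. card F = d} = card {F \<in> S. card F = d}"
      and low: "\<And>m j. m \<le> n \<Longrightarrow> card {F \<in> slice m j. F \<notin> S} \<le> card {F \<in> slice m j. F \<notin> T}" and p: "p \<le> n"
    for T i j p
  proof (rule cartan_betti_le_stable[OF inf J T p, where ?v0.0 = "\<lambda>_. 0"])
    fix k j assume k: "k \<le> n"
    obtain A :: "'k mat" where "A \<in> carrier_mat k n"
      "cartan_homology_dim n k (lin_form n A) J 0 j \<le> card {F \<in> slice (n - k) j. F \<notin> S}"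
      using gin_zero_bound[OF J gG(1) k] unfolding S_def by blast
    then show "\<exists>A\<in>carrier_mat k n. cartan_homology_dim n k (lin_form n A) J 0 j \<le> card {F \<in> slice (n - k) j. F \<notin> T}"
      using low[of "n - k" j] by (meson diff_le_self le_trans)
  next
    fix j
    have "{F \<in> T. card F = j} = {F \<in> slice n j. F \<in> T}" using T(1) by (auto simp: slice_def upset_def)
    moreover have "card {F \<in> slice n j. F \<notin> T} + card {F \<in> slice n j. F \<in> T} = card ({F \<in> slice n j. F \<notin> T} \<union> {F \<in> slice n j. F \<in> T})"
      by (rule card_Un_disjoint[symmetric]) auto
    moreover have "{F \<in> slice n j. F \<notin> T} \<union> {F \<in> slice n j. F \<in> T} = slice n j" by blast
    ultimately show "cartan_homology_dim n 0 (\<lambda>_. 0) J 0 j = card {F \<in> slice n j. F \<notin> T}"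
      using h0_hilbert[OF J, of "\<lambda>_. 0" j] hilb[of j] hT[of j] by simp
  qed
  have "cartan_betti n J i j p \<le> cartan_betti n (gin n tau J) i j p" if "p \<le> n" for i j p
    unfolding gin_eq[OF inf J g] S_def[symmetric] by (rule le[OF S]) (use that in auto)
  moreover have "cartan_betti n J i j p \<le> cartan_betti n (lex_ideal n J) i j p" if "p \<le> n" for i j p
    unfolding lex_ideal_eq[OF S hilb]
    by (rule le[OF lex_upset_upset[OF S] lex_upset_shifted[OF Sn]])
      (use that lex_upset_low[OF S] in \<open>auto simp: lex_upset_degree[OF Sn] lex_family(2)[OF Sn]\<close>)
  ultimately show ?thesis by blast
qed

end
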